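(* Let $x\in\mathcal{D}^\chi_0$. Then there exists a $\Gamma_1$-invariant neighborhood $\mathcal{N}^\chi_x\subseteq\mathcal{D}^\chi\cup\mathcal{D}^\chi_0$ of $x$ throughout which $F^\chi$ is invertible (as a map onto its image).
   Context: $\mathbb{H}_1$ is the upper half-plane, $\mathbb{H}_2$ the genus 2 Siegel upper half-space; $\Lambda_\tau$ is the lattice with basis $(2\pi i\tau,2\pi i)$; $\mathcal{D}^\rho=\{(\tau,w,\rho)\in\mathbb{H}_1\times\mathbb{C}\times\mathbb{C}\mid|w-\lambda|>2|\rho|^{1/2}>0\text{ for all }\lambda\in\Lambda_\tau\}$. With $\chi=-\rho/w^2$, $$\mathcal{D}^\chi=\{(\tau,w,\chi)\in\mathbb{H}_1\times\mathbb{C}\times\mathbb{C}\mid(\tau,w,-w^2\chi)\in\mathcal{D}^\rho,\ 0<|\chi|<\tfrac14\},\qquad\mathcal{D}^\chi_0=\{(\tau,0,\chi)\in\mathbb{H}_1\times\mathbb{C}\times\mathbb{C}\mid0<|\chi|<\tfrac14\}.$$ $F^\chi(\tau,w,\chi)=\Omega^{(2)}(\tau,w,-w^2\chi)$ for $(\tau,w,\chi)\in\mathcal{D}^\chi$, where $\Omega^{(2)}(\tau,w,\rho)\in\mathbb{H}_2$ is the period matrix of the genus two surface obtained from $\mathbb{C}/\Lambda_\tau$ with coordinates $z_1=z$ at $0$, $z_2=z-w$ at $w$, by excising discs $|z_a|<|\rho|/r_{\bar a}$ ($\bar1=2$, $\bar2=1$) and identifying annuli $|\rho|/r_{\bar a}\le|z_a|\le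 r_a$ via $z_1z_2=\rho$; homology basis $a_1,b_1$ with periods $2\pi i,2\pi i\tau$, $a_2$ an anticlockwise contour about $w$, $b_2$ a path from $z_1=z_0$ to $z_2=\rho/z_0$; $\Omega^{(2)}_{ij}=\frac1{2\pi i}\oint_{b_i}\nu_j$, $\oint_{a_i}\nu_j=2\pi i\delta_{ij}$. Explicitly, $$2\pi i\Omega^{(2)}_{11}=2\pi i\tau-\rho\,\sigma((I-R)^{-1}(1,1)),\quad2\pi i\Omega^{(2)}_{12}=w-\rho^{1/2}\sigma((\beta(I-R)^{-1})(1)),\quad2\pi i\Omega^{(2)}_{22}=\log\Big(-\frac\rho{K(\tau,w)^2}\Big)-\beta(I-R)^{-1}\bar\beta^T,$$ where $R$ has $2\times2$ blocks $R(k,l)=-\frac{\rho^{(k+l)/2}}{\sqrt{kl}}\begin{pmatrix}D(k,l,\tau,w)&C(k,l,\tau)\\C(k,l,\tau)&D(l,k,\tau,w)\end{pmatrix}$, $\beta$ has blocks $\beta(k)=(\beta_1(k),\beta_2(k))=\frac{\rho^{k/2}}{\sqrt k}(P_k(\tau,w)-E_k(\tau))[-1,(-1)^k]$, $\bar\beta_a=\beta_{\bar a}$, $\sigma$ is the sum of the entries of a block, $(1,1)$ and $(1)$ denote the blocks with $k=l=1$, resp. $k=1$, $(I-R)^{-1}=\sum_{n\geq 0}R^n$, $C(k,l,\tau)=(-1)^{k+1}\frac{(k+l-1)!}{(k-1)!(l-1)!}E_{k+l}(\tau)$, $D(k,l,\tau,z)=(-1)^{k+1}\frac{(k+l-1)!}{(k-1)!(l-1)!}P_{k+l}(\tau,z)$,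 $E_k=0$ for $k$ odd, $E_k(\tau)=-\frac{B_k}{k!}+\frac2{(k-1)!}\sum_{n\ge1}\sigma_{k-1}(n)e^{2\pi in\tau}$ for $k$ even, $P_1(\tau,z)=\frac1z-\sum_{k\ge2}E_k(\tau)z^{k-1}$, $P_k=\frac{(-1)^{k-1}}{(k-1)!}\partial_z^{k-1}P_1$, $K(\tau,z)=z\exp(-\sum_{k\ge2}\frac1kE_k(\tau)z^k)$ (all continued in $z$). A branch of the logarithm is chosen, for which $F^\chi$ is holomorphic and $\Gamma_1$-equivariant. $F^\chi$ extends holomorphically to $\mathcal{D}^\chi_0$ with $$F^\chi(\tau,0,\chi)=\mathrm{diag}\Big(\tau,\frac1{2\pi i}\log f(\chi)\Big),\qquad f(\chi)=\frac{1-\sqrt{1-4\chi}}{2\chi}-1=\sum_{n\ge1}\frac1n\binom{2n}{n+1}\chi^n.$$ $\Gamma_1\cong SL(2,\mathbb{Z})$ acts on $(\tau,w,\chi)$ by $\begin{pmatrix}a_1&b_1\\c_1&d_1\end{pmatrix}.(\tau,w,\chi)=\left(\frac{a_1\tau+b_1}{c_1\tau+d_1},\frac w{c_1\tau+d_1},\chi\right)$, and on $\mathbb{H}_2$ via the embedding into $Sp(4,\mathbb{Z})$ as $\begin{pmatrix}a_1&0&b_1&0\\0&1&0&0\\c_1&0&d_1&0\\0&0&0&1\end{pmatrix}$. *)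

theory Defs
  imports "HOL-Analysis.Analysis"
begin

section \<open>Eisenstein series, \<open>P\<^sub>k\<close> and the prime form\<close>

definition upper_half_plane :: "complex set" where
  "upper_half_plane = {\<tau>. Im \<tau> > 0}"

definition Lam :: "complex \<Rightarrow> complex set" where
  "Lam \<tau> = {2 * of_real pi * \<i> * (of_int m * \<tau> + of_int n) | m n. True}"

definition bernoulli :: "nat \<Rightarrow> real" where
  "bernoulli n = fact n * fps_nth (fps_X / (fps_exp 1 - 1)) n"

definition divisor_sum :: "nat \<Rightarrow> nat \<Rightarrow> nat" where
  "divisor_sum k n = (\<Sum>d | d dvd n. d ^ k)"

definition eisenstein :: "nat \<Rightarrow> complex \<Rightarrow> complex" where
  "eisenstein k \<tau> =
     (if odd k then 0
      else - of_real (bernoulli k) / fact k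
           + 2 / fact (k - 1) *
             (\<Sum>n. of_nat (divisor_sum (k - 1) (Suc n)) * exp (2 * of_real pi * \<i> * of_nat (Suc n) * \<tau>)))"

text \<open>
  The holomorphic function on \<open>S\<close> that agrees with \<open>f\<close> in a punctured neighbourhood of \<open>0\<close>.  If it
  exists and \<open>S\<close> is open and connected with \<open>0\<close> as a limit point, its values on \<open>S\<close> are uniquely
  determined; only such values are used below.
\<close>
definition continuation :: "complex set \<Rightarrow> (complex \<Rightarrow> complex) \<Rightarrow> complex \<Rightarrow> complex" where
  "continuation S f = (SOME g. g holomorphic_on S \<and> (\<forall>\<^sub>F z in at 0. g z = f z))"

definition P1 :: "complex \<Rightarrow> complex \<Rightarrow> complex" where
  "P1 \<tau> = continuation (- Lam \<tau>) (\<lambda>z. 1 / z - (\<Sum>k. eisenstein (k + 2) \<tau> * z ^ (k + 1)))"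

definition P :: "nat \<Rightarrow> complex \<Rightarrow> complex \<Rightarrow> complex" where
  "P k \<tau> z = (-1) ^ (k - 1) / fact (k - 1) * (deriv ^^ (k - 1)) (P1 \<tau>) z"

definition K :: "complex \<Rightarrow> complex \<Rightarrow> complex" where
  "K \<tau> = continuation UNIV
     (\<lambda>z. z * exp (- (\<Sum>k. eisenstein (k + 2) \<tau> / of_nat (k + 2) * z ^ (k + 2))))"


section \<open>Infinite matrices with \<open>2 \<times> 2\<close> blocks, indexed from 1\<close>

type_synonym block_matrix = "nat \<Rightarrow> nat \<Rightarrow> complex^2^2"
type_synonym block_row = "nat \<Rightarrow> complex^2"

fun block_power :: "block_matrix \<Rightarrow> nat \<Rightarrow> block_matrix" where
  "block_power A 0 = (\<lambda>k l. if k = l then mat 1 else 0)"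
| "block_power A (Suc n) = (\<lambda>k l. \<Sum>\<^sub>\<infinity>m\<in>{1..}. block_power A n k m ** A m l)"

text \<open>\<open>(I - A)\<^sup>-\<^sup>1\<close> as the Neumann series \<open>\<Sum>\<^sub>n A\<^sup>n\<close>.\<close>
definition neumann_inverse :: "block_matrix \<Rightarrow> block_matrix" where
  "neumann_inverse A k l = (\<Sum>n. block_power A n k l)"

definition row_times :: "block_row \<Rightarrow> block_matrix \<Rightarrow> block_row" where
  "row_times b A l = (\<Sum>\<^sub>\<infinity>k\<in>{1..}. b k v* A k l)"

definition row_dot :: "block_row \<Rightarrow> block_row \<Rightarrow> complex" where
  "row_dot b c = (\<Sum>\<^sub>\<infinity>k\<in>{1..}. \<Sum>a\<in>UNIV. b k $ a * c k $ a)"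


section \<open>The genus two period matrix in the \<open>\<rho>\<close> parametrisation\<close>

definition CC :: "nat \<Rightarrow> nat \<Rightarrow> complex \<Rightarrow> complex" where
  "CC k l \<tau> = (-1) ^ (k + 1) * fact (k + l - 1) / (fact (k - 1) * fact (l - 1)) * eisenstein (k + l) \<tau>"

definition DD :: "nat \<Rightarrow> nat \<Rightarrow> complex \<Rightarrow> complex \<Rightarrow> complex" where
  "DD k l \<tau> z = (-1) ^ (k + 1) * fact (k + l - 1) / (fact (k - 1) * fact (l - 1)) * P (k + l) \<tau> z"

text \<open>
  Half-integral powers of \<open>\<rho>\<close> are powers of one fixed square root \<open>csqrt \<rho>\<close>.  Changing its sign
  conjugates \<open>R\<close> by \<open>(-1)\<^sup>k\<close> and multiplies \<open>\<beta>(k)\<close> by \<open>(-1)\<^sup>k\<close>, so that the expressions for the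
  period matrix below do not depend on the choice.
\<close>
definition R :: "complex \<Rightarrow> complex \<Rightarrow> complex \<Rightarrow> block_matrix" where
  "R \<tau> w \<rho> k l =
     (let c = - (csqrt \<rho> ^ (k + l)) / of_real (sqrt (real (k * l)))
      in vector [vector [c * DD k l \<tau> w, c * CC k l \<tau>],
                 vector [c * CC k l \<tau>, c * DD l k \<tau> w]])"

definition \<beta> :: "complex \<Rightarrow> complex \<Rightarrow> complex \<Rightarrow> block_row" where
  "\<beta> \<tau> w \<rho> k =
     (csqrt \<rho> ^ k / of_real (sqrt (real k)) * (P k \<tau> w - eisenstein k \<tau>)) *s vector [-1, (-1) ^ k]"

definition \<beta>_bar :: "complex \<Rightarrow> complex \<Rightarrow> complex \<Rightarrow> block_row" where
  "\<beta>_bar \<tau> w \<rho> k = vector [\<beta> \<tau> w \<rho> k $ 2, \<beta> \<tau> w \<rho> k $ 1]"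

definition Omega11 :: "complex \<Rightarrow> complex \<Rightarrow> complex \<Rightarrow> complex" where
  "Omega11 \<tau> w \<rho> =
     (2 * of_real pi * \<i> * \<tau>
        - \<rho> * (\<Sum>a\<in>UNIV. \<Sum>b\<in>UNIV. neumann_inverse (R \<tau> w \<rho>) 1 1 $ a $ b)) / (2 * of_real pi * \<i>)"

definition Omega12 :: "complex \<Rightarrow> complex \<Rightarrow> complex \<Rightarrow> complex" where
  "Omega12 \<tau> w \<rho> =
     (w - csqrt \<rho> * (\<Sum>a\<in>UNIV. row_times (\<beta> \<tau> w \<rho>) (neumann_inverse (R \<tau> w \<rho>)) 1 $ a))
       / (2 * of_real pi * \<i>)"

text \<open>
  \<open>\<Omega>\<close> is a value of the period matrix \<open>\<Omega>\<^sup>(\<^sup>2\<^sup>)(\<tau>, w, \<rho>)\<close>.  Its entry \<open>\<Omega>\<^sub>2\<^sub>2\<close> is only determined up to the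
  choice of a logarithm \<open>L\<close> of \<open>-\<rho>/K(\<tau>,w)\<^sup>2\<close>, that is, up to an integer.
\<close>
definition is_Omega2 :: "complex \<Rightarrow> complex \<Rightarrow> complex \<Rightarrow> complex^2^2 \<Rightarrow> bool" where
  "is_Omega2 \<tau> w \<rho> \<Omega> \<longleftrightarrow>
     \<Omega> $ 1 $ 1 = Omega11 \<tau> w \<rho> \<and>
     \<Omega> $ 1 $ 2 = Omega12 \<tau> w \<rho> \<and>
     \<Omega> $ 2 $ 1 = Omega12 \<tau> w \<rho> \<and>
     (\<exists>L. exp L = - \<rho> / (K \<tau> w)\<^sup>2 \<and>
          2 * of_real pi * \<i> * \<Omega> $ 2 $ 2
            = L - row_dot (row_times (\<beta> \<tau> w \<rho>) (neumann_inverse (R \<tau> w \<rho>))) (\<beta>_bar \<tau> w \<rho>))"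


section \<open>The domains\<close>

definition D_rho :: "(complex \<times> complex \<times> complex) set" where
  "D_rho = {(\<tau>, w, \<rho>). \<tau> \<in> upper_half_plane \<and>
      (\<forall>l\<in>Lam \<tau>. cmod (w - l) > 2 * sqrt (cmod \<rho>) \<and> 2 * sqrt (cmod \<rho>) > 0)}"

definition D_chi :: "(complex \<times> complex \<times> complex) set" where
  "D_chi = {(\<tau>, w, chi). (\<tau>, w, - w\<^sup>2 * chi) \<in> D_rho \<and> 0 < cmod chi \<and> cmod chi < 1 / 4}"

definition D_chi0 :: "(complex \<times> complex \<times> complex) set" where
  "D_chi0 = {(\<tau>, w, chi). \<tau> \<in> upper_half_plane \<and> w = 0 \<and> 0 < cmod chi \<and> cmod chi < 1 / 4}"

definition siegel_upper_half_space :: "(complex^2^2) set" where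
  "siegel_upper_half_space =
     {\<Omega>. transpose \<Omega> = \<Omega> \<and> (\<forall>v::real^2. v \<noteq> 0 \<longrightarrow> v \<bullet> ((\<chi> i j. Im (\<Omega> $ i $ j)) *v v) > 0)}"


section \<open>The group \<open>\<Gamma>\<^sub>1\<close> and its actions\<close>

definition Gamma1 :: "(int^2^2) set" where
  "Gamma1 = {g. det g = 1}"

definition Gamma1_act :: "int^2^2 \<Rightarrow> complex \<times> complex \<times> complex \<Rightarrow> complex \<times> complex \<times> complex" where
  "Gamma1_act g = (\<lambda>(\<tau>, w, chi).
     ((of_int (g $ 1 $ 1) * \<tau> + of_int (g $ 1 $ 2)) / (of_int (g $ 2 $ 1) * \<tau> + of_int (g $ 2 $ 2)),
      w / (of_int (g $ 2 $ 1) * \<tau> + of_int (g $ 2 $ 2)),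
      chi))"

text \<open>The action \<open>(A\<Omega> + B)(C\<Omega> + D)\<^sup>-\<^sup>1\<close> of the symplectic matrix with blocks \<open>A, B, C, D\<close>.\<close>
definition Sp4_act ::
  "complex^2^2 \<Rightarrow> complex^2^2 \<Rightarrow> complex^2^2 \<Rightarrow> complex^2^2 \<Rightarrow> complex^2^2 \<Rightarrow> complex^2^2" where
  "Sp4_act A B C D \<Omega> = (A ** \<Omega> + B) ** matrix_inv (C ** \<Omega> + D)"

definition Gamma1_act_siegel :: "int^2^2 \<Rightarrow> complex^2^2 \<Rightarrow> complex^2^2" where
  "Gamma1_act_siegel g =
     Sp4_act (vector [vector [of_int (g $ 1 $ 1), 0], vector [0, 1]])
             (vector [vector [of_int (g $ 1 $ 2), 0], vector [0, 0]])
             (vector [vector [of_int (g $ 2 $ 1), 0], vector [0, 0]])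
             (vector [vector [of_int (g $ 2 $ 2), 0], vector [0, 1]])"


section \<open>The map \<open>F\<^sup>\<chi>\<close>\<close>

text \<open>Holomorphy in three complex variables: the real derivative exists and is complex linear.\<close>
definition holomorphic3_on ::
  "(complex \<times> complex \<times> complex \<Rightarrow> complex) \<Rightarrow> (complex \<times> complex \<times> complex) set \<Rightarrow> bool" where
  "holomorphic3_on f N \<longleftrightarrow>
     (\<forall>p\<in>N. \<exists>a b c. (f has_derivative (\<lambda>(t, u, v). a * t + b * u + c * v)) (at p within N))"

definition f_chi :: "complex \<Rightarrow> complex" where
  "f_chi chi = (1 - csqrt (1 - 4 * chi)) / (2 * chi) - 1"

text \<open>
  \<open>F\<close> is, on \<open>N \<subseteq> D_chi \<union> D_chi0\<close>, the map \<open>F\<^sup>\<chi>\<close> for some choice of the branch of the logarithm for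
  which it is holomorphic and equivariant.  The logarithm has monodromy, for instance when \<open>\<chi>\<close> runs
  around \<open>0\<close>, so there is no such branch on all of \<open>D_chi \<union> D_chi0\<close> and the domain \<open>N\<close> on which it is
  chosen has to be part of the notion.
\<close>
definition is_F_chi ::
  "(complex \<times> complex \<times> complex) set \<Rightarrow> (complex \<times> complex \<times> complex \<Rightarrow> complex^2^2) \<Rightarrow> bool" where
  "is_F_chi N F \<longleftrightarrow>
     F ` N \<subseteq> siegel_upper_half_space \<and>
     (\<forall>\<tau> w chi. (\<tau>, w, chi) \<in> N \<inter> D_chi \<longrightarrow> is_Omega2 \<tau> w (- w\<^sup>2 * chi) (F (\<tau>, w, chi))) \<and>
     (\<forall>\<tau> chi. (\<tau>, 0, chi) \<in> N \<inter> D_chi0 \<longrightarrow>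
        (\<exists>L. exp L = f_chi chi \<and>
             F (\<tau>, 0, chi) = vector [vector [\<tau>, 0], vector [0, L / (2 * of_real pi * \<i>)]])) \<and>
     (\<forall>i j. holomorphic3_on (\<lambda>p. F p $ i $ j) N) \<and>
     (\<forall>g\<in>Gamma1. \<forall>p\<in>N. F (Gamma1_act g p) = Gamma1_act_siegel g (F p))"

end

theory Submission
  imports Defs "HOL-Complex_Analysis.Complex_Analysis"
begin

text \<open>
  Put \<open>e\<^sub>m = E\<^sub>m(\<tau>) w\<^sup>m\<close>.  After a diagonal conjugation the matrix \<open>R\<close> depends on \<open>\<chi>\<close> and the \<open>e\<^sub>m\<close> only,
  and it is a contraction when the \<open>e\<^sub>m\<close> are small.  Hence the period matrix extends holomorphically to
  \<open>w = 0\<close>, where \<open>e = 0\<close> and the linear system is solved by geometric sequences.  There the map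
  \<open>(\<Omega>\<^sub>1\<^sub>1, \<Omega>\<^sub>1\<^sub>2, exp (2\<pi>i \<Omega>\<^sub>2\<^sub>2))\<close>, which is the same for all branches of the logarithm, has the diagonal derivative
  with entries \<open>1\<close>, \<open>\<surd>(1 - 4\<chi>)/(2\<pi>i)\<close> and \<open>f'(\<chi>) \<noteq> 0\<close>, so it is injective near \<open>x = (\<tau>0, 0, \<chi>0)\<close>.

  Under \<open>\<Gamma>\<^sub>1\<close> only \<open>e\<^sub>2\<close> changes, by the quasi-modularity of \<open>E\<^sub>2\<close>, and \<open>R\<close> changes by a matrix of rank one;
  the Sherman--Morrison formula then gives the equivariance.  Let \<open>U\<close> be a small neighbourhood of \<open>x\<close>
  invariant under the stabiliser of \<open>\<tau>0\<close>, and \<open>N\<close> the union of its translates.  If two points of \<open>N\<close> have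
  the same image, translate one of them to \<open>u \<in> U\<close> and the other to \<open>h u'\<close> with \<open>u' \<in> U\<close> and \<open>h \<in> \<Gamma>\<^sub>1\<close>.
  The entries \<open>\<Omega>\<^sub>1\<^sub>1\<close> at \<open>u\<close> and \<open>u'\<close> are near \<open>\<tau>0\<close> and related by \<open>h\<close>, which therefore fixes \<open>\<tau>0\<close>.
  So \<open>h u' \<in> U\<close>, and \<open>u = h u'\<close> by injectivity on \<open>U\<close>.
\<close>

section \<open>The generating function of the Bernoulli numbers\<close>

text \<open>The claim quantifies over every \<open>F\<close> with \<open>is_F_chi\<close>, whatever
  branch it uses. So injectivity is proved for \<open>F33\<close>, where the logarithm is
  exponentiated away, and one explicit branch serves only for existence.

  N has to be invariant, and on an orbit \<tau> comes arbitrarily close to the real axis, where no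
  bound on E_m(\<tau>) alone is uniform. Hence all estimates are made for the e_m. For m = 2 the
  orbit adds c w^2 / (2 pi i j), j = c \<tau> + d, which is at most |w|^2 / Im \<tau>; this is why
  that invariant is made small.

  The bound |\<chi>| < 1/4 enters through x < 1/2: at e = 0 the row sums of block k are at most
  (x/(1-x))^k - x^k, and x/(1-x) < 1 exactly then. The gap to 1 leaves room for small e.

  \<open>P1\<close> and \<open>K\<close> are chosen continuations from a punctured disc at 0, of
  which nothing is known until one is exhibited. The q-series \<open>zeta_q\<close> and the product
  \<open>sigma_q\<close> provide them, and the explicit lattice translations of
  \<open>zeta_q\<close> also give the quasi-modularity.\<close>

definition bern_coeff :: "nat \<Rightarrow> complex" where
  "bern_coeff n = of_real (bernoulli n) / fact n"

definition bern_fun :: "complex \<Rightarrow> complex" where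
  "bern_fun z = (if z = 0 then 1 else z / (exp z - 1))"

lemma exp_neq_1:
  assumes "norm z < 2 * pi" "z \<noteq> 0"
  shows "exp z \<noteq> (1::complex)"
proof
  assume "exp z = 1"
  then obtain n :: int where n: "Re z = 0" "Im z = of_int (2 * n) * pi"
    unfolding exp_eq_1 by blast
  have "\<bar>Im z\<bar> < 2 * pi"
    using assms(1) abs_Im_le_cmod[of z] by linarith
  then have "\<bar>real_of_int n\<bar> < 1"
    by (simp add: n abs_mult)
  then have "n = 0" by linarith
  then show False using n assms(2) by (simp add: complex_eq_iff)
qed

text \<open>(e^z - 1)/z has a removable singularity at 0 with value 1 and no zero in |z| < 2 pi, so
  its reciprocal is holomorphic there.\<close>

lemma bern_fun_holomorphic: "bern_fun holomorphic_on ball 0 (2 * pi)"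
proof -
  have "(\<lambda>z. if z = 0 then deriv (\<lambda>w. exp w - 1) 0 else (exp z - 1 - (exp 0 - 1)) / (z - 0))
      holomorphic_on ball (0::complex) (2 * pi)"
    by (rule pole_lemma) (auto intro!: holomorphic_intros)
  moreover have "deriv (\<lambda>w. exp w - (1::complex)) 0 = 1"
    by (rule DERIV_imp_deriv) (auto intro!: derivative_eq_intros)
  ultimately have "(\<lambda>z. if z = 0 then 1 else (exp z - 1) / z) holomorphic_on ball (0::complex) (2 * pi)"
    by (simp cong: if_cong)
  then have "(\<lambda>z. 1 / (if z = 0 then 1 else (exp z - 1) / z)) holomorphic_on ball (0::complex) (2 * pi)"
    by (rule holomorphic_on_divide[OF holomorphic_on_const]) (auto dest: exp_neq_1)
  then show ?thesis
    by (rule holomorphic_transform) (auto simp: bern_fun_def)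
qed

text \<open>\<open>bernoulli\<close> is a formal quotient over the reals. Both its series and the
  Taylor series of \<open>bern_fun\<close> give z when multiplied by e^z - 1, and formal power
  series have no zero divisors.\<close>

lemma bern_fun_expansion:
  "bern_fun has_fps_expansion Abs_fps bern_coeff"
proof -
  define A where "A = fps_expansion bern_fun 0"
  have A: "bern_fun has_fps_expansion A"
    unfolding A_def by (rule has_fps_expansion_fps_expansion[OF open_ball _ bern_fun_holomorphic]) auto
  have "(\<lambda>z. bern_fun z * (exp z - 1)) has_fps_expansion A * (fps_exp 1 - 1)"
    by (intro fps_expansion_intros A has_fps_expansion_exp[of 1, simplified])
  moreover have "bern_fun z * (exp z - 1) = z" if "norm z < 2 * pi" for z
    using exp_neq_1[OF that] by (auto simp: bern_fun_def)
  then have "eventually (\<lambda>z. bern_fun z * (exp z - 1) = z) (nhds 0)"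
    by (intro eventually_nhds_in_open[of "ball 0 (2 * pi)", THEN eventually_mono]) auto
  ultimately have "(\<lambda>z. z) has_fps_expansion A * (fps_exp 1 - 1)"
    by (simp add: has_fps_expansion_cong)
  then have 1: "A * (fps_exp 1 - 1) = fps_X"
    using fps_expansion_unique_complex has_fps_expansion_fps_X by blast
  define Br where "Br = (fps_X / (fps_exp 1 - 1) :: real fps)"
  have sub: "subdegree (fps_exp 1 - 1 :: real fps) = 1"
    by (rule subdegreeI) auto
  have nz: "(fps_exp 1 - 1 :: real fps) \<noteq> 0" "(fps_exp 1 - 1 :: complex fps) \<noteq> 0"
    by (auto simp: fps_eq_iff intro!: exI[of _ 1])
  \<comment> \<open>Formal division is exact only by a divisor; e^X - 1 has subdegree 1, the same as
    X.\<close>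
  have "(fps_exp 1 - 1 :: real fps) dvd fps_X"
    using nz sub by (simp add: fps_dvd_iff)
  then have Br: "Br * (fps_exp 1 - 1) = fps_X"
    unfolding Br_def by (rule dvd_div_mult_self)
  have "Abs_fps (\<lambda>n. of_real (Br $ n)) * (fps_exp 1 - 1) = (fps_X :: complex fps)"
  proof (rule fps_ext)
    fix n
    have "(Abs_fps (\<lambda>n. of_real (Br $ n)) * (fps_exp 1 - 1)) $ n = (of_real ((Br * (fps_exp 1 - 1)) $ n) :: complex)"
      unfolding fps_mult_nth of_real_sum by (intro sum.cong) auto
    then show "(Abs_fps (\<lambda>n. of_real (Br $ n)) * (fps_exp 1 - 1)) $ n = (fps_X :: complex fps) $ n"
      by (simp add: Br)
  qed
  with 1 have "A * (fps_exp 1 - 1) = Abs_fps (\<lambda>n. of_real (Br $ n)) * (fps_exp 1 - 1)"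
    by (simp only:)
  then have "A = Abs_fps (\<lambda>n. of_real (Br $ n))"
    unfolding mult_right_cancel[OF nz(2)] .
  also have "(\<lambda>n. of_real (Br $ n)) = bern_coeff"
    by (auto simp: bern_coeff_def bernoulli_def Br_def)
  finally show ?thesis using A by simp
qed

lemma bern_fun_sums:
  assumes "norm z < 2 * pi"
  shows "(\<lambda>n. bern_coeff n * z ^ n) sums bern_fun z"
proof -
  have "fps_expansion bern_fun 0 = Abs_fps bern_coeff"
    using bern_fun_expansion
      has_fps_expansion_fps_expansion[OF open_ball _ bern_fun_holomorphic]
    by (intro fps_expansion_unique_complex[of bern_fun]) auto
  then have *: "(deriv ^^ n) bern_fun 0 / fact n = bern_coeff n" for n
    by (simp add: fps_eq_iff fps_expansion_def)
  have "(\<lambda>n. (deriv ^^ n) bern_fun 0 / fact n * (z - 0) ^ n) sums bern_fun z"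
    using assms by (intro holomorphic_power_series[OF bern_fun_holomorphic]) auto
  then show ?thesis by (simp add: *)
qed

lemma bern_coeff_0 [simp]: "bern_coeff 0 = 1"
proof -
  have "(\<lambda>n. bern_coeff n * 0 ^ n) sums bern_coeff 0"
    by (rule powser_sums_zero)
  moreover have "(\<lambda>n. bern_coeff n * 0 ^ n) sums bern_fun 0"
    by (rule bern_fun_sums) simp
  ultimately have "bern_coeff 0 = bern_fun 0"
    by (rule sums_unique2)
  then show ?thesis by (simp add: bern_fun_def)
qed

text \<open>Compare coefficients in the reflection formula
  \<open>bern_fun (- z) = bern_fun z + z\<close>.\<close>

lemma bern_coeff_parity:
  "bern_coeff 1 = -1/2" "odd n \<Longrightarrow> n \<noteq> 1 \<Longrightarrow> bern_coeff n = 0"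
proof -
  have refl: "bern_fun (- z) = bern_fun z + z" if "norm z < 2 * pi" for z
    using exp_neq_1[OF that] exp_neq_1[of "-z"] that
    by (auto simp: bern_fun_def exp_minus divide_simps) (auto simp: algebra_simps)
  have 1: "(\<lambda>z. bern_fun z + z) has_fps_expansion Abs_fps bern_coeff + fps_X"
    by (intro fps_expansion_intros bern_fun_expansion)
  have 2: "(\<lambda>z. bern_fun (- z)) has_fps_expansion fps_compose (Abs_fps bern_coeff) (- fps_X)"
  proof -
    have "(\<lambda>z::complex. - z) has_fps_expansion - fps_X"
      by (intro fps_expansion_intros)
    from has_fps_expansion_compose[OF bern_fun_expansion this] show ?thesis
      by (simp add: o_def)
  qed
  have "eventually (\<lambda>z. bern_fun (- z) = bern_fun z + z) (nhds 0)"
    by (intro eventually_nhds_in_open[of "ball 0 (2 * pi)", THEN eventually_mono]) (auto intro: refl)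
  with 2 have "(\<lambda>z. bern_fun z + z) has_fps_expansion fps_compose (Abs_fps bern_coeff) (- fps_X)"
    by (simp add: has_fps_expansion_cong)
  with 1 have "fps_compose (Abs_fps bern_coeff) (- fps_X) = Abs_fps bern_coeff + fps_X"
    by (rule fps_expansion_unique_complex[rotated])
  then have *: "(-1) ^ n * bern_coeff n = bern_coeff n + (if n = 1 then 1 else 0)" for n
    by (simp add: fps_eq_iff fps_compose_uminus')
  show "bern_coeff 1 = -1/2"
    using *[of 1] by (simp add: field_simps eq_neg_iff_add_eq_0)
  show "bern_coeff n = 0" if "odd n" "n \<noteq> 1"
    using *[of n] that by simp
qed

text \<open>The Bernoulli constants of the Eisenstein series sum up to the part of
  \<open>zeta_q\<close> that is free of the nome.\<close>

lemma inverse_exp_minus_1_sums: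
  assumes "norm z < 2 * pi" "z \<noteq> 0"
  shows "(\<lambda>k. bern_coeff (k + 2) * z ^ (k + 1)) sums (1 / 2 + 1 / (exp z - 1) - 1 / z)"
proof -
  have "(\<lambda>n. bern_coeff (n + 2) * z ^ (n + 2)) sums (bern_fun z - (\<Sum>i<2. bern_coeff i * z ^ i))"
    using bern_fun_sums[OF assms(1)] by (rule sums_split_initial_segment)
  then have "(\<lambda>n. bern_coeff (n + 2) * z ^ (n + 2) / z) sums ((z / (exp z - 1) - (1 - z / 2)) / z)"
    using assms by (intro sums_divide) (simp add: bern_fun_def numeral_2_eq_2 bern_coeff_parity[simplified])
  moreover have "bern_coeff (n + 2) * z ^ (n + 2) / z = bern_coeff (n + 2) * z ^ (n + 1)" for n
    using assms by simp
  moreover have "(z / (exp z - 1) - (1 - z / 2)) / z = 1 / 2 + 1 / (exp z - 1) - 1 / z"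
    using assms exp_neq_1[OF assms] by (simp add: field_simps)
  ultimately show ?thesis by simp
qed

section \<open>The nome and the growth of divisor sums\<close>

definition nome :: "complex \<Rightarrow> complex" where
  "nome \<tau> = exp (2 * of_real pi * \<i> * \<tau>)"

lemma norm_nome: "norm (nome \<tau>) = exp (- 2 * pi * Im \<tau>)"
  by (simp add: nome_def)

lemma norm_nome_less_1: "Im \<tau> > 0 \<Longrightarrow> norm (nome \<tau>) < 1"
  by (simp add: norm_nome)

lemma nome_nonzero [simp]: "nome \<tau> \<noteq> 0"
  by (simp add: nome_def)

lemma nome_power: "exp (2 * of_real pi * \<i> * of_nat n * \<tau>) = nome \<tau> ^ n"
  by (simp add: nome_def exp_of_nat_mult[symmetric] mult_ac)

text \<open>Each divisor contributes (d r)^k / k!, a single term of the series of e^(d r). The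
  weight r^k / k! thus makes the bound independent of k.\<close>

lemma divisor_sum_le:
  assumes "r \<ge> 0" "n > 0"
  shows "real (divisor_sum k n) * r ^ k / fact k \<le> real n * exp (real n * r)"
proof -
  have "real (divisor_sum k n) * r ^ k / fact k = (\<Sum>d | d dvd n. (real d * r) ^ k / fact k)"
    by (simp add: divisor_sum_def sum_distrib_right sum_divide_distrib power_mult_distrib)
  also have "\<dots> \<le> (\<Sum>d | d dvd n. exp (real n * r))"
  proof (rule sum_mono)
    fix d assume "d \<in> {d. d dvd n}"
    then have "d \<le> n" using assms by (auto dest: dvd_imp_le)
    have s: "(\<lambda>k. (real d * r) ^ k /\<^sub>R fact k) sums exp (real d * r)"
      by (rule exp_converges)
    have "(\<Sum>k\<in>{k}. (real d * r) ^ k /\<^sub>R fact k) \<le> (\<Sum>k. (real d * r) ^ k /\<^sub>R fact k)"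
      by (rule sum_le_suminf[OF sums_summable[OF s]]) (use assms in auto)
    then have "(real d * r) ^ k / fact k \<le> exp (real d * r)"
      using sums_unique[OF s] by (simp add: divide_inverse mult.commute)
    also have "\<dots> \<le> exp (real n * r)"
      using \<open>d \<le> n\<close> assms by (simp add: mult_right_mono)
    finally show "(real d * r) ^ k / fact k \<le> exp (real n * r)" .
  qed
  also have "\<dots> = real (card {d. d dvd n}) * exp (real n * r)"
    by simp
  also have "\<dots> \<le> real n * exp (real n * r)"
  proof -
    have "{d. d dvd n} \<subseteq> {1..n}" using assms by (auto intro: dvd_imp_le Nat.gr0I)
    then have "card {d. d dvd n} \<le> card {1..n}" by (intro card_mono) auto
    then show ?thesis by (simp add: mult_right_mono)
  qed
  finally show ?thesis .
qed

lemma summable_n_power: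
  fixes x :: real
  assumes "0 \<le> x" "x < 1"
  shows "summable (\<lambda>n. real (Suc n) * x ^ Suc n)"
proof -
  have "summable (\<lambda>n. real (Suc n) * x ^ n)"
    using geometric_deriv_sums[of x] assms by (auto simp: sums_iff)
  from summable_mult[OF this, of x] show ?thesis
    by (simp add: mult_ac)
qed

section \<open>Infinite matrices with small row sums\<close>

lemma abs_summable_product:
  fixes f :: "'i \<Rightarrow> 'j \<Rightarrow> complex"
  assumes 1: "\<And>i. (\<lambda>j. norm (f i j)) summable_on UNIV"
    and 2: "\<And>i. (\<Sum>\<^sub>\<infinity>j. norm (f i j)) \<le> M i" and 3: "M summable_on UNIV"
  shows "(\<lambda>x. norm (case x of (i, j) \<Rightarrow> f i j)) summable_on UNIV \<times> UNIV"
  unfolding Infinite_Sum.abs_summable_on_Sigma_iff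
proof (intro conjI ballI)
  have "(\<lambda>i. \<Sum>\<^sub>\<infinity>j. norm (f i j)) summable_on UNIV"
    by (rule summable_on_comparison_test[OF 3]) (auto intro: 2 infsum_nonneg)
  then show "(\<lambda>i. norm (\<Sum>\<^sub>\<infinity>j. norm (case (i, j) of (i, j) \<Rightarrow> f i j))) summable_on UNIV"
    by (simp add: infsum_nonneg)
qed (use 1 in simp)

text \<open>The bound M makes the family absolutely summable over pairs, so that Fubini applies and
  the column sums inherit the bound.\<close>

lemma
  fixes f :: "'i \<Rightarrow> 'j \<Rightarrow> complex"
  assumes 1: "\<And>i. (\<lambda>j. norm (f i j)) summable_on UNIV"
    and 2: "\<And>i. (\<Sum>\<^sub>\<infinity>j. norm (f i j)) \<le> M i" and 3: "M summable_on UNIV"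
  shows infsum_swap_majorised: "(\<Sum>\<^sub>\<infinity>i. \<Sum>\<^sub>\<infinity>j. f i j) = (\<Sum>\<^sub>\<infinity>j. \<Sum>\<^sub>\<infinity>i. f i j)"
    and abs_summable_swap_majorised: "(\<lambda>j. norm (\<Sum>\<^sub>\<infinity>i. f i j)) summable_on UNIV"
    and infsum_norm_swap_le: "(\<Sum>\<^sub>\<infinity>j. norm (\<Sum>\<^sub>\<infinity>i. f i j)) \<le> (\<Sum>\<^sub>\<infinity>i. M i)"
proof -
  have abs: "(\<lambda>x. norm (case x of (i, j) \<Rightarrow> f i j)) summable_on UNIV \<times> UNIV"
    by (rule abs_summable_product[OF assms])
  show "(\<Sum>\<^sub>\<infinity>i. \<Sum>\<^sub>\<infinity>j. f i j) = (\<Sum>\<^sub>\<infinity>j. \<Sum>\<^sub>\<infinity>i. f i j)"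
    using abs abs_summable_summable by (intro infsum_swap_banach) blast
  have abs': "(\<lambda>x. norm (case x of (j, i) \<Rightarrow> f i j)) summable_on UNIV \<times> UNIV"
  proof -
    have "bij_betw prod.swap (UNIV :: ('j \<times> 'i) set) UNIV"
      by (simp add: bij_betw_def)
    from summable_on_reindex_bij_betw[OF this, of "\<lambda>x. norm (case x of (i, j) \<Rightarrow> f i j)"]
    show ?thesis using abs by (simp add: case_prod_unfold)
  qed
  then have col: "(\<lambda>i. norm (f i j)) summable_on UNIV" for j
    unfolding Infinite_Sum.abs_summable_on_Sigma_iff by simp
  have colsum: "(\<lambda>j. \<Sum>\<^sub>\<infinity>i. norm (f i j)) summable_on UNIV"
    using abs' unfolding Infinite_Sum.abs_summable_on_Sigma_iff by (simp add: infsum_nonneg)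
  have le: "norm (\<Sum>\<^sub>\<infinity>i. f i j) \<le> (\<Sum>\<^sub>\<infinity>i. norm (f i j))" for j
    by (rule norm_infsum_bound) (rule col)
  show sm: "(\<lambda>j. norm (\<Sum>\<^sub>\<infinity>i. f i j)) summable_on UNIV"
    by (rule summable_on_comparison_test[OF colsum]) (auto intro: le)
  have "(\<Sum>\<^sub>\<infinity>j. norm (\<Sum>\<^sub>\<infinity>i. f i j)) \<le> (\<Sum>\<^sub>\<infinity>j. \<Sum>\<^sub>\<infinity>i. norm (f i j))"
    by (rule infsum_mono[OF sm colsum]) (rule le)
  also have "\<dots> = (\<Sum>\<^sub>\<infinity>i. \<Sum>\<^sub>\<infinity>j. norm (f i j))"
    by (rule infsum_swap_banach[symmetric]) (use abs in \<open>simp add: case_prod_unfold\<close>)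
  also have "\<dots> \<le> (\<Sum>\<^sub>\<infinity>i. M i)"
  proof (rule infsum_mono[OF _ 3])
    show "(\<lambda>i. \<Sum>\<^sub>\<infinity>j. norm (f i j)) summable_on UNIV"
      by (rule summable_on_comparison_test[OF 3]) (auto intro: 2 infsum_nonneg)
  qed (rule 2)
  finally show "(\<Sum>\<^sub>\<infinity>j. norm (\<Sum>\<^sub>\<infinity>i. f i j)) \<le> (\<Sum>\<^sub>\<infinity>i. M i)" .
qed

lemma infsum_diff_complex:
  fixes f g :: "'i \<Rightarrow> complex"
  assumes "f summable_on B" "g summable_on B"
  shows "(\<Sum>\<^sub>\<infinity>i\<in>B. f i - g i) = infsum f B - infsum g B"
  using infsum_add[OF assms(1), of "\<lambda>i. - g i"] assms(2)
  by (simp add: infsum_uminus summable_on_uminus)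

text \<open>The largest row sum is the operator norm on bounded sequences. Columns therefore only
  have to be bounded, while the rows that they are paired with are summable.\<close>

definition row_contraction :: "('i \<Rightarrow> 'i \<Rightarrow> complex) \<Rightarrow> real \<Rightarrow> bool" where
  "row_contraction A \<theta> \<longleftrightarrow> 0 \<le> \<theta> \<and> \<theta> < 1 \<and>
     (\<forall>i. (\<lambda>j. norm (A i j)) summable_on UNIV \<and> (\<Sum>\<^sub>\<infinity>j. norm (A i j)) \<le> \<theta>)"

definition mat_app :: "('i \<Rightarrow> 'i \<Rightarrow> complex) \<Rightarrow> ('i \<Rightarrow> complex) \<Rightarrow> 'i \<Rightarrow> complex" where
  "mat_app A y i = (\<Sum>\<^sub>\<infinity>j. A i j * y j)"

fun mat_pow :: "('i \<Rightarrow> 'i \<Rightarrow> complex) \<Rightarrow> nat \<Rightarrow> 'i \<Rightarrow> 'i \<Rightarrow> complex" where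
  "mat_pow A 0 = (\<lambda>i j. if i = j then 1 else 0)"
| "mat_pow A (Suc n) = (\<lambda>i j. \<Sum>\<^sub>\<infinity>m. mat_pow A n i m * A m j)"

definition mat_neumann :: "('i \<Rightarrow> 'i \<Rightarrow> complex) \<Rightarrow> 'i \<Rightarrow> 'i \<Rightarrow> complex" where
  "mat_neumann A i j = (\<Sum>\<^sub>\<infinity>n. mat_pow A n i j)"

text \<open>The bounded solution of y = c + A y. It is kept apart from \<open>mat_neumann\<close>
  because for a given right-hand side the solution can be guessed, whereas the entries of the
  inverse stay implicit.\<close>

definition mat_solve :: "('i \<Rightarrow> 'i \<Rightarrow> complex) \<Rightarrow> ('i \<Rightarrow> complex) \<Rightarrow> 'i \<Rightarrow> complex" where
  "mat_solve A c i = (\<Sum>\<^sub>\<infinity>n. (mat_app A ^^ n) c i)"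

lemma norm_mult_bounded_summable:
  fixes a y :: "'i \<Rightarrow> complex"
  assumes "(\<lambda>j. norm (a j)) summable_on UNIV" "\<And>j. norm (y j) \<le> C"
  shows "(\<lambda>j. norm (a j * y j)) summable_on UNIV"
    and "(\<Sum>\<^sub>\<infinity>j. norm (a j * y j)) \<le> (\<Sum>\<^sub>\<infinity>j. norm (a j)) * C"
    and "norm (\<Sum>\<^sub>\<infinity>j. a j * y j) \<le> (\<Sum>\<^sub>\<infinity>j. norm (a j)) * C"
proof -
  have s: "(\<lambda>j. norm (a j) * C) summable_on UNIV"
    by (rule summable_on_cmult_left) (rule assms)
  show 1: "(\<lambda>j. norm (a j * y j)) summable_on UNIV"
    by (rule summable_on_comparison_test[OF s]) (auto simp: norm_mult intro: mult_left_mono assms)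
  have "(\<Sum>\<^sub>\<infinity>j. norm (a j * y j)) \<le> (\<Sum>\<^sub>\<infinity>j. norm (a j) * C)"
    by (rule infsum_mono[OF 1 s]) (auto simp: norm_mult intro: mult_left_mono assms)
  then show 2: "(\<Sum>\<^sub>\<infinity>j. norm (a j * y j)) \<le> (\<Sum>\<^sub>\<infinity>j. norm (a j)) * C"
    by (simp add: infsum_cmult_left')
  show "norm (\<Sum>\<^sub>\<infinity>j. a j * y j) \<le> (\<Sum>\<^sub>\<infinity>j. norm (a j)) * C"
    by (rule order_trans[OF norm_infsum_bound 2]) (rule 1)
qed

lemma geometric_summable_on:
  "0 \<le> \<theta> \<Longrightarrow> \<theta> < 1 \<Longrightarrow> (\<lambda>n. \<theta> ^ n * C) summable_on (UNIV :: nat set)"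
  for \<theta> C :: real
  by (intro summable_on_cmult_left norm_summable_imp_summable_on) (simp add: summable_geometric)

lemma geometric_infsum:
  "0 \<le> \<theta> \<Longrightarrow> \<theta> < 1 \<Longrightarrow> (\<Sum>\<^sub>\<infinity>n. \<theta> ^ n * C) = C / (1 - \<theta>)"
  for \<theta> C :: real
proof -
  assume *: "0 \<le> \<theta>" "\<theta> < 1"
  have "((\<lambda>n. \<theta> ^ n) has_sum 1 / (1 - \<theta>)) UNIV"
    using * geometric_sums[of \<theta>] by (intro norm_summable_imp_has_sum) (auto simp: summable_geometric)
  then show ?thesis
    by (simp add: infsumI infsum_cmult_left')
qed

context
  fixes A :: "'i \<Rightarrow> 'i \<Rightarrow> complex" and \<theta> :: real
  assumes A: "row_contraction A \<theta>"
begin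

lemma row_contractionD:
  "0 \<le> \<theta>" "\<theta> < 1" "(\<lambda>j. norm (A i j)) summable_on UNIV" "(\<Sum>\<^sub>\<infinity>j. norm (A i j)) \<le> \<theta>"
  using A unfolding row_contraction_def by auto

lemma mat_app_summable:
  assumes "\<And>j. norm (y j) \<le> C"
  shows "(\<lambda>j. A i j * y j) summable_on UNIV"
  using norm_mult_bounded_summable(1)[OF row_contractionD(3) assms] by (rule abs_summable_summable)

lemma norm_mat_app_le:
  assumes "\<And>j. norm (y j) \<le> C"
  shows "norm (mat_app A y i) \<le> \<theta> * C"
proof -
  have "C \<ge> 0" using assms norm_ge_zero order_trans by blast
  then show ?thesis unfolding mat_app_def
    by (intro order_trans[OF norm_mult_bounded_summable(3)[OF row_contractionD(3) assms]]
        mult_right_mono row_contractionD)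
qed

lemma mat_app_add:
  assumes "\<And>j. norm (y j) \<le> C" "\<And>j. norm (z j) \<le> C'"
  shows "mat_app A (\<lambda>j. y j + z j) i = mat_app A y i + mat_app A z i"
  unfolding mat_app_def distrib_left
  by (intro infsum_add mat_app_summable[OF assms(1)] mat_app_summable[OF assms(2)])

lemma mat_app_scale: "mat_app A (\<lambda>j. c * y j) i = c * mat_app A y i"
  unfolding mat_app_def by (simp add: infsum_cmult_right' mult.left_commute)

lemma norm_funpow_mat_app_le:
  assumes "\<And>j. norm (y j) \<le> C"
  shows "norm ((mat_app A ^^ n) y i) \<le> \<theta> ^ n * C"
proof (induction n arbitrary: i)
  case (Suc n)
  show ?case using norm_mat_app_le[OF Suc] by (simp add: mult.assoc)
qed (use assms in simp)

lemma norm_mat_solve_le: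
  assumes "\<And>j. norm (c j) \<le> C"
  shows "norm (mat_solve A c i) \<le> C / (1 - \<theta>)"
proof -
  have s: "(\<lambda>n. norm ((mat_app A ^^ n) c i)) summable_on UNIV"
    by (rule summable_on_comparison_test[OF geometric_summable_on[OF row_contractionD(1,2), of C]])
       (auto intro: norm_funpow_mat_app_le assms)
  have "norm (mat_solve A c i) \<le> (\<Sum>\<^sub>\<infinity>n. norm ((mat_app A ^^ n) c i))"
    unfolding mat_solve_def by (rule norm_infsum_bound) (rule s)
  also have "\<dots> \<le> (\<Sum>\<^sub>\<infinity>n. \<theta> ^ n * C)"
    by (rule infsum_mono[OF s geometric_summable_on[OF row_contractionD(1,2)]])
       (intro norm_funpow_mat_app_le assms)
  finally show ?thesis by (simp add: geometric_infsum row_contractionD)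
qed

lemma funpow_mat_app_summable:
  assumes "\<And>j. norm (c j) \<le> C"
  shows "(\<lambda>n. (mat_app A ^^ n) c i) summable_on UNIV"
  by (rule abs_summable_summable,
      rule summable_on_comparison_test[OF geometric_summable_on[OF row_contractionD(1,2), of C]])
     (auto intro: norm_funpow_mat_app_le assms)

lemma mat_solve_eq:
  assumes c: "\<And>j. norm (c j) \<le> C"
  shows "mat_solve A c i = c i + mat_app A (mat_solve A c) i"
proof -
  have C: "C \<ge> 0" using c norm_ge_zero order_trans by blast
  have "mat_solve A c i = (mat_app A ^^ 0) c i + (\<Sum>\<^sub>\<infinity>n. (mat_app A ^^ Suc n) c i)"
  proof -
    have "mat_solve A c i = (\<Sum>\<^sub>\<infinity>n\<in>{0} \<union> range Suc. (mat_app A ^^ n) c i)"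
      unfolding mat_solve_def by (subst UNIV_nat_eq) simp
    also have "\<dots> = (mat_app A ^^ 0) c i + (\<Sum>\<^sub>\<infinity>n\<in>range Suc. (mat_app A ^^ n) c i)"
      using summable_on_subset_banach[OF funpow_mat_app_summable[of c C i, OF c], of "range Suc"]
      by (subst infsum_Un_disjoint) auto
    also have "(\<Sum>\<^sub>\<infinity>n\<in>range Suc. (mat_app A ^^ n) c i) = (\<Sum>\<^sub>\<infinity>n. (mat_app A ^^ Suc n) c i)"
      by (subst infsum_reindex) (auto simp: o_def)
    finally show ?thesis .
  qed
  also have "(\<Sum>\<^sub>\<infinity>n. (mat_app A ^^ Suc n) c i) = (\<Sum>\<^sub>\<infinity>n. \<Sum>\<^sub>\<infinity>j. A i j * (mat_app A ^^ n) c j)"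
    by (simp add: mat_app_def)
  also have "\<dots> = (\<Sum>\<^sub>\<infinity>j. \<Sum>\<^sub>\<infinity>n. A i j * (mat_app A ^^ n) c j)"
  proof (rule infsum_swap_majorised)
    fix n
    note b = norm_funpow_mat_app_le[OF c]
    show "(\<lambda>j. norm (A i j * (mat_app A ^^ n) c j)) summable_on UNIV"
      by (rule norm_mult_bounded_summable(1)[OF row_contractionD(3) b])
    show "(\<Sum>\<^sub>\<infinity>j. norm (A i j * (mat_app A ^^ n) c j)) \<le> \<theta> ^ n * (\<theta> * C)"
      using order_trans[OF norm_mult_bounded_summable(2)[OF row_contractionD(3) b, of i n]
          mult_right_mono[OF row_contractionD(4)]] C row_contractionD(1)
      by (simp add: mult_ac)
  qed (intro geometric_summable_on row_contractionD)
  also have "\<dots> = mat_app A (mat_solve A c) i"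
    by (simp add: mat_app_def mat_solve_def infsum_cmult_right')
  finally show ?thesis by simp
qed

text \<open>Iterating the fixed point equation bounds y by \<theta>^n C for every n.\<close>

lemma mat_app_fixed_point_zero:
  assumes "\<And>j. norm (y j) \<le> C" "\<And>i. y i = mat_app A y i"
  shows "y i = 0"
proof -
  have "mat_app A y = y"
    using assms(2) by (auto simp: fun_eq_iff)
  then have "(mat_app A ^^ n) y = y" for n
    by (induction n) auto
  then have "norm (y i) \<le> \<theta> ^ n * C" for n
    using norm_funpow_mat_app_le[of y C n i, OF assms(1)] by simp
  moreover have "(\<lambda>n. \<theta> ^ n * C) \<longlonglongrightarrow> 0 * C"
    by (intro tendsto_mult_right LIMSEQ_realpow_zero row_contractionD)
  ultimately have "norm (y i) \<le> 0"
    by (intro LIMSEQ_le_const) auto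
  then show ?thesis by simp
qed

text \<open>The difference of two bounded solutions is a bounded fixed point of A, hence 0. This is
  how explicit solutions are recognised later.\<close>

lemma mat_solve_unique:
  assumes c: "\<And>j. norm (c j) \<le> C" and y: "\<And>j. norm (y j) \<le> C'"
    and eq: "\<And>i. y i = c i + mat_app A y i"
  shows "mat_solve A c = y"
proof
  fix i
  let ?z = "\<lambda>j. y j + (-1) * mat_solve A c j"
  have "?z i = 0"
  proof (rule mat_app_fixed_point_zero)
    show "norm (?z j) \<le> C' + C / (1 - \<theta>)" for j
      using norm_triangle_ineq4[of "y j" "mat_solve A c j"] y[of j] norm_mat_solve_le[of c C j, OF c] by simp
    show "?z i = mat_app A ?z i" for i
    proof -
      have "mat_app A ?z i = mat_app A y i + mat_app A (\<lambda>j. (-1) * mat_solve A c j) i"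
        by (rule mat_app_add[OF y, of _ "C / (1 - \<theta>)"]) (use norm_mat_solve_le[OF c] in simp)
      then show ?thesis
        using eq[of i] mat_solve_eq[of c C i, OF c] by (simp only: mat_app_scale) simp
    qed
  qed
  then show "mat_solve A c i = y i" by simp
qed

text \<open>Row sums are submultiplicative.\<close>

lemma mat_pow_bound:
  "(\<lambda>j. norm (mat_pow A n i j)) summable_on UNIV \<and> (\<Sum>\<^sub>\<infinity>j. norm (mat_pow A n i j)) \<le> \<theta> ^ n"
proof (induction n)
  case 0
  have "((\<lambda>j. norm (mat_pow A 0 i j)) has_sum 1) UNIV"
    by (rule has_sum_finite_neutralI[of "{i}"]) auto
  then show ?case by (auto simp: has_sum_iff)
next
  case (Suc n)
  let ?f = "\<lambda>m j. mat_pow A n i m * A m j"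
  have 1: "(\<lambda>j. norm (?f m j)) summable_on UNIV" for m
    using summable_on_cmult_right[OF row_contractionD(3), of "norm (mat_pow A n i m)"] by (simp add: norm_mult)
  have 2: "(\<Sum>\<^sub>\<infinity>j. norm (?f m j)) \<le> norm (mat_pow A n i m) * \<theta>" for m
    by (simp add: norm_mult infsum_cmult_right' mult_left_mono row_contractionD)
  have 3: "(\<lambda>m. norm (mat_pow A n i m) * \<theta>) summable_on UNIV"
    using Suc by (intro summable_on_cmult_left) auto
  have "(\<Sum>\<^sub>\<infinity>m. norm (mat_pow A n i m) * \<theta>) \<le> \<theta> ^ Suc n"
    using Suc row_contractionD(1) by (simp add: infsum_cmult_left' mult_right_mono mult.commute[of \<theta>])
  then show ?case
    using abs_summable_swap_majorised[OF 1 2 3] infsum_norm_swap_le[OF 1 2 3] by simp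
qed

lemma norm_mat_pow_le: "norm (mat_pow A n i j) \<le> \<theta> ^ n"
proof -
  have "norm (mat_pow A n i j) = (\<Sum>\<^sub>\<infinity>j\<in>{j}. norm (mat_pow A n i j))" by simp
  also have "\<dots> \<le> (\<Sum>\<^sub>\<infinity>j. norm (mat_pow A n i j))"
    by (rule infsum_mono_neutral) (use mat_pow_bound in auto)
  finally show ?thesis using mat_pow_bound order_trans by blast
qed

lemma mat_pow_app:
  assumes c: "\<And>j. norm (c j) \<le> C"
  shows "(\<Sum>\<^sub>\<infinity>j. mat_pow A n i j * c j) = (mat_app A ^^ n) c i"
  using c
proof (induction n arbitrary: c C)
  case 0
  have "(\<Sum>\<^sub>\<infinity>j. mat_pow A 0 i j * c j) = (\<Sum>\<^sub>\<infinity>j\<in>{i}. c j)"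
    by (rule infsum_cong_neutral) auto
  then show ?case by simp
next
  case (Suc n)
  have C: "C \<ge> 0" using Suc.prems norm_ge_zero order_trans by blast
  have b: "\<And>m j. norm (A m j * c j) \<le> norm (A m j) * C"
    using Suc.prems by (simp add: norm_mult mult_left_mono)
  have "(\<Sum>\<^sub>\<infinity>j. mat_pow A (Suc n) i j * c j) = (\<Sum>\<^sub>\<infinity>j. \<Sum>\<^sub>\<infinity>m. mat_pow A n i m * A m j * c j)"
    by (simp add: infsum_cmult_left')
  also have "\<dots> = (\<Sum>\<^sub>\<infinity>m. \<Sum>\<^sub>\<infinity>j. mat_pow A n i m * A m j * c j)"
  proof (rule infsum_swap_majorised[symmetric])
    fix m
    have eq: "norm (mat_pow A n i m * A m j * c j) = norm (mat_pow A n i m) * norm (A m j * c j)" for j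
      by (simp add: norm_mult)
    show "(\<lambda>j. norm (mat_pow A n i m * A m j * c j)) summable_on UNIV"
      unfolding eq by (intro summable_on_cmult_right norm_mult_bounded_summable[OF row_contractionD(3) Suc.prems])
    show "(\<Sum>\<^sub>\<infinity>j. norm (mat_pow A n i m * A m j * c j)) \<le> norm (mat_pow A n i m) * (\<theta> * C)"
      unfolding eq infsum_cmult_right'
      by (intro mult_left_mono order_trans[OF norm_mult_bounded_summable(2)[OF row_contractionD(3) Suc.prems]]
          mult_right_mono row_contractionD C norm_ge_zero)
    show "(\<lambda>m. norm (mat_pow A n i m) * (\<theta> * C)) summable_on UNIV"
      using mat_pow_bound by (intro summable_on_cmult_left) auto
  qed
  also have "\<dots> = (\<Sum>\<^sub>\<infinity>m. mat_pow A n i m * mat_app A c m)"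
    by (simp add: mat_app_def infsum_cmult_right' mult.assoc)
  also have "\<dots> = (mat_app A ^^ n) (mat_app A c) i"
    by (rule Suc.IH) (rule norm_mat_app_le[OF Suc.prems])
  finally show ?case by (simp add: funpow_swap1)
qed

lemma mat_neumann_sums: "(\<lambda>n. mat_pow A n i j) sums mat_neumann A i j"
proof -
  have "summable (\<lambda>n. norm (mat_pow A n i j))"
  proof (rule summable_comparison_test'[where g = "\<lambda>n. \<theta> ^ n" and N = 0])
    show "summable (\<lambda>n. \<theta> ^ n)"
      using row_contractionD(1,2) by (simp add: summable_geometric)
  qed (simp add: norm_mat_pow_le)
  moreover from this have "(\<lambda>n. mat_pow A n i j) sums (\<Sum>n. mat_pow A n i j)"
    by (intro summable_sums) (rule summable_norm_cancel)
  ultimately have "((\<lambda>n. mat_pow A n i j) has_sum (\<Sum>n. mat_pow A n i j)) UNIV"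
    by (rule norm_summable_imp_has_sum)
  from has_sum_imp_sums[OF this] infsumI[OF this] show ?thesis
    unfolding mat_neumann_def by simp
qed

lemma
  assumes c: "\<And>j. norm (c j) \<le> C"
  shows mat_neumann_app: "(\<Sum>\<^sub>\<infinity>j. mat_neumann A i j * c j) = mat_solve A c i"
    and mat_neumann_norm_summable: "(\<lambda>j. norm (mat_neumann A i j)) summable_on UNIV"
    and mat_neumann_norm_bound: "(\<Sum>\<^sub>\<infinity>j. norm (mat_neumann A i j)) \<le> 1 / (1 - \<theta>)"
proof -
  have C: "C \<ge> 0" using c norm_ge_zero order_trans by blast
  have g: "(\<lambda>n. \<theta> ^ n * 1) summable_on UNIV"
    by (intro geometric_summable_on row_contractionD)
  show "(\<lambda>j. norm (mat_neumann A i j)) summable_on UNIV"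
    unfolding mat_neumann_def
    by (rule abs_summable_swap_majorised[OF _ _ g]) (use mat_pow_bound in auto)
  show "(\<Sum>\<^sub>\<infinity>j. norm (mat_neumann A i j)) \<le> 1 / (1 - \<theta>)"
    unfolding mat_neumann_def
    using infsum_norm_swap_le[OF _ _ g, of "\<lambda>n. mat_pow A n i"] mat_pow_bound
    by (simp add: geometric_infsum[of \<theta> 1, simplified] row_contractionD)
  have "(\<Sum>\<^sub>\<infinity>j. mat_neumann A i j * c j) = (\<Sum>\<^sub>\<infinity>j. \<Sum>\<^sub>\<infinity>n. mat_pow A n i j * c j)"
    by (simp add: mat_neumann_def infsum_cmult_left')
  also have "\<dots> = (\<Sum>\<^sub>\<infinity>n. \<Sum>\<^sub>\<infinity>j. mat_pow A n i j * c j)"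
  proof (rule infsum_swap_majorised[symmetric, where M = "\<lambda>n. \<theta> ^ n * C"])
    fix n
    have mp: "(\<lambda>j. norm (mat_pow A n i j)) summable_on UNIV" "(\<Sum>\<^sub>\<infinity>j. norm (mat_pow A n i j)) \<le> \<theta> ^ n"
      using mat_pow_bound by auto
    show "(\<lambda>j. norm (mat_pow A n i j * c j)) summable_on UNIV"
      by (rule norm_mult_bounded_summable(1)[OF mp(1) c])
    show "(\<Sum>\<^sub>\<infinity>j. norm (mat_pow A n i j * c j)) \<le> \<theta> ^ n * C"
      by (rule order_trans[OF norm_mult_bounded_summable(2)[OF mp(1) c] mult_right_mono[OF mp(2) C]])
  qed (intro geometric_summable_on row_contractionD)
  also have "\<dots> = mat_solve A c i"
    unfolding mat_solve_def by (simp add: mat_pow_app[OF c])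
  finally show "(\<Sum>\<^sub>\<infinity>j. mat_neumann A i j * c j) = mat_solve A c i" .
qed

text \<open>Associativity (b (I - A)^-1) c = b ((I - A)^-1 c). The period matrix is defined through
  the row product, whereas the estimates and the explicit solutions concern the column
  system.\<close>

lemma row_neumann_pairing:
  assumes b: "(\<lambda>i. norm (b i)) summable_on UNIV" and c: "\<And>j. norm (c j) \<le> C"
  shows "(\<Sum>\<^sub>\<infinity>j. (\<Sum>\<^sub>\<infinity>i. b i * mat_neumann A i j) * c j) = (\<Sum>\<^sub>\<infinity>i. b i * mat_solve A c i)"
    and "(\<lambda>j. norm (\<Sum>\<^sub>\<infinity>i. b i * mat_neumann A i j)) summable_on UNIV"
proof -
  have C: "C \<ge> 0" using c norm_ge_zero order_trans by blast
  note N = mat_neumann_norm_summable[OF c] mat_neumann_norm_bound[OF c]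
  have "(\<Sum>\<^sub>\<infinity>j. (\<Sum>\<^sub>\<infinity>i. b i * mat_neumann A i j) * c j) = (\<Sum>\<^sub>\<infinity>j. \<Sum>\<^sub>\<infinity>i. b i * mat_neumann A i j * c j)"
    by (simp add: infsum_cmult_left')
  also have "\<dots> = (\<Sum>\<^sub>\<infinity>i. \<Sum>\<^sub>\<infinity>j. b i * mat_neumann A i j * c j)"
  proof (rule infsum_swap_majorised[symmetric])
    fix i
    have eq: "norm (b i * mat_neumann A i j * c j) = norm (b i) * norm (mat_neumann A i j * c j)" for j
      by (simp add: norm_mult)
    show "(\<lambda>j. norm (b i * mat_neumann A i j * c j)) summable_on UNIV"
      unfolding eq by (intro summable_on_cmult_right norm_mult_bounded_summable[OF N(1) c])
    show "(\<Sum>\<^sub>\<infinity>j. norm (b i * mat_neumann A i j * c j)) \<le> norm (b i) * (1 / (1 - \<theta>) * C)"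
      unfolding eq infsum_cmult_right'
      by (intro mult_left_mono order_trans[OF norm_mult_bounded_summable(2)[OF N(1) c]]
          mult_right_mono N C norm_ge_zero)
  qed (intro summable_on_cmult_left b)
  also have "\<dots> = (\<Sum>\<^sub>\<infinity>i. b i * mat_solve A c i)"
    by (simp add: mat_neumann_app[OF c, symmetric] infsum_cmult_right' mult.assoc)
  finally show "(\<Sum>\<^sub>\<infinity>j. (\<Sum>\<^sub>\<infinity>i. b i * mat_neumann A i j) * c j) = (\<Sum>\<^sub>\<infinity>i. b i * mat_solve A c i)" .
  show "(\<lambda>j. norm (\<Sum>\<^sub>\<infinity>i. b i * mat_neumann A i j)) summable_on UNIV"
  proof (rule abs_summable_swap_majorised)
    fix i
    show "(\<lambda>j. norm (b i * mat_neumann A i j)) summable_on UNIV"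
      unfolding norm_mult by (intro summable_on_cmult_right N)
    show "(\<Sum>\<^sub>\<infinity>j. norm (b i * mat_neumann A i j)) \<le> norm (b i) * (1 / (1 - \<theta>))"
      unfolding norm_mult infsum_cmult_right' by (intro mult_left_mono N norm_ge_zero)
  qed (intro summable_on_cmult_left b)
qed

text \<open>If \<open>A\<close> is symmetric for the bilinear form \<open>\<langle>y, z\<rangle> = \<Sum>\<^sub>i \<mu>\<^sub>i y\<^bsub>\<sigma>(i)\<^esub> z\<^sub>i\<close>, so is \<open>(I - A)\<^sup>-\<^sup>1\<close>.\<close>
lemma mat_solve_adjoint:
  assumes \<sigma>: "bij \<sigma>" "\<And>i. \<sigma> (\<sigma> i) = i" and \<mu>: "(\<lambda>i. norm (\<mu> i)) summable_on UNIV" "\<And>i. \<mu> (\<sigma> i) = \<mu> i"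
    and sym: "\<And>i j. \<mu> i * A (\<sigma> i) j = \<mu> j * A (\<sigma> j) i"
    and c: "\<And>j. norm (c j) \<le> C" and d: "\<And>j. norm (d j) \<le> D"
  shows "(\<Sum>\<^sub>\<infinity>i. \<mu> i * c (\<sigma> i) * mat_solve A d i) = (\<Sum>\<^sub>\<infinity>i. \<mu> i * d (\<sigma> i) * mat_solve A c i)"
proof -
  define y where "y = mat_solve A c"
  define z where "z = mat_solve A d"
  have y: "\<And>j. norm (y j) \<le> C / (1 - \<theta>)" and z: "\<And>j. norm (z j) \<le> D / (1 - \<theta>)"
    unfolding y_def z_def by (rule norm_mat_solve_le[OF c] norm_mat_solve_le[OF d])+
  have CD: "C / (1 - \<theta>) \<ge> 0" "D / (1 - \<theta>) \<ge> 0"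
    using y z norm_ge_zero order_trans by blast+
  \<comment> \<open>After this substitution both sides are the pairing of y and z minus a term
    containing A. The pairings agree by reindexing along \<sigma>, the other terms by
    \<open>sym\<close>.\<close>
  have yeq: "c i = y i - mat_app A y i" and zeq: "d i = z i - mat_app A z i" for i
    using mat_solve_eq[of c C i, OF c] mat_solve_eq[of d D i, OF d] by (simp_all add: y_def z_def)
  have sm: "(\<lambda>i. \<mu> i * (f i * g i)) summable_on UNIV"
    if "\<And>j. norm (f j) \<le> F" "\<And>j. norm (g j) \<le> G" for f g F G
    by (rule abs_summable_summable, rule norm_mult_bounded_summable(1)[OF \<mu>(1), of _ "F * G"])
       (simp add: norm_mult mult_mono' that)
  note app = norm_mat_app_le[OF y] norm_mat_app_le[OF z]
  have "(\<Sum>\<^sub>\<infinity>i. \<mu> i * c (\<sigma> i) * z i)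
      = (\<Sum>\<^sub>\<infinity>i. \<mu> i * (y (\<sigma> i) * z i)) - (\<Sum>\<^sub>\<infinity>i. \<mu> i * (mat_app A y (\<sigma> i) * z i))"
    by (subst infsum_diff_complex[symmetric]) (auto intro: sm y z app simp: yeq algebra_simps)
  also have "(\<Sum>\<^sub>\<infinity>i. \<mu> i * (mat_app A y (\<sigma> i) * z i))
      = (\<Sum>\<^sub>\<infinity>i. \<Sum>\<^sub>\<infinity>j. (\<mu> i * z i) * (A (\<sigma> i) j * y j))"
    unfolding infsum_cmult_right' mat_app_def[symmetric] by (simp add: mult_ac)
  also have "\<dots> = (\<Sum>\<^sub>\<infinity>j. \<Sum>\<^sub>\<infinity>i. (\<mu> i * z i) * (A (\<sigma> i) j * y j))"
  proof (rule infsum_swap_majorised)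
    fix i
    show "(\<lambda>j. norm ((\<mu> i * z i) * (A (\<sigma> i) j * y j))) summable_on UNIV"
      unfolding norm_mult[of "\<mu> i * z i"]
      by (intro summable_on_cmult_right norm_mult_bounded_summable[OF row_contractionD(3) y])
    have "(\<Sum>\<^sub>\<infinity>j. norm ((\<mu> i * z i) * (A (\<sigma> i) j * y j))) \<le> norm (\<mu> i * z i) * (\<theta> * (C / (1 - \<theta>)))"
      unfolding norm_mult[of "\<mu> i * z i"] infsum_cmult_right'
      by (intro mult_left_mono order_trans[OF norm_mult_bounded_summable(2)[OF row_contractionD(3) y]]
          mult_right_mono row_contractionD CD norm_ge_zero)
    also have "\<dots> \<le> norm (\<mu> i) * (D / (1 - \<theta>)) * (\<theta> * (C / (1 - \<theta>)))"
      unfolding norm_mult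
      using CD row_contractionD(1) mult_nonneg_nonneg[OF row_contractionD(1) CD(1)]
      by (intro mult_right_mono mult_left_mono z) auto
    finally show "(\<Sum>\<^sub>\<infinity>j. norm ((\<mu> i * z i) * (A (\<sigma> i) j * y j))) \<le> norm (\<mu> i) * (D / (1 - \<theta>)) * (\<theta> * (C / (1 - \<theta>)))" .
  qed (intro summable_on_cmult_left \<mu>)
  also have "\<dots> = (\<Sum>\<^sub>\<infinity>j. \<Sum>\<^sub>\<infinity>i. (\<mu> j * y j) * (A (\<sigma> j) i * z i))"
  proof (intro infsum_cong)
    fix i j
    have "(\<mu> i * z i) * (A (\<sigma> i) j * y j) = (\<mu> i * A (\<sigma> i) j) * (z i * y j)" by simp
    also have "\<dots> = (\<mu> j * y j) * (A (\<sigma> j) i * z i)" unfolding sym[of i j] by simp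
    finally show "(\<mu> i * z i) * (A (\<sigma> i) j * y j) = (\<mu> j * y j) * (A (\<sigma> j) i * z i)" .
  qed
  also have "\<dots> = (\<Sum>\<^sub>\<infinity>j. \<mu> j * (y j * mat_app A z (\<sigma> j)))"
    unfolding infsum_cmult_right' mat_app_def[symmetric] by (simp add: mult_ac)
  also have "(\<Sum>\<^sub>\<infinity>i. \<mu> i * (y (\<sigma> i) * z i)) = (\<Sum>\<^sub>\<infinity>i. \<mu> i * (y i * z (\<sigma> i)))"
    using infsum_reindex_bij_betw[OF \<sigma>(1), of "\<lambda>i. \<mu> i * (y (\<sigma> i) * z i)"] by (simp add: \<sigma> \<mu>)
  also have "(\<Sum>\<^sub>\<infinity>i. \<mu> i * (y i * z (\<sigma> i))) - (\<Sum>\<^sub>\<infinity>j. \<mu> j * (y j * mat_app A z (\<sigma> j)))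
      = (\<Sum>\<^sub>\<infinity>i. \<mu> i * d (\<sigma> i) * y i)"
    by (subst infsum_diff_complex[symmetric]) (auto intro: sm y z app simp: zeq algebra_simps)
  finally show ?thesis unfolding y_def z_def .
qed

end

section \<open>Rank one perturbations\<close>

lemma row_contraction_mat_app_rank_one:
  assumes "row_contraction A \<theta>" "finite S" "\<And>j. norm (y j) \<le> C"
    and "\<And>i j. A' i j = A i j + l * indicator S i * indicator S j"
  shows "mat_app A' y i = mat_app A y i + l * indicator S i * (\<Sum>j\<in>S. y j)"
proof -
  have fs: "((\<lambda>j. l * indicator S i * indicator S j * y j) has_sum (\<Sum>j\<in>S. l * indicator S i * indicator S j * y j)) UNIV"
    by (rule has_sum_finite_neutralI[OF assms(2)]) auto
  have "mat_app A' y i = (\<Sum>\<^sub>\<infinity>j. A i j * y j + l * indicator S i * indicator S j * y j)"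
    by (simp add: mat_app_def assms(4) algebra_simps)
  also have "\<dots> = mat_app A y i + (\<Sum>\<^sub>\<infinity>j. l * indicator S i * indicator S j * y j)"
    unfolding mat_app_def using fs
    by (intro infsum_add mat_app_summable[OF assms(1) assms(3)]) (auto simp: has_sum_iff)
  also have "(\<Sum>\<^sub>\<infinity>j. l * indicator S i * indicator S j * y j) = (\<Sum>j\<in>S. l * indicator S i * indicator S j * y j)"
    using fs by (rule infsumI)
  also have "\<dots> = l * indicator S i * (\<Sum>j\<in>S. y j)"
    by (simp add: sum_distrib_left)
  finally show ?thesis .
qed

text \<open>The perturbed solution is sought as \<eta> + \<mu> \<xi>, with \<eta> and \<xi> the
  unperturbed solutions for c and for the indicator. If the denominator vanished, \<xi> would be a
  bounded fixed point of the contraction A', hence 0, and then s = 0, a contradiction.\<close>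

lemma
  fixes A A' :: "'i \<Rightarrow> 'i \<Rightarrow> complex"
  assumes A: "row_contraction A \<theta>" and A': "row_contraction A' \<theta>'" and S: "finite S" "S \<noteq> {}"
    and rank: "\<And>i j. A' i j = A i j + l * indicator S i * indicator S j"
  defines "\<xi> \<equiv> mat_solve A (indicator S)"
  defines "s \<equiv> \<Sum>j\<in>S. \<xi> j"
  shows sherman_morrison_nonzero: "1 - l * s \<noteq> 0"
    and sherman_morrison: "(\<And>j. norm (c j) \<le> C) \<Longrightarrow>
      mat_solve A' (\<lambda>i. c i - \<alpha> * indicator S i) i
        = mat_solve A c i + (l * (\<Sum>j\<in>S. mat_solve A c j) - \<alpha>) / (1 - l * s) * \<xi> i"
proof -
  have ind: "norm (indicator S j :: complex) \<le> 1" for j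
    by (simp add: indicator_def)
  have \<xi>: "norm (\<xi> j) \<le> 1 / (1 - \<theta>)" for j
    unfolding \<xi>_def by (rule norm_mat_solve_le[OF A ind])
  have \<xi>_eq: "\<xi> i = indicator S i + mat_app A \<xi> i" for i
    unfolding \<xi>_def by (rule mat_solve_eq[OF A ind])
  note app = row_contraction_mat_app_rank_one[OF A S(1) _ rank]
  show nz: "1 - l * s \<noteq> 0"
  proof
    assume *: "1 - l * s = 0"
    have "\<xi> i = mat_app A' \<xi> i" for i
      using \<xi>_eq[of i] * app[of \<xi> "1 / (1 - \<theta>)" i, OF \<xi>] by (simp add: s_def algebra_simps)
    then have "\<xi> i = 0" for i
      by (rule mat_app_fixed_point_zero[OF A' \<xi>])
    then show False using * by (simp add: s_def)
  qed
  assume c: "\<And>j. norm (c j) \<le> C"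
  define \<eta> where "\<eta> = mat_solve A c"
  define t where "t = (\<Sum>j\<in>S. \<eta> j)"
  \<comment> \<open>Inserting \<eta> + \<mu> \<xi> into the perturbed system leaves exactly the
    condition \<mu> (1 - l s) = l t - \<alpha>.\<close>
  define \<mu> where "\<mu> = (l * t - \<alpha>) / (1 - l * s)"
  have \<mu>: "\<mu> * (1 - l * s) = l * t - \<alpha>"
    using nz by (simp add: \<mu>_def)
  have \<eta>: "norm (\<eta> j) \<le> C / (1 - \<theta>)" for j
    unfolding \<eta>_def by (rule norm_mat_solve_le[OF A c])
  have \<eta>_eq: "\<eta> i = c i + mat_app A \<eta> i" for i
    unfolding \<eta>_def by (rule mat_solve_eq[OF A c])
  have \<mu>\<xi>: "norm (\<mu> * \<xi> j) \<le> norm \<mu> * (1 / (1 - \<theta>))" for j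
    unfolding norm_mult by (intro mult_left_mono \<xi>) auto
  have sum_b: "norm (\<eta> j + \<mu> * \<xi> j) \<le> C / (1 - \<theta>) + norm \<mu> * (1 / (1 - \<theta>))" for j
    by (intro norm_triangle_mono \<eta> \<mu>\<xi>)
  have "mat_solve A' (\<lambda>i. c i - \<alpha> * indicator S i) = (\<lambda>i. \<eta> i + \<mu> * \<xi> i)"
  proof (rule mat_solve_unique[OF A' _ sum_b])
    show "norm (c j - \<alpha> * indicator S j) \<le> C + norm \<alpha> * 1" for j
      unfolding norm_mult[symmetric]
      by (rule order_trans[OF norm_triangle_ineq4], unfold norm_mult, intro add_mono c mult_left_mono ind norm_ge_zero)
    show "\<eta> i + \<mu> * \<xi> i = c i - \<alpha> * indicator S i + mat_app A' (\<lambda>i. \<eta> i + \<mu> * \<xi> i) i" for i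
    proof -
      have "mat_app A' (\<lambda>i. \<eta> i + \<mu> * \<xi> i) i
          = mat_app A \<eta> i + \<mu> * mat_app A \<xi> i + l * indicator S i * (t + \<mu> * s)"
        by (simp add: app[OF sum_b] mat_app_add[OF A \<eta> \<mu>\<xi>] mat_app_scale[OF A] sum.distrib s_def t_def
            sum_distrib_left[symmetric])
      also have "\<dots> = \<eta> i + \<mu> * \<xi> i - c i + indicator S i * (l * t - \<mu> * (1 - l * s))"
        using \<eta>_eq[of i] \<xi>_eq[of i] by (simp add: algebra_simps)
      also have "\<dots> = \<eta> i + \<mu> * \<xi> i - c i + indicator S i * \<alpha>"
        unfolding \<mu> by simp
      finally show ?thesis by simp
    qed
  qed
  then show "mat_solve A' (\<lambda>i. c i - \<alpha> * indicator S i) i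
      = mat_solve A c i + (l * (\<Sum>j\<in>S. mat_solve A c j) - \<alpha>) / (1 - l * s) * \<xi> i"
    by (simp add: \<mu>_def t_def \<eta>_def)
qed

section \<open>Holomorphic functions of three variables\<close>

type_synonym c3 = "complex \<times> complex \<times> complex"

definition c3_scale :: "complex \<Rightarrow> c3 \<Rightarrow> c3" where
  "c3_scale z e = (z * fst e, z * fst (snd e), z * snd (snd e))"

lemma c3_scale_simps [simp]: "c3_scale z (a, b, c) = (z * a, z * b, z * c)"
  by (simp add: c3_scale_def)

lemma norm_c3_scale: "norm (c3_scale z e) = norm z * norm e"
  unfolding c3_scale_def norm_Pair norm_prod_def
  by (simp add: norm_mult power_mult_distrib real_sqrt_mult flip: distrib_left)

definition pderiv3 :: "(c3 \<Rightarrow> complex) \<Rightarrow> c3 \<Rightarrow> c3 \<Rightarrow> complex" where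
  "pderiv3 f e p = deriv (\<lambda>z. f (p + c3_scale z e)) 0"

lemma slice_has_field_derivative:
  assumes "(\<lambda>\<zeta>. f ((q + c3_scale z e) + c3_scale \<zeta> e)) field_differentiable at 0"
  shows "((\<lambda>\<zeta>. f (q + c3_scale \<zeta> e)) has_field_derivative pderiv3 f e (q + c3_scale z e)) (at z)"
proof -
  have "((\<lambda>\<zeta>. f ((q + c3_scale z e) + c3_scale \<zeta> e)) has_field_derivative
      pderiv3 f e (q + c3_scale z e)) (at (z - z))"
    using assms unfolding pderiv3_def by (simp add: field_differentiable_derivI)
  then have "((\<lambda>\<zeta>. f ((q + c3_scale z e) + c3_scale (\<zeta> - z) e)) has_field_derivative
      pderiv3 f e (q + c3_scale z e)) (at z)"
    using DERIV_shift[of "\<lambda>\<zeta>. f ((q + c3_scale z e) + c3_scale \<zeta> e)" _ z "- z"] by simp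
  moreover have "(q + c3_scale z e) + c3_scale (\<zeta> - z) e = q + c3_scale \<zeta> e" for \<zeta>
    by (simp add: c3_scale_def algebra_simps)
  ultimately show ?thesis
    by simp
qed

text \<open>Cauchy's inequality for the difference of two parallel slices: on a disc of radius r it
  is small by uniform continuity of f, so its derivative at the centre is small too.\<close>

lemma continuous_pderiv3:
  assumes N: "open N" and cont: "continuous_on N f" and e: "norm e = 1"
    and diff: "\<And>p. p \<in> N \<Longrightarrow> (\<lambda>z. f (p + c3_scale z e)) field_differentiable at 0"
  shows "continuous_on N (pderiv3 f e)"
proof (rule continuous_onI)
  fix p and \<epsilon> :: real
  assume p: "p \<in> N" and \<epsilon>: "\<epsilon> > 0"
  from N p obtain r0 where r0: "r0 > 0" "cball p r0 \<subseteq> N"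
    by (meson open_contains_cball)
  define r where "r = r0 / 2"
  have r: "r > 0" "cball p (2 * r) \<subseteq> N"
    using r0 by (auto simp: r_def)
  have "uniformly_continuous_on (cball p (2 * r)) f"
    by (intro compact_uniformly_continuous continuous_on_subset[OF cont] r compact_cball)
  \<comment> \<open>The tolerance is scaled by r because Cauchy's inequality divides by r. The ball
    of radius 2 r holds the discs of radius r about all nearby points.\<close>
  then obtain d where d: "d > 0"
    "\<And>x y. x \<in> cball p (2 * r) \<Longrightarrow> y \<in> cball p (2 * r) \<Longrightarrow> dist y x < d \<Longrightarrow> dist (f y) (f x) < \<epsilon> / 2 * r"
    unfolding uniformly_continuous_on_def using \<epsilon> r(1) by (metis half_gt_zero mult_pos_pos)
  show "\<exists>d>0. \<forall>x'\<in>N. dist x' p < d \<longrightarrow> dist (pderiv3 f e x') (pderiv3 f e p) \<le> \<epsilon>"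
  proof (intro exI[of _ "min d r"] conjI ballI impI)
    show "min d r > 0" using d r by simp
    fix p' assume p': "p' \<in> N" "dist p' p < min d r"
    define g where "g = (\<lambda>z. f (p' + c3_scale z e) - f (p + c3_scale z e))"
    have mem: "p + c3_scale z e \<in> cball p (2 * r)" "p' + c3_scale z e \<in> cball p (2 * r)"
      if "z \<in> cball 0 r" for z
    proof -
      have "norm (c3_scale z e) \<le> r"
        using that e by (simp add: norm_c3_scale)
      moreover have "norm (p' - p) < r"
        using p' by (simp add: dist_norm)
      ultimately show "p + c3_scale z e \<in> cball p (2 * r)" "p' + c3_scale z e \<in> cball p (2 * r)"
        using r(1) norm_triangle_ineq[of "p' - p" "c3_scale z e"]
        by (simp_all add: dist_norm norm_minus_commute[of p] algebra_simps)
    qed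
    have fd: "((\<lambda>\<zeta>. f (q + c3_scale \<zeta> e)) has_field_derivative pderiv3 f e (q + c3_scale z e)) (at z)"
      if "q + c3_scale z e \<in> cball p (2 * r)" for z q
      by (rule slice_has_field_derivative) (use diff that r(2) in blast)
    have gd: "(g has_field_derivative (pderiv3 f e (p' + c3_scale z e) - pderiv3 f e (p + c3_scale z e))) (at z)"
      if "z \<in> cball 0 r" for z
      unfolding g_def using mem that by (intro DERIV_diff fd) auto
    have hol: "g holomorphic_on cball 0 r"
      using gd unfolding holomorphic_on_def
      by (meson field_differentiable_at_within field_differentiable_def)
    have "norm ((deriv ^^ 1) g 0) \<le> fact 1 * (\<epsilon> / 2 * r) / r ^ 1"
    proof (rule Cauchy_inequality)
      show "g holomorphic_on ball 0 r"
        using hol by (rule holomorphic_on_subset) auto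
      show "continuous_on (cball 0 r) g"
        using hol by (rule holomorphic_on_imp_continuous_on)
      show "norm (g x) \<le> \<epsilon> / 2 * r" if "norm (0 - x) = r" for x
      proof -
        have "dist (f (p' + c3_scale x e)) (f (p + c3_scale x e)) < \<epsilon> / 2 * r"
          using that p' mem[of x] by (intro d) (auto simp: dist_norm)
        then show ?thesis
          by (simp add: g_def dist_norm)
      qed
    qed (use r in auto)
    moreover have "deriv g 0 = pderiv3 f e p' - pderiv3 f e p"
      using gd[of 0] r(1) by (intro DERIV_imp_deriv) (auto simp: c3_scale_def zero_prod_def[symmetric])
    ultimately show "dist (pderiv3 f e p') (pderiv3 f e p) \<le> \<epsilon>"
      using r(1) \<epsilon> by (simp add: dist_norm)
  qed
qed

text \<open>The mean value inequality along one complex line, whose part inside the ball is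
  convex.\<close>

lemma slice_increment_bound:
  assumes diff: "\<And>q. q \<in> ball p r \<Longrightarrow> (\<lambda>z. f (q + c3_scale z e)) field_differentiable at 0"
    and bd: "\<And>q. q \<in> ball p r \<Longrightarrow> norm (pderiv3 f e q - d) \<le> \<epsilon>"
    and q: "q \<in> ball p r" "q + c3_scale z e \<in> ball p r"
  shows "norm (f (q + c3_scale z e) - f q - d * z) \<le> \<epsilon> * norm z"
proof -
  define S where "S = {\<zeta>. q + c3_scale \<zeta> e \<in> ball p r}"
  have "convex S"
  proof (rule convexI)
    fix x y u v assume xy: "x \<in> S" "y \<in> S" and uv: "(0::real) \<le> u" "0 \<le> v" "u + v = 1"
    have eq: "q + c3_scale (u *\<^sub>R x + v *\<^sub>R y) e = u *\<^sub>R (q + c3_scale x e) + v *\<^sub>R (q + c3_scale y e)"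
    proof -
      have "u *\<^sub>R q + v *\<^sub>R q = q" using uv by (simp flip: scaleR_left_distrib)
      moreover have "c3_scale (u *\<^sub>R x + v *\<^sub>R y) e = u *\<^sub>R c3_scale x e + v *\<^sub>R c3_scale y e"
        by (simp add: c3_scale_def algebra_simps)
      ultimately show ?thesis
        by (metis (no_types, lifting) add.assoc add.left_commute scaleR_right_distrib)
    qed
    have "u *\<^sub>R (q + c3_scale x e) + v *\<^sub>R (q + c3_scale y e) \<in> ball p r"
      using xy uv convexD[OF convex_ball, of "q + c3_scale x e" p r "q + c3_scale y e" u v]
      unfolding S_def by blast
    then show "u *\<^sub>R x + v *\<^sub>R y \<in> S"
      using eq unfolding S_def by simp
  qed
  define g where "g = (\<lambda>\<zeta>. f (q + c3_scale \<zeta> e) - d * \<zeta>)"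
  have "norm (g z - g 0) \<le> \<epsilon> * norm (z - 0)"
  proof (rule field_differentiable_bound[OF \<open>convex S\<close>, where f' = "\<lambda>\<zeta>. pderiv3 f e (q + c3_scale \<zeta> e) - d"])
    fix \<zeta> assume "\<zeta> \<in> S"
    then have \<zeta>: "q + c3_scale \<zeta> e \<in> ball p r" by (simp add: S_def)
    have "((\<lambda>\<zeta>. f (q + c3_scale \<zeta> e)) has_field_derivative pderiv3 f e (q + c3_scale \<zeta> e)) (at \<zeta>)"
      by (rule slice_has_field_derivative) (use diff \<zeta> in blast)
    then show "(g has_field_derivative pderiv3 f e (q + c3_scale \<zeta> e) - d) (at \<zeta> within S)"
      unfolding g_def by (auto intro!: derivative_eq_intros intro: has_field_derivative_at_within)
    show "norm (pderiv3 f e (q + c3_scale \<zeta> e) - d) \<le> \<epsilon>"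
      using bd \<zeta> by blast
  qed (use q in \<open>auto simp: S_def c3_scale_def simp flip: zero_prod_def\<close>)
  moreover have "c3_scale 0 e = 0"
    by (simp add: c3_scale_def zero_prod_def)
  ultimately show ?thesis
    by (simp add: g_def algebra_simps)
qed

text \<open>By \<open>sep_hol_has_derivative\<close> this is holomorphy in three variables, but in a form which is
  evidently closed under composition and locally uniform limits.\<close>
definition sep_hol :: "c3 set \<Rightarrow> (c3 \<Rightarrow> complex) \<Rightarrow> bool" where
  "sep_hol N f \<longleftrightarrow> continuous_on N f \<and> (\<forall>(t, u, v)\<in>N.
     (\<lambda>z. f (z, u, v)) field_differentiable at t \<and>
     (\<lambda>z. f (t, z, v)) field_differentiable at u \<and>
     (\<lambda>z. f (t, u, z)) field_differentiable at v)"

lemma sep_holD: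
  assumes "sep_hol N f" "(t, u, v) \<in> N"
  shows "(\<lambda>z. f (z, u, v)) field_differentiable at t" "(\<lambda>z. f (t, z, v)) field_differentiable at u"
    "(\<lambda>z. f (t, u, z)) field_differentiable at v"
  using assms unfolding sep_hol_def by blast+

lemma field_differentiable_shift_0:
  fixes f :: "complex \<Rightarrow> complex"
  assumes "f field_differentiable at t"
  shows "(\<lambda>z. f (t + z)) field_differentiable at 0"
proof -
  have "f field_differentiable at ((\<lambda>z. t + z) 0)"
    using assms by simp
  then show ?thesis
    using field_differentiable_compose[of "\<lambda>z. t + z" 0 f]
    by (auto simp: o_def intro!: field_differentiable_add)
qed

lemma sep_hol_slices:
  assumes "sep_hol N f" "p \<in> N" "e \<in> {(1, 0, 0), (0, 1, 0), (0, 0, 1)}"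
  shows "(\<lambda>z. f (p + c3_scale z e)) field_differentiable at 0"
  using assms
  by (cases p) (auto simp: sep_hol_def dest!: bspec intro: field_differentiable_shift_0
    dest: field_differentiable_shift_0)

text \<open>Continuity of the partial derivatives comes from Cauchy's inequality; total
  differentiability then follows as in real analysis, by increments in one coordinate at a
  time.\<close>

theorem sep_hol_has_derivative:
  assumes N: "open N" and f: "sep_hol N f"
  shows "\<exists>D1 D2 D3. continuous_on N D1 \<and> continuous_on N D2 \<and> continuous_on N D3 \<and>
     (\<forall>p\<in>N. (f has_derivative (\<lambda>(a, b, c). D1 p * a + D2 p * b + D3 p * c)) (at p))"
proof -
  define E :: "c3 set" where "E = {(1, 0, 0), (0, 1, 0), (0, 0, 1)}"
  have E: "norm e = 1" if "e \<in> E" for e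
    using that by (auto simp: E_def norm_Pair)
  have diff: "(\<lambda>z. f (p + c3_scale z e)) field_differentiable at 0" if "p \<in> N" "e \<in> E" for p e
    using sep_hol_slices[OF f] that unfolding E_def by blast
  have cont: "continuous_on N (pderiv3 f e)" if "e \<in> E" for e
    using f diff that by (intro continuous_pderiv3 N E) (auto simp: sep_hol_def)
  define D1 where "D1 = pderiv3 f (1, 0, 0)"
  define D2 where "D2 = pderiv3 f (0, 1, 0)"
  define D3 where "D3 = pderiv3 f (0, 0, 1)"
  have "(f has_derivative (\<lambda>(a, b, c). D1 p * a + D2 p * b + D3 p * c)) (at p)" if p: "p \<in> N" for p
    unfolding has_derivative_at_alt
  proof (intro conjI allI impI)
    show "bounded_linear (\<lambda>(a, b, c). D1 p * a + D2 p * b + D3 p * c)"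
    proof -
      have "bounded_linear (\<lambda>x::c3. D1 p * fst x + D2 p * fst (snd x) + D3 p * snd (snd x))"
        by (intro bounded_linear_add bounded_linear_mult_right[THEN bounded_linear_compose]
            bounded_linear_fst bounded_linear_snd
            bounded_linear_compose[OF bounded_linear_fst bounded_linear_snd]
            bounded_linear_compose[OF bounded_linear_snd bounded_linear_snd])
      then show ?thesis by (simp add: case_prod_unfold)
    qed
    fix \<epsilon> :: real assume \<epsilon>: "\<epsilon> > 0"
    define Q where "Q = (\<lambda>e r. r > 0 \<and> ball p r \<subseteq> N \<and>
      (\<forall>q\<in>ball p r. norm (pderiv3 f e q - pderiv3 f e p) \<le> \<epsilon> / 3))"
    have "\<exists>r. Q e r" if e: "e \<in> E" for e
    proof -
      obtain r1 where r1: "r1 > 0" "ball p r1 \<subseteq> N"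
        using N p by (meson open_contains_ball)
      have "\<epsilon> / 3 > 0" using \<epsilon> by simp
      then obtain d where d: "d > 0" "\<And>x'. x' \<in> N \<Longrightarrow> dist x' p < d \<Longrightarrow> dist (pderiv3 f e x') (pderiv3 f e p) < \<epsilon> / 3"
        using cont[OF e] p unfolding continuous_on_iff by blast
      show ?thesis
        unfolding Q_def
      proof (intro exI[of _ "min r1 d"] conjI ballI)
        fix q assume q: "q \<in> ball p (min r1 d)"
        then have "q \<in> N" "dist q p < d" using r1 by (auto simp: dist_commute)
        then show "norm (pderiv3 f e q - pderiv3 f e p) \<le> \<epsilon> / 3"
          using d(2)[of q] by (simp add: dist_norm)
      qed (use r1 d in auto)
    qed
    then obtain r where "\<And>e. e \<in> E \<Longrightarrow> Q e (r e)"
      by metis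
    then have r: "e \<in> E \<Longrightarrow> r e > 0" "e \<in> E \<Longrightarrow> ball p (r e) \<subseteq> N"
      "\<And>q. e \<in> E \<Longrightarrow> q \<in> ball p (r e) \<Longrightarrow> norm (pderiv3 f e q - pderiv3 f e p) \<le> \<epsilon> / 3" for e
      by (auto simp: Q_def)
    define r0 where "r0 = Min (r ` E)"
    have finE: "finite E" "E \<noteq> {}" by (auto simp: E_def)
    have r0: "r0 > 0" "\<And>e. e \<in> E \<Longrightarrow> r0 \<le> r e"
      using r(1) finE by (auto simp: r0_def)
    have inc: "norm (f (q + c3_scale z e) - f q - pderiv3 f e p * z) \<le> \<epsilon> / 3 * norm z"
      if "e \<in> E" "q \<in> ball p r0" "q + c3_scale z e \<in> ball p r0" for q z e
    proof (rule slice_increment_bound[where r = r0 and p = p])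
      have "ball p r0 \<subseteq> ball p (r e)"
        using r0(2)[OF that(1)] by (intro subset_ball)
      then show "(\<lambda>z. f (q + c3_scale z e)) field_differentiable at 0"
        "norm (pderiv3 f e q - pderiv3 f e p) \<le> \<epsilon> / 3" if "q \<in> ball p r0" for q
        using that \<open>e \<in> E\<close> r(2,3)[of e] by (blast intro!: diff)+
    qed (use that in auto)
    show "\<exists>d>0. \<forall>y. norm (y - p) < d \<longrightarrow>
        norm (f y - f p - (case y - p of (a, b, c) \<Rightarrow> D1 p * a + D2 p * b + D3 p * c)) \<le> \<epsilon> * norm (y - p)"
    proof (intro exI[of _ r0] conjI allI impI r0)
      fix y assume y: "norm (y - p) < r0"
      obtain t u v where p_eq: "p = (t, u, v)" by (cases p)
      obtain a b c where y_eq: "y - p = (a, b, c)" by (cases "y - p")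
      have y': "y = (t + a, u + b, v + c)"
        using y_eq p_eq by (cases y) auto
      have nm: "norm (a, b, c) < r0"
        using y y_eq by simp
      have na: "norm a \<le> norm (a, b, c)" and nb: "norm b \<le> norm (a, b, c)" and nc: "norm c \<le> norm (a, b, c)"
        using norm_fst_le[of a "(b, c)"] norm_snd_le[of "(b, c)" a] norm_fst_le[of b c] norm_snd_le[of c b]
        by linarith+
      have nbc: "norm (b, c) \<le> norm (a, b, c)" "norm (0::complex, b, c) \<le> norm (a,b,c)"
        "norm (0::complex, 0::complex, c) \<le> norm (a,b,c)"
        using nc norm_snd_le[of "(b, c)" a] by (simp_all add: norm_Pair)
      \<comment> \<open>The corners of the path from p to y along the coordinate directions.\<close>
      define q1 q2 where "q1 = (t, u + b, v + c)" and "q2 = (t, u, v + c)"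
      have mem: "y \<in> ball p r0" "q1 \<in> ball p r0" "q2 \<in> ball p r0" "p \<in> ball p r0"
        using nm nbc[unfolded norm_Pair] y r0(1) nc order_le_less_trans[OF nbc(1) nm] by (simp_all add: q1_def q2_def dist_norm p_eq y' norm_minus_commute norm_Pair)
      have 1: "norm (f y - f q1 - D1 p * a) \<le> \<epsilon> / 3 * norm a"
        using inc[of "(1,0,0)" q1 a] mem by (simp add: E_def q1_def y' D1_def add.commute)
      have 2: "norm (f q1 - f q2 - D2 p * b) \<le> \<epsilon> / 3 * norm b"
        using inc[of "(0,1,0)" q2 b] mem by (simp add: E_def q1_def q2_def D2_def add.commute)
      have 3: "norm (f q2 - f p - D3 p * c) \<le> \<epsilon> / 3 * norm c"
        using inc[of "(0,0,1)" p c] mem by (simp add: E_def q2_def p_eq D3_def add.commute)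
      have "f y - f p - (D1 p * a + D2 p * b + D3 p * c)
         = (f y - f q1 - D1 p * a) + (f q1 - f q2 - D2 p * b) + (f q2 - f p - D3 p * c)"
        by simp
      also have "norm \<dots> \<le> \<epsilon> / 3 * norm a + \<epsilon> / 3 * norm b + \<epsilon> / 3 * norm c"
        by (intro norm_triangle_mono 1 2 3)
      also have "\<dots> \<le> \<epsilon> / 3 * norm (a, b, c) + \<epsilon> / 3 * norm (a, b, c) + \<epsilon> / 3 * norm (a, b, c)"
        using \<epsilon> by (intro add_mono mult_left_mono na nb nc) auto
      finally show "norm (f y - f p - (case y - p of (a, b, c) \<Rightarrow> D1 p * a + D2 p * b + D3 p * c)) \<le> \<epsilon> * norm (y - p)"
        unfolding y_eq by simp
    qed
  qed
  then show ?thesis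
    using cont unfolding D1_def D2_def D3_def E_def by blast
qed

lemma sep_hol_imp_holomorphic3:
  assumes "open N" "sep_hol N f"
  shows "holomorphic3_on f N"
  using sep_hol_has_derivative[OF assms] unfolding holomorphic3_on_def
  by (meson has_derivative_at_withinI)

lemma sep_holI_continuous: "sep_hol N f \<Longrightarrow> continuous_on N f"
  by (simp add: sep_hol_def)

section \<open>Closure properties of separate holomorphy\<close>

lemma sep_hol_const [simp, intro]: "sep_hol N (\<lambda>_. c)"
  and sep_hol_fst [intro]: "sep_hol N (\<lambda>p. fst p)"
  and sep_hol_fst_snd [intro]: "sep_hol N (\<lambda>p. fst (snd p))"
  and sep_hol_snd_snd [intro]: "sep_hol N (\<lambda>p. snd (snd p))"
  by (auto simp: sep_hol_def intro!: continuous_intros)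

lemma sep_hol_add [intro]: "sep_hol N f \<Longrightarrow> sep_hol N g \<Longrightarrow> sep_hol N (\<lambda>p. f p + g p)"
  and sep_hol_diff [intro]: "sep_hol N f \<Longrightarrow> sep_hol N g \<Longrightarrow> sep_hol N (\<lambda>p. f p - g p)"
  and sep_hol_mult [intro]: "sep_hol N f \<Longrightarrow> sep_hol N g \<Longrightarrow> sep_hol N (\<lambda>p. f p * g p)"
  by (auto simp: sep_hol_def intro!: continuous_intros field_differentiable_add
       field_differentiable_diff field_differentiable_mult)

lemma sep_hol_minus [intro]: "sep_hol N f \<Longrightarrow> sep_hol N (\<lambda>p. - f p)"
  using sep_hol_diff[of N "\<lambda>_. 0" f] by simp

lemma sep_hol_divide_const [intro]: "sep_hol N f \<Longrightarrow> sep_hol N (\<lambda>p. f p / c)"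
  using sep_hol_mult[of N f "\<lambda>_. inverse c"] by (simp add: field_simps)

lemma sep_hol_power [intro]: "sep_hol N f \<Longrightarrow> sep_hol N (\<lambda>p. f p ^ n)"
  by (induction n) auto

lemma sep_hol_sum [intro]: "(\<And>i. i \<in> A \<Longrightarrow> sep_hol N (f i)) \<Longrightarrow> sep_hol N (\<lambda>p. \<Sum>i\<in>A. f i p)"
  by (induction A rule: infinite_finite_induct) auto

lemma sep_hol_compose:
  assumes "sep_hol N f" "g holomorphic_on S" "open S" "f ` N \<subseteq> S"
  shows "sep_hol N (\<lambda>p. g (f p))"
  unfolding sep_hol_def
proof (intro conjI, goal_cases)
  case 1
  show ?case
    using assms by (intro continuous_on_compose2[of S g N f] holomorphic_on_imp_continuous_on)
      (auto simp: sep_hol_def)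
next
  case 2
  have "g field_differentiable at (f p)" if "p \<in> N" for p
    using assms(2-4) that by (intro holomorphic_on_imp_differentiable_at[of g S]) auto
  then have slice: "(\<lambda>z. g (f (h z))) field_differentiable at t"
    if "(\<lambda>z. f (h z)) field_differentiable at t" "h t \<in> N" for h and t :: complex
    using field_differentiable_compose[OF that(1), of g] that(2) by (simp add: o_def)
  show ?case
  proof (safe, goal_cases)
    case (1 t u v)
    then have "(\<lambda>z. f (z, u, v)) field_differentiable at t"
      using assms(1) unfolding sep_hol_def by blast
    with 1 show ?case by (intro slice)
  next
    case (2 t u v)
    then have "(\<lambda>z. f (t, z, v)) field_differentiable at u"
      using assms(1) unfolding sep_hol_def by blast
    with 2 show ?case by (intro slice)
  next
    case (3 t u v)
    then have "(\<lambda>z. f (t, u, z)) field_differentiable at v"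
      using assms(1) unfolding sep_hol_def by blast
    with 3 show ?case by (intro slice)
  qed
qed

text \<open>On each coordinate slice this is Weierstrass' theorem in one variable, and continuity
  survives uniform limits.\<close>

lemma sep_hol_uniform_limit:
  assumes N: "open N" and hol: "\<And>i. sep_hol N (f i)" and lim: "uniform_limit N f g F" and F: "F \<noteq> bot"
  shows "sep_hol N g"
proof -
  have slice: "(\<lambda>z. g (h z)) field_differentiable at t"
    if h: "continuous_on UNIV h" "h t \<in> N"
      and d: "\<And>z i. h z \<in> N \<Longrightarrow> (\<lambda>z. f i (h z)) field_differentiable at z" for h and t :: complex
  proof -
    have "open (h -` N)"
      using h(1) N by (simp add: open_vimage)
    then obtain r where r: "r > 0" "cball t r \<subseteq> h -` N"
      using h(2) by (metis open_contains_cball vimage_eq)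
    have hol: "(\<lambda>z. f i (h z)) holomorphic_on cball t r" for i
      using r d unfolding holomorphic_on_def by (auto intro: field_differentiable_at_within)
    have "uniform_limit (cball t r) (\<lambda>i z. f i (h z)) (\<lambda>z. g (h z)) F"
      by (rule uniform_limit_compose'[OF lim]) (use r in auto)
    moreover have "\<forall>\<^sub>F i in F. continuous_on (cball t r) (\<lambda>z. f i (h z)) \<and> (\<lambda>z. f i (h z)) holomorphic_on ball t r"
      using holomorphic_on_imp_continuous_on[OF hol] holomorphic_on_subset[OF hol ball_subset_cball]
      by (intro always_eventually) blast
    ultimately have "(\<lambda>z. g (h z)) holomorphic_on ball t r"
      using holomorphic_uniform_limit[of t r "\<lambda>i z. f i (h z)" F "\<lambda>z. g (h z)"] F by blast
    then show ?thesis
      using r(1) by (simp add: holomorphic_on_imp_differentiable_at)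
  qed
  show ?thesis
    unfolding sep_hol_def
  proof (intro conjI ballI, goal_cases)
    case 1
    show ?case
      by (rule uniform_limit_theorem[OF _ lim F]) (use hol in \<open>auto simp: sep_hol_def\<close>)
  next
    case (2 p)
    then show ?case
      by (auto intro!: slice continuous_intros intro: sep_holD[OF hol])
  qed
qed

lemma sep_hol_infsum:
  assumes "open N" "\<And>i. i \<in> A \<Longrightarrow> sep_hol N (f i)" "\<And>i p. i \<in> A \<Longrightarrow> p \<in> N \<Longrightarrow> norm (f i p) \<le> M i"
    "M summable_on A"
  shows "sep_hol N (\<lambda>p. \<Sum>\<^sub>\<infinity>i\<in>A. f i p)"
proof -
  \<comment> \<open>The partial sums are indexed by all finite sets, also those not contained in A;
    extension by 0 keeps every one of them holomorphic.\<close>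
  define f' where "f' = (\<lambda>i. if i \<in> A then f i else (\<lambda>_. 0))"
  have "uniform_limit N (\<lambda>X p. \<Sum>i\<in>X. f' i p) (\<lambda>p. \<Sum>\<^sub>\<infinity>i\<in>A. f' i p) (finite_subsets_at_top A)"
    using assms by (intro Weierstrass_m_test_general[where M = M]) (auto simp: f'_def)
  then have "sep_hol N (\<lambda>p. \<Sum>\<^sub>\<infinity>i\<in>A. f' i p)"
    by (rule sep_hol_uniform_limit[OF assms(1)[of ], rotated])
       (use assms in \<open>auto simp: f'_def intro!: sep_hol_sum\<close>)
  moreover have "(\<Sum>\<^sub>\<infinity>i\<in>A. f' i p) = (\<Sum>\<^sub>\<infinity>i\<in>A. f i p)" for p
    by (intro infsum_cong) (auto simp: f'_def)
  ultimately show ?thesis by simp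
qed

section \<open>The lattice, Eisenstein series and the \<open>q\<close>-series of \<open>P\<^sub>1\<close>\<close>

lemma Lam_iff: "z \<in> Lam \<tau> \<longleftrightarrow> (\<exists>m n. z = 2 * of_real pi * \<i> * (of_int m * \<tau> + of_int n))"
  by (auto simp: Lam_def)

lemma Lam_0 [simp]: "0 \<in> Lam \<tau>"
  unfolding Lam_iff by (intro exI[of _ 0]) simp

lemma Lam_diff: "x \<in> Lam \<tau> \<Longrightarrow> y \<in> Lam \<tau> \<Longrightarrow> x - y \<in> Lam \<tau>"
  unfolding Lam_iff
proof (elim exE)
  fix m n m' n' assume "x = 2 * of_real pi * \<i> * (of_int m * \<tau> + of_int n)" "y = 2 * of_real pi * \<i> * (of_int m' * \<tau> + of_int n')"
  then show "\<exists>m n. x - y = 2 * of_real pi * \<i> * (of_int m * \<tau> + of_int n)"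
    by (intro exI[of _ "m - m'"] exI[of _ "n - n'"]) (simp add: algebra_simps)
qed

lemma Lam_minus: "x \<in> Lam \<tau> \<Longrightarrow> - x \<in> Lam \<tau>"
  using Lam_diff[of 0 \<tau> x] by simp

lemma Lam_add: "x \<in> Lam \<tau> \<Longrightarrow> y \<in> Lam \<tau> \<Longrightarrow> x + y \<in> Lam \<tau>"
  using Lam_diff[of x \<tau> "- y"] Lam_minus by simp

lemma Lam_add_iff: "y \<in> Lam \<tau> \<Longrightarrow> x + y \<in> Lam \<tau> \<longleftrightarrow> x \<in> Lam \<tau>"
  using Lam_add Lam_diff by fastforce

lemma Lam_norm_ge:
  assumes "Im \<tau> > 0" "l \<in> Lam \<tau>" "l \<noteq> 0"
  shows "norm l \<ge> 2 * pi * min 1 (Im \<tau>)"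
proof -
  obtain m n where l: "l = 2 * of_real pi * \<i> * (of_int m * \<tau> + of_int n)"
    using assms(2) Lam_iff by blast
  have "norm (of_int m * \<tau> + of_int n) \<ge> min 1 (Im \<tau>)"
  proof (cases "m = 0")
    case True
    then have "n \<noteq> 0" using l assms(3) by auto
    then have "\<bar>real_of_int n\<bar> \<ge> 1" by linarith
    then show ?thesis using True by (simp add: norm_of_int)
  next
    case False
    then have "\<bar>real_of_int m\<bar> \<ge> 1" by linarith
    then have "Im \<tau> \<le> \<bar>real_of_int m\<bar> * Im \<tau>" using assms(1) by simp
    also have "\<dots> = \<bar>Im (of_int m * \<tau> + of_int n)\<bar>" using assms(1) by (simp add: abs_mult)
    also have "\<dots> \<le> norm (of_int m * \<tau> + of_int n)" by (rule abs_Im_le_cmod)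
    finally show ?thesis by simp
  qed
  then show ?thesis by (simp add: l norm_mult)
qed

lemma closed_Lam:
  assumes "Im \<tau> > 0"
  shows "closed (Lam \<tau>)"
proof (rule discrete_imp_closed)
  show "0 < 2 * pi * min 1 (Im \<tau>)" using assms by simp
  show "\<forall>x\<in>Lam \<tau>. \<forall>y\<in>Lam \<tau>. dist y x < 2 * pi * min 1 (Im \<tau>) \<longrightarrow> y = x"
    using Lam_norm_ge[OF assms Lam_diff] by (force simp: dist_norm)
qed

lemma countable_Lam: "countable (Lam \<tau>)"
proof -
  have "Lam \<tau> = range (\<lambda>(m, n). 2 * of_real pi * \<i> * (of_int m * \<tau> + of_int n))"
    by (auto simp: Lam_def)
  then show ?thesis by simp
qed

text \<open>The denominators of the q-series: if one of them vanishes, taking logarithms puts z into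
  the lattice.\<close>

lemma not_Lam:
  assumes "z \<notin> Lam \<tau>"
  shows "nome \<tau> ^ m * exp z \<noteq> 1" "nome \<tau> ^ m * exp (- z) \<noteq> 1" "exp z \<noteq> 1"
proof -
  have *: "z' \<in> Lam \<tau>" if "nome \<tau> ^ m * exp z' = 1" for z' m
  proof -
    have "exp (2 * of_real pi * \<i> * of_nat m * \<tau> + z') = 1"
      using that by (simp add: exp_add nome_power)
    then obtain n :: int where n: "2 * of_real pi * \<i> * of_nat m * \<tau> + z' = of_int (2 * n) * pi * \<i>"
      unfolding exp_eq_1 by (auto simp: complex_eq_iff)
    then have "z' = 2 * of_real pi * \<i> * (of_int (- int m) * \<tau> + of_int n)"
      by (simp add: algebra_simps add_eq_0_iff2 eq_diff_eq')
    then show ?thesis unfolding Lam_iff by blast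
  qed
  show "nome \<tau> ^ m * exp z \<noteq> 1" "nome \<tau> ^ m * exp (- z) \<noteq> 1" "exp z \<noteq> 1"
    using *[of m z] *[of m "- z"] *[of 0 z] Lam_minus[of "- z"] assms by auto
qed

section \<open>Eisenstein series as functions of the nome\<close>

lemma summable_q_sigma:
  assumes "norm (q :: complex) < 1"
  shows "summable (\<lambda>n. norm (of_nat (divisor_sum k (Suc n)) * q ^ Suc n))"
proof (cases "q = 0")
  case False
  \<comment> \<open>This choice gives |q| e^r = |q|^(1/2) < 1.\<close>
  define r where "r = - ln (norm q) / 2"
  have r: "r > 0" "norm q * exp r < 1"
  proof -
    show "r > 0" using assms False by (simp add: r_def)
    have "norm q * exp r = exp (ln (norm q) + r)" using False by (simp add: exp_add)
    also have "\<dots> < 1" using \<open>r > 0\<close> by (simp add: r_def)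
    finally show "norm q * exp r < 1" .
  qed
  show ?thesis
  proof (rule summable_comparison_test')
    show "summable (\<lambda>n. fact k / r ^ k * (real (Suc n) * (norm q * exp r) ^ Suc n))"
      by (intro summable_mult summable_n_power) (use r in auto)
    show "norm (norm (of_nat (divisor_sum k (Suc n)) * q ^ Suc n))
        \<le> fact k / r ^ k * (real (Suc n) * (norm q * exp r) ^ Suc n)" if "n \<ge> 0" for n
    proof -
      have "real (divisor_sum k (Suc n)) \<le> fact k / r ^ k * (real (Suc n) * exp (real (Suc n) * r))"
        using divisor_sum_le[of r "Suc n" k] r by (simp add: field_simps)
      then have "real (divisor_sum k (Suc n)) * norm q ^ Suc n
          \<le> fact k / r ^ k * (real (Suc n) * exp (real (Suc n) * r)) * norm q ^ Suc n"
        by (rule mult_right_mono) simp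
      also have "exp (real (Suc n) * r) = exp r ^ Suc n"
        by (rule exp_of_nat_mult)
      also have "fact k / r ^ k * (real (Suc n) * exp r ^ Suc n) * norm q ^ Suc n
          = fact k / r ^ k * (real (Suc n) * (norm q * exp r) ^ Suc n)"
        unfolding power_mult_distrib by simp
      finally show ?thesis by (simp add: norm_mult norm_power del: power_Suc of_nat_Suc)
    qed
  qed
qed (use assms in auto)

definition eis_q :: "nat \<Rightarrow> complex \<Rightarrow> complex" where
  "eis_q k q = (\<Sum>n. of_nat (divisor_sum k (Suc n)) * q ^ Suc n)"

lemma eisenstein_eq:
  "eisenstein (k + 2) \<tau> = (if odd k then 0 else - bern_coeff (k + 2) + 2 / fact (k + 1) * eis_q (k + 1) (nome \<tau>))"
  by (simp add: eisenstein_def bern_coeff_def eis_q_def nome_power del: of_nat_Suc power_Suc)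

lemma eis_q_holomorphic: "eis_q k holomorphic_on ball 0 1"
proof (rule power_series_holomorphic)
  fix q :: complex assume "q \<in> ball 0 1"
  then have "summable (\<lambda>n. of_nat (divisor_sum k (Suc n)) * q ^ Suc n)"
    by (intro summable_norm_cancel[OF summable_q_sigma]) simp
  then have "(\<lambda>n. of_nat (divisor_sum k (Suc n)) * q ^ Suc n) sums eis_q k q"
    unfolding eis_q_def by (rule summable_sums)
  from sums_Suc[of "\<lambda>n. (if n = 0 then 0 else of_nat (divisor_sum k n)) * q ^ n" "eis_q k q"] this
  show "(\<lambda>n. (if n = 0 then 0 else of_nat (divisor_sum k n)) * (q - 0) ^ n) sums eis_q k q"
    by (simp del: power_Suc of_nat_Suc)
qed

lemma eisenstein_holomorphic: "eisenstein (k + 2) holomorphic_on upper_half_plane"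
proof -
  have "(\<lambda>\<tau>. eis_q (k + 1) (nome \<tau>)) holomorphic_on upper_half_plane"
    by (rule holomorphic_on_compose_gen[OF _ eis_q_holomorphic, unfolded o_def])
       (auto simp: nome_def[abs_def] upper_half_plane_def intro!: holomorphic_intros norm_nome_less_1[unfolded nome_def])
  then show ?thesis
    unfolding eisenstein_eq[abs_def] by (cases "odd k") (auto intro!: holomorphic_intros)
qed

text \<open>One constant serves all weights and all \<tau> with |q| <= q0. The Bernoulli part is
  bounded because r lies inside the disc of radius 2 pi, and r^(k+1)/(k+1)! is the weight for which
  \<open>divisor_sum_le\<close> is uniform in k.\<close>

lemma eisenstein_bound:
  assumes "0 < r" "r < 2 * pi" "0 \<le> q0" "q0 * exp r < 1"
  shows "\<exists>A. \<forall>\<tau> k. norm (nome \<tau>) \<le> q0 \<longrightarrow> norm (eisenstein (k + 2) \<tau>) * r ^ (k + 1) \<le> A"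
proof -
  have "summable (\<lambda>n. bern_coeff n * (of_real r) ^ n)"
    by (rule sums_summable[OF bern_fun_sums]) (use assms in auto)
  then have "Bseq (\<lambda>n. bern_coeff n * (of_real r) ^ n)"
    using summable_imp_Bseq by blast
  then obtain B where B: "\<And>n. norm (bern_coeff n * (of_real r) ^ n) \<le> B"
    unfolding Bseq_def by blast
  define S where "S = (\<Sum>n. real (Suc n) * (q0 * exp r) ^ Suc n)"
  have sS: "summable (\<lambda>n. real (Suc n) * (q0 * exp r) ^ Suc n)"
    by (rule summable_n_power) (use assms in auto)
  have "norm (eisenstein (k + 2) \<tau>) * r ^ (k + 1) \<le> B / r + 2 * S" if q: "norm (nome \<tau>) \<le> q0" for \<tau> k
  proof -
    have "1 < exp r" using assms by simp
    have "q0 < 1"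
    proof (rule ccontr)
      assume "\<not> q0 < 1"
      then have "1 * 1 \<le> q0 * exp r" using \<open>1 < exp r\<close> by (intro mult_mono) auto
      then show False using assms by simp
    qed
    have q1: "norm (nome \<tau>) < 1" using q \<open>q0 < 1\<close> by simp
    have "norm (eis_q (k + 1) (nome \<tau>)) \<le> (\<Sum>n. norm (of_nat (divisor_sum (k + 1) (Suc n)) * nome \<tau> ^ Suc n))"
      unfolding eis_q_def by (rule summable_norm[OF summable_q_sigma[OF q1]])
    then have "norm (2 / fact (k + 1) * eis_q (k + 1) (nome \<tau>)) * r ^ (k + 1)
        \<le> 2 / fact (k + 1) * (\<Sum>n. norm (of_nat (divisor_sum (k + 1) (Suc n)) * nome \<tau> ^ Suc n)) * r ^ (k + 1)"
      using assms(1) unfolding norm_mult norm_divide by (intro mult_right_mono mult_mono) (auto simp del: fact_Suc)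
    also have "\<dots> = 2 * (\<Sum>n. r ^ (k + 1) / fact (k + 1) * norm (of_nat (divisor_sum (k + 1) (Suc n)) * nome \<tau> ^ Suc n))"
      by (subst suminf_mult[OF summable_q_sigma[OF q1]]) (simp add: field_simps)
    also have "\<dots> \<le> 2 * S"
      unfolding S_def
    proof (intro mult_left_mono suminf_le summable_mult summable_q_sigma[OF q1] sS)
      fix n
      have "r ^ (k + 1) / fact (k + 1) * norm (of_nat (divisor_sum (k + 1) (Suc n)) * nome \<tau> ^ Suc n)
          = real (divisor_sum (k + 1) (Suc n)) * r ^ (k + 1) / fact (k + 1) * norm (nome \<tau>) ^ Suc n"
        by (simp add: norm_mult norm_power del: of_nat_Suc power_Suc)
      also have "\<dots> \<le> (real (Suc n) * exp (real (Suc n) * r)) * q0 ^ Suc n"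
        by (intro mult_mono divisor_sum_le power_mono q) (use assms in auto)
      also have "\<dots> = real (Suc n) * (q0 * exp r) ^ Suc n"
        unfolding exp_of_nat_mult power_mult_distrib by simp
      finally show "r ^ (k + 1) / fact (k + 1) * norm (of_nat (divisor_sum (k + 1) (Suc n)) * nome \<tau> ^ Suc n)
          \<le> real (Suc n) * (q0 * exp r) ^ Suc n" .
    qed auto
    finally have 1: "norm (2 / fact (k + 1) * eis_q (k + 1) (nome \<tau>)) * r ^ (k + 1) \<le> 2 * S" .
    have "norm (bern_coeff (k + 2)) * r ^ (k + 1) \<le> B / r"
      using B[of "k + 2"] assms(1) by (simp add: norm_mult norm_power field_simps)
    moreover have "0 \<le> B / r" "0 \<le> 2 * S"
      using order_trans[OF norm_ge_zero B[of 0]] assms(1) order_trans[OF _ 1] by auto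
    moreover have "norm (eisenstein (k + 2) \<tau>) \<le> norm (bern_coeff (k + 2)) + norm (2 / fact (k + 1) * eis_q (k + 1) (nome \<tau>))"
      unfolding eisenstein_eq using norm_triangle_ineq[of "- bern_coeff (k + 2)"] by (auto simp del: fact_Suc)
    then have "norm (eisenstein (k + 2) \<tau>) * r ^ (k + 1)
        \<le> norm (bern_coeff (k + 2)) * r ^ (k + 1) + norm (2 / fact (k + 1) * eis_q (k + 1) (nome \<tau>)) * r ^ (k + 1)"
      using assms(1) by (subst distrib_right[symmetric], intro mult_right_mono) auto
    ultimately show ?thesis using 1 by linarith
  qed
  then show ?thesis by blast
qed

text \<open>Rearrangement of a Lambert series: a pair (m, d) of positive integers corresponds to n =
  m d together with its divisor d.\<close>

lemma infsum_divisor_pairs: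
  assumes q: "norm (q :: complex) < 1"
    and s: "(\<lambda>(m, d). q ^ (Suc m * Suc d) * of_nat (Suc d) ^ k) summable_on (UNIV :: (nat \<times> nat) set)"
  shows "(\<Sum>\<^sub>\<infinity>(m, d)\<in>(UNIV :: (nat \<times> nat) set). q ^ (Suc m * Suc d) * of_nat (Suc d) ^ k) = eis_q k q"
proof -
  define S where "S = (SIGMA n:(UNIV :: nat set). {d. d dvd Suc n})"
  have bij: "bij_betw (\<lambda>(m, d). (Suc m * Suc d - 1, Suc d)) (UNIV :: (nat \<times> nat) set) S"
  proof (rule bij_betw_byWitness[where f' = "\<lambda>(n, d). (Suc n div d - 1, d - 1)"])
    show "\<forall>a\<in>UNIV. (case case a of (m, d) \<Rightarrow> (Suc m * Suc d - 1, Suc d) of (n, d) \<Rightarrow> (Suc n div d - 1, d - 1)) = a"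
      by (auto simp del: mult_Suc mult_Suc_right)
    show "(\<lambda>(m, d). (Suc m * Suc d - 1, Suc d)) ` (UNIV :: (nat \<times> nat) set) \<subseteq> S"
      by (auto simp: S_def simp del: mult_Suc mult_Suc_right)
    show "\<forall>a'\<in>S. (case case a' of (n, d) \<Rightarrow> (Suc n div d - 1, d - 1) of (m, d) \<Rightarrow> (Suc m * Suc d - 1, Suc d)) = a'"
    proof (safe, goal_cases)
      case (1 n d)
      then have d: "d dvd Suc n" by (simp add: S_def)
      then have "d > 0" by (cases "d = 0") auto
      moreover from this have "Suc n div d > 0" using d by (simp add: dvd_imp_le div_greater_zero_iff)
      ultimately show ?case using d by simp
    next
      case (2 n d)
      then show ?case by (cases d) (auto simp: S_def)
    qed
    show "(\<lambda>(n, d). (Suc n div d - 1, d - 1)) ` S \<subseteq> UNIV" by simp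
  qed
  let ?g = "\<lambda>(n, d). q ^ Suc n * of_nat d ^ k"
  have eq: "?g ((\<lambda>(m, d). (Suc m * Suc d - 1, Suc d)) x) = (\<lambda>(m, d). q ^ (Suc m * Suc d) * of_nat (Suc d) ^ k) x" for x
    by (cases x) (simp del: of_nat_Suc power_Suc mult_Suc mult_Suc_right)
  have sS: "?g summable_on S"
    using summable_on_reindex_bij_betw[OF bij, of ?g] s unfolding eq by simp
  have "(\<Sum>\<^sub>\<infinity>(m, d)\<in>(UNIV :: (nat \<times> nat) set). q ^ (Suc m * Suc d) * of_nat (Suc d) ^ k) = (\<Sum>\<^sub>\<infinity>x\<in>S. ?g x)"
    using infsum_reindex_bij_betw[OF bij, of ?g] unfolding eq by simp
  also have "\<dots> = (\<Sum>\<^sub>\<infinity>n. \<Sum>\<^sub>\<infinity>d\<in>{d. d dvd Suc n}. q ^ Suc n * of_nat d ^ k)"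
    using infsum_Sigma'_banach[of "\<lambda>n d. q ^ Suc n * of_nat d ^ k" UNIV "\<lambda>n. {d. d dvd Suc n}"] sS
    unfolding S_def by simp
  also have "\<dots> = (\<Sum>\<^sub>\<infinity>n. of_nat (divisor_sum k (Suc n)) * q ^ Suc n)"
    by (intro infsum_cong) (simp add: divisor_sum_def sum_distrib_left mult.commute del: power_Suc)
  also have "\<dots> = eis_q k q"
    unfolding eis_q_def
    by (intro infsumI norm_summable_imp_has_sum summable_sums summable_norm_cancel[OF summable_q_sigma] summable_q_sigma q)
  finally show ?thesis .
qed

text \<open>The \<open>q\<close>-series of \<open>P\<^sub>1\<close>.  Unlike the expansion at \<open>0\<close> it shows the behaviour under translation
  by the lattice.\<close>
definition zeta_term :: "complex \<Rightarrow> nat \<Rightarrow> complex \<Rightarrow> complex" where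
  "zeta_term \<tau> m z = nome \<tau> ^ m * exp (- z) / (1 - nome \<tau> ^ m * exp (- z)) - nome \<tau> ^ m * exp z / (1 - nome \<tau> ^ m * exp z)"

definition zeta_q :: "complex \<Rightarrow> complex \<Rightarrow> complex" where
  "zeta_q \<tau> z = 1 / 2 + 1 / (exp z - 1) + (\<Sum>m. zeta_term \<tau> (Suc m) z)"

lemma geometric_Suc_has_sum:
  "norm (x :: complex) < 1 \<Longrightarrow> ((\<lambda>d. x ^ Suc d) has_sum x / (1 - x)) UNIV"
proof -
  assume x: "norm x < 1"
  have "(\<lambda>d. x * x ^ d) sums (x * (1 / (1 - x)))"
    by (intro sums_mult geometric_sums x)
  moreover have "summable (\<lambda>d. norm (x ^ Suc d))"
    using x by (simp add: norm_mult norm_power summable_geometric summable_mult)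
  ultimately show ?thesis
    by (intro norm_summable_imp_has_sum) (auto simp: field_simps)
qed

text \<open>Expand each \<open>zeta_term\<close> geometrically in q^m e^z and q^m e^(-z), then each
  exponential in powers of z, and collect the coefficient of z^(k+1). The hypothesis on z says |q|
  e^|z| < 1, which makes the triple series absolutely convergent.\<close>

lemma zeta_term_sum_expansion:
  assumes \<tau>: "Im \<tau> > 0" and z: "norm z < 2 * pi * Im \<tau>"
  shows "((\<lambda>k. ((-1) ^ (k + 1) - 1) / fact (k + 1) * eis_q (k + 1) (nome \<tau>) * z ^ (k + 1)) has_sum
      (\<Sum>m. zeta_term \<tau> (Suc m) z)) UNIV"
proof -
  define q where "q = nome \<tau>"
  define f where "f = (\<lambda>(m :: nat, d :: nat) k. ((-1) ^ (k + 1) - 1) * (q ^ (Suc m * Suc d) * (of_nat (Suc d) * z) ^ (k + 1) / fact (k + 1)))"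
  define e where "e = norm q * exp (norm z)"
  have q: "norm q < 1" "q \<noteq> 0" using norm_nome_less_1[OF \<tau>] by (auto simp: q_def)
  have e: "0 < e" "e < 1"
  proof -
    have "e = exp (- 2 * pi * Im \<tau> + norm z)" unfolding e_def q_def norm_nome by (simp add: mult_exp_exp)
    also have "\<dots> < 1" using z by simp
    finally show "e < 1" .
    show "0 < e" using q by (simp add: e_def)
  qed
  \<comment> \<open>Since (m+1)(d+1) >= m + (d+1), d + 1 factors |q| can be spent on e^((d+1)|z|),
    which turns them into e^(d+1) for the number \<open>e\<close>; the factor |q|^m remains.\<close>
  define M where "M = (\<lambda>(m :: nat, d :: nat). 2 * norm q ^ m * e ^ Suc d)"
  have M: "M summable_on UNIV"
  proof -
    have "(\<lambda>x. norm (case x of (m, d) \<Rightarrow> complex_of_real (2 * norm q ^ m * e ^ Suc d))) summable_on (UNIV \<times> UNIV)"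
    proof (rule abs_summable_product[where M = "\<lambda>m. norm q ^ m * (2 * e / (1 - e))"])
      fix m
      have hs: "((\<lambda>d. 2 * norm q ^ m * e ^ Suc d) has_sum (2 * norm q ^ m * (e / (1 - e)))) UNIV"
      proof (rule has_sum_cmult_right, rule norm_summable_imp_has_sum)
        show "(\<lambda>d. e ^ Suc d) sums (e / (1 - e))"
          using sums_mult[OF geometric_sums[of e], of e] e by simp
        show "summable (\<lambda>d. norm (e ^ Suc d))"
          using e by (auto intro!: summable_mult summable_geometric)
      qed
      moreover have "2 * norm q ^ m * (e / (1 - e)) = norm q ^ m * (2 * e / (1 - e))"
        by simp
      ultimately show "(\<lambda>d. norm (complex_of_real (2 * norm q ^ m * e ^ Suc d))) summable_on UNIV"
        and "(\<Sum>\<^sub>\<infinity>d. norm (complex_of_real (2 * norm q ^ m * e ^ Suc d))) \<le> norm q ^ m * (2 * e / (1 - e))"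
        using e by (auto simp: norm_mult norm_power has_sum_iff abs_mult simp del: power_Suc times_divide_eq_right)
    qed (intro geometric_summable_on norm_ge_zero q)
    then show ?thesis using e by (simp add: M_def case_prod_unfold norm_mult norm_power abs_mult)
  qed
  have fk: "(\<lambda>k. norm (f x k)) summable_on UNIV" "(\<Sum>\<^sub>\<infinity>k. norm (f x k)) \<le> M x"
    "(\<Sum>\<^sub>\<infinity>k. f x k) = (case x of (m, d) \<Rightarrow> (q ^ Suc m * exp (- z)) ^ Suc d - (q ^ Suc m * exp z) ^ Suc d)" for x
  proof -
    obtain m d where x: "x = (m, d)" by (cases x)
    define y where "y = of_nat (Suc d) * z"
    define Q where "Q = q ^ (Suc m * Suc d)"
    have f_eq: "f x k = ((-1) ^ (k + 1) - 1) * (Q * y ^ (k + 1) / fact (k + 1))" for k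
      by (simp add: f_def x y_def Q_def del: of_nat_Suc)
    have se: "(\<lambda>k. norm y ^ (k + 1) / fact (k + 1)) sums (exp (norm y) - 1)"
      using sums_split_initial_segment[OF exp_converges[of "norm y"], of 1]
      by (simp add: divide_inverse mult.commute)
    have b: "norm (f x k) \<le> 2 * norm Q * (norm y ^ (k + 1) / fact (k + 1))" for k
    proof -
      have "norm ((-1) ^ (k + 1) - 1 :: complex) \<le> 2"
        by (cases "even k") auto
      then have "norm (f x k) \<le> 2 * norm (Q * y ^ (k + 1) / fact (k + 1))"
        unfolding f_eq norm_mult[of "_ - _"] by (rule mult_right_mono) simp
      then show ?thesis by (simp add: norm_mult norm_divide norm_power del: fact_Suc power_Suc)
    qed
    have sb: "(\<lambda>k. 2 * norm Q * (norm y ^ (k + 1) / fact (k + 1))) sums (2 * norm Q * (exp (norm y) - 1))"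
      by (intro sums_mult se)
    have sm: "summable (\<lambda>k. norm (f x k))"
      by (rule summable_comparison_test'[OF sums_summable[OF sb], of 0]) (use b in auto)
    then show "(\<lambda>k. norm (f x k)) summable_on UNIV"
      by (simp add: norm_summable_imp_summable_on)
    have "(\<Sum>\<^sub>\<infinity>k. norm (f x k)) = (\<Sum>k. norm (f x k))"
      by (intro infsumI norm_summable_imp_has_sum summable_sums) (use sm in auto)
    also have "\<dots> \<le> 2 * norm Q * (exp (norm y) - 1)"
      using suminf_le[OF b sm sums_summable[OF sb]] sums_unique[OF sb] by simp
    also have "\<dots> \<le> 2 * norm Q * exp (norm y)"
      by (rule mult_left_mono) auto
    also have "exp (norm y) = exp (norm z) ^ Suc d"
      by (simp add: y_def norm_mult exp_of_nat_mult[symmetric] del: of_nat_Suc power_Suc)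
    also have "norm Q \<le> norm q ^ m * norm q ^ Suc d"
    proof -
      have "norm Q = norm q ^ (m * Suc d + Suc d)" unfolding Q_def norm_power by (simp only: mult_Suc add.commute)
      also have "\<dots> \<le> norm q ^ (m + Suc d)"
        using q by (intro power_decreasing) auto
      finally show ?thesis by (simp only: power_add)
    qed
    finally show "(\<Sum>\<^sub>\<infinity>k. norm (f x k)) \<le> M x"
      by (simp add: M_def x e_def power_mult_distrib mult_ac del: power_Suc)
    have "(\<lambda>k. f x k) sums (Q * (exp (- y) - exp y))"
    proof -
      have "(\<lambda>k. (- y) ^ (k + 1) /\<^sub>R fact (k + 1) - y ^ (k + 1) /\<^sub>R fact (k + 1)) sums ((exp (- y) - 1) - (exp y - 1))"
        using sums_split_initial_segment[OF exp_converges[of y], of 1]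
          sums_split_initial_segment[OF exp_converges[of "- y"], of 1]
        by (intro sums_diff) (simp_all del: fact_Suc)
      from sums_mult[OF this, of Q] show ?thesis
        by (simp add: f_eq scaleR_conv_of_real power_minus[of y] field_simps del: fact_Suc)
    qed
    then have "(\<Sum>\<^sub>\<infinity>k. f x k) = Q * (exp (- y) - exp y)"
      by (intro infsumI norm_summable_imp_has_sum sm)
    moreover have "exp (- y) = exp (- z) ^ Suc d" "exp y = exp z ^ Suc d"
      unfolding y_def exp_of_nat_mult[symmetric] by simp_all
    ultimately show "(\<Sum>\<^sub>\<infinity>k. f x k) = (case x of (m, d) \<Rightarrow> (q ^ Suc m * exp (- z)) ^ Suc d - (q ^ Suc m * exp z) ^ Suc d)"
      by (simp only: x Q_def power_mult_distrib power_mult prod.case right_diff_distrib)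
  qed
  have swap: "(\<Sum>\<^sub>\<infinity>x. \<Sum>\<^sub>\<infinity>k. f x k) = (\<Sum>\<^sub>\<infinity>k. \<Sum>\<^sub>\<infinity>x. f x k)"
    and col: "(\<lambda>k. norm (\<Sum>\<^sub>\<infinity>x. f x k)) summable_on UNIV"
    by (rule infsum_swap_majorised[OF fk(1,2) M], rule abs_summable_swap_majorised[OF fk(1,2) M])
  have colsm: "(\<lambda>x. f x k) summable_on UNIV" for k
  proof (rule abs_summable_summable, rule summable_on_comparison_test[OF M])
    fix x
    have "norm (f x k) = (\<Sum>\<^sub>\<infinity>k\<in>{k}. norm (f x k))" by simp
    also have "\<dots> \<le> (\<Sum>\<^sub>\<infinity>k. norm (f x k))"
      by (rule infsum_mono_neutral) (use fk(1) in auto)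
    finally show "norm (f x k) \<le> M x" using fk(2) order_trans by blast
  qed auto
  have k_eq: "(\<Sum>\<^sub>\<infinity>x. f x k) = ((-1) ^ (k + 1) - 1) / fact (k + 1) * eis_q (k + 1) q * z ^ (k + 1)" for k
  proof (cases "even k")
    case True
    have f_eq: "f x k = - 2 * z ^ (k + 1) / fact (k + 1) * (case x of (m, d) \<Rightarrow> q ^ (Suc m * Suc d) * of_nat (Suc d) ^ (k + 1))" for x
      using True by (simp add: f_def case_prod_unfold power_mult_distrib field_simps del: fact_Suc of_nat_Suc mult_Suc mult_Suc_right)
    show ?thesis
    proof (cases "z = 0")
      case False
      have "(\<lambda>x. case x of (m, d) \<Rightarrow> q ^ (Suc m * Suc d) * of_nat (Suc d) ^ (k + 1)) summable_on UNIV"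
      proof -
        have "(\<lambda>x. (- 2 * z ^ (k + 1) / fact (k + 1)) * (case x of (m, d) \<Rightarrow> q ^ (Suc m * Suc d) * of_nat (Suc d) ^ (k + 1))) summable_on UNIV"
          using colsm[of k] unfolding f_eq .
        then show ?thesis using False
          by (subst (asm) summable_on_cmult_right') (auto simp del: fact_Suc)
      qed
      from infsum_divisor_pairs[OF q(1) this] show ?thesis
        unfolding f_eq infsum_cmult_right' using True by (simp add: field_simps del: fact_Suc)
    qed (simp add: f_eq)
  qed (simp add: f_def case_prod_unfold)
  have iter: "(\<Sum>\<^sub>\<infinity>x. \<Sum>\<^sub>\<infinity>k. f x k) = (\<Sum>\<^sub>\<infinity>m. \<Sum>\<^sub>\<infinity>d. (q ^ Suc m * exp (- z)) ^ Suc d - (q ^ Suc m * exp z) ^ Suc d)"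
  proof -
    have "(\<lambda>x. norm (\<Sum>\<^sub>\<infinity>k. f x k)) summable_on UNIV"
      by (rule summable_on_comparison_test[OF M])
         (auto intro: order_trans[OF norm_infsum_bound[OF fk(1)] fk(2)])
    then have "(\<lambda>x. \<Sum>\<^sub>\<infinity>k. f x k) summable_on (UNIV \<times> UNIV)"
      using abs_summable_summable by auto
    then show ?thesis
      using infsum_Sigma'_banach[of "\<lambda>m d. (q ^ Suc m * exp (- z)) ^ Suc d - (q ^ Suc m * exp z) ^ Suc d" UNIV "\<lambda>_. UNIV"]
      unfolding fk(3) by (simp del: power_Suc)
  qed
  have in1: "(\<Sum>\<^sub>\<infinity>d. (q ^ Suc m * exp (- z)) ^ Suc d - (q ^ Suc m * exp z) ^ Suc d) = zeta_term \<tau> (Suc m) z" for m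
  proof -
    have "norm (q ^ Suc m * exp z') < 1" if "norm z' = norm z" for z'
    proof -
      have "norm (q ^ Suc m * exp z') \<le> norm q ^ 1 * exp (norm z)"
        unfolding norm_mult norm_power
        by (intro mult_mono power_decreasing norm_exp[THEN order_trans]) (use q that in auto)
      then show ?thesis using e by (simp add: e_def)
    qed
    then have n: "norm (q ^ Suc m * exp z) < 1" "norm (q ^ Suc m * exp (- z)) < 1"
      by auto
    show ?thesis
      using geometric_Suc_has_sum[OF n(1)] geometric_Suc_has_sum[OF n(2)]
      by (subst infsum_diff_complex) (auto simp: has_sum_iff zeta_term_def q_def simp del: power_Suc)
  qed
  have main: "(\<Sum>\<^sub>\<infinity>m. zeta_term \<tau> (Suc m) z) = (\<Sum>\<^sub>\<infinity>k. \<Sum>\<^sub>\<infinity>x. f x k)"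
    using iter unfolding swap in1 by simp
  have "(\<Sum>\<^sub>\<infinity>m. zeta_term \<tau> (Suc m) z) = (\<Sum>m. zeta_term \<tau> (Suc m) z)"
  proof -
    have "(\<lambda>m. norm (zeta_term \<tau> (Suc m) z)) summable_on UNIV"
    proof -
      have "(\<lambda>x. norm (\<Sum>\<^sub>\<infinity>k. f x k)) summable_on UNIV \<times> UNIV"
        using summable_on_comparison_test[OF M, of "\<lambda>x. norm (\<Sum>\<^sub>\<infinity>k. f x k)"]
        by (auto intro: order_trans[OF norm_infsum_bound[OF fk(1)] fk(2)])
      then have "(\<lambda>m. norm (\<Sum>\<^sub>\<infinity>d. norm (\<Sum>\<^sub>\<infinity>k. f (m, d) k))) summable_on UNIV"
        and "\<And>m. (\<lambda>d. norm (\<Sum>\<^sub>\<infinity>k. f (m, d) k)) summable_on UNIV"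
        unfolding Infinite_Sum.abs_summable_on_Sigma_iff by auto
      then have 1: "(\<lambda>m. \<Sum>\<^sub>\<infinity>d. norm (\<Sum>\<^sub>\<infinity>k. f (m, d) k)) summable_on UNIV"
        and 2: "\<And>m. (\<lambda>d. norm (\<Sum>\<^sub>\<infinity>k. f (m, d) k)) summable_on UNIV"
        by (simp_all add: infsum_nonneg)
      have in2: "zeta_term \<tau> (Suc m) z = (\<Sum>\<^sub>\<infinity>d. \<Sum>\<^sub>\<infinity>k. f (m, d) k)" for m
        unfolding in1[symmetric] fk(3) prod.case ..
      show ?thesis
        unfolding in2 by (rule summable_on_comparison_test[OF 1]) (auto intro: norm_infsum_bound 2)
    qed
    then have "(\<lambda>m. zeta_term \<tau> (Suc m) z) summable_on UNIV"
      by (rule abs_summable_summable)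
    then have "((\<lambda>m. zeta_term \<tau> (Suc m) z) has_sum (\<Sum>\<^sub>\<infinity>m. zeta_term \<tau> (Suc m) z)) UNIV"
      by (simp add: has_sum_infsum)
    from has_sum_imp_sums[OF this] show ?thesis
      by (simp add: sums_iff)
  qed
  moreover have "((\<lambda>k. \<Sum>\<^sub>\<infinity>x. f x k) has_sum (\<Sum>\<^sub>\<infinity>k. \<Sum>\<^sub>\<infinity>x. f x k)) UNIV"
    by (rule has_sum_infsum[OF abs_summable_summable[OF col]])
  ultimately have "((\<lambda>k. \<Sum>\<^sub>\<infinity>x. f x k) has_sum (\<Sum>m. zeta_term \<tau> (Suc m) z)) UNIV"
    using main by (simp only:)
  then show ?thesis
    unfolding k_eq q_def .
qed

text \<open>For odd k both parts vanish, by the parity of the Bernoulli numbers and by the factor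
  (-1)^(k+1) - 1. For even k this factor is -2 and produces the normalisation of E_(k+2).\<close>

lemma zeta_q_expansion:
  assumes \<tau>: "Im \<tau> > 0" and z: "norm z < 2 * pi * min 1 (Im \<tau>)" "z \<noteq> 0"
  shows "(\<lambda>k. eisenstein (k + 2) \<tau> * z ^ (k + 1)) sums (1 / z - zeta_q \<tau> z)"
proof -
  have z': "norm z < 2 * pi" "norm z < 2 * pi * Im \<tau>"
    using z by (auto simp: min_mult_distrib_left)
  have "(\<lambda>k. - (bern_coeff (k + 2) * z ^ (k + 1) + ((-1) ^ (k + 1) - 1) / fact (k + 1) * eis_q (k + 1) (nome \<tau>) * z ^ (k + 1)))
    sums (- ((1 / 2 + 1 / (exp z - 1) - 1 / z) + (\<Sum>m. zeta_term \<tau> (Suc m) z)))"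
    by (intro sums_minus sums_add inverse_exp_minus_1_sums z' z has_sum_imp_sums[OF zeta_term_sum_expansion] \<tau>)
  moreover have "- (bern_coeff (k + 2) * z ^ (k + 1) + ((-1) ^ (k + 1) - 1) / fact (k + 1) * eis_q (k + 1) (nome \<tau>) * z ^ (k + 1))
      = eisenstein (k + 2) \<tau> * z ^ (k + 1)" for k
    unfolding eisenstein_eq using bern_coeff_parity(2)[of "k + 2"]
    by (cases "odd k") (simp_all add: algebra_simps del: fact_Suc add_2_eq_Suc add_2_eq_Suc')
  ultimately show ?thesis by (simp add: zeta_q_def diff_diff_eq)
qed

section \<open>Quasi-modularity of the Eisenstein series\<close>

lemma zeta_term_bound:
  assumes "norm (exp z) \<le> C" "norm (exp (- z)) \<le> C" "norm (nome \<tau>) ^ m * C \<le> 1 / 2"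
  shows "norm (zeta_term \<tau> m z) \<le> 4 * C * norm (nome \<tau>) ^ m"
proof -
  have *: "norm (x / (1 - x)) \<le> 2 * C * norm (nome \<tau>) ^ m"
    if x: "x = nome \<tau> ^ m * exp z'" "norm (exp z') \<le> C" for x z' :: complex
  proof -
    have "norm x \<le> norm (nome \<tau>) ^ m * C"
      using x by (simp add: norm_mult norm_power mult_left_mono)
    moreover from this have "norm (1 - x) \<ge> 1 / 2"
      using norm_triangle_ineq2[of 1 x] assms(3) by simp
    ultimately have "norm x / norm (1 - x) \<le> (norm (nome \<tau>) ^ m * C) / (1 / 2)"
      by (intro frac_le) (auto intro: order_trans[OF norm_ge_zero])
    then show ?thesis by (simp add: norm_divide mult_ac)
  qed
  show ?thesis
    unfolding zeta_term_def
    using norm_triangle_ineq4[of "nome \<tau> ^ m * exp (- z) / (1 - nome \<tau> ^ m * exp (- z))" "nome \<tau> ^ m * exp z / (1 - nome \<tau> ^ m * exp z)"]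
      *[OF refl assms(1)] *[OF refl assms(2)]
    by linarith
qed

lemma zeta_term_bound_ev:
  assumes \<tau>: "Im \<tau> > 0"
  shows "\<exists>M. summable M \<and> (\<forall>\<^sub>F m in sequentially. \<forall>z\<in>cball 0 r. norm (zeta_term \<tau> (Suc m) z) \<le> M m)"
proof (intro exI conjI)
  define C where "C = exp r"
  show "summable (\<lambda>m. 4 * C * norm (nome \<tau>) ^ Suc m)"
    using norm_nome_less_1[OF \<tau>] by (auto intro!: summable_mult summable_geometric)
  have "(\<lambda>m. norm (nome \<tau>) ^ m * C) \<longlonglongrightarrow> 0 * C"
    by (intro tendsto_mult_right LIMSEQ_realpow_zero) (use norm_nome_less_1[OF \<tau>] in auto)
  then have "\<forall>\<^sub>F m in sequentially. norm (nome \<tau>) ^ m * C < 1 / 2"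
    by (rule order_tendstoD) simp
  then have "\<forall>\<^sub>F m in sequentially. norm (nome \<tau>) ^ Suc m * C < 1 / 2"
    by (subst eventually_sequentially_Suc)
  then show "\<forall>\<^sub>F m in sequentially. \<forall>z\<in>cball 0 r. norm (zeta_term \<tau> (Suc m) z) \<le> 4 * C * norm (nome \<tau>) ^ Suc m"
  proof eventually_elim
    case (elim m)
    show ?case
    proof
      fix z :: complex assume "z \<in> cball 0 r"
      then have "exp (norm z) \<le> C" by (simp add: C_def)
      then have "norm (exp z) \<le> C" "norm (exp (- z)) \<le> C"
        using order_trans[OF norm_exp[of z]] order_trans[OF norm_exp[of "- z"]] by simp_all
      with elim show "norm (zeta_term \<tau> (Suc m) z) \<le> 4 * C * norm (nome \<tau>) ^ Suc m"
        by (intro zeta_term_bound) auto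
    qed
  qed
qed

lemma summable_zeta_term:
  assumes "Im \<tau> > 0"
  shows "summable (\<lambda>m. zeta_term \<tau> (Suc m) z)"
proof -
  obtain M where M: "summable M" "\<forall>\<^sub>F m in sequentially. \<forall>y\<in>cball 0 (norm z). norm (zeta_term \<tau> (Suc m) y) \<le> M m"
    using zeta_term_bound_ev[OF assms] by blast
  from M(2) have "\<forall>\<^sub>F m in sequentially. norm (zeta_term \<tau> (Suc m) z) \<le> M m"
    by eventually_elim simp
  then show ?thesis using M(1) by (rule summable_comparison_test_ev)
qed

lemma zeta_term_holomorphic: "zeta_term \<tau> m holomorphic_on - Lam \<tau>"
  unfolding zeta_term_def[abs_def] by (auto intro!: holomorphic_intros) (metis not_Lam(1,2))+

lemma zeta_q_holomorphic:
  assumes \<tau>: "Im \<tau> > 0"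
  shows "zeta_q \<tau> holomorphic_on - Lam \<tau>"
proof -
  have "(\<lambda>z. \<Sum>m. zeta_term \<tau> (Suc m) z) holomorphic_on - Lam \<tau>"
  proof (rule holomorphic_uniform_sequence)
    show "open (- Lam \<tau>)" using closed_Lam[OF \<tau>] by auto
    show "(\<lambda>z. \<Sum>m<n. zeta_term \<tau> (Suc m) z) holomorphic_on - Lam \<tau>" for n
      by (intro holomorphic_on_sum zeta_term_holomorphic)
    fix z assume "z \<in> - Lam \<tau>"
    then obtain d where d: "d > 0" "cball z d \<subseteq> - Lam \<tau>"
      using \<open>open (- Lam \<tau>)\<close> open_contains_cball by blast
    obtain M where M: "summable M" "\<forall>\<^sub>F m in sequentially. \<forall>y\<in>cball 0 (norm z + d). norm (zeta_term \<tau> (Suc m) y) \<le> M m"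
      using zeta_term_bound_ev[OF \<tau>] by blast
    have sub: "cball z d \<subseteq> cball 0 (norm z + d)"
    proof
      fix y assume "y \<in> cball z d"
      then show "y \<in> cball 0 (norm z + d)"
        using norm_triangle_sub[of y z] by (simp add: dist_norm norm_minus_commute)
    qed
    from M(2) have "\<forall>\<^sub>F m in sequentially. \<forall>y\<in>cball z d. norm (zeta_term \<tau> (Suc m) y) \<le> M m"
      by eventually_elim (use sub in blast)
    from Weierstrass_m_test_ev[OF this M(1)] d
    show "\<exists>d>0. cball z d \<subseteq> - Lam \<tau> \<and> uniform_limit (cball z d) (\<lambda>n z. \<Sum>m<n. zeta_term \<tau> (Suc m) z) (\<lambda>z. \<Sum>m. zeta_term \<tau> (Suc m) z) sequentially"
      by blast
  qed
  then show ?thesis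
    unfolding zeta_q_def[abs_def] by (auto intro!: holomorphic_intros dest: not_Lam(3))
qed

lemma zeta_q_shift_int: "zeta_q \<tau> (z + 2 * of_real pi * \<i> * of_int n) = zeta_q \<tau> z"
proof -
  have "exp (2 * of_real pi * \<i> * of_int n) = (1 :: complex)"
    unfolding exp_eq_1 by (auto intro!: exI[of _ n])
  then have "exp (z + 2 * of_real pi * \<i> * of_int n) = exp z" "exp (- (z + 2 * of_real pi * \<i> * of_int n)) = exp (- z)"
    by (auto simp: exp_add exp_minus exp_diff)
  then show ?thesis unfolding zeta_q_def zeta_term_def by simp
qed

text \<open>In the shifted series the terms with e^z move up by one index and those with e^(-z) down
  by one, so the difference telescopes. The boundary terms \<open>A 1\<close> and \<open>B 0\<close>
  combine with the two values of 1/(e^z - 1) to -1.\<close>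

lemma zeta_q_shift_nome:
  assumes \<tau>: "Im \<tau> > 0" and z: "z \<notin> Lam \<tau>"
  shows "zeta_q \<tau> (z + 2 * of_real pi * \<i> * \<tau>) = zeta_q \<tau> z - 1"
proof -
  define q where "q = nome \<tau>"
  define A where "A = (\<lambda>m. q ^ m * exp z / (1 - q ^ m * exp z))"
  define B where "B = (\<lambda>m. q ^ m * exp (- z) / (1 - q ^ m * exp (- z)))"
  have q: "norm q < 1" "q \<noteq> 0" using norm_nome_less_1[OF \<tau>] by (auto simp: q_def)
  have e: "exp (z + 2 * of_real pi * \<i> * \<tau>) = q * exp z" "exp (- (z + 2 * of_real pi * \<i> * \<tau>)) = exp (- z) / q"
    by (auto simp: q_def nome_def exp_add exp_diff exp_minus field_simps)
  have t: "zeta_term \<tau> (Suc m) z = B (Suc m) - A (Suc m)" for m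
    by (simp add: zeta_term_def A_def B_def q_def del: power_Suc)
  have eA: "q ^ Suc m * (q * exp z) = q ^ Suc (Suc m) * exp z"
    and eB: "q ^ Suc m * (exp (- z) / q) = q ^ m * exp (- z)" for m
    using q by auto
  have t': "zeta_term \<tau> (Suc m) (z + 2 * of_real pi * \<i> * \<tau>) = B m - A (Suc (Suc m))" for m
    unfolding zeta_term_def e q_def[symmetric] eA eB A_def B_def ..
  have lim: "(\<lambda>m. q ^ m * x / (1 - q ^ m * x)) \<longlonglongrightarrow> 0 * x / (1 - 0 * x)" for x
    by (intro tendsto_intros LIMSEQ_power_zero q) auto
  have limA: "(\<lambda>m. A (Suc m)) \<longlonglongrightarrow> 0" and limB: "B \<longlonglongrightarrow> 0"
    using lim[of "exp z"] lim[of "exp (- z)"] unfolding A_def B_def by (auto intro: LIMSEQ_Suc[where f = "\<lambda>m. q ^ m * exp z / (1 - q ^ m * exp z)"] simp del: power_Suc)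
  have "(\<lambda>m. (A (Suc m) - A (Suc (Suc m))) + (B m - B (Suc m))) sums ((A (Suc 0) - 0) + (B 0 - 0))"
    by (intro sums_add telescope_sums' limA limB)
  moreover have "zeta_term \<tau> (Suc m) (z + 2 * of_real pi * \<i> * \<tau>) - zeta_term \<tau> (Suc m) z
     = (A (Suc m) - A (Suc (Suc m))) + (B m - B (Suc m))" for m
    unfolding t t' by simp
  ultimately have "(\<lambda>m. zeta_term \<tau> (Suc m) (z + 2 * of_real pi * \<i> * \<tau>) - zeta_term \<tau> (Suc m) z) sums (A 1 + B 0)"
    by simp
  then have "A 1 + B 0 = (\<Sum>m. zeta_term \<tau> (Suc m) (z + 2 * of_real pi * \<i> * \<tau>)) - (\<Sum>m. zeta_term \<tau> (Suc m) z)"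
    using suminf_diff[OF summable_zeta_term summable_zeta_term, OF \<tau> \<tau>] by (simp add: sums_iff)
  then have X: "(\<Sum>m. zeta_term \<tau> (Suc m) (z + 2 * of_real pi * \<i> * \<tau>)) = A 1 + B 0 + (\<Sum>m. zeta_term \<tau> (Suc m) z)"
    by (simp add: algebra_simps)
  have "A 1 + 1 / (q * exp z - 1) = - 1"
    using not_Lam(1)[OF z, of 1] by (simp add: A_def q_def divide_simps) (auto simp: algebra_simps)
  then have E: "1 / (q * exp z - 1) = - 1 - A 1"
    by (simp add: eq_diff_eq add.commute)
  have "B 0 = 1 / (exp z - 1)"
    using not_Lam(3)[OF z] by (simp add: B_def exp_minus divide_simps)
  then show ?thesis
    unfolding zeta_q_def e(1) X E by simp
qed

lemma zeta_q_shift: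
  assumes \<tau>: "Im \<tau> > 0" and z: "z \<notin> Lam \<tau>"
  shows "zeta_q \<tau> (z + 2 * of_real pi * \<i> * (of_int m * \<tau> + of_int n)) = zeta_q \<tau> z - of_int m"
proof -
  have L: "2 * of_real pi * \<i> * (of_int m * \<tau>) \<in> Lam \<tau>" for m
    unfolding Lam_iff by (rule exI[of _ m], rule exI[of _ 0]) simp
  have "zeta_q \<tau> (z + 2 * of_real pi * \<i> * (of_int m * \<tau>)) = zeta_q \<tau> z - of_int m"
  proof (induction m rule: int_induct[where k = 0])
    case (step1 m)
    have "z + 2 * of_real pi * \<i> * (of_int m * \<tau>) \<notin> Lam \<tau>"
      using z Lam_add_iff[OF L] by blast
    from zeta_q_shift_nome[OF \<tau> this]
    have "zeta_q \<tau> (z + 2 * of_real pi * \<i> * (of_int m * \<tau>) + 2 * of_real pi * \<i> * \<tau>) = zeta_q \<tau> z - of_int m - 1"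
      unfolding step1(2) .
    moreover have "z + 2 * of_real pi * \<i> * (of_int m * \<tau>) + 2 * of_real pi * \<i> * \<tau> = z + 2 * of_real pi * \<i> * (of_int (m + 1) * \<tau>)"
      by (simp add: algebra_simps)
    ultimately show ?case by (simp add: diff_diff_eq)
  next
    case (step2 m)
    have "z + 2 * of_real pi * \<i> * (of_int (m - 1) * \<tau>) \<notin> Lam \<tau>"
      using z Lam_add_iff[OF L] by blast
    moreover have B: "z + 2 * of_real pi * \<i> * (of_int (m - 1) * \<tau>) + 2 * of_real pi * \<i> * \<tau> = z + 2 * of_real pi * \<i> * (of_int m * \<tau>)"
      by (simp add: algebra_simps)
    ultimately have "zeta_q \<tau> (z + 2 * of_real pi * \<i> * (of_int m * \<tau>)) = zeta_q \<tau> (z + 2 * of_real pi * \<i> * (of_int (m - 1) * \<tau>)) - 1"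
      using zeta_q_shift_nome[OF \<tau>] by (simp only: flip: B)
    then show ?case unfolding step2(2) by (simp add: algebra_simps)
  qed simp
  then show ?thesis
    using zeta_q_shift_int[of \<tau> "z + 2 * of_real pi * \<i> * (of_int m * \<tau>)" n] by (simp add: algebra_simps)
qed

section \<open>The modular group acting on lattices\<close>

lemma Lam_modular:
  fixes a b c d :: int
  assumes \<tau>: "Im \<tau> > 0" and det: "a * d - b * c = 1"
  defines "j \<equiv> of_int c * \<tau> + of_int d"
  assumes j: "j \<noteq> 0"
  shows "z / j \<in> Lam ((of_int a * \<tau> + of_int b) / j) \<longleftrightarrow> z \<in> Lam \<tau>"
proof
  assume "z / j \<in> Lam ((of_int a * \<tau> + of_int b) / j)"
  then obtain m n where "z / j = 2 * of_real pi * \<i> * (of_int m * ((of_int a * \<tau> + of_int b) / j) + of_int n)"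
    unfolding Lam_iff by blast
  then have "z = 2 * of_real pi * \<i> * (of_int m * (of_int a * \<tau> + of_int b) + of_int n * j)"
    using j by (simp add: field_simps)
  then show "z \<in> Lam \<tau>"
    unfolding Lam_iff j_def
    by (intro exI[of _ "m * a + n * c"] exI[of _ "m * b + n * d"]) (simp add: algebra_simps)
next
  have lin: "(X * w + Y * j) / j = X * (w / j) + Y" for X Y w
    using j by (simp add: add_divide_distrib)
  assume "z \<in> Lam \<tau>"
  then obtain m n where z: "z = 2 * of_real pi * \<i> * (of_int m * \<tau> + of_int n)"
    unfolding Lam_iff by blast
  have "of_int m * \<tau> + of_int n = of_int (m * d - n * c) * (of_int a * \<tau> + of_int b) + of_int (n * a - m * b) * j"
  proof -
    have "of_int (m * d - n * c) * (of_int a * \<tau> + of_int b) + of_int (n * a - m * b) * j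
       = of_int (a * d - b * c) * (of_int m * \<tau> + of_int n)"
      unfolding j_def by (simp add: algebra_simps)
    then show ?thesis unfolding det by simp
  qed
  then have "z / j = 2 * of_real pi * \<i> * ((of_int (m * d - n * c) * (of_int a * \<tau> + of_int b) + of_int (n * a - m * b) * j) / j)"
    unfolding z by simp
  also have "(of_int (m * d - n * c) * (of_int a * \<tau> + of_int b) + of_int (n * a - m * b) * j) / j
      = of_int (m * d - n * c) * ((of_int a * \<tau> + of_int b) / j) + of_int (n * a - m * b)"
    using lin .
  finally have "z / j = 2 * of_real pi * \<i> * (of_int (m * d - n * c) * ((of_int a * \<tau> + of_int b) / j) + of_int (n * a - m * b))" .

  then show "z / j \<in> Lam ((of_int a * \<tau> + of_int b) / j)"
    unfolding Lam_iff by blast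
qed

lemma Im_modular:
  fixes a b c d :: int
  assumes "a * d - b * c = 1" "Im \<tau> > 0"
  shows "of_int c * \<tau> + of_int d \<noteq> 0"
    and "Im ((of_int a * \<tau> + of_int b) / (of_int c * \<tau> + of_int d)) = Im \<tau> / (norm (of_int c * \<tau> + of_int d))\<^sup>2"
proof -
  show "of_int c * \<tau> + of_int d \<noteq> 0"
  proof
    assume 0: "of_int c * \<tau> + of_int d = 0"
    then have "of_int c * Im \<tau> = 0" by (auto simp: complex_eq_iff)
    then have "c = 0" using assms by simp
    with 0 have "d = 0" by simp
    then show False using assms \<open>c = 0\<close> by simp
  qed
  have "Im ((of_int a * \<tau> + of_int b) / (of_int c * \<tau> + of_int d))
     = (of_int (a * d - b * c) * Im \<tau>) / (norm (of_int c * \<tau> + of_int d))\<^sup>2"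
    by (simp add: Im_divide cmod_power2 algebra_simps)
  then show "Im ((of_int a * \<tau> + of_int b) / (of_int c * \<tau> + of_int d)) = Im \<tau> / (norm (of_int c * \<tau> + of_int d))\<^sup>2"
    by (simp add: assms)
qed

lemma field_differentiable_transfer:
  assumes "f field_differentiable at z" "\<forall>\<^sub>F y in nhds z. f y = g y"
  shows "g field_differentiable at z"
  using assms(1) unfolding field_differentiable_def DERIV_cong_ev[OF refl assms(2) refl] .

text \<open>The difference of \<open>P\<^sub>1(\<tau>, z)\<close> and \<open>j\<^sup>-\<^sup>1 P\<^sub>1(\<tau>', z/j)\<close> has no poles and constant additive
  periods, so its derivative is constant by Liouville's theorem.\<close>
theorem eisenstein_modular:
  fixes a b c d :: int
  assumes \<tau>: "Im \<tau> > 0" and det: "a * d - b * c = 1"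
  defines "j \<equiv> of_int c * \<tau> + of_int d"
  defines "\<tau>' \<equiv> (of_int a * \<tau> + of_int b) / j"
  shows "eisenstein (k + 2) \<tau> - eisenstein (k + 2) \<tau>' / j ^ (k + 2)
    = (if k = 0 then of_int c / (2 * of_real pi * \<i> * j) else 0)"
proof -
  have j: "j \<noteq> 0" and Im': "Im \<tau>' = Im \<tau> / (norm j)\<^sup>2"
    using Im_modular[OF det \<tau>] by (simp_all add: j_def \<tau>'_def)
  then have \<tau>': "Im \<tau>' > 0" using \<tau> by simp
  have L: "z / j \<in> Lam \<tau>' \<longleftrightarrow> z \<in> Lam \<tau>" for z
    using Lam_modular[OF \<tau> det] j by (simp add: j_def \<tau>'_def)
  have op: "open (- Lam \<tau>)" using closed_Lam[OF \<tau>] by auto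
  define h where "h = (\<lambda>z. zeta_q \<tau>' (z / j) / j - zeta_q \<tau> z)"
  have hol: "h holomorphic_on - Lam \<tau>"
  proof -
    have "(zeta_q \<tau>' \<circ> (\<lambda>z. z / j)) holomorphic_on - Lam \<tau>"
      by (rule holomorphic_on_compose_gen[OF _ zeta_q_holomorphic[OF \<tau>']]) (use L j in \<open>auto intro!: holomorphic_intros\<close>)
    then show ?thesis unfolding h_def o_def
      using j by (intro holomorphic_intros zeta_q_holomorphic \<tau>) auto
  qed
  have hd: "(h has_field_derivative deriv h z) (at z)" if "z \<notin> Lam \<tau>" for z
    using holomorphic_derivI[OF hol op, of z] that by simp
  have lin: "(X * w + Y * j) / j = X * (w / j) + Y" for X Y w
    using j by (simp add: add_divide_distrib)
  have shift: "h (z + 2 * of_real pi * \<i> * (of_int m * \<tau> + of_int n)) = h z - of_int (m * d - n * c) / j + of_int m"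
    if z: "z \<notin> Lam \<tau>" for z m n
  proof -
    have "of_int (m * d - n * c) * (of_int a * \<tau> + of_int b) + of_int (n * a - m * b) * j
       = of_int (a * d - b * c) * (of_int m * \<tau> + of_int n)"
      unfolding j_def by (simp add: algebra_simps)
    then have "of_int (m * d - n * c) * (of_int a * \<tau> + of_int b) + of_int (n * a - m * b) * j = of_int m * \<tau> + of_int n"
      unfolding det by simp
    then have "(z + 2 * of_real pi * \<i> * (of_int m * \<tau> + of_int n)) / j
        = z / j + 2 * of_real pi * \<i> * ((of_int (m * d - n * c) * (of_int a * \<tau> + of_int b) + of_int (n * a - m * b) * j) / j)"
      by (simp only: add_divide_distrib[of z] times_divide_eq_right)
    also have "(of_int (m * d - n * c) * (of_int a * \<tau> + of_int b) + of_int (n * a - m * b) * j) / j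
        = of_int (m * d - n * c) * \<tau>' + of_int (n * a - m * b)"
      unfolding \<tau>'_def by (rule lin)
    finally have arg: "(z + 2 * of_real pi * \<i> * (of_int m * \<tau> + of_int n)) / j
        = z / j + 2 * of_real pi * \<i> * (of_int (m * d - n * c) * \<tau>' + of_int (n * a - m * b))" .
    have "z / j \<notin> Lam \<tau>'" using L z by simp
    from zeta_q_shift[OF \<tau>' this] show ?thesis
      unfolding h_def arg zeta_q_shift[OF \<tau> z] by (simp only: diff_divide_distrib) simp
  qed
  define t where "t = (\<lambda>k. eisenstein (k + 2) \<tau> - eisenstein (k + 2) \<tau>' / j ^ (k + 2))"
  define r where "r = min (2 * pi * min 1 (Im \<tau>)) (norm j * (2 * pi * min 1 (Im \<tau>')))"
  have r: "r > 0" using \<tau> \<tau>' j by (simp add: r_def)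
  \<comment> \<open>The power series of h at 0, whose coefficients, shifted by one, are the
    differences to be determined.\<close>
  define T where "T = (\<lambda>z. \<Sum>n. (if n = 0 then 0 else t (n - 1)) * z ^ n)"
  have sums: "(\<lambda>k. t k * z ^ (k + 1)) sums h z" if "norm z < r" "z \<noteq> 0" for z
  proof -
    have "norm (z / j) < 2 * pi * min 1 (Im \<tau>')" using that j by (simp add: r_def norm_divide field_simps)
    then have "(\<lambda>k. eisenstein (k + 2) \<tau> * z ^ (k + 1) - eisenstein (k + 2) \<tau>' * (z / j) ^ (k + 1) / j)
       sums ((1 / z - zeta_q \<tau> z) - (1 / (z / j) - zeta_q \<tau>' (z / j)) / j)"
      using that j by (intro sums_diff sums_divide zeta_q_expansion \<tau> \<tau>') (auto simp: r_def)
    moreover have "(1 / z - zeta_q \<tau> z) - (1 / (z / j) - zeta_q \<tau>' (z / j)) / j = h z"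
      using that j by (simp add: h_def field_simps)
    moreover have "eisenstein (k + 2) \<tau> * z ^ (k + 1) - eisenstein (k + 2) \<tau>' * (z / j) ^ (k + 1) / j = t k * z ^ (k + 1)" for k
      unfolding t_def using j by (simp add: power_divide field_simps)
    ultimately show ?thesis by simp
  qed
  have Tsums: "(\<lambda>n. (if n = 0 then 0 else t (n - 1)) * z ^ n) sums T z" if "norm z < r" for z
  proof (cases "z = 0")
    case False
    have "(\<lambda>n. (if n = 0 then 0 else t (n - 1)) * z ^ n) sums h z"
      using sums_Suc[of "\<lambda>n. (if n = 0 then 0 else t (n - 1)) * z ^ n" "h z"] sums[OF that False] by simp
    then show ?thesis unfolding T_def by (simp add: sums_iff)
  next
    case True
    then show ?thesis unfolding T_def
      using powser_sums_zero[of "\<lambda>n. if n = 0 then 0 else t (n - 1)"] by (simp add: sums_iff)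
  qed
  have Th: "T z = h z" if "norm z < r" "z \<noteq> 0" for z
    using sums_Suc[of "\<lambda>n. (if n = 0 then 0 else t (n - 1)) * z ^ n" "h z"] sums[OF that] Tsums[OF that(1)]
    by (simp add: sums_iff)
  have holT: "T holomorphic_on ball 0 r"
    by (rule power_series_holomorphic[where a = "\<lambda>n. if n = 0 then 0 else t (n - 1)"]) (use Tsums in simp)
  have ballL: "z \<notin> Lam \<tau>" if "norm z < r" "z \<noteq> 0" for z
    using Lam_norm_ge[OF \<tau>, of z] that by (auto simp: r_def)
  \<comment> \<open>The derivative of h with its removable singularities filled: periodicity moves
    every lattice point to 0, where T is holomorphic.\<close>
  define D where "D = (\<lambda>z. if z \<in> Lam \<tau> then deriv T 0 else deriv h z)"
  have dh_shift: "deriv h (z + l) = deriv h z" if z: "z \<notin> Lam \<tau>" and l: "l \<in> Lam \<tau>" for z l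
  proof -
    obtain m n where l': "l = 2 * of_real pi * \<i> * (of_int m * \<tau> + of_int n)"
      using l Lam_iff by blast
    have zl: "z + l \<notin> Lam \<tau>" using z Lam_add_iff[OF l] by blast
    have "((\<lambda>y. h (y + l)) has_field_derivative deriv h (z + l)) (at z)"
      using hd[OF zl] by (simp add: DERIV_shift)
    moreover have "\<forall>\<^sub>F y in nhds z. h (y + l) = h y - of_int (m * d - n * c) / j + of_int m"
    proof -
      have "\<forall>\<^sub>F y in nhds z. y \<in> - Lam \<tau>"
        using z by (intro eventually_nhds_in_open op) auto
      then show ?thesis
        by eventually_elim (use shift in \<open>auto simp: l'\<close>)
    qed
    ultimately have "((\<lambda>y. h y - of_int (m * d - n * c) / j + of_int m) has_field_derivative deriv h (z + l)) (at z)"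
      by (subst (asm) DERIV_cong_ev[OF refl _ refl])
    moreover have "((\<lambda>y. h y - of_int (m * d - n * c) / j + of_int m) has_field_derivative deriv h z) (at z)"
      using hd[OF z] by (auto intro!: derivative_eq_intros)
    ultimately show ?thesis by (rule DERIV_unique)
  qed
  have D_shift: "D (z + l) = D z" if l: "l \<in> Lam \<tau>" for z l
    using dh_shift[OF _ l] Lam_add_iff[OF l] by (auto simp: D_def)
  have D_T: "D z = deriv T z" if "norm z < r" for z
  proof (cases "z = 0")
    case False
    have "\<forall>\<^sub>F y in nhds z. y \<in> ball 0 r - {0}"
      by (rule eventually_nhds_in_open) (use that False in auto)
    then have "\<forall>\<^sub>F y in nhds z. T y = h y"
      by eventually_elim (use Th in auto)
    then show ?thesis
      using ballL[OF that False] deriv_cong_ev[OF _ refl, of T h z] by (simp add: D_def)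
  qed (simp add: D_def)
  have "D holomorphic_on UNIV"
  proof -
    have "D field_differentiable at z" for z
    proof (cases "z \<in> Lam \<tau>")
      case False
      have "deriv h field_differentiable at z"
        by (rule holomorphic_on_imp_differentiable_at[OF holomorphic_deriv[OF hol op] op]) (use False in auto)
      moreover have "\<forall>\<^sub>F y in nhds z. deriv h y = D y"
      proof -
        have "\<forall>\<^sub>F y in nhds z. y \<in> - Lam \<tau>"
          using False by (intro eventually_nhds_in_open op) auto
        then show ?thesis by eventually_elim (simp add: D_def)
      qed
      ultimately show ?thesis
        by (rule field_differentiable_transfer)
    next
      case True
      have "deriv T field_differentiable at 0"
        by (rule holomorphic_on_imp_differentiable_at[OF holomorphic_deriv[OF holT open_ball] open_ball]) (use r in auto)
      then have "(\<lambda>y. deriv T (y + - z)) field_differentiable at z"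
        unfolding field_differentiable_def using DERIV_shift[of "deriv T" _ z "- z"] by auto
      moreover have "\<forall>\<^sub>F y in nhds z. y \<in> ball z r"
        by (rule eventually_nhds_in_open) (use r in auto)
      then have "\<forall>\<^sub>F y in nhds z. deriv T (y + - z) = D y"
      proof eventually_elim
        case (elim y)
        then have "norm (y - z) < r" by (simp add: dist_norm norm_minus_commute)
        then have "deriv T (y - z) = D (y - z)" by (simp add: D_T)
        also have "\<dots> = D y" using D_shift[OF Lam_minus[OF True], of y] by simp
        finally show ?case by simp
      qed
      ultimately show ?thesis
        by (rule field_differentiable_transfer)
    qed
    then show ?thesis by (auto simp: holomorphic_on_def intro: field_differentiable_at_within)
  qed
  moreover have "bounded (range D)"
  proof -
    \<comment> \<open>Parametrises a period parallelogram, on which D already takes all its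
      values.\<close>
    define G where "G = (\<lambda>(x, y). 2 * of_real pi * \<i> * (of_real x * \<tau> + of_real y))"
    have "compact (D ` G ` ({0..1} \<times> {0..1}))"
      unfolding G_def case_prod_unfold
      by (intro compact_continuous_image continuous_on_subset[OF holomorphic_on_imp_continuous_on[OF \<open>D holomorphic_on UNIV\<close>]]
          compact_Times continuous_intros) auto
    moreover have "range D \<subseteq> D ` G ` ({0..1} \<times> {0..1})"
    proof
      fix v assume "v \<in> range D"
      then obtain z where z: "v = D z" by blast
      define w where "w = z / (2 * of_real pi * \<i>)"
      define x where "x = Im w / Im \<tau>"
      define y where "y = Re w - x * Re \<tau>"
      have w: "w = of_real x * \<tau> + of_real y"
        using \<tau> by (auto simp: complex_eq_iff x_def y_def)
      have "z = 2 * of_real pi * \<i> * w" by (simp add: w_def)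
      then have "z = G (frac x, frac y) + 2 * of_real pi * \<i> * (of_int \<lfloor>x\<rfloor> * \<tau> + of_int \<lfloor>y\<rfloor>)"
        unfolding w G_def frac_def by (simp add: algebra_simps)
      then have "D z = D (G (frac x, frac y))"
        using D_shift[of "2 * of_real pi * \<i> * (of_int \<lfloor>x\<rfloor> * \<tau> + of_int \<lfloor>y\<rfloor>)" "G (frac x, frac y)"]
        by (auto simp: Lam_iff)
      moreover have "(frac x, frac y) \<in> {0..1} \<times> {0..1}"
        using frac_lt_1[of x] frac_lt_1[of y] by auto
      ultimately show "v \<in> D ` G ` ({0..1} \<times> {0..1})" using z by blast
    qed
    ultimately show ?thesis by (meson bounded_subset compact_imp_bounded)
  qed
  ultimately have "D constant_on UNIV"
    by (rule Liouville_theorem)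
  then obtain D0 where D0: "\<And>z. D z = D0"
    by (auto simp: constant_on_def)
  have "(\<lambda>z. h z - D0 * z) constant_on - Lam \<tau>"
  proof (rule has_field_derivative_0_imp_constant_on)
    show "connected (- Lam \<tau>)"
      by (intro path_connected_imp_connected path_connected_complement_countable countable_Lam) simp
    fix z assume "z \<in> - Lam \<tau>"
    then show "((\<lambda>z. h z - D0 * z) has_field_derivative 0) (at z)"
      using hd[of z] D0[of z] by (auto intro!: derivative_eq_intros simp: D_def)
  qed (rule op)
  then obtain C where C: "\<And>z. z \<notin> Lam \<tau> \<Longrightarrow> h z - D0 * z = C"
    by (auto simp: constant_on_def)
  have D0_eq: "D0 = of_int c / (2 * of_real pi * \<i> * j)"
  proof -
    define z where "z = (of_real (r / 2) :: complex)"
    have z: "z \<notin> Lam \<tau>" using r by (intro ballL) (auto simp: z_def)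
    \<comment> \<open>The period 2 pi i j, that is (m, n) = (c, d). Here m d - n c = 0, so h
      increases by exactly c.\<close>
    define l where "l = 2 * of_real pi * \<i> * (of_int c * \<tau> + of_int d)"
    have "l \<in> Lam \<tau>" unfolding Lam_iff l_def by blast
    then have "z + l \<notin> Lam \<tau>" using z Lam_add_iff by blast
    then have "h (z + l) - h z = D0 * l" using C[of z] C[of "z + l"] z by (simp add: algebra_simps)
    moreover have "h (z + l) = h z + of_int c"
      using shift[OF z, of c d] by (simp add: l_def)
    ultimately have "D0 * l = of_int c" by simp
    moreover have "l \<noteq> 0" using j by (simp add: l_def j_def)
    ultimately show ?thesis by (simp add: l_def j_def field_simps)
  qed
  have "T z = D0 * z" if "norm z < r" for z
  proof -
    have "\<exists>c. \<forall>z\<in>ball 0 r. T z - D0 * z = c"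
    proof (rule has_field_derivative_zero_constant)
      fix y :: complex assume y: "y \<in> ball 0 r"
      have "(T has_field_derivative D0) (at y)"
        using holomorphic_derivI[OF holT open_ball y] D_T[of y] D0[of y] y by simp
      then show "((\<lambda>z. T z - D0 * z) has_field_derivative 0) (at y within ball 0 r)"
        by (auto intro!: derivative_eq_intros intro: has_field_derivative_at_within)
    qed simp
    then obtain c where "\<And>z. norm z < r \<Longrightarrow> T z - D0 * z = c" by auto
    from this[of 0] this[OF that] r show ?thesis by (simp add: T_def)
  qed
  then have "\<forall>\<^sub>F z in nhds 0. (\<lambda>n. fps_nth (Abs_fps (\<lambda>n. if n = 0 then 0 else t (n - 1))) n * z ^ n) sums (D0 * z)"
    using Tsums r by (intro eventually_nhds_in_open[of "ball 0 r", THEN eventually_mono]) auto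
  then have "(\<lambda>z. D0 * z) has_fps_expansion Abs_fps (\<lambda>n. if n = 0 then 0 else t (n - 1))"
    by (rule has_fps_expansionI)
  moreover have "(\<lambda>z. D0 * z) has_fps_expansion fps_const D0 * fps_X"
    by (intro fps_expansion_intros)
  ultimately have "Abs_fps (\<lambda>n. if n = 0 then 0 else t (n - 1)) = fps_const D0 * fps_X"
    by (rule fps_expansion_unique_complex)
  from arg_cong[OF this, of "\<lambda>F. F $ Suc k"] have "t k = (if k = 0 then D0 else 0)"
    by (simp add: fps_X_def)
  then show ?thesis unfolding t_def D0_eq .
qed

section \<open>Values of \<open>K\<close> and \<open>P\<^sub>k\<close>\<close>

text \<open>The \<open>q\<close>-product of \<open>K\<close>, entire with logarithmic derivative \<open>P\<^sub>1\<close>.\<close>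
definition theta_factor :: "complex \<Rightarrow> nat \<Rightarrow> complex \<Rightarrow> complex" where
  "theta_factor \<tau> m z = (1 - nome \<tau> ^ m * exp z) * (1 - nome \<tau> ^ m * exp (- z)) / (1 - nome \<tau> ^ m)\<^sup>2"

lemma one_minus_nome_power:
  assumes "Im \<tau> > 0"
  shows "norm (1 - nome \<tau> ^ Suc m) \<ge> 1 - norm (nome \<tau>)" "1 - nome \<tau> ^ Suc m \<noteq> 0"
proof -
  have "norm (nome \<tau> ^ Suc m) \<le> norm (nome \<tau>) ^ 1"
    unfolding norm_power by (intro power_decreasing) (use norm_nome_less_1[OF assms] in auto)
  then show *: "norm (1 - nome \<tau> ^ Suc m) \<ge> 1 - norm (nome \<tau>)"
    using norm_triangle_ineq2[of 1 "nome \<tau> ^ Suc m"] by simp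
  show "1 - nome \<tau> ^ Suc m \<noteq> 0"
    using * norm_nome_less_1[OF assms] by auto
qed

text \<open>With Q = q^(m+1) the factor differs from 1 by Q (2 - e^z - e^(-z)) / (1 - Q)^2, which is
  summable in m uniformly on discs.\<close>

lemma norm_theta_factor_minus_1:
  assumes \<tau>: "Im \<tau> > 0" and z: "norm z \<le> r"
  shows "norm (theta_factor \<tau> (Suc m) z - 1) \<le> norm (nome \<tau>) ^ Suc m * ((2 + 2 * exp r) / (1 - norm (nome \<tau>))\<^sup>2)"
proof -
  let ?Q = "nome \<tau> ^ Suc m"
  have q: "norm (nome \<tau>) < 1" by (rule norm_nome_less_1[OF \<tau>])
  have ee: "exp z * exp (- z) = 1" by (simp add: exp_minus)
  have "(1 - ?Q * exp z) * (1 - ?Q * exp (- z)) - (1 - ?Q)\<^sup>2 = ?Q * (2 - exp z - exp (- z)) + ?Q\<^sup>2 * (exp z * exp (- z) - 1)"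
    by (simp add: power2_eq_square algebra_simps del: power_Suc)
  then have "theta_factor \<tau> (Suc m) z - 1 = ?Q * (2 - exp z - exp (- z)) / (1 - ?Q)\<^sup>2"
    using one_minus_nome_power(2)[OF \<tau>, of m] unfolding theta_factor_def ee
    by (simp add: divide_simps del: power_Suc)
  also have "norm \<dots> \<le> norm (nome \<tau>) ^ Suc m * (2 + 2 * exp r) / (1 - norm (nome \<tau>))\<^sup>2"
    unfolding norm_divide norm_mult norm_power
  proof (intro frac_le mult_left_mono)
    have b: "norm (exp z) \<le> exp r" "norm (exp (- z)) \<le> exp r"
      using order_trans[OF norm_exp[of z], of "exp r"] order_trans[OF norm_exp[of "- z"], of "exp r"] z
      by simp_all
    show "norm (2 - exp z - exp (- z)) \<le> 2 + 2 * exp r"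
      using norm_triangle_ineq4[of "2 - exp z" "exp (- z)"] norm_triangle_ineq4[of 2 "exp z"] b
      unfolding norm_numeral by linarith
    show "(1 - norm (nome \<tau>))\<^sup>2 \<le> (norm (1 - nome \<tau> ^ Suc m))\<^sup>2"
      using q one_minus_nome_power(1)[OF \<tau>] by (intro power_mono) auto
  qed (use q in \<open>auto intro!: mult_nonneg_nonneg add_nonneg_nonneg\<close>)
  finally show ?thesis by simp
qed

lemma theta_factor_0: "Im \<tau> > 0 \<Longrightarrow> theta_factor \<tau> (Suc m) 0 = 1"
  using one_minus_nome_power(2)[of \<tau> m] by (simp add: theta_factor_def power2_eq_square del: power_Suc)

lemma theta_factor_field_differentiable: "theta_factor \<tau> m field_differentiable at z"
proof -
  have "theta_factor \<tau> m holomorphic_on UNIV"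
    unfolding theta_factor_def[abs_def]
    by (cases "1 - nome \<tau> ^ m = 0") (auto intro!: holomorphic_intros)
  then show ?thesis by (simp add: holomorphic_on_imp_differentiable_at)
qed

lemma theta_factor_deriv:
  assumes \<tau>: "Im \<tau> > 0" and z: "z \<notin> Lam \<tau>"
  shows "(theta_factor \<tau> (Suc m) has_field_derivative theta_factor \<tau> (Suc m) z * zeta_term \<tau> (Suc m) z) (at z)"
proof -
  define Q where "Q = nome \<tau> ^ Suc m"
  have nz: "1 - Q * exp z \<noteq> 0" "1 - Q * exp (- z) \<noteq> 0" "1 - Q \<noteq> 0"
    using not_Lam(1,2)[OF z, of "Suc m"] one_minus_nome_power(2)[OF \<tau>, of m] unfolding Q_def
    by (auto simp del: power_Suc)
  have "((\<lambda>z. (1 - Q * exp z) * (1 - Q * exp (- z)) / (1 - Q)\<^sup>2) has_field_derivative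
      ((- Q * exp z) * (1 - Q * exp (- z)) + (1 - Q * exp z) * (Q * exp (- z))) / (1 - Q)\<^sup>2) (at z)"
    by (intro DERIV_cdivide) (auto intro!: derivative_eq_intros)
  moreover have "((- Q * exp z) * (1 - Q * exp (- z)) + (1 - Q * exp z) * (Q * exp (- z))) / (1 - Q)\<^sup>2
      = (1 - Q * exp z) * (1 - Q * exp (- z)) / (1 - Q)\<^sup>2 * (Q * exp (- z) / (1 - Q * exp (- z)) - Q * exp z / (1 - Q * exp z))"
  proof -
    define x y where "x = Q * exp z" and "y = Q * exp (- z)"
    have "(- x * (1 - y) + (1 - x) * y) = (1 - x) * (1 - y) * (y / (1 - y) - x / (1 - x))"
    proof -
      have "(1 - x) * (1 - y) * (y / (1 - y)) = (1 - x) * y" "(1 - x) * (1 - y) * (x / (1 - x)) = x * (1 - y)"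
        using nz by (simp_all add: x_def[symmetric] y_def[symmetric])
      then show ?thesis by (simp only: right_diff_distrib) simp
    qed
    then show ?thesis unfolding x_def y_def by simp
  qed
  ultimately show ?thesis
    unfolding theta_factor_def[abs_def] zeta_term_def Q_def[symmetric] by (simp only:)
qed

definition theta_prod :: "complex \<Rightarrow> complex \<Rightarrow> complex" where
  "theta_prod \<tau> z = lim (\<lambda>n. \<Prod>m<n. theta_factor \<tau> (Suc m) z)"

lemma theta_prod_uniform_limit:
  assumes \<tau>: "Im \<tau> > 0"
  shows "uniform_limit (cball 0 r) (\<lambda>n z. \<Prod>m<n. theta_factor \<tau> (Suc m) z) (theta_prod \<tau>) sequentially"
proof -
  have "uniformly_convergent_on (cball 0 r) (\<lambda>n z. \<Prod>m<n. theta_factor \<tau> (Suc m) z)"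
  proof (rule uniformly_convergent_on_prod')
    show "continuous_on (cball 0 r) (theta_factor \<tau> (Suc m))" for m
      by (intro continuous_at_imp_continuous_on ballI field_differentiable_imp_continuous_at theta_factor_field_differentiable)
    show "uniformly_convergent_on (cball 0 r) (\<lambda>N z. \<Sum>m<N. norm (theta_factor \<tau> (Suc m) z - 1))"
    proof (rule Weierstrass_m_test')
      show "norm (norm (theta_factor \<tau> (Suc m) z - 1)) \<le> norm (nome \<tau>) ^ Suc m * ((2 + 2 * exp r) / (1 - norm (nome \<tau>))\<^sup>2)"
        if "z \<in> cball 0 r" for m z
        using norm_theta_factor_minus_1[OF \<tau>, of z r m] that by simp
      show "summable (\<lambda>m. norm (nome \<tau>) ^ Suc m * ((2 + 2 * exp r) / (1 - norm (nome \<tau>))\<^sup>2))"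
        using norm_nome_less_1[OF \<tau>] by (intro summable_mult2) (simp add: summable_geometric summable_mult)
    qed
  qed (rule compact_cball)
  then show ?thesis
    unfolding theta_prod_def[abs_def] uniformly_convergent_uniform_limit_iff .
qed

lemma theta_prod_0: "Im \<tau> > 0 \<Longrightarrow> theta_prod \<tau> 0 = 1"
  by (simp add: theta_prod_def theta_factor_0)

text \<open>The derivatives of the partial products converge to that of the limit. Each is the
  product times its logarithmic derivative, a partial sum of the \<open>zeta_term\<close>.\<close>

lemma
  assumes \<tau>: "Im \<tau> > 0"
  shows theta_prod_holomorphic: "theta_prod \<tau> holomorphic_on UNIV"
    and theta_prod_deriv: "z \<notin> Lam \<tau> \<Longrightarrow>
      (theta_prod \<tau> has_field_derivative theta_prod \<tau> z * (\<Sum>m. zeta_term \<tau> (Suc m) z)) (at z)"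
proof -
  define g where "g = (\<lambda>n z. \<Prod>m<n. theta_factor \<tau> (Suc m) z)"
  have "g n field_differentiable at z" for n z
    unfolding g_def
  proof (induction n)
    case (Suc n)
    then have "(\<lambda>z. (\<Prod>m<n. theta_factor \<tau> (Suc m) z) * theta_factor \<tau> (Suc n) z) field_differentiable at z"
      by (rule field_differentiable_mult[OF _ theta_factor_field_differentiable])
    then show ?case by simp
  qed simp
  then have gd: "(g n has_field_derivative deriv (g n) z) (at z)" for n z
    by (rule field_differentiable_derivI)
  have ul: "uniform_limit (cball x 1) g (theta_prod \<tau>) sequentially" for x
  proof (rule uniform_limit_on_subset)
    show "uniform_limit (cball 0 (norm x + 1)) g (theta_prod \<tau>) sequentially"
      unfolding g_def by (rule theta_prod_uniform_limit[OF \<tau>])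
    show "cball x 1 \<subseteq> cball 0 (norm x + 1)"
    proof
      fix y assume "y \<in> cball x 1"
      then show "y \<in> cball 0 (norm x + 1)"
        using norm_triangle_sub[of y x] by (simp add: dist_norm norm_minus_commute)
    qed
  qed
  have "\<exists>g'. \<forall>x\<in>UNIV. (theta_prod \<tau> has_field_derivative g' x) (at x) \<and> ((\<lambda>n. deriv (g n) x) \<longlongrightarrow> g' x) sequentially"
    by (rule has_complex_derivative_uniform_sequence[OF open_UNIV gd]) (use ul in \<open>auto intro!: exI[of _ 1]\<close>)
  then obtain g' where g': "\<And>x. (theta_prod \<tau> has_field_derivative g' x) (at x)" "\<And>x. (\<lambda>n. deriv (g n) x) \<longlonglongrightarrow> g' x"
    by blast
  show "theta_prod \<tau> holomorphic_on UNIV"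
    using g'(1) by (auto simp: holomorphic_on_def field_differentiable_def)
  assume z: "z \<notin> Lam \<tau>"
  have "deriv (g n) z = g n z * (\<Sum>m<n. zeta_term \<tau> (Suc m) z)" for n
  proof (rule DERIV_imp_deriv)
    show "(g n has_field_derivative g n z * (\<Sum>m<n. zeta_term \<tau> (Suc m) z)) (at z)"
      unfolding g_def
    proof (induction n)
      case (Suc n)
      show ?case
        using DERIV_mult[OF Suc theta_factor_deriv[OF \<tau> z, of n]] by (simp add: algebra_simps)
    qed simp
  qed
  moreover have "(\<lambda>n. g n z * (\<Sum>m<n. zeta_term \<tau> (Suc m) z)) \<longlonglongrightarrow> theta_prod \<tau> z * (\<Sum>m. zeta_term \<tau> (Suc m) z)"
    by (intro tendsto_mult summable_LIMSEQ summable_zeta_term \<tau> tendsto_uniform_limitI[OF ul[of z]]) simp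
  ultimately have "g' z = theta_prod \<tau> z * (\<Sum>m. zeta_term \<tau> (Suc m) z)"
    using g'(2)[of z] LIMSEQ_unique by auto
  then show "(theta_prod \<tau> has_field_derivative theta_prod \<tau> z * (\<Sum>m. zeta_term \<tau> (Suc m) z)) (at z)"
    using g'(1)[of z] by simp
qed

text \<open>The odd theta function divided by its derivative at 0: 2 sinh(z/2) times the product. It
  is the entire candidate for \<open>K \<tau>\<close>.\<close>

definition sigma_q :: "complex \<Rightarrow> complex \<Rightarrow> complex" where
  "sigma_q \<tau> z = (exp (z / 2) - exp (- z / 2)) * theta_prod \<tau> z"

lemma sigma_q_holomorphic: "Im \<tau> > 0 \<Longrightarrow> sigma_q \<tau> holomorphic_on UNIV"
  unfolding sigma_q_def[abs_def] by (intro holomorphic_intros theta_prod_holomorphic) auto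

text \<open>Logarithmic differentiation: the factor 2 sinh(z/2) contributes 1/2 + 1/(e^z - 1) and
  the product contributes the q-series.\<close>

lemma sigma_q_deriv:
  assumes \<tau>: "Im \<tau> > 0" and z: "z \<notin> Lam \<tau>"
  shows "(sigma_q \<tau> has_field_derivative sigma_q \<tau> z * zeta_q \<tau> z) (at z)"
proof -
  define u where "u = exp (z / 2)"
  have u: "exp z = u * u" "exp (- z / 2) = 1 / u" "u \<noteq> 0"
    by (auto simp: u_def mult_exp_exp exp_minus field_simps)
  have "u * u \<noteq> 1" using not_Lam(3)[OF z] u(1) by simp
  have "(sigma_q \<tau> has_field_derivative (exp (z / 2) / 2 + exp (- z / 2) / 2) * theta_prod \<tau> z
      + (exp (z / 2) - exp (- z / 2)) * (theta_prod \<tau> z * (\<Sum>m. zeta_term \<tau> (Suc m) z))) (at z)"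
    unfolding sigma_q_def[abs_def]
    by (rule derivative_eq_intros theta_prod_deriv[OF \<tau> z] refl | simp)+
  moreover have "(exp (z / 2) / 2 + exp (- z / 2) / 2) = (exp (z / 2) - exp (- z / 2)) * (1 / 2 + 1 / (exp z - 1))"
    unfolding u u_def[symmetric] using \<open>u * u \<noteq> 1\<close> u(3) by (simp add: field_simps)
  ultimately show ?thesis
    unfolding sigma_q_def zeta_q_def by (simp only: algebra_simps)
qed

lemma sigma_q_0: "sigma_q \<tau> 0 = 0"
  by (simp add: sigma_q_def)

lemma sigma_q_deriv_0:
  assumes \<tau>: "Im \<tau> > 0"
  shows "(sigma_q \<tau> has_field_derivative 1) (at 0)"
proof -
  have "(theta_prod \<tau> has_field_derivative deriv (theta_prod \<tau>) 0) (at 0)"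
    using holomorphic_derivI[OF theta_prod_holomorphic[OF \<tau>] open_UNIV] by simp
  then have "(sigma_q \<tau> has_field_derivative (exp (0 / 2) / 2 + exp (- 0 / 2) / 2) * theta_prod \<tau> 0
      + (exp (0 / 2) - exp (- 0 / 2)) * deriv (theta_prod \<tau>) 0) (at 0)"
    unfolding sigma_q_def[abs_def]
    by - (rule derivative_eq_intros refl | assumption | simp)+
  then show ?thesis by (simp add: theta_prod_0[OF \<tau>])
qed

section \<open>Taylor series at 0 and the chosen continuations\<close>

definition eis_series :: "complex \<Rightarrow> complex \<Rightarrow> complex" where
  "eis_series \<tau> z = (\<Sum>k. eisenstein (k + 2) \<tau> * z ^ (k + 1))"

definition eis_log_series :: "complex \<Rightarrow> complex \<Rightarrow> complex" where
  "eis_log_series \<tau> z = (\<Sum>k. eisenstein (k + 2) \<tau> / of_nat (k + 2) * z ^ (k + 2))"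

lemma eisenstein_0_1 [simp]: "eisenstein (Suc 0) \<tau> = 0"
  by (simp add: eisenstein_def)

context
  fixes \<tau> :: complex and \<rho> M :: real
  assumes \<rho>: "\<rho> > 0" and bound: "\<And>k. norm (eisenstein (k + 2) \<tau>) * \<rho> ^ (k + 2) \<le> M"
begin

lemma eisenstein_summable:
  assumes "norm z < \<rho>"
  shows "summable (\<lambda>p. norm (eisenstein (Suc p) \<tau> * z ^ Suc p))"
proof (rule summable_comparison_test')
  show "summable (\<lambda>p. M * (norm z / \<rho>) ^ Suc p)"
    using assms \<rho> by (intro summable_mult) (simp add: summable_geometric summable_mult)
  have "M \<ge> 0" using order_trans[OF _ bound[of 0]] \<rho> by simp
  show "norm (norm (eisenstein (Suc p) \<tau> * z ^ Suc p)) \<le> M * (norm z / \<rho>) ^ Suc p" for p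
  proof (cases p)
    case 0
    then show ?thesis using \<open>M \<ge> 0\<close> \<rho> by simp
  next
    case (Suc k)
    have "norm (eisenstein (k + 2) \<tau>) \<le> M / \<rho> ^ (k + 2)"
      using bound[of k] \<rho> by (simp add: field_simps)
    then have "norm (eisenstein (k + 2) \<tau>) * norm z ^ (k + 2) \<le> M / \<rho> ^ (k + 2) * norm z ^ (k + 2)"
      by (rule mult_right_mono) simp
    then show ?thesis by (simp add: Suc norm_mult norm_power power_divide)
  qed
qed

lemma eisenstein_powser_summable:
  assumes "norm z < \<rho>"
  shows "summable (\<lambda>p. (if p = 0 then 0 else eisenstein (Suc p) \<tau>) * z ^ p)"
proof (cases "z = 0")
  case False
  have "summable (\<lambda>p. eisenstein (Suc p) \<tau> * z ^ Suc p / z)"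
    by (intro summable_divide summable_norm_cancel[OF eisenstein_summable] assms)
  then have "summable (\<lambda>p. eisenstein (Suc p) \<tau> * z ^ p)"
    using False by simp
  moreover have "(if p = 0 then 0 else eisenstein (Suc p) \<tau>) = eisenstein (Suc p) \<tau>" for p
    by simp
  ultimately show ?thesis by simp
qed simp

lemma eis_series_eq:
  assumes "norm z < \<rho>"
  shows "eis_series \<tau> z = (\<Sum>p. (if p = 0 then 0 else eisenstein (Suc p) \<tau>) * z ^ p)"
  using suminf_split_head[OF eisenstein_powser_summable[OF assms]] by (simp add: eis_series_def)

lemma eis_series_holomorphic: "eis_series \<tau> holomorphic_on ball 0 \<rho>"
  by (rule power_series_holomorphic[where a = "\<lambda>p. if p = 0 then 0 else eisenstein (Suc p) \<tau>"])
     (use summable_sums[OF eisenstein_powser_summable] in \<open>auto simp: eis_series_eq\<close>)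

lemma eis_log_series_deriv:
  assumes z: "norm z < \<rho>"
  shows "(eis_log_series \<tau> has_field_derivative eis_series \<tau> z) (at z)"
proof -
  define c where "c = (\<lambda>n. if n < 2 then 0 else eisenstein n \<tau> / of_nat n)"
  have sc: "summable (\<lambda>n. c n * y ^ n)" if "norm y < \<rho>" for y
  proof -
    have "summable (\<lambda>p. c (Suc p) * y ^ Suc p)"
    proof (rule summable_comparison_test'[OF eisenstein_summable[OF that], of 0])
      fix p
      have "norm (c (Suc p)) \<le> norm (eisenstein (Suc p) \<tau>)"
        using divide_left_mono[of 1 "real (Suc p)" "norm (eisenstein (Suc p) \<tau>)"]
        by (auto simp: c_def norm_divide simp del: of_nat_Suc)
      then show "norm (c (Suc p) * y ^ Suc p) \<le> norm (eisenstein (Suc p) \<tau> * y ^ Suc p)"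
        unfolding norm_mult by (rule mult_right_mono) simp
    qed
    then show ?thesis by (subst (asm) summable_Suc_iff)
  qed
  have eq: "eis_log_series \<tau> y = (\<Sum>n. c n * y ^ n)" if "norm y < \<rho>" for y
    using suminf_split_initial_segment[OF sc[OF that], of 2] by (simp add: eis_log_series_def c_def numeral_2_eq_2)
  have diffs: "diffs c = (\<lambda>p. if p = 0 then 0 else eisenstein (Suc p) \<tau>)"
    by (auto simp: diffs_def c_def fun_eq_iff simp del: of_nat_Suc)
  have "((\<lambda>y. \<Sum>n. c n * y ^ n) has_field_derivative (\<Sum>n. diffs c n * z ^ n)) (at z)"
    by (rule termdiffs_strong') (use sc z in auto)
  moreover have "\<forall>\<^sub>F y in nhds z. y \<in> ball 0 \<rho>"
    using z by (intro eventually_nhds_in_open) auto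
  then have "\<forall>\<^sub>F y in nhds z. (\<Sum>n. c n * y ^ n) = eis_log_series \<tau> y"
    by eventually_elim (simp add: eq)
  ultimately show ?thesis
    unfolding diffs eis_series_eq[OF z] by (subst (asm) DERIV_cong_ev[OF refl _ refl])
qed

lemma eis_log_series_holomorphic: "eis_log_series \<tau> holomorphic_on ball 0 \<rho>"
  unfolding holomorphic_on_def field_differentiable_def
  by (intro ballI, rule exI, rule has_field_derivative_at_within, rule eis_log_series_deriv) simp

end

lemma eisenstein_bound_at:
  assumes \<tau>: "Im \<tau> > 0"
  obtains \<rho> M where "\<rho> > 0" "\<And>k. norm (eisenstein (k + 2) \<tau>) * \<rho> ^ (k + 2) \<le> M"
proof -
  have q: "norm (nome \<tau>) < 1" by (rule norm_nome_less_1[OF \<tau>])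
  \<comment> \<open>At most half of 2 pi Im \<tau>, the value at which |q| e^r reaches 1.\<close>
  define r where "r = min 1 (pi * Im \<tau>)"
  have "r \<le> 1" "r \<le> pi * Im \<tau>" "0 < pi * Im \<tau>"
    using \<tau> by (auto simp: r_def)
  then have r: "0 < r" "r < 2 * pi" "r < 2 * pi * Im \<tau>"
    using pi_gt3 by (auto simp: r_def)
  have "norm (nome \<tau>) * exp r < 1"
    using r(3) unfolding norm_nome mult_exp_exp by simp
  from eisenstein_bound[OF r(1,2) norm_ge_zero this]
  obtain A where "\<And>k. norm (eisenstein (k + 2) \<tau>) * r ^ (k + 1) \<le> A" by blast
  then have "norm (eisenstein (k + 2) \<tau>) * r ^ (k + 2) \<le> A * r" for k
    using mult_right_mono[of _ A r] r(1) by (simp add: mult_ac)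
  then show ?thesis using that r(1) by blast
qed

text \<open>The choice that defines \<open>P1\<close> has the wanted properties as soon as one
  continuation exists, and \<open>zeta_q\<close> is one.\<close>

lemma
  assumes \<tau>: "Im \<tau> > 0"
  shows P1_holomorphic: "P1 \<tau> holomorphic_on - Lam \<tau>"
    and P1_eventually: "\<forall>\<^sub>F z in at 0. P1 \<tau> z = 1 / z - eis_series \<tau> z"
proof -
  define r where "r = 2 * pi * min 1 (Im \<tau>)"
  have "r > 0" using \<tau> by (simp add: r_def)
  then have "\<forall>\<^sub>F z in at 0. z \<in> ball 0 r - {0}"
    by (intro eventually_at_in_open) auto
  then have "\<forall>\<^sub>F z in at 0. zeta_q \<tau> z = 1 / z - (\<Sum>k. eisenstein (k + 2) \<tau> * z ^ (k + 1))"
    by eventually_elim (use zeta_q_expansion[OF \<tau>] in \<open>auto simp: r_def sums_iff\<close>)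
  then have "\<exists>g. g holomorphic_on - Lam \<tau> \<and> (\<forall>\<^sub>F z in at 0. g z = 1 / z - (\<Sum>k. eisenstein (k + 2) \<tau> * z ^ (k + 1)))"
    using zeta_q_holomorphic[OF \<tau>] by blast
  from someI_ex[OF this]
  show "P1 \<tau> holomorphic_on - Lam \<tau>" "\<forall>\<^sub>F z in at 0. P1 \<tau> z = 1 / z - eis_series \<tau> z"
    unfolding P1_def continuation_def eis_series_def by auto
qed

text \<open>The quotient of the two sides has derivative 0 on a punctured disc and tends to 1 at 0.
  So \<open>sigma_q\<close> witnesses the existence of the entire continuation that defines
  \<open>K\<close>.\<close>

lemma sigma_q_eq:
  assumes \<tau>: "Im \<tau> > 0"
  shows "\<forall>\<^sub>F z in at 0. sigma_q \<tau> z = z * exp (- eis_log_series \<tau> z)"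
proof -
  obtain \<rho> M where \<rho>: "\<rho> > 0" and M: "\<And>k. norm (eisenstein (k + 2) \<tau>) * \<rho> ^ (k + 2) \<le> M"
    by (rule eisenstein_bound_at[OF \<tau>]) (rule that)
  define r where "r = min \<rho> (2 * pi * min 1 (Im \<tau>))"
  have r: "r > 0" using \<rho> \<tau> by (simp add: r_def)
  define H where "H = (\<lambda>z. sigma_q \<tau> z * exp (eis_log_series \<tau> z) / z)"
  have dH: "(H has_field_derivative 0) (at z)" if "z \<in> ball 0 r - {0}" for z
  proof -
    have z: "norm z < \<rho>" "norm z < 2 * pi * min 1 (Im \<tau>)" "z \<noteq> 0" using that by (auto simp: r_def)
    have zL: "z \<notin> Lam \<tau>" using Lam_norm_ge[OF \<tau>, of z] z by auto
    have zq: "zeta_q \<tau> z = 1 / z - eis_series \<tau> z"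
      using zeta_q_expansion[OF \<tau> z(2,3)] by (simp add: eis_series_def sums_iff)
    have "(H has_field_derivative ((sigma_q \<tau> z * zeta_q \<tau> z * exp (eis_log_series \<tau> z)
       + sigma_q \<tau> z * (exp (eis_log_series \<tau> z) * eis_series \<tau> z)) * z - sigma_q \<tau> z * exp (eis_log_series \<tau> z)) / (z * z)) (at z)"
      unfolding H_def
      by (rule derivative_eq_intros sigma_q_deriv[OF \<tau> zL] eis_log_series_deriv[OF \<rho> M z(1)] refl z(3) | simp)+
    then show ?thesis using z(3) unfolding zq by (simp add: algebra_simps)
  qed
  have "H constant_on (ball 0 r - {0})"
    by (rule has_field_derivative_0_imp_constant_on[OF dH]) (auto intro!: connected_punctured_ball)
  then obtain C where C: "\<And>z. z \<in> ball 0 r - {0} \<Longrightarrow> H z = C"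
    by (auto simp: constant_on_def)
  have ev: "\<forall>\<^sub>F z in at 0. z \<in> ball 0 r - {0}"
    using r by (intro eventually_at_in_open) auto
  have "H \<midarrow>0\<rightarrow> 1 * exp 0"
  proof -
    have "(\<lambda>z. sigma_q \<tau> z / z) \<midarrow>0\<rightarrow> 1"
      using sigma_q_deriv_0[OF \<tau>] by (simp add: has_field_derivative_iff sigma_q_0)
    moreover have "(\<lambda>z. exp (eis_log_series \<tau> z)) \<midarrow>0\<rightarrow> exp (eis_log_series \<tau> 0)"
      using DERIV_isCont[OF eis_log_series_deriv[OF \<rho> M, of 0]] \<rho> by (intro tendsto_exp) (auto simp: isCont_def)
    moreover have "eis_log_series \<tau> 0 = 0" by (simp add: eis_log_series_def)
    ultimately have "(\<lambda>z. sigma_q \<tau> z / z * exp (eis_log_series \<tau> z)) \<midarrow>0\<rightarrow> 1 * exp 0"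
      by (intro tendsto_mult) simp_all
    then show ?thesis by (simp add: H_def)
  qed
  moreover have "H \<midarrow>0\<rightarrow> C"
    by (rule tendsto_eventually) (use ev C in \<open>auto elim: eventually_mono\<close>)
  ultimately have "C = 1" using LIM_unique by fastforce
  show ?thesis
    using ev
  proof eventually_elim
    case (elim z)
    then have "H z = 1" using C \<open>C = 1\<close> by simp
    then show ?case using elim by (simp add: H_def exp_minus field_simps)
  qed
qed

lemma
  assumes \<tau>: "Im \<tau> > 0"
  shows K_holomorphic: "K \<tau> holomorphic_on UNIV"
    and K_eventually: "\<forall>\<^sub>F z in at 0. K \<tau> z = z * exp (- eis_log_series \<tau> z)"
proof -
  have "\<exists>g. g holomorphic_on UNIV \<and> (\<forall>\<^sub>F z in at 0. g z = z * exp (- (\<Sum>k. eisenstein (k + 2) \<tau> / of_nat (k + 2) * z ^ (k + 2))))"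
    using sigma_q_holomorphic[OF \<tau>] sigma_q_eq[OF \<tau>] unfolding eis_log_series_def by blast
  from someI_ex[OF this]
  show "K \<tau> holomorphic_on UNIV" "\<forall>\<^sub>F z in at 0. K \<tau> z = z * exp (- eis_log_series \<tau> z)"
    unfolding K_def continuation_def eis_log_series_def by auto
qed

lemma holomorphic_eq_punctured:
  assumes "f holomorphic_on ball 0 \<rho> - {0}" "g holomorphic_on ball 0 \<rho> - {0}"
    and ev: "\<forall>\<^sub>F z in at 0. f z = g z" and z: "norm z < \<rho>" "z \<noteq> 0"
  shows "f z = (g z :: complex)"
proof -
  have \<rho>: "\<rho> > 0" using z norm_ge_zero[of z] by linarith
  obtain d where d: "d > 0" "\<And>z. z \<noteq> 0 \<Longrightarrow> dist z 0 < d \<Longrightarrow> f z = g z"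
    using ev unfolding eventually_at by auto
  show ?thesis
  proof (rule analytic_continuation_open[where s = "ball 0 (min d \<rho>) - {0}" and s' = "ball 0 \<rho> - {0}" and f = f and g = g])
    have "of_real (min d \<rho> / 2) \<in> ball (0::complex) (min d \<rho>) - {0}" using d \<rho> by auto
    then show "ball (0::complex) (min d \<rho>) - {0} \<noteq> {}" by blast
    show "connected (ball (0::complex) \<rho> - {0})" by (rule connected_punctured_ball) simp
  qed (use assms d z in auto)
qed

lemma K_eq:
  assumes \<tau>: "Im \<tau> > 0" and \<rho>: "\<rho> > 0" "\<And>k. norm (eisenstein (k + 2) \<tau>) * \<rho> ^ (k + 2) \<le> M"
    and z: "norm z < \<rho>" "z \<noteq> 0"
  shows "K \<tau> z = z * exp (- eis_log_series \<tau> z)"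
  by (rule holomorphic_eq_punctured[OF _ _ K_eventually[OF \<tau>] z])
     (auto intro!: holomorphic_intros holomorphic_on_subset[OF K_holomorphic[OF \<tau>]]
        holomorphic_on_subset[OF eis_log_series_holomorphic[OF \<rho>]])

lemma P1_eq:
  assumes \<tau>: "Im \<tau> > 0" and \<rho>: "\<rho> > 0" "\<And>k. norm (eisenstein (k + 2) \<tau>) * \<rho> ^ (k + 2) \<le> M"
    and L: "\<And>l. l \<in> Lam \<tau> \<Longrightarrow> l \<noteq> 0 \<Longrightarrow> \<rho> \<le> norm l"
    and z: "norm z < \<rho>" "z \<noteq> 0"
  shows "P1 \<tau> z = 1 / z - eis_series \<tau> z"
proof (rule holomorphic_eq_punctured[OF _ _ P1_eventually[OF \<tau>] z])
  show "P1 \<tau> holomorphic_on ball 0 \<rho> - {0}"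
    by (rule holomorphic_on_subset[OF P1_holomorphic[OF \<tau>]]) (use L in force)
qed (auto intro!: holomorphic_intros holomorphic_on_subset[OF eis_series_holomorphic[OF \<rho>]])

text \<open>Differentiate the expansion of P_1 at 0 n times and multiply by z^(n+1): the pole
  contributes 1, and the Taylor part becomes a series in E_m z^m, m = p + 1, with binomial
  coefficients. The hypothesis \<open>L\<close> keeps all other poles out of the disc.\<close>

lemma P_eq:
  assumes \<tau>: "Im \<tau> > 0" and \<rho>: "\<rho> > 0" "\<And>k. norm (eisenstein (k + 2) \<tau>) * \<rho> ^ (k + 2) \<le> M"
    and L: "\<And>l. l \<in> Lam \<tau> \<Longrightarrow> l \<noteq> 0 \<Longrightarrow> \<rho> \<le> norm l"
    and z: "norm z < \<rho>" "z \<noteq> 0"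
  shows "P (Suc n) \<tau> z * z ^ Suc n
    = 1 - (-1) ^ n * (\<Sum>p. of_nat (p choose n) * (eisenstein (Suc p) \<tau> * z ^ Suc p))"
proof -
  define s where "s = (\<lambda>p. if p = 0 then 0 else eisenstein (Suc p) \<tau>)"
  define sn where "sn = (\<lambda>n i. fact (i + n) / fact i * s (i + n))"
  have sn_diffs: "diffs (sn n) = sn (Suc n)" for n
  proof
    fix i
    have "of_nat (Suc i) / fact (Suc i) = (1 / fact i :: complex)"
      by (simp del: of_nat_Suc)
    then have "of_nat (Suc i) * (fact (Suc i + n) / fact (Suc i) * s (Suc i + n)) = fact (i + Suc n) / fact i * s (i + Suc n)"
      by (simp del: of_nat_Suc fact_Suc) (simp add: field_simps del: of_nat_Suc fact_Suc)?
    then show "diffs (sn n) i = sn (Suc n) i" by (simp add: diffs_def sn_def del: of_nat_Suc fact_Suc)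
  qed
  have sm: "summable (\<lambda>i. sn n i * y ^ i)" if "norm y < \<rho>" for n y
    using that
  proof (induction n arbitrary: y)
    case 0
    then show ?case using eisenstein_powser_summable[OF \<rho> 0] by (simp add: sn_def s_def cong: if_cong)
  next
    case (Suc n)
    show ?case unfolding sn_diffs[symmetric]
      by (rule termdiff_converges[where K = \<rho>]) (use Suc in auto)
  qed
  have der: "(deriv ^^ n) (P1 \<tau>) y = (-1) ^ n * fact n / y ^ Suc n - (\<Sum>i. sn n i * y ^ i)"
    if "norm y < \<rho>" "y \<noteq> 0" for n y
    using that
  proof (induction n arbitrary: y)
    case 0
    then show ?case
      using P1_eq[OF \<tau> \<rho> L 0] eis_series_eq[OF \<rho> 0(1)] by (simp add: sn_def s_def cong: if_cong)
  next
    case (Suc n)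
    have "\<forall>\<^sub>F x in nhds y. x \<in> ball 0 \<rho> - {0}"
      using Suc.prems by (intro eventually_nhds_in_open) auto
    then have ev: "\<forall>\<^sub>F x in nhds y. (deriv ^^ n) (P1 \<tau>) x = (-1) ^ n * fact n / x ^ Suc n - (\<Sum>i. sn n i * x ^ i)"
      by eventually_elim (use Suc.IH in auto)
    have d1: "((\<lambda>x. (-1) ^ n * fact n / x ^ Suc n) has_field_derivative (-1) ^ Suc n * fact (Suc n) / y ^ Suc (Suc n)) (at y)"
    proof -
      have "((\<lambda>x. (-1) ^ n * fact n / x ^ Suc n) has_field_derivative
          - ((-1) ^ n * fact n * (of_nat (Suc n) * y ^ n)) / (y ^ Suc n * y ^ Suc n)) (at y)"
        by (rule derivative_eq_intros refl | use Suc.prems in simp)+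
      moreover have "- ((-1) ^ n * fact n * (of_nat (Suc n) * y ^ n)) / (y ^ Suc n * y ^ Suc n)
          = (-1) ^ Suc n * fact (Suc n) / y ^ Suc (Suc n)"
        using Suc.prems by (simp add: field_simps)
      ultimately show ?thesis by (simp only:)
    qed
    have d2: "((\<lambda>x. \<Sum>i. sn n i * x ^ i) has_field_derivative (\<Sum>i. sn (Suc n) i * y ^ i)) (at y)"
      unfolding sn_diffs[symmetric] by (rule termdiffs_strong'[where K = \<rho>]) (use sm Suc.prems in auto)
    have "(deriv ^^ Suc n) (P1 \<tau>) y = deriv (\<lambda>x. (-1) ^ n * fact n / x ^ Suc n - (\<Sum>i. sn n i * x ^ i)) y"
      using deriv_cong_ev[OF ev refl] by simp
    also have "\<dots> = (-1) ^ Suc n * fact (Suc n) / y ^ Suc (Suc n) - (\<Sum>i. sn (Suc n) i * y ^ i)"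
      by (intro DERIV_imp_deriv DERIV_diff d1 d2)
    finally show ?case .
  qed
  have S: "(\<Sum>i. sn n i * z ^ i) * z ^ Suc n / fact n = (\<Sum>p. of_nat (p choose n) * (eisenstein (Suc p) \<tau> * z ^ Suc p))"
  proof -
    define g where "g = (\<lambda>p. of_nat (p choose n) * (eisenstein (Suc p) \<tau> * z ^ Suc p))"
    have eq: "sn n i * z ^ i * z ^ Suc n / fact n = g (i + n)" for i
    proof -
      have "of_nat (i + n choose n) = (fact (i + n) / (fact n * fact i) :: complex)"
        using binomial_fact[of n "i + n"] by simp
      moreover have "s (i + n) = eisenstein (Suc (i + n)) \<tau>" by (auto simp: s_def)
      ultimately show ?thesis by (simp add: g_def sn_def power_add field_simps)
    qed
    have "summable (\<lambda>i. sn n i * z ^ i * z ^ Suc n / fact n)"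
      by (intro summable_divide summable_mult2 sm z)
    then have sg: "summable g"
      unfolding eq by (subst (asm) summable_iff_shift)
    have "(\<Sum>i. sn n i * z ^ i) * z ^ Suc n / fact n = (\<Sum>i. g (i + n))"
      using sums_divide[OF sums_mult2[OF summable_sums[OF sm[OF z(1), of n]], of "z ^ Suc n"], of "fact n"]
      unfolding eq by (rule sums_unique)
    \<comment> \<open>The index shift by n loses nothing, since the binomial coefficient vanishes
      for p < n.\<close>
    also have "\<dots> = (\<Sum>p. g p)"
    proof -
      have "(\<Sum>i<n. g i) = 0"
        by (intro sum.neutral) (auto simp: g_def binomial_eq_0)
      then show ?thesis using suminf_split_initial_segment[OF sg, of n] by simp
    qed
    finally show ?thesis by (simp add: g_def)
  qed
  have "P (Suc n) \<tau> z * z ^ Suc n = (-1) ^ n / fact n * ((-1) ^ n * fact n / z ^ Suc n - (\<Sum>i. sn n i * z ^ i)) * z ^ Suc n"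
    unfolding P_def using der[OF z, of n] by simp
  also have "\<dots> = ((-1) ^ n * (-1) ^ n) - (-1) ^ n * ((\<Sum>i. sn n i * z ^ i) * z ^ Suc n / fact n)"
    using z(2) by (simp add: field_simps)
  also have "(-1) ^ n * (-1) ^ n = (1 :: complex)" by (simp flip: power_add)
  finally show ?thesis unfolding S .
qed

section \<open>The sewing matrix as a function of \<open>E\<^sub>m(\<tau>) w\<^sup>m\<close>\<close>

lemma binomial_series_complex:
  fixes y :: complex
  assumes "norm y < 1"
  shows "(\<lambda>i. of_nat (n + i choose i) * y ^ i) sums (1 / (1 - y) ^ Suc n)"
proof -
  have "(\<lambda>i. ((- of_nat (Suc n)) gchoose i) * (- y) ^ i) sums (1 + - y) powr (- of_nat (Suc n))"
    by (rule gen_binomial_complex) (use assms in simp)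
  moreover have "((- of_nat (Suc n)) gchoose i) * (- y) ^ i = of_nat (n + i choose i) * y ^ i" for i
  proof -
    have "(of_nat (Suc n) + of_nat i - 1 :: complex) = of_nat (n + i)" by simp
    then have "((- of_nat (Suc n)) gchoose i) = (-1) ^ i * (of_nat (n + i choose i) :: complex)"
      unfolding gbinomial_minus by (simp only: binomial_gbinomial)
    moreover have "(-1) ^ i * (- y) ^ i = y ^ i"
      unfolding power_mult_distrib[symmetric] by simp
    ultimately show ?thesis
      by (metis (no_types, lifting) mult.assoc mult.commute)
  qed
  moreover have "(1 + - y) powr (- of_nat (Suc n)) = 1 / (1 - y) ^ Suc n"
  proof -
    have "1 - y \<noteq> 0" using assms by auto
    then show ?thesis by (simp add: powr_minus powr_nat' field_simps del: of_nat_Suc)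
  qed
  ultimately show ?thesis by simp
qed

lemma binomial_series_real:
  fixes y :: real
  assumes "\<bar>y\<bar> < 1"
  shows "(\<lambda>i. of_nat (n + i choose i) * y ^ i) sums (1 / (1 - y) ^ Suc n)"
proof -
  have "(\<lambda>i. complex_of_real (of_nat (n + i choose i) * y ^ i)) sums complex_of_real (1 / (1 - y) ^ Suc n)"
    using binomial_series_complex[of "of_real y" n] assms by simp
  then show ?thesis by (simp only: sums_of_real_iff)
qed

text \<open>In block numbers K = k + 1 and L = l + 1 this is (K+L-1)! / ((K-1)! L!): the coefficient
  in C and D after the square roots of K and L have been conjugated into a factor 1/L.\<close>

definition upper_binomial :: "nat \<Rightarrow> nat \<Rightarrow> nat" where
  "upper_binomial k l = (k + Suc l choose Suc l)"

lemma upper_binomial_swap: "Suc l * upper_binomial k l = Suc k * upper_binomial l k"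
proof -
  have "Suc l * (Suc (k + l) choose Suc l) = Suc (k + l) * (k + l choose l)"
    using Suc_times_binomial_eq[of "k + l" l] by (simp only: mult.commute)
  moreover have "Suc k * (Suc (k + l) choose Suc k) = Suc (k + l) * (k + l choose k)"
    using Suc_times_binomial_eq[of "k + l" k] by (simp only: mult.commute)
  moreover have "(k + l choose l) = (k + l choose k)"
    using binomial_symmetric[of l "k + l"] by simp
  ultimately show ?thesis by (simp add: upper_binomial_def add.commute del: binomial_Suc_Suc)
qed

lemma binomial_lower_series:
  fixes y :: real
  assumes "0 \<le> y" "y < 1"
  shows "((\<lambda>p. of_nat (p choose n) * y ^ Suc p) has_sum (y / (1 - y)) ^ Suc n) UNIV"
proof -
  have "(\<lambda>i. of_nat (n + i choose i) * y ^ i * y ^ Suc n) sums (1 / (1 - y) ^ Suc n * y ^ Suc n)"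
    by (intro sums_mult2 binomial_series_real) (use assms in auto)
  moreover have "of_nat (n + i choose i) * y ^ i * y ^ Suc n = of_nat (i + n choose n) * y ^ Suc (i + n)" for i
    using binomial_symmetric[of i "n + i"] by (simp add: power_add add.commute mult_ac)
  moreover have "1 / (1 - y) ^ Suc n * y ^ Suc n = (y / (1 - y)) ^ Suc n"
    unfolding power_divide by simp
  ultimately have "(\<lambda>i. of_nat (i + n choose n) * y ^ Suc (i + n)) sums ((y / (1 - y)) ^ Suc n)"
    by (simp only:)
  moreover have "(\<Sum>p<n. of_nat (p choose n) * y ^ Suc p) = 0"
    by (intro sum.neutral) (auto simp: binomial_eq_0)
  ultimately have "(\<lambda>p. of_nat (p choose n) * y ^ Suc p) sums ((y / (1 - y)) ^ Suc n)"
    using sums_iff_shift[of "\<lambda>p. of_nat (p choose n) * y ^ Suc p" n "(y / (1 - y)) ^ Suc n"] by simp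
  moreover from this have "summable (\<lambda>p. norm (of_nat (p choose n) * y ^ Suc p))"
    using assms by (simp add: sums_iff norm_mult abs_mult)
  ultimately show ?thesis by (intro norm_summable_imp_has_sum)
qed

text \<open>Row sums of the binomial matrix. Blocks start at 1, so the term i = 0 of the full
  binomial series is missing; hence the subtraction.\<close>

lemma binomial_upper_series:
  fixes y :: real
  assumes "0 \<le> y" "y < 1"
  shows "((\<lambda>l. of_nat (upper_binomial k l) * y ^ (Suc k + Suc l)) has_sum ((y / (1 - y)) ^ Suc k - y ^ Suc k)) UNIV"
proof -
  have "(\<lambda>i. of_nat (k + i choose i) * y ^ i) sums (1 / (1 - y) ^ Suc k)"
    by (rule binomial_series_real) (use assms in auto)
  from sums_split_initial_segment[OF this, of 1]
  have "(\<lambda>l. of_nat (upper_binomial k l) * y ^ Suc l) sums (1 / (1 - y) ^ Suc k - 1)"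
    by (simp add: upper_binomial_def del: binomial_Suc_Suc)
  from sums_mult2[OF this, of "y ^ Suc k"]
  have "(\<lambda>l. of_nat (upper_binomial k l) * y ^ (Suc k + Suc l)) sums ((y / (1 - y)) ^ Suc k - y ^ Suc k)"
    unfolding power_add by (simp add: power_divide left_diff_distrib right_diff_distrib mult_ac del: power_Suc)
  moreover from this have "summable (\<lambda>l. norm (of_nat (upper_binomial k l) * y ^ (Suc k + Suc l)))"
    using assms by (simp add: sums_iff norm_mult abs_mult)
  ultimately show ?thesis by (intro norm_summable_imp_has_sum)
qed

lemma binomial_upper_series_complex:
  fixes y :: complex
  assumes "norm y < 1"
  shows "((\<lambda>l. of_nat (upper_binomial k l) * y ^ Suc l) has_sum (1 / (1 - y) ^ Suc k - 1)) UNIV"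
proof -
  have "(\<lambda>i. of_nat (k + i choose i) * y ^ i) sums (1 / (1 - y) ^ Suc k)"
    by (rule binomial_series_complex) (use assms in auto)
  from sums_split_initial_segment[OF this, of 1]
  have "(\<lambda>l. of_nat (upper_binomial k l) * y ^ Suc l) sums (1 / (1 - y) ^ Suc k - 1)"
    by (simp add: upper_binomial_def del: binomial_Suc_Suc)
  moreover have "summable (\<lambda>l. norm (of_nat (upper_binomial k l) * y ^ Suc l))"
  proof -
    have "(\<lambda>i. of_nat (k + i choose i) * norm y ^ i) sums (1 / (1 - norm y) ^ Suc k)"
      by (rule binomial_series_real) (use assms in auto)
    from sums_split_initial_segment[OF this, of 1] show ?thesis
      by (simp add: sums_iff norm_mult norm_power upper_binomial_def del: binomial_Suc_Suc)
  qed
  ultimately show ?thesis by (intro norm_summable_imp_has_sum)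
qed

text \<open>Each iterate is a sum dominated by the fixed matrix M, and the iterates are dominated by
  a geometric series. Both bounds are uniform in p, so holomorphy passes to the sums.\<close>

lemma sep_hol_mat_solve:
  fixes A :: "c3 \<Rightarrow> 'i \<Rightarrow> 'i \<Rightarrow> complex"
  assumes N: "open N" and hol: "\<And>i j. sep_hol N (\<lambda>p. A p i j)"
    and M: "\<And>p i j. p \<in> N \<Longrightarrow> norm (A p i j) \<le> M i j" "\<And>i. M i summable_on UNIV" "\<And>i. (\<Sum>\<^sub>\<infinity>j. M i j) \<le> \<theta>"
    and \<theta>: "0 \<le> \<theta>" "\<theta> < 1"
    and c: "\<And>i. sep_hol N (\<lambda>p. c p i)" "\<And>p i. p \<in> N \<Longrightarrow> norm (c p i) \<le> C" and C: "0 \<le> C"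
  shows "sep_hol N (\<lambda>p. mat_solve (A p) (c p) i)"
proof -
  have rc: "row_contraction (A p) \<theta>" if "p \<in> N" for p
    unfolding row_contraction_def
  proof (intro conjI allI \<theta>)
    fix i
    show s: "(\<lambda>j. norm (A p i j)) summable_on UNIV"
      by (rule summable_on_comparison_test[OF M(2)[of i]]) (use M(1) that in auto)
    show "(\<Sum>\<^sub>\<infinity>j. norm (A p i j)) \<le> \<theta>"
      by (rule order_trans[OF infsum_mono[OF s M(2)] M(3)]) (rule M(1)[OF that])
  qed
  have "sep_hol N (\<lambda>p. (mat_app (A p) ^^ n) (c p) i)" for n i
  proof (induction n arbitrary: i)
    case (Suc n)
    have b: "norm ((mat_app (A p) ^^ n) (c p) j) \<le> \<theta> ^ n * C" if "p \<in> N" for p j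
      by (rule norm_funpow_mat_app_le[OF rc[OF that] c(2)[OF that]])
    have "sep_hol N (\<lambda>p. \<Sum>\<^sub>\<infinity>j. A p i j * (mat_app (A p) ^^ n) (c p) j)"
    proof (rule sep_hol_infsum[OF N, where M = "\<lambda>j. M i j * (\<theta> ^ n * C)"])
      show "norm (A p i j * (mat_app (A p) ^^ n) (c p) j) \<le> M i j * (\<theta> ^ n * C)" if "p \<in> N" for p j
        unfolding norm_mult using that by (intro mult_mono M(1) b order_trans[OF norm_ge_zero M(1)]) auto
    qed (use Suc hol in \<open>auto intro!: summable_on_cmult_left M(2)\<close>)
    moreover have "(mat_app (A p) ^^ Suc n) (c p) i = (\<Sum>\<^sub>\<infinity>j. A p i j * (mat_app (A p) ^^ n) (c p) j)" for p
      by (simp only: funpow.simps o_apply mat_app_def[of "A p" "(mat_app (A p) ^^ n) (c p)" i])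
    ultimately show ?case by (simp only:)
  qed (simp add: c)
  then show ?thesis
    unfolding mat_solve_def
    by (rule sep_hol_infsum[OF N _ _ geometric_summable_on[OF \<theta>, of C]])
       (use norm_funpow_mat_app_le[OF rc c(2)] in auto)
qed

text \<open>For \<open>e m = E\<^sub>m(\<tau>) w\<^sup>m\<close> this is \<open>w\<^sup>n P\<^sub>n(\<tau>, w)\<close>, by the expansion of \<open>P\<^sub>n\<close> at \<open>0\<close>.\<close>
definition pi_fun :: "(nat \<Rightarrow> complex) \<Rightarrow> nat \<Rightarrow> complex" where
  "pi_fun e n = 1 + (-1) ^ n * (\<Sum>\<^sub>\<infinity>p. of_nat (p choose (n - 1)) * e (Suc p))"

type_synonym idx = "nat \<times> 2"

text \<open>The matrix \<open>R\<close> conjugated by the diagonal matrix with entries \<open>\<surd>k (x w / \<surd>\<rho>)\<^sup>k\<close>.  This removes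
  \<open>w\<close> from all denominators and makes sense at \<open>w = 0\<close>, that is, at \<open>e = 0\<close>.  The auxiliary number \<open>x\<close>
  with \<open>|\<chi>| < x\<^sup>2 < 1/4\<close> makes the row sums less than \<open>1\<close>.  The index \<open>k\<close> stands for the block \<open>k + 1\<close>.\<close>
definition norm_R :: "real \<Rightarrow> complex \<Rightarrow> (nat \<Rightarrow> complex) \<Rightarrow> idx \<Rightarrow> idx \<Rightarrow> complex" where
  "norm_R x chi e = (\<lambda>(k, a) (l, b).
     of_real x ^ Suc k * (- chi / of_real x) ^ Suc l * of_nat (upper_binomial k l) *
     (if a = b then (if a = 1 then (-1) ^ Suc k else (-1) ^ Suc l) * pi_fun e (Suc k + Suc l)
      else (-1) ^ Suc k * e (Suc k + Suc l)))"

text \<open>The row \<beta> times the inverse of the conjugating diagonal matrix;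
  \<open>beta_col\<close> is this matrix times the barred column. The two square roots of the block
  number multiply up in the row and cancel in the column.\<close>

definition beta_row :: "real \<Rightarrow> complex \<Rightarrow> (nat \<Rightarrow> complex) \<Rightarrow> idx \<Rightarrow> complex" where
  "beta_row x chi e = (\<lambda>(k, a). (- chi / of_real x) ^ Suc k / of_nat (Suc k) * (pi_fun e (Suc k) - e (Suc k)) *
     (if a = 1 then - 1 else (-1) ^ Suc k))"

definition beta_col :: "real \<Rightarrow> (nat \<Rightarrow> complex) \<Rightarrow> idx \<Rightarrow> complex" where
  "beta_col x e = (\<lambda>(k, a). of_real x ^ Suc k * (pi_fun e (Suc k) - e (Suc k)) *
     (if a = 1 then (-1) ^ Suc k else - 1))"

text \<open>The two indices of the first block. Summing the entries of a (1, 1) block is pairing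
  with this indicator on both sides.\<close>

definition unit_set :: "idx set" where
  "unit_set = {(0, 1), (0, 2)}"

lemma one_neq_two [simp]: "(1 :: 2) \<noteq> 2"
  by simp

lemma sum_unit_set: "(\<Sum>i\<in>unit_set. f i) = f (0, 1) + f (0, 2)"
  by (simp add: unit_set_def)

definition xi_vec :: "real \<Rightarrow> complex \<Rightarrow> (nat \<Rightarrow> complex) \<Rightarrow> idx \<Rightarrow> complex" where
  "xi_vec x chi e = mat_solve (norm_R x chi e) (indicator unit_set)"

definition eta_vec :: "real \<Rightarrow> complex \<Rightarrow> (nat \<Rightarrow> complex) \<Rightarrow> idx \<Rightarrow> complex" where
  "eta_vec x chi e = mat_solve (norm_R x chi e) (beta_col x e)"

text \<open>Up to elementary factors, \<open>s_fun\<close>, \<open>g_fun\<close> and \<open>h_fun\<close> are \<open>\<sigma>((I - R)\<^sup>-\<^sup>1(1, 1))\<close>,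
  \<open>\<sigma>((\<beta>(I - R)\<^sup>-\<^sup>1)(1))\<close> and \<open>\<beta>(I - R)\<^sup>-\<^sup>1\<beta>\<^sup>T\<close> with the last \<open>\<beta>\<close> barred, while \<open>t_fun\<close> is the transpose of \<open>g_fun\<close>.\<close>
definition s_fun where "s_fun x chi e = (\<Sum>i\<in>unit_set. xi_vec x chi e i)"
definition g_fun where "g_fun x chi e = (\<Sum>\<^sub>\<infinity>i. beta_row x chi e i * xi_vec x chi e i)"
definition h_fun where "h_fun x chi e = (\<Sum>\<^sub>\<infinity>i. beta_row x chi e i * eta_vec x chi e i)"
definition t_fun where "t_fun x chi e = (\<Sum>i\<in>unit_set. eta_vec x chi e i)"

text \<open>\<open>x / (1 - x)\<close> bounds the row sums at e = 0, and e raises them by at most 2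
  \<epsilon> / (1 - \<epsilon>). The last condition allows this to use up half of the gap to
  1.\<close>

locale period_params =
  fixes x \<epsilon> :: real
  assumes x: "0 < x" "x < 1 / 2" and \<epsilon>: "0 < \<epsilon>" "\<epsilon> < 1" "\<epsilon> / (1 - \<epsilon>) \<le> (1 - x / (1 - x)) / 4"
begin

text \<open>Its powers bound both |e_n| and the deviation of pi_n from 1, the latter by the binomial
  series with ratio \<epsilon>.\<close>

definition E where "E = \<epsilon> / (1 - \<epsilon>)"
definition \<theta> where "\<theta> = x / (1 - x) + 2 * (x * E / (1 - x * E))"
definition good :: "complex \<Rightarrow> (nat \<Rightarrow> complex) \<Rightarrow> bool" where
  "good chi e \<longleftrightarrow> (\<forall>m. norm (e (Suc m)) \<le> \<epsilon> ^ Suc m) \<and> norm chi \<le> x\<^sup>2"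

lemma E_bounds: "0 < E" "E \<le> 1 / 4" "\<epsilon> \<le> E"
proof -
  show "0 < E" using \<epsilon> by (simp add: E_def)
  have "0 \<le> x / (1 - x)" using x by simp
  moreover have "a \<le> 1 / 4" if "0 \<le> b" "a \<le> (1 - b) / 4" for a b :: real
    using that by simp
  ultimately show "E \<le> 1 / 4" unfolding E_def using \<epsilon>(3) by blast
  show "\<epsilon> \<le> E" using \<epsilon> by (simp add: E_def field_simps)
qed

lemma \<theta>_bounds: "0 \<le> \<theta>" "\<theta> < 1"
proof -
  have xE: "0 < x * E" "x * E \<le> 1 / 2"
    using x E_bounds mult_mono[of x "1/2" E 1] by auto
  then show "0 \<le> \<theta>" using x by (simp add: \<theta>_def)
  have "x * E / (1 - x * E) \<le> (1 / 2 * E) / (1 / 2)"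
    using xE x E_bounds by (intro frac_le mult_right_mono) auto
  then have "\<theta> \<le> x / (1 - x) + 2 * E" by (simp add: \<theta>_def)
  also have "b + 2 * a \<le> b + (1 - b) / 2" if "a \<le> (1 - b) / 4" for a b :: real
    using that by simp
  from this[OF \<epsilon>(3)] have "x / (1 - x) + 2 * E \<le> x / (1 - x) + (1 - x / (1 - x)) / 2" unfolding E_def .
  also have "\<dots> < 1" using x by (simp add: field_simps)
  finally show "\<theta> < 1" .
qed

lemma pi_fun_majorant: "((\<lambda>p. of_nat (p choose n) * \<epsilon> ^ Suc p) has_sum E ^ Suc n) UNIV"
  unfolding E_def by (rule binomial_lower_series) (use \<epsilon> in auto)

lemma good_pi_fun_summable:
  assumes "good chi e"
  shows "(\<lambda>p. norm (of_nat (p choose n) * e (Suc p))) summable_on UNIV"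
  by (rule summable_on_comparison_test[OF has_sum_imp_summable[OF pi_fun_majorant]])
     (use assms in \<open>auto simp: good_def norm_mult intro!: mult_left_mono simp del: power_Suc\<close>)

lemma good_pi_fun:
  assumes "good chi e"
  shows "norm (pi_fun e (Suc n) - 1) \<le> E ^ Suc n"
proof -
  have "norm (pi_fun e (Suc n) - 1) = norm (\<Sum>\<^sub>\<infinity>p. of_nat (p choose n) * e (Suc p))"
    by (simp add: pi_fun_def norm_mult norm_power)
  also have "\<dots> \<le> (\<Sum>\<^sub>\<infinity>p. norm (of_nat (p choose n) * e (Suc p)))"
    by (rule norm_infsum_bound) (rule good_pi_fun_summable[OF assms])
  also have "\<dots> \<le> (\<Sum>\<^sub>\<infinity>p. of_nat (p choose n) * \<epsilon> ^ Suc p)"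
    by (rule infsum_mono[OF good_pi_fun_summable[OF assms] has_sum_imp_summable[OF pi_fun_majorant]])
       (use assms in \<open>auto simp: good_def norm_mult intro!: mult_left_mono simp del: power_Suc\<close>)
  also have "\<dots> = E ^ Suc n" by (rule infsumI) (rule pi_fun_majorant)
  finally show ?thesis .
qed

lemma good_e: "good chi e \<Longrightarrow> norm (e (Suc n)) \<le> E ^ Suc n"
  using order_trans[OF _ power_mono[OF E_bounds(3), of "Suc n"]] \<epsilon> unfolding good_def by fastforce

definition maj :: "idx \<Rightarrow> idx \<Rightarrow> real" where
  "maj = (\<lambda>(k, a) (l, b). of_nat (upper_binomial k l) * x ^ (Suc k + Suc l) * (if a = b then 1 + E ^ (Suc k + Suc l) else E ^ (Suc k + Suc l)))"

lemma power_ratio_le: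
  fixes y :: real
  assumes "0 \<le> y" "y \<le> 1 / 2"
  shows "(y / (1 - y)) ^ Suc k - y ^ Suc k \<le> y / (1 - y)"
proof -
  have "0 \<le> y / (1 - y)" "y / (1 - y) \<le> 1" using assms by (auto simp: field_simps)
  then have "(y / (1 - y)) ^ Suc k \<le> (y / (1 - y)) ^ 1" by (intro power_decreasing) auto
  then show ?thesis using zero_le_power[OF assms(1), of "Suc k"] by simp
qed

text \<open>The summand 1 occurs only for b = a and gives the first term of \<theta>; the powers of
  E occur for both values of b and give twice the second term.\<close>

lemma maj_row:
  shows "maj i summable_on UNIV" "(\<Sum>\<^sub>\<infinity>j. maj i j) \<le> \<theta>"
proof -
  obtain k a where i: "i = (k, a)" by (cases i)
  define S1 where "S1 = (x / (1 - x)) ^ Suc k - x ^ Suc k"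
  define S2 where "S2 = (x * E / (1 - x * E)) ^ Suc k - (x * E) ^ Suc k"
  have xE: "0 \<le> x * E" "x * E \<le> 1 / 2"
    using x E_bounds mult_mono[of x "1/2" E 1] by auto
  have 1: "((\<lambda>l. of_nat (upper_binomial k l) * x ^ (Suc k + Suc l)) has_sum S1) UNIV"
    unfolding S1_def by (rule binomial_upper_series) (use x in auto)
  have 2: "((\<lambda>l. of_nat (upper_binomial k l) * (x * E) ^ (Suc k + Suc l)) has_sum S2) UNIV"
    unfolding S2_def by (rule binomial_upper_series) (use xE in auto)
  have "((\<lambda>l. of_nat (upper_binomial k l) * x ^ (Suc k + Suc l) + of_nat (upper_binomial k l) * (x * E) ^ (Suc k + Suc l)) has_sum (S1 + S2)) UNIV"
    by (rule has_sum_add[OF 1 2])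
  then have same: "((\<lambda>l. maj i (l, a)) has_sum (S1 + S2)) UNIV"
    by (simp add: maj_def i power_mult_distrib distrib_left mult_ac del: power_Suc)
  have diff: "((\<lambda>l. maj i (l, b)) has_sum S2) UNIV" if "b \<noteq> a" for b
    using 2 that by (auto simp: maj_def i power_mult_distrib mult_ac simp del: power_Suc)
  have col: "((\<lambda>l. maj i (l, b)) has_sum (if b = a then S1 + S2 else S2)) UNIV" for b
    using same diff by auto
  have "((\<lambda>j. maj i j) has_sum (\<Sum>b\<in>UNIV. if b = a then S1 + S2 else S2)) (UNIV \<times> UNIV)"
  proof -
    have "((\<lambda>(b, l). maj i (l, b)) has_sum (\<Sum>b\<in>UNIV. if b = a then S1 + S2 else S2)) (Sigma UNIV (\<lambda>_. UNIV))"
    proof (rule has_sum_SigmaI)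
      show "((\<lambda>b. if b = a then S1 + S2 else S2) has_sum (\<Sum>b\<in>UNIV. if b = a then S1 + S2 else S2)) UNIV"
        by (rule has_sum_finite) simp
      show "(\<lambda>(b, l). maj i (l, b)) summable_on (SIGMA b:UNIV. UNIV)"
      proof (rule summable_on_SigmaI)
        show "(\<lambda>b. if b = a then S1 + S2 else S2) summable_on UNIV"
          by (rule summable_on_finite) simp
      qed (use col x E_bounds in \<open>auto simp: maj_def i\<close>)
    qed (use col in auto)
    moreover have "bij_betw prod.swap (UNIV :: (2 \<times> nat) set) UNIV"
      by (simp add: bij_betw_def)
    ultimately show ?thesis
      using has_sum_reindex_bij_betw[of prod.swap "UNIV :: (2 \<times> nat) set" UNIV "maj i"]
      by (simp add: case_prod_unfold prod.swap_def)
  qed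
  then have hs: "(maj i has_sum (\<Sum>b\<in>UNIV. if b = a then S1 + S2 else S2)) UNIV" by simp
  then show "maj i summable_on UNIV" by (rule has_sum_imp_summable)
  have "(\<Sum>\<^sub>\<infinity>j. maj i j) = (\<Sum>b\<in>UNIV. if b = a then S1 + S2 else S2)" using hs by (rule infsumI)
  also have "\<dots> = S1 + 2 * S2" using exhaust_2[of a] by (auto simp: sum_2)
  also have "\<dots> \<le> \<theta>"
    unfolding \<theta>_def S1_def S2_def by (intro add_mono mult_left_mono power_ratio_le) (use x xE in auto)
  finally show "(\<Sum>\<^sub>\<infinity>j. maj i j) \<le> \<theta>" .
qed

lemma chi_div_le: "norm (chi :: complex) \<le> x\<^sup>2 \<Longrightarrow> norm (- chi / of_real x) \<le> x"
  using x by (simp add: norm_divide field_simps power2_eq_square)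

lemma norm_R_le_maj:
  assumes "good chi e"
  shows "norm (norm_R x chi e i j) \<le> maj i j"
proof -
  obtain k a l b where ij: "i = (k, a)" "j = (l, b)" by (cases i, cases j)
  have c: "norm (- chi / of_real x) \<le> x" by (rule chi_div_le) (use assms in \<open>simp add: good_def\<close>)
  have p: "norm (pi_fun e (Suc k + Suc l)) \<le> 1 + E ^ (Suc k + Suc l)"
    using good_pi_fun[OF assms, of "Suc k + l"] norm_triangle_ineq[of 1 "pi_fun e (Suc k + Suc l) - 1"] by simp
  have q: "norm (e (Suc k + Suc l)) \<le> E ^ (Suc k + Suc l)"
    using good_e[OF assms, of "Suc k + l"] by simp
  have f: "norm (if a = b then (if a = 1 then (-1) ^ Suc k else (-1) ^ Suc l) * pi_fun e (Suc k + Suc l)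
      else (-1) ^ Suc k * e (Suc k + Suc l)) \<le> (if a = b then 1 + E ^ (Suc k + Suc l) else E ^ (Suc k + Suc l))"
    using p q by (simp add: norm_mult norm_power del: power_Suc)
  have "norm (of_real x ^ Suc k * (- chi / of_real x) ^ Suc l * of_nat (upper_binomial k l)) \<le> x ^ Suc k * x ^ Suc l * of_nat (upper_binomial k l)"
    unfolding norm_mult norm_power using c x by (intro mult_mono power_mono) auto
  then have "norm (of_real x ^ Suc k * (- chi / of_real x) ^ Suc l * of_nat (upper_binomial k l)) *
      norm (if a = b then (if a = 1 then (-1) ^ Suc k else (-1) ^ Suc l) * pi_fun e (Suc k + Suc l) else (-1) ^ Suc k * e (Suc k + Suc l))
    \<le> x ^ Suc k * x ^ Suc l * of_nat (upper_binomial k l) * (if a = b then 1 + E ^ (Suc k + Suc l) else E ^ (Suc k + Suc l))"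
    using mult_mono[OF _ f] x by simp
  moreover have "maj i j = x ^ Suc k * x ^ Suc l * of_nat (upper_binomial k l) * (if a = b then 1 + E ^ (Suc k + Suc l) else E ^ (Suc k + Suc l))"
    unfolding maj_def ij prod.case by (simp only: power_add mult_ac)
  ultimately show ?thesis
    unfolding norm_R_def ij prod.case by (simp only: norm_mult[of "_ * _ * of_nat _"])
qed

lemma norm_R_row_contraction:
  assumes "good chi e"
  shows "row_contraction (norm_R x chi e) \<theta>"
  unfolding row_contraction_def
proof (intro conjI allI \<theta>_bounds)
  fix i
  show s: "(\<lambda>j. norm (norm_R x chi e i j)) summable_on UNIV"
    by (rule summable_on_comparison_test[OF maj_row(1)[of i]]) (use norm_R_le_maj[OF assms] in auto)
  show "(\<Sum>\<^sub>\<infinity>j. norm (norm_R x chi e i j)) \<le> \<theta>"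
    by (rule order_trans[OF infsum_mono[OF s maj_row(1)] maj_row(2)]) (rule norm_R_le_maj[OF assms])
qed

lemma norm_pi_minus_e:
  assumes "good chi e"
  shows "norm (pi_fun e (Suc k) - e (Suc k)) \<le> 3"
proof -
  have "E ^ Suc k \<le> 1" using E_bounds by (intro power_le_one) auto
  then show ?thesis
    using good_pi_fun[OF assms, of k] good_e[OF assms, of k]
      norm_triangle_ineq[of 1 "pi_fun e (Suc k) - 1 - e (Suc k)"]
      norm_triangle_ineq4[of "pi_fun e (Suc k) - 1" "e (Suc k)"] by (simp del: power_Suc)
qed

lemma beta_col_bound:
  assumes "good chi e"
  shows "norm (beta_col x e i) \<le> 3"
proof -
  obtain k a where i: "i = (k, a)" by (cases i)
  have "norm (beta_col x e i) = x ^ Suc k * norm (pi_fun e (Suc k) - e (Suc k))"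
    using x by (simp add: beta_col_def i norm_mult norm_power del: power_Suc)
  also have "\<dots> \<le> 1 * 3"
    by (intro mult_mono norm_pi_minus_e[OF assms] power_le_one) (use x in auto)
  finally show ?thesis by simp
qed

lemma beta_row_bound:
  assumes "good chi e"
  shows "norm (beta_row x chi e (k, a)) \<le> x ^ Suc k * 3"
proof -
  have c: "norm (- chi / of_real x) \<le> x" by (rule chi_div_le) (use assms in \<open>simp add: good_def\<close>)
  have "norm (beta_row x chi e (k, a)) = norm (- chi / of_real x) ^ Suc k / of_nat (Suc k) * norm (pi_fun e (Suc k) - e (Suc k))"
    by (simp add: beta_row_def norm_mult norm_power norm_divide del: power_Suc of_nat_Suc)
  also have "\<dots> \<le> (x ^ Suc k / 1) * 3"
    by (intro mult_mono norm_pi_minus_e[OF assms] frac_le power_mono c) (use x in auto)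
  finally show ?thesis by simp
qed

lemma geometric_idx_summable: "(\<lambda>(k, a). x ^ Suc k * 3) summable_on (UNIV :: idx set)"
proof -
  have "(\<lambda>z. norm (case z of (k :: nat, a :: 2) \<Rightarrow> complex_of_real (x ^ Suc k * 3))) summable_on (UNIV \<times> UNIV)"
  proof (rule abs_summable_product[where M = "\<lambda>k. x ^ k * (6 * x)"])
    fix k
    show "(\<lambda>a::2. norm (complex_of_real (x ^ Suc k * 3))) summable_on UNIV"
      by (rule summable_on_finite) simp
    show "(\<Sum>\<^sub>\<infinity>a::2. norm (complex_of_real (x ^ Suc k * 3))) \<le> x ^ k * (6 * x)"
      using x by (simp add: norm_mult norm_power)
  qed (intro geometric_summable_on, use x in auto)
  then show ?thesis using x by (simp add: case_prod_unfold norm_mult norm_power)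
qed

lemma beta_row_summable:
  assumes "good chi e"
  shows "(\<lambda>i. norm (beta_row x chi e i)) summable_on UNIV"
  by (rule summable_on_comparison_test[OF geometric_idx_summable]) (use beta_row_bound[OF assms] in auto)

lemma indicator_bound: "norm (indicator A i :: complex) \<le> 1"
  by (simp add: indicator_def)

text \<open>The symmetry of \<open>R\<close> survives the normalisation as symmetry for a weighted bilinear form.\<close>
lemma g_fun_eq_t_fun:
  assumes good: "good chi e" and e_odd: "\<And>m. odd m \<Longrightarrow> e m = 0" and chi: "norm chi < x\<^sup>2" "chi \<noteq> 0"
  shows "g_fun x chi e = - chi / of_real x ^ 2 * t_fun x chi e"
proof -
  define \<sigma> :: "idx \<Rightarrow> idx" where "\<sigma> = (\<lambda>(k, a). (k, if a = 1 then 2 else 1))"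
  define y where "y = - chi / of_real x ^ 2"
  define \<mu> :: "idx \<Rightarrow> complex" where "\<mu> = (\<lambda>(k, a). y ^ Suc k / of_nat (Suc k))"
  \<comment> \<open>Strictness of |\<chi>| < x^2 is what makes the weights of the bilinear form
    summable.\<close>
  have y: "norm y < 1" "y \<noteq> 0" using chi x by (auto simp: y_def norm_divide norm_power field_simps)
  have inv: "\<sigma> (\<sigma> i) = i" for i
    using exhaust_2[of "snd i"] by (cases i) (auto simp: \<sigma>_def)
  have adj: "(\<Sum>\<^sub>\<infinity>i. \<mu> i * beta_col x e (\<sigma> i) * mat_solve (norm_R x chi e) (indicator unit_set) i)
     = (\<Sum>\<^sub>\<infinity>i. \<mu> i * indicator unit_set (\<sigma> i) * mat_solve (norm_R x chi e) (beta_col x e) i)"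
  proof (rule mat_solve_adjoint[OF norm_R_row_contraction[OF good] _ inv _ _ _ beta_col_bound[OF good] indicator_bound])
    show "bij \<sigma>" using inv by (metis involuntory_imp_bij)
    show "\<mu> (\<sigma> i) = \<mu> i" for i by (cases i) (simp add: \<sigma>_def \<mu>_def)
    show "(\<lambda>i. norm (\<mu> i)) summable_on UNIV"
    proof -
      have "(\<lambda>z. norm (case z of (k :: nat, a :: 2) \<Rightarrow> \<mu> (k, a))) summable_on (UNIV \<times> UNIV)"
      proof (rule abs_summable_product[where M = "\<lambda>k. norm y ^ k * 2"])
        fix k
        show "(\<lambda>a. norm (\<mu> (k, a))) summable_on UNIV"
          by (rule summable_on_finite) simp
        have "norm (y ^ Suc k / of_nat (Suc k)) \<le> norm y ^ k / 1"
          unfolding norm_divide norm_power norm_of_nat by (intro frac_le power_decreasing) (use y in auto)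
        then show "(\<Sum>\<^sub>\<infinity>a. norm (\<mu> (k, a))) \<le> norm y ^ k * 2"
          by (simp add: \<mu>_def)
      qed (intro geometric_summable_on, use y in auto)
      then show ?thesis by simp
    qed
    show "\<mu> i * norm_R x chi e (\<sigma> i) j = \<mu> j * norm_R x chi e (\<sigma> j) i" for i j
    proof -
      obtain k a l b where ij: "i = (k, a)" "j = (l, b)" by (cases i, cases j)
      define n where "n = Suc k + Suc l"
      have comb: "of_nat (upper_binomial k l) / of_nat (Suc k) = (of_nat (upper_binomial l k) / of_nat (Suc l) :: complex)"
      proof -
        have "of_nat (Suc l * upper_binomial k l) = (of_nat (Suc k * upper_binomial l k) :: complex)"
          by (simp only: upper_binomial_swap)
        then show ?thesis unfolding of_nat_mult by (simp add: frac_eq_eq mult.commute del: of_nat_Suc)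
      qed
      have pw: "y ^ Suc k * (of_real x ^ Suc k * (- chi / of_real x) ^ Suc l) = y ^ Suc l * (of_real x ^ Suc l * (- chi / of_real x) ^ Suc k)"
      proof -
        have "y * of_real x = - chi / of_real x" using x by (simp add: y_def power2_eq_square)
        then show ?thesis by (metis (no_types, lifting) mult.assoc mult.commute power_mult_distrib)
      qed
      \<comment> \<open>The sign of the off-diagonal entries depends on k alone. Exchanging k and l
        matters only for k + l odd, where the Eisenstein series vanishes.\<close>
      have sgn: "(-1) ^ Suc k * e n = (-1) ^ Suc l * e n"
      proof (cases "odd n")
        case False
        then have "even (Suc k) \<longleftrightarrow> even (Suc l)" by (simp add: n_def)
        then show ?thesis by (cases "even (Suc k)") (auto simp del: power_Suc)
      qed (simp add: e_odd)
      define w1 where "w1 = (if a = b then (-1) ^ Suc k * e n else (if b = 1 then (-1) ^ Suc l else (-1) ^ Suc k) * pi_fun e n)"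
      have 1: "norm_R x chi e (\<sigma> i) j = of_real x ^ Suc k * (- chi / of_real x) ^ Suc l * of_nat (upper_binomial k l) *
         (if a = b then (-1) ^ Suc k * e n else (if b = 1 then (-1) ^ Suc k else (-1) ^ Suc l) * pi_fun e n)"
        unfolding norm_R_def ij \<sigma>_def n_def using exhaust_2[of a] exhaust_2[of b] by (auto simp del: power_Suc)
      have 2: "norm_R x chi e (\<sigma> j) i = of_real x ^ Suc l * (- chi / of_real x) ^ Suc k * of_nat (upper_binomial l k) *
         (if a = b then (-1) ^ Suc k * e n else (if b = 1 then (-1) ^ Suc k else (-1) ^ Suc l) * pi_fun e n)"
        unfolding norm_R_def ij \<sigma>_def n_def using exhaust_2[of a] exhaust_2[of b] sgn[unfolded n_def]
        by (auto simp: add.commute[of l k] add.commute[of "Suc l" "Suc k"] simp del: power_Suc)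
      define W where "W = (if a = b then (-1) ^ Suc k * e n else (if b = 1 then (-1) ^ Suc k else (-1) ^ Suc l) * pi_fun e n)"
      have "\<mu> i * norm_R x chi e (\<sigma> i) j = (y ^ Suc k * (of_real x ^ Suc k * (- chi / of_real x) ^ Suc l)) * (of_nat (upper_binomial k l) / of_nat (Suc k)) * W"
        unfolding 1 W_def[symmetric] by (simp add: \<mu>_def ij del: power_Suc of_nat_Suc binomial_Suc_Suc)
      also have "\<dots> = \<mu> j * norm_R x chi e (\<sigma> j) i"
        unfolding 2 W_def[symmetric] pw comb by (simp add: \<mu>_def ij del: power_Suc of_nat_Suc binomial_Suc_Suc)
      finally show ?thesis .
    qed
  qed
  have "beta_row x chi e i = \<mu> i * beta_col x e (\<sigma> i)" for i
  proof -
    obtain k a where i: "i = (k, a)" by (cases i)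
    have "y * of_real x = - chi / of_real x" using x by (simp add: y_def power2_eq_square)
    then have "y ^ Suc k * of_real x ^ Suc k = (- chi / of_real x) ^ Suc k" by (metis power_mult_distrib)
    then show ?thesis using exhaust_2[of a]
      by (auto simp: beta_row_def beta_col_def \<mu>_def \<sigma>_def i simp del: power_Suc of_nat_Suc)
  qed
  then have "g_fun x chi e = (\<Sum>\<^sub>\<infinity>i. \<mu> i * indicator unit_set (\<sigma> i) * eta_vec x chi e i)"
    unfolding g_fun_def xi_vec_def eta_vec_def using adj by simp
  \<comment> \<open>The indicator only sees the first block, which \<sigma> preserves and where the
    weight is y.\<close>
  also have "\<dots> = (\<Sum>\<^sub>\<infinity>i\<in>unit_set. y * eta_vec x chi e i)"
  proof (rule infsum_cong_neutral)
    fix i show "i \<in> UNIV - unit_set \<Longrightarrow> \<mu> i * indicator unit_set (\<sigma> i) * eta_vec x chi e i = 0"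
      using exhaust_2[of "snd i"] by (cases i) (auto simp: unit_set_def \<sigma>_def)
    show "i \<in> UNIV \<inter> unit_set \<Longrightarrow> \<mu> i * indicator unit_set (\<sigma> i) * eta_vec x chi e i = y * eta_vec x chi e i"
      by (auto simp: unit_set_def \<sigma>_def \<mu>_def)
  qed simp
  also have "\<dots> = y * t_fun x chi e"
    by (simp add: t_fun_def unit_set_def distrib_left)
  finally show ?thesis by (simp add: y_def)
qed

end

section \<open>Degeneration at \<open>w = 0\<close> and modular transformation\<close>

lemma idx_infsum_fixed:
  assumes "\<And>l b. b \<noteq> a \<Longrightarrow> f (l, b) = 0"
  shows "(\<Sum>\<^sub>\<infinity>j. f j) = (\<Sum>\<^sub>\<infinity>l. f (l, a :: 2) :: complex)"
proof -
  have "(\<Sum>\<^sub>\<infinity>j. f j) = (\<Sum>\<^sub>\<infinity>j\<in>range (\<lambda>l. (l, a)). f j)"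
    by (rule infsum_cong_neutral) (use assms in auto)
  also have "\<dots> = (\<Sum>\<^sub>\<infinity>l. f (l, a))"
    by (subst infsum_reindex) (auto simp: inj_on_def o_def)
  finally show ?thesis .
qed

lemma idx_infsum_split:
  fixes f :: "idx \<Rightarrow> complex"
  assumes "(\<lambda>i. norm (f i)) summable_on UNIV"
  shows "(\<Sum>\<^sub>\<infinity>i. f i) = (\<Sum>\<^sub>\<infinity>l. f (l, 1) + f (l, 2))"
proof -
  have "f summable_on (UNIV \<times> UNIV)"
    using abs_summable_summable[OF assms] by simp
  then have "(\<Sum>\<^sub>\<infinity>i\<in>UNIV \<times> UNIV. f i) = (\<Sum>\<^sub>\<infinity>l. \<Sum>\<^sub>\<infinity>b. f (l, b))"
    using infsum_Sigma'_banach[of "\<lambda>l b. f (l, b)" UNIV "\<lambda>_. UNIV"] by (simp add: case_prod_unfold)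
  then show ?thesis by (simp add: sum_2)
qed

lemma pi_fun_zero [simp]: "pi_fun (\<lambda>_. 0) n = 1"
  by (simp add: pi_fun_def)

context period_params
begin

lemma xi_vec_bound: "good chi e \<Longrightarrow> norm (xi_vec x chi e i) \<le> 1 / (1 - \<theta>)"
  unfolding xi_vec_def by (rule norm_mat_solve_le[OF norm_R_row_contraction indicator_bound])

lemma eta_vec_bound: "good chi e \<Longrightarrow> norm (eta_vec x chi e i) \<le> 3 / (1 - \<theta>)"
  unfolding eta_vec_def by (rule norm_mat_solve_le[OF norm_R_row_contraction beta_col_bound])

lemma good_zero: "norm chi \<le> x\<^sup>2 \<Longrightarrow> good chi (\<lambda>_. 0)"
  using \<epsilon> by (simp add: good_def)

text \<open>\<zeta> is the smaller root of \<zeta> (1 - \<zeta>) = \<chi>. The principal root has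
  positive real part, so 1 - \<zeta> = (1 + q)/2 has modulus at least 1/2, and |\<zeta>| = |\<chi>|
  / |1 - \<zeta>| < 1/2.\<close>

lemma csqrt_root_facts:
  assumes chi: "norm chi < x\<^sup>2"
  defines "\<zeta> \<equiv> (1 - csqrt (1 - 4 * chi)) / 2"
  shows "\<zeta> * (1 - \<zeta>) = chi" "1 - \<zeta> \<noteq> 0" "norm (1 / (1 - \<zeta>)) \<le> 2" "norm \<zeta> < 1 / 2"
    "Re (csqrt (1 - 4 * chi)) > 0"
proof -
  define q where "q = csqrt (1 - 4 * chi)"
  have x2: "x\<^sup>2 < 1 / 4"
    using x power_strict_mono[of x "1/2" 2] by (simp add: power2_eq_square)
  have qq: "q * q = 1 - 4 * chi"
    using power2_csqrt[of "1 - 4 * chi"] by (simp add: q_def power2_eq_square)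
  show z: "\<zeta> * (1 - \<zeta>) = chi"
  proof -
    have "\<zeta> = (1 - q) / 2" by (simp add: \<zeta>_def q_def)
    then have "\<zeta> * (1 - \<zeta>) = (1 - q) / 2 * (1 - (1 - q) / 2)" by (simp only:)
    also have "\<dots> = (1 - q * q) / 4" by (simp add: field_simps)
    finally have "\<zeta> * (1 - \<zeta>) = (1 - q * q) / 4" .
    then show ?thesis by (simp add: qq)
  qed
  have "Re (1 - 4 * chi) > 0"
    using chi x2 abs_Re_le_cmod[of chi] by simp
  then show req: "Re (csqrt (1 - 4 * chi)) > 0"
  proof -
    have "Re q * Re q - Im q * Im q > 0"
      using \<open>Re (1 - 4 * chi) > 0\<close> unfolding qq[symmetric] by simp
    moreover have "Im q * Im q \<ge> 0" by simp
    ultimately have "Re q \<noteq> 0" by auto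
    then show ?thesis using csqrt_principal[of "1 - 4 * chi"] by (auto simp: q_def)
  qed
  have "1 \<le> Re (1 + q)" using req by (simp add: q_def)
  also have "\<dots> \<le> norm (1 + q)" by (rule complex_Re_le_cmod)
  finally have n: "norm (1 + q) \<ge> 1" .
  have e: "1 - \<zeta> = (1 + q) / 2" by (simp add: \<zeta>_def q_def field_simps)
  have n2: "norm (1 - \<zeta>) \<ge> 1 / 2" unfolding e norm_divide using n by simp
  then show nz: "1 - \<zeta> \<noteq> 0" by auto
  show b: "norm (1 / (1 - \<zeta>)) \<le> 2"
    using n2 nz by (simp add: norm_divide field_simps)
  have "\<zeta> = chi * (1 / (1 - \<zeta>))" using z nz by (simp add: field_simps)
  then have "norm \<zeta> = norm chi * norm (1 / (1 - \<zeta>))" by (metis norm_mult)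
  also have "\<dots> \<le> norm chi * 2" by (intro mult_left_mono b) simp
  also have "\<dots> < 1 / 2" using chi x2 by simp
  finally show "norm \<zeta> < 1 / 2" .
qed

text \<open>At \<open>e = 0\<close> the linear system has geometric sequences as solutions; their ratio solves
  \<open>\<zeta> (1 - \<zeta>) = \<chi>\<close>.\<close>
lemma
  assumes chi: "norm chi < x\<^sup>2" "chi \<noteq> 0"
  shows g_fun_zero: "1 - of_real x * g_fun x chi (\<lambda>_. 0) = csqrt (1 - 4 * chi)"
    and h_fun_zero: "chi * exp (- h_fun x chi (\<lambda>_. 0)) = f_chi chi"
proof -
  define \<zeta> where "\<zeta> = (1 - csqrt (1 - 4 * chi)) / 2"
  \<comment> \<open>The ratio of the solution in the first component. It satisfies (-\<chi>/x) y =
    \<zeta>, so that the rows become binomial series at \<zeta>.\<close>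
  define y where "y = - of_real x / (1 - \<zeta>)"
  have z: "\<zeta> * (1 - \<zeta>) = chi" "1 - \<zeta> \<noteq> 0" "norm (1 / (1 - \<zeta>)) \<le> 2" "norm \<zeta> < 1 / 2"
    using csqrt_root_facts[OF chi(1)] by (simp_all add: \<zeta>_def)
  have good: "good chi (\<lambda>_. 0)" by (rule good_zero) (use chi in simp)
  have xnz: "of_real x \<noteq> (0 :: complex)" using x by simp
  have yx: "(- chi / of_real x) * y = \<zeta>"
    using z(2) xnz by (simp add: y_def z(1)[symmetric])
  have ny: "norm y \<le> 1"
  proof -
    have "norm y = x * norm (1 / (1 - \<zeta>))" using x by (simp add: y_def norm_divide)
    also have "\<dots> \<le> 1 / 2 * 2" using x z(3) by (intro mult_mono) auto
    finally show ?thesis by simp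
  qed
  define \<eta> :: "idx \<Rightarrow> complex" where "\<eta> = (\<lambda>(k, a). if a = 1 then y ^ Suc k else - ((- y) ^ Suc k))"
  have eta: "eta_vec x chi (\<lambda>_. 0) = \<eta>"
    unfolding eta_vec_def
  proof (rule mat_solve_unique[OF norm_R_row_contraction[OF good] beta_col_bound[OF good]])
    show "norm (\<eta> j) \<le> 1" for j
      using ny by (cases j) (auto simp: \<eta>_def norm_power intro!: power_le_one simp del: power_Suc)
    fix i :: idx
    obtain k a where i: "i = (k, a)" by (cases i)
    have ub: "(\<Sum>\<^sub>\<infinity>l. of_nat (upper_binomial k l) * \<zeta> ^ Suc l) = 1 / (1 - \<zeta>) ^ Suc k - 1"
      by (rule infsumI, rule binomial_upper_series_complex) (use z(4) in simp)
    have app: "mat_app (norm_R x chi (\<lambda>_. 0)) \<eta> i = (\<Sum>\<^sub>\<infinity>l. norm_R x chi (\<lambda>_. 0) i (l, a) * \<eta> (l, a))"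
      unfolding mat_app_def by (rule idx_infsum_fixed) (auto simp: norm_R_def i)
    show "\<eta> i = beta_col x (\<lambda>_. 0) i + mat_app (norm_R x chi (\<lambda>_. 0)) \<eta> i"
    proof (cases "a = 1")
      case True
      have "norm_R x chi (\<lambda>_. 0) i (l, a) * \<eta> (l, a) = (- of_real x) ^ Suc k * (of_nat (upper_binomial k l) * \<zeta> ^ Suc l)" for l
        using True unfolding norm_R_def i \<eta>_def yx[symmetric] power_mult_distrib power_minus[of "of_real x"]
        by (simp del: power_Suc)
      then have "mat_app (norm_R x chi (\<lambda>_. 0)) \<eta> i = (- of_real x) ^ Suc k * (1 / (1 - \<zeta>) ^ Suc k - 1)"
        unfolding app by (simp only: infsum_cmult_right' ub)
      also have "\<dots> = y ^ Suc k - (- of_real x) ^ Suc k"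
        unfolding y_def power_divide by (simp add: right_diff_distrib del: power_Suc)
      finally show ?thesis
        using True by (simp add: \<eta>_def beta_col_def i power_minus[of "of_real x"] mult.commute del: power_Suc)
    next
      case False
      have "norm_R x chi (\<lambda>_. 0) i (l, a) * \<eta> (l, a) = - (of_real x ^ Suc k) * (of_nat (upper_binomial k l) * \<zeta> ^ Suc l)" for l
      proof -
        have "(-1) ^ Suc l * (- y) ^ Suc l = y ^ Suc l"
          unfolding power_mult_distrib[symmetric] by simp
        then have "(- chi / of_real x) ^ Suc l * ((-1) ^ Suc l * (- y) ^ Suc l) = \<zeta> ^ Suc l"
          unfolding yx[symmetric] power_mult_distrib by simp
        then show ?thesis using False unfolding norm_R_def i \<eta>_def
          by (simp del: power_Suc) (simp add: mult_ac del: power_Suc)?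
      qed
      then have "mat_app (norm_R x chi (\<lambda>_. 0)) \<eta> i = - (of_real x ^ Suc k) * (1 / (1 - \<zeta>) ^ Suc k - 1)"
        unfolding app by (simp only: infsum_cmult_right' ub)
      also have "\<dots> = of_real x ^ Suc k - (- y) ^ Suc k"
        unfolding y_def minus_divide_left minus_minus power_divide by (simp add: right_diff_distrib del: power_Suc)
      finally show ?thesis
        using False by (simp add: \<eta>_def beta_col_def i del: power_Suc)
    qed
  qed
  \<comment> \<open>Only \<eta> is solved for explicitly; g is read off from t by the adjoint
    relation.\<close>
  have "t_fun x chi (\<lambda>_. 0) = 2 * y"
    by (simp add: t_fun_def eta sum_unit_set \<eta>_def)
  then have "g_fun x chi (\<lambda>_. 0) = - chi / of_real x ^ 2 * (2 * y)"
    using g_fun_eq_t_fun[OF good _ chi] by simp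
  then have "of_real x * g_fun x chi (\<lambda>_. 0) = 2 * ((- chi / of_real x) * y)"
    using xnz by (simp add: power2_eq_square)
  then show "1 - of_real x * g_fun x chi (\<lambda>_. 0) = csqrt (1 - 4 * chi)"
    unfolding yx by (simp add: \<zeta>_def del: distrib_left_numeral right_diff_distrib_numeral)
  have sm: "(\<lambda>i. norm (beta_row x chi (\<lambda>_. 0) i * \<eta> i)) summable_on UNIV"
    by (rule norm_mult_bounded_summable(1)[OF beta_row_summable[OF good], of _ 1])
       (use ny in \<open>auto simp: \<eta>_def norm_power intro!: power_le_one simp del: power_Suc split: prod.split\<close>)
  have br: "beta_row x chi (\<lambda>_. 0) (l, 1) * \<eta> (l, 1) + beta_row x chi (\<lambda>_. 0) (l, 2) * \<eta> (l, 2) = - 2 * (\<zeta> ^ Suc l / of_nat (Suc l))" for l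
  proof -
    have 1: "(- chi / of_real x) ^ Suc l * y ^ Suc l = \<zeta> ^ Suc l"
      unfolding yx[symmetric] power_mult_distrib by simp
    have 2: "(-1) ^ Suc l * (- y) ^ Suc l = y ^ Suc l"
      unfolding power_mult_distrib[symmetric] by simp
    have "beta_row x chi (\<lambda>_. 0) (l, 2) * \<eta> (l, 2) = - ((- chi / of_real x) ^ Suc l * ((-1) ^ Suc l * (- y) ^ Suc l)) / of_nat (Suc l)"
      by (simp add: beta_row_def \<eta>_def del: power_Suc of_nat_Suc)
    also have "\<dots> = - (\<zeta> ^ Suc l / of_nat (Suc l))" unfolding 2 1 by simp
    finally have r2: "beta_row x chi (\<lambda>_. 0) (l, 2) * \<eta> (l, 2) = - (\<zeta> ^ Suc l / of_nat (Suc l))" .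
    have "beta_row x chi (\<lambda>_. 0) (l, 1) * \<eta> (l, 1) = - ((- chi / of_real x) ^ Suc l * y ^ Suc l) / of_nat (Suc l)"
      by (simp add: beta_row_def \<eta>_def del: power_Suc of_nat_Suc)
    then show ?thesis unfolding 1 r2 by simp
  qed
  have "h_fun x chi (\<lambda>_. 0) = (\<Sum>\<^sub>\<infinity>l. - 2 * (\<zeta> ^ Suc l / of_nat (Suc l)))"
    unfolding h_fun_def eta idx_infsum_split[OF sm] br ..
  \<comment> \<open>The logarithmic series, once for each component; exponentiated, it leads to
    f(\<chi>) = \<zeta> / (1 - \<zeta>).\<close>
  also have "\<dots> = 2 * Ln (1 - \<zeta>)"
  proof (rule infsumI, rule norm_summable_imp_has_sum)
    have "(\<lambda>n. (-1) ^ Suc n / of_nat n * (- \<zeta>) ^ n) sums Ln (1 + - \<zeta>)"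
      by (rule Ln_series) (use z(4) in simp)
    then have "(\<lambda>n. (-1) ^ Suc (Suc n) / of_nat (Suc n) * (- \<zeta>) ^ Suc n) sums Ln (1 - \<zeta>)"
      using sums_Suc_iff[of "\<lambda>n. (-1) ^ Suc n / of_nat n * (- \<zeta>) ^ n"] by simp
    moreover have "(-1) ^ Suc (Suc n) / of_nat (Suc n) * (- \<zeta>) ^ Suc n = - (\<zeta> ^ Suc n / of_nat (Suc n))" for n
    proof -
      have "(-1) ^ Suc n * (- \<zeta>) ^ Suc n = \<zeta> ^ Suc n"
        unfolding power_mult_distrib[symmetric] by simp
      then show ?thesis by (simp del: of_nat_Suc add: field_simps)
    qed
    ultimately have "(\<lambda>n. - (\<zeta> ^ Suc n / of_nat (Suc n))) sums Ln (1 - \<zeta>)" by (simp only:)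
    from sums_mult[OF this, of 2] show "(\<lambda>n. - 2 * (\<zeta> ^ Suc n / of_nat (Suc n))) sums (2 * Ln (1 - \<zeta>))"
      by (simp del: of_nat_Suc power_Suc)
    show "summable (\<lambda>n. norm (- 2 * (\<zeta> ^ Suc n / of_nat (Suc n))))"
    proof (rule summable_comparison_test'[of "\<lambda>n. 2 * norm \<zeta> ^ n" 0])
      show "summable (\<lambda>n. 2 * norm \<zeta> ^ n)"
        using z(4) by (intro summable_mult summable_geometric) simp
      fix n
      have "norm (\<zeta> ^ Suc n / of_nat (Suc n)) \<le> norm \<zeta> ^ n / 1"
        unfolding norm_divide norm_power norm_of_nat using z(4) by (intro frac_le power_decreasing) auto
      then show "norm (norm (- 2 * (\<zeta> ^ Suc n / of_nat (Suc n)))) \<le> 2 * norm \<zeta> ^ n"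
        unfolding norm_mult[of "- 2"] by simp
    qed
  qed
  finally have h: "h_fun x chi (\<lambda>_. 0) = 2 * Ln (1 - \<zeta>)" .
  have "exp (- h_fun x chi (\<lambda>_. 0)) = 1 / (1 - \<zeta>)\<^sup>2"
    unfolding h using z(2) by (simp add: exp_minus exp_double field_simps)
  then have "chi * exp (- h_fun x chi (\<lambda>_. 0)) = \<zeta> / (1 - \<zeta>)"
    using z(2) by (simp add: z(1)[symmetric] power2_eq_square)
  also have "\<dots> = \<zeta> / chi - 1"
  proof -
    have "\<zeta> \<noteq> 0" using z(1) chi(2) by auto
    then show ?thesis using z(2) by (simp add: z(1)[symmetric] field_simps)
  qed
  also have "\<dots> = f_chi chi" by (simp add: f_chi_def \<zeta>_def)
  finally show "chi * exp (- h_fun x chi (\<lambda>_. 0)) = f_chi chi" .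
qed

lemma infsum_beta_row_add:
  assumes good: "good chi e" and v: "\<And>i. norm (v i) \<le> C"
  shows "(\<Sum>\<^sub>\<infinity>i. (beta_row x chi e i + \<gamma> * indicator unit_set i) * v i)
    = (\<Sum>\<^sub>\<infinity>i. beta_row x chi e i * v i) + \<gamma> * (\<Sum>i\<in>unit_set. v i)"
proof -
  have s1: "(\<lambda>i. beta_row x chi e i * v i) summable_on UNIV"
    by (rule abs_summable_summable, rule norm_mult_bounded_summable(1)[OF beta_row_summable[OF good] v])
  have s2: "((\<lambda>i. \<gamma> * indicator unit_set i * v i) has_sum (\<Sum>i\<in>unit_set. \<gamma> * indicator unit_set i * v i)) UNIV"
    by (rule has_sum_finite_neutralI[of unit_set]) (auto simp: unit_set_def)
  have "(\<Sum>\<^sub>\<infinity>i. (beta_row x chi e i + \<gamma> * indicator unit_set i) * v i)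
     = (\<Sum>\<^sub>\<infinity>i. beta_row x chi e i * v i) + (\<Sum>\<^sub>\<infinity>i. \<gamma> * indicator unit_set i * v i)"
    unfolding distrib_right by (rule infsum_add[OF s1 has_sum_imp_summable[OF s2]])
  also have "(\<Sum>\<^sub>\<infinity>i. \<gamma> * indicator unit_set i * v i) = \<gamma> * (\<Sum>i\<in>unit_set. v i)"
    using infsumI[OF s2] by (simp add: sum_distrib_left)
  finally show ?thesis .
qed

text \<open>A modular transformation changes only \<open>e 2\<close>, because of the quasi-modularity of \<open>E\<^sub>2\<close>.  This
  perturbs the matrix by a matrix of rank one.\<close>
lemma
  assumes good: "good chi e" and good': "good chi e'" and e_odd: "\<And>m. odd m \<Longrightarrow> e m = 0"
    and chi: "norm chi < x\<^sup>2" "chi \<noteq> 0"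
    and e': "\<And>m. m \<noteq> 2 \<Longrightarrow> e' m = e m" "e' 2 = e 2 - \<kappa>"
  defines "D \<equiv> 1 + chi * \<kappa> * s_fun x chi e"
  shows modular_change_nonzero: "D \<noteq> 0"
    and modular_change_s: "s_fun x chi e' = s_fun x chi e / D"
    and modular_change_g: "1 - of_real x * g_fun x chi e' = (1 - of_real x * g_fun x chi e) / D"
    and modular_change_h: "h_fun x chi e' = h_fun x chi e - \<kappa> + \<kappa> * (1 - of_real x * g_fun x chi e)\<^sup>2 / D"
proof -
  have xnz: "of_real x \<noteq> (0 :: complex)" using x by simp
  have pi': "pi_fun e' n = pi_fun e n - (-1) ^ n * of_nat (1 choose (n - 1)) * \<kappa>" for n
  proof (cases n)
    case 0
    then have "(\<Sum>\<^sub>\<infinity>p. of_nat (p choose 0) * e' (Suc p)) = (\<Sum>\<^sub>\<infinity>p. of_nat (p choose 0) * e (Suc p)) - \<kappa>"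
    proof -
      have s: "(\<lambda>p. of_nat (p choose 0) * e (Suc p)) summable_on UNIV"
        by (rule abs_summable_summable[OF good_pi_fun_summable[OF good]])
      have k: "((\<lambda>p. if p = Suc 0 then \<kappa> else 0) has_sum (\<Sum>p\<in>{Suc 0}. if p = Suc 0 then \<kappa> else 0)) UNIV"
        by (rule has_sum_finite_neutralI[of "{1}"]) auto
      have "of_nat (p choose 0) * e' (Suc p) = of_nat (p choose 0) * e (Suc p) - (if p = Suc 0 then \<kappa> else 0)" for p
        using e' by (cases "p = 1") (auto simp: numeral_2_eq_2)
      then show ?thesis
        using infsum_diff_complex[OF s has_sum_imp_summable[OF k]] infsumI[OF k] by simp
    qed
    then show ?thesis using 0 by (simp add: pi_fun_def)
  next
    case (Suc n')
    have s: "(\<lambda>p. of_nat (p choose n') * e (Suc p)) summable_on UNIV"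
      by (rule abs_summable_summable[OF good_pi_fun_summable[OF good]])
    have k: "((\<lambda>p. if p = Suc 0 then of_nat (1 choose n') * \<kappa> else 0) has_sum (\<Sum>p\<in>{Suc 0}. if p = Suc 0 then of_nat (1 choose n') * \<kappa> else 0)) UNIV"
      by (rule has_sum_finite_neutralI[of "{1}"]) auto
    have "of_nat (p choose n') * e' (Suc p) = of_nat (p choose n') * e (Suc p) - (if p = Suc 0 then of_nat (1 choose n') * \<kappa> else 0)" for p
      using e'(1) e'(2)[unfolded numeral_2_eq_2] by (cases "p = Suc 0") (auto simp: right_diff_distrib)
    then have "(\<Sum>\<^sub>\<infinity>p. of_nat (p choose n') * e' (Suc p)) = (\<Sum>\<^sub>\<infinity>p. of_nat (p choose n') * e (Suc p)) - of_nat (1 choose n') * \<kappa>"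
      using infsum_diff_complex[OF s has_sum_imp_summable[OF k]] infsumI[OF k] by simp
    then show ?thesis
      unfolding pi_fun_def Suc diff_Suc_1 by (simp add: right_diff_distrib mult.assoc del: power_Suc)
  qed
  \<comment> \<open>The coefficient 1 choose (n - 1) vanishes for n > 2, so only pi_1 and pi_2 feel
    the change of e_2. It cancels in pi_2 - e_2, so both \<beta> vectors change in the first block
    only.\<close>
  have pi1: "pi_fun e' 1 = pi_fun e 1 + \<kappa>" and pi2: "pi_fun e' 2 = pi_fun e 2 - \<kappa>"
    and pi3: "n > 2 \<Longrightarrow> pi_fun e' n = pi_fun e n" for n
    using pi'[of 1] pi'[of 2] pi'[of n] by (auto simp: binomial_eq_0)
  have unit: "indicator unit_set (k, a) = (if k = 0 then 1 else 0 :: complex)" for k a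
    using exhaust_2[of a] by (auto simp: unit_set_def indicator_def)
  \<comment> \<open>All four entries of the (1, 1) block change by this number, the diagonal ones
    through pi_2 and the others through e_2; hence rank one.\<close>
  define l where "l = - chi * \<kappa>"
  have rank: "norm_R x chi e' i j = norm_R x chi e i j + l * indicator unit_set i * indicator unit_set j" for i j
  proof -
    obtain k a k' b where ij: "i = (k, a)" "j = (k', b)" by (cases i, cases j)
    show ?thesis
    proof (cases "k = 0 \<and> k' = 0")
      case True
      have two: "Suc 0 + Suc 0 = 2" by simp
      show ?thesis
        using True xnz unfolding ij norm_R_def prod.case unit l_def True[THEN conjunct1] True[THEN conjunct2] two e'(2) pi2
        by (auto simp: upper_binomial_def algebra_simps)
    next
      case False
      then have "Suc k + Suc k' > 2" by linarith
      then show ?thesis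
        using False pi3[of "Suc k + Suc k'"] e'(1)[of "Suc k + Suc k'"] unfolding ij norm_R_def prod.case unit by auto
    qed
  qed
  have col: "beta_col x e' = (\<lambda>i. beta_col x e i - (of_real x * \<kappa>) * indicator unit_set i)"
  proof
    fix i :: idx
    obtain k a where i: "i = (k, a)" by (cases i)
    consider "k = 0" | "k = 1" | "k > 1" by linarith
    then show "beta_col x e' i = beta_col x e i - (of_real x * \<kappa>) * indicator unit_set i"
    proof cases
      case 1
      then show ?thesis using pi1 e'(1)[of 1] unfolding i beta_col_def prod.case unit by (auto simp: algebra_simps)
    next
      case 2
      then have "Suc k = 2" by simp
      then show ?thesis using 2 pi2[unfolded numeral_2_eq_2] e'(2)[unfolded numeral_2_eq_2] unfolding i beta_col_def prod.case unit by simp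
    next
      case 3
      then show ?thesis using pi3[of "Suc k"] e'(1)[of "Suc k"] unfolding i beta_col_def prod.case unit by auto
    qed
  qed
  define \<gamma> where "\<gamma> = chi * \<kappa> / of_real x"
  have row: "beta_row x chi e' = (\<lambda>i. beta_row x chi e i + \<gamma> * indicator unit_set i)"
  proof
    fix i :: idx
    obtain k a where i: "i = (k, a)" by (cases i)
    consider "k = 0" | "k = 1" | "k > 1" by linarith
    then show "beta_row x chi e' i = beta_row x chi e i + \<gamma> * indicator unit_set i"
    proof cases
      case 1
      then show ?thesis using pi1 e'(1)[of 1] xnz unfolding i beta_row_def prod.case unit \<gamma>_def by (auto simp: field_simps)
    next
      case 2
      then have "Suc k = 2" by simp
      then show ?thesis using 2 pi2[unfolded numeral_2_eq_2] e'(2)[unfolded numeral_2_eq_2] unfolding i beta_row_def prod.case unit by simp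
    next
      case 3
      then show ?thesis using pi3[of "Suc k"] e'(1)[of "Suc k"] unfolding i beta_row_def prod.case unit by auto
    qed
  qed
  note RC = norm_R_row_contraction[OF good] norm_R_row_contraction[OF good']
  have fin: "finite unit_set" "unit_set \<noteq> {}" by (auto simp: unit_set_def)
  note SM = sherman_morrison[OF RC fin rank] and SMnz = sherman_morrison_nonzero[OF RC fin rank]
  have Dl: "1 - l * (\<Sum>j\<in>unit_set. mat_solve (norm_R x chi e) (indicator unit_set) j) = D"
    by (simp add: D_def l_def s_fun_def xi_vec_def)
  show D: "D \<noteq> 0" using SMnz unfolding Dl .
  define s g h t where "s = s_fun x chi e" and "g = g_fun x chi e" and "h = h_fun x chi e" and "t = t_fun x chi e"
  have D_eq: "D = 1 - l * s" by (simp add: D_def l_def s_def)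
  have xi': "xi_vec x chi e' i = xi_vec x chi e i / D" for i
  proof -
    have "xi_vec x chi e' i = xi_vec x chi e i + l * s / D * xi_vec x chi e i"
      using SM[where c = "indicator unit_set" and C = 1 and \<alpha> = 0 and i = i, OF indicator_bound] unfolding Dl
      by (simp add: xi_vec_def s_def s_fun_def)
    also have "\<dots> = xi_vec x chi e i / D"
      using D by (simp add: D_eq field_simps)
    finally show ?thesis .
  qed
  show s': "s_fun x chi e' = s_fun x chi e / D"
    by (simp add: s_fun_def xi' sum_divide_distrib)
  define \<mu> where "\<mu> = (l * t - of_real x * \<kappa>) / D"
  have eta': "eta_vec x chi e' i = eta_vec x chi e i + \<mu> * xi_vec x chi e i" for i
    using SM[where c = "beta_col x e" and C = 3 and \<alpha> = "of_real x * \<kappa>" and i = i, OF beta_col_bound[OF good]] unfolding Dl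
    by (simp add: eta_vec_def col xi_vec_def \<mu>_def t_def t_fun_def)
  have g': "g_fun x chi e' = (g + \<gamma> * s) / D"
  proof -
    have "g_fun x chi e' = (\<Sum>\<^sub>\<infinity>i. (beta_row x chi e i + \<gamma> * indicator unit_set i) * xi_vec x chi e i * (1 / D))"
      unfolding g_fun_def row xi' by simp
    also have "\<dots> = (g + \<gamma> * s) * (1 / D)"
      unfolding infsum_cmult_left' infsum_beta_row_add[OF good xi_vec_bound[OF good]] g_def g_fun_def s_def s_fun_def ..
    finally show ?thesis by simp
  qed
  have xg: "of_real x * \<gamma> = - l" using xnz by (simp add: \<gamma>_def l_def)
  have "1 - of_real x * g_fun x chi e' = (D - (of_real x * g + (of_real x * \<gamma>) * s)) / D"
    unfolding g' using D by (simp add: field_simps)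
  also have "\<dots> = (1 - of_real x * g) / D"
    unfolding xg D_eq by simp
  finally show "1 - of_real x * g_fun x chi e' = (1 - of_real x * g_fun x chi e) / D"
    by (simp add: g_def)
  have h': "h_fun x chi e' = h + \<mu> * g + \<gamma> * (t + \<mu> * s)"
  proof -
    have b: "norm (eta_vec x chi e i + \<mu> * xi_vec x chi e i) \<le> 3 / (1 - \<theta>) + norm \<mu> * (1 / (1 - \<theta>))" for i
      by (rule order_trans[OF norm_triangle_ineq])
         (auto simp: norm_mult intro!: add_mono eta_vec_bound[OF good] mult_left_mono xi_vec_bound[OF good] simp del: mult_1_right times_divide_eq_right)
    have s1: "(\<lambda>i. beta_row x chi e i * eta_vec x chi e i) summable_on UNIV"
      by (rule abs_summable_summable, rule norm_mult_bounded_summable(1)[OF beta_row_summable[OF good] eta_vec_bound[OF good]])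
    have s2: "(\<lambda>i. \<mu> * (beta_row x chi e i * xi_vec x chi e i)) summable_on UNIV"
      by (intro summable_on_cmult_right abs_summable_summable[OF norm_mult_bounded_summable(1)[OF beta_row_summable[OF good] xi_vec_bound[OF good]]])
    have "h_fun x chi e' = (\<Sum>\<^sub>\<infinity>i. beta_row x chi e i * (eta_vec x chi e i + \<mu> * xi_vec x chi e i))
        + \<gamma> * (\<Sum>i\<in>unit_set. eta_vec x chi e i + \<mu> * xi_vec x chi e i)"
      unfolding h_fun_def row eta' by (rule infsum_beta_row_add[OF good b])
    also have "(\<Sum>\<^sub>\<infinity>i. beta_row x chi e i * (eta_vec x chi e i + \<mu> * xi_vec x chi e i)) = h + \<mu> * g"
      using infsum_add[OF s1 s2] by (simp add: h_def h_fun_def g_def g_fun_def infsum_cmult_right' algebra_simps)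
    also have "(\<Sum>i\<in>unit_set. eta_vec x chi e i + \<mu> * xi_vec x chi e i) = t + \<mu> * s"
      by (simp add: sum.distrib t_def t_fun_def s_def s_fun_def sum_distrib_left)
    finally show ?thesis .
  qed
  \<comment> \<open>The adjoint relation eliminates t, which turns the cross terms of the new h into
    the square of 1 - x g.\<close>
  have gt: "of_real x * (of_real x * g) = - chi * t"
    using g_fun_eq_t_fun[OF good e_odd chi] xnz by (simp add: g_def t_def power2_eq_square field_simps)
  define X where "X = (of_real x :: complex)"
  have ct: "chi * t = - (X * (X * g))" using gt by (simp add: X_def)
  have "l * t = - \<kappa> * (chi * t)" by (simp add: l_def)
  then have "l * t = \<kappa> * X * (X * g)" unfolding ct by simp
  then have \<mu>D: "\<mu> * D = - \<kappa> * X * (1 - X * g)"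
  proof -
    have "\<mu> * D = l * t - X * \<kappa>" using D by (simp add: \<mu>_def X_def)
    then show ?thesis using \<open>l * t = \<kappa> * X * (X * g)\<close> by (simp add: algebra_simps)
  qed
  have \<gamma>t: "\<gamma> * t = - \<kappa> * (X * g)"
  proof -
    have "\<gamma> * t = \<kappa> * (chi * t) / X" by (simp add: \<gamma>_def X_def)
    then show ?thesis unfolding ct using xnz by (simp add: X_def)
  qed
  have \<gamma>s: "X * (\<gamma> * s) = D - 1"
    unfolding mult.assoc[symmetric] X_def xg D_eq by simp
  have "X * (h_fun x chi e' * D) = X * ((h - \<kappa>) * D + \<kappa> * (1 - X * g)\<^sup>2)"
  proof -
    have "X * (h_fun x chi e' * D) = X * h * D + X * g * (\<mu> * D) + X * (\<gamma> * t) * D + (X * (\<gamma> * s)) * (\<mu> * D)"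
      unfolding h' by (simp add: algebra_simps)
    also have "\<dots> = X * ((h - \<kappa>) * D + \<kappa> * (1 - X * g)\<^sup>2)"
      unfolding \<mu>D \<gamma>t \<gamma>s by (simp add: algebra_simps power2_eq_square)
    finally show ?thesis .
  qed
  then have "h_fun x chi e' * D = (h - \<kappa>) * D + \<kappa> * (1 - X * g)\<^sup>2"
    using xnz by (simp add: X_def)
  then have "h_fun x chi e' = ((h - \<kappa>) * D + \<kappa> * (1 - X * g)\<^sup>2) / D"
    using D by (simp add: eq_divide_eq)
  then show "h_fun x chi e' = h_fun x chi e - \<kappa> + \<kappa> * (1 - of_real x * g_fun x chi e)\<^sup>2 / D"
    using D by (simp add: add_divide_distrib X_def g_def h_def)
qed

section \<open>Holomorphic dependence on parameters\<close>

context
  fixes N :: "c3 set" and e :: "c3 \<Rightarrow> nat \<Rightarrow> complex" and chi :: "c3 \<Rightarrow> complex"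
  assumes N: "open N" and hol_e: "\<And>m. sep_hol N (\<lambda>p. e p m)" and hol_chi: "sep_hol N chi"
    and good: "\<And>p. p \<in> N \<Longrightarrow> good (chi p) (e p)"
begin

lemma sep_hol_pi_fun: "sep_hol N (\<lambda>p. pi_fun (e p) (Suc n))"
proof -
  have "sep_hol N (\<lambda>p. \<Sum>\<^sub>\<infinity>m. of_nat (m choose n) * e p (Suc m))"
    by (rule sep_hol_infsum[OF N _ _ has_sum_imp_summable[OF pi_fun_majorant[of n]]])
       (use good hol_e in \<open>auto simp: good_def norm_mult intro!: mult_left_mono simp del: power_Suc\<close>)
  then show ?thesis unfolding pi_fun_def diff_Suc_1 by (intro sep_hol_add sep_hol_mult sep_hol_const)
qed

lemma sep_hol_norm_R: "sep_hol N (\<lambda>p. norm_R x (chi p) (e p) i j)"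
proof -
  obtain k a l b where ij: "i = (k, a)" "j = (l, b)" by (cases i, cases j)
  have pf: "sep_hol N (\<lambda>p. pi_fun (e p) (Suc k + Suc l))"
    using sep_hol_pi_fun[of "k + Suc l"] by simp
  show ?thesis
    unfolding norm_R_def ij prod.case
    by (cases "a = b") (use pf hol_e hol_chi in \<open>auto intro!: sep_hol_mult sep_hol_power sep_hol_minus sep_hol_divide_const simp del: power_Suc add_Suc\<close>)
qed

lemma sep_hol_beta_col: "sep_hol N (\<lambda>p. beta_col x (e p) i)"
  by (cases i) (use hol_e in \<open>auto simp: beta_col_def intro!: sep_hol_mult sep_hol_diff sep_hol_pi_fun simp del: power_Suc\<close>)

lemma sep_hol_beta_row: "sep_hol N (\<lambda>p. beta_row x (chi p) (e p) i)"
  by (cases i) (use hol_e hol_chi in \<open>auto simp: beta_row_def intro!: sep_hol_mult sep_hol_diff sep_hol_pi_fun sep_hol_power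
      sep_hol_divide_const sep_hol_minus simp del: power_Suc of_nat_Suc\<close>)

lemma sep_hol_xi_vec: "sep_hol N (\<lambda>p. xi_vec x (chi p) (e p) i)"
  unfolding xi_vec_def
  by (rule sep_hol_mat_solve[OF N sep_hol_norm_R norm_R_le_maj maj_row \<theta>_bounds, where C = 1])
     (use good indicator_bound in auto)

lemma sep_hol_eta_vec: "sep_hol N (\<lambda>p. eta_vec x (chi p) (e p) i)"
  unfolding eta_vec_def
  by (rule sep_hol_mat_solve[OF N sep_hol_norm_R norm_R_le_maj maj_row \<theta>_bounds sep_hol_beta_col beta_col_bound])
     (use good in auto)

lemma sep_hol_s_fun: "sep_hol N (\<lambda>p. s_fun x (chi p) (e p))"
  unfolding s_fun_def by (intro sep_hol_sum sep_hol_xi_vec)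

lemma sep_hol_row_pairing:
  assumes v: "\<And>i. sep_hol N (\<lambda>p. v p i)" "\<And>p i. p \<in> N \<Longrightarrow> norm (v p i) \<le> C" and C: "C \<ge> 0"
  shows "sep_hol N (\<lambda>p. \<Sum>\<^sub>\<infinity>i. beta_row x (chi p) (e p) i * v p i)"
proof (rule sep_hol_infsum[OF N])
  show "(\<lambda>i. (case i of (k, a :: 2) \<Rightarrow> x ^ Suc k * 3) * C) summable_on UNIV"
    by (rule summable_on_cmult_left[OF geometric_idx_summable])
  show "norm (beta_row x (chi p) (e p) i * v p i) \<le> (case i of (k, a) \<Rightarrow> x ^ Suc k * 3) * C" if "p \<in> N" for i p
    unfolding norm_mult using beta_row_bound[OF good[OF that]] v(2)[OF that] x
    by (cases i) (auto intro!: mult_mono simp del: power_Suc)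
qed (intro sep_hol_mult sep_hol_beta_row v)

lemma sep_hol_g_fun: "sep_hol N (\<lambda>p. g_fun x (chi p) (e p))"
  unfolding g_fun_def
  by (rule sep_hol_row_pairing[OF sep_hol_xi_vec xi_vec_bound[OF good]]) (use \<theta>_bounds in auto)

lemma sep_hol_h_fun: "sep_hol N (\<lambda>p. h_fun x (chi p) (e p))"
  unfolding h_fun_def
  by (rule sep_hol_row_pairing[OF sep_hol_eta_vec eta_vec_bound[OF good]]) (use \<theta>_bounds in auto)

end

end

section \<open>Entries of the period matrix\<close>

lemma has_sum_matrix:
  fixes f :: "'i \<Rightarrow> complex^2^2"
  assumes "\<And>a b. ((\<lambda>i. f i $ a $ b) has_sum S $ a $ b) A"
  shows "(f has_sum S) A"
  using assms unfolding has_sum_def by (intro vec_tendstoI) (simp add: sum_component)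

lemma has_sum_vector:
  fixes f :: "'i \<Rightarrow> complex^2"
  assumes "\<And>a. ((\<lambda>i. f i $ a) has_sum S $ a) A"
  shows "(f has_sum S) A"
  using assms unfolding has_sum_def by (intro vec_tendstoI) (simp add: sum_component)

lemma sums_matrix:
  fixes f :: "nat \<Rightarrow> complex^2^2"
  assumes "\<And>a b. (\<lambda>i. f i $ a $ b) sums (S $ a $ b)"
  shows "f sums S"
  using assms unfolding sums_def by (intro vec_tendstoI) (simp add: sum_component)

lemma has_sum_atLeast_1:
  "((\<lambda>k. f (Suc k)) has_sum S) UNIV \<Longrightarrow> (f has_sum S) {1..}"
proof -
  assume "((\<lambda>k. f (Suc k)) has_sum S) UNIV"
  moreover have "bij_betw Suc UNIV {1..}"
    by (rule bij_betwI[where g = "\<lambda>n. n - 1"]) auto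
  ultimately show ?thesis using has_sum_reindex_bij_betw[of Suc UNIV "{1..}" f S] by simp
qed

lemma idx_has_sum:
  fixes f :: "idx \<Rightarrow> complex"
  assumes "(\<lambda>i. norm (f i)) summable_on UNIV"
  shows "((\<lambda>k. \<Sum>b\<in>UNIV. f (k, b)) has_sum (\<Sum>\<^sub>\<infinity>i. f i)) UNIV"
proof -
  have "(f has_sum (\<Sum>\<^sub>\<infinity>i. f i)) (UNIV \<times> UNIV)"
    using has_sum_infsum[OF abs_summable_summable[OF assms]] by simp
  then show ?thesis
    by (rule has_sum_SigmaD) (auto intro: has_sum_finite)
qed

text \<open>A point off w = 0 at which the expansions at 0 may be evaluated: the open disc of radius
  2 |w| meets the lattice only in 0.\<close>

locale period_point = period_params +
  fixes \<tau> w chi :: complex and e :: "nat \<Rightarrow> complex"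
  assumes \<tau>: "Im \<tau> > 0" and w: "w \<noteq> 0" and chi: "norm chi < x\<^sup>2" "chi \<noteq> 0"
    and lattice: "\<And>l. l \<in> Lam \<tau> \<Longrightarrow> l \<noteq> 0 \<Longrightarrow> 2 * norm w \<le> norm l"
    and e_def: "e = (\<lambda>m. if m = 0 then 0 else eisenstein m \<tau> * w ^ m)" and good: "good chi e"
begin

lemma eps_le: "\<epsilon> \<le> 1 / 4"
  using E_bounds by linarith

text \<open>Doubling |w| is affordable since 2 \<epsilon> <= 1; it puts w strictly inside the disc
  of convergence.\<close>

lemma eisenstein_radius: "norm (eisenstein (k + 2) \<tau>) * (2 * norm w) ^ (k + 2) \<le> 1"
proof -
  have "norm (eisenstein (k + 2) \<tau>) * norm w ^ (k + 2) \<le> \<epsilon> ^ (k + 2)"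
    using good[unfolded good_def, THEN conjunct1, THEN spec[of _ "Suc k"]] by (simp add: e_def norm_mult norm_power)
  then have "2 ^ (k + 2) * (norm (eisenstein (k + 2) \<tau>) * norm w ^ (k + 2)) \<le> 2 ^ (k + 2) * \<epsilon> ^ (k + 2)"
    by (rule mult_left_mono) simp
  also have "\<dots> = (2 * \<epsilon>) ^ (k + 2)" by (simp only: power_mult_distrib)
  also have "\<dots> \<le> 1" using eps_le \<epsilon> by (intro power_le_one) auto
  finally show ?thesis by (simp only: power_mult_distrib mult_ac)
qed

lemma P_pi_fun: "P (Suc n) \<tau> w * w ^ Suc n = pi_fun e (Suc n)"
proof -
  have "P (Suc n) \<tau> w * w ^ Suc n = 1 - (-1) ^ n * (\<Sum>p. of_nat (p choose n) * e (Suc p))"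
    using P_eq[OF \<tau> _ eisenstein_radius lattice, of w n] w by (simp add: e_def)
  also have "(\<Sum>p. of_nat (p choose n) * e (Suc p)) = (\<Sum>\<^sub>\<infinity>p. of_nat (p choose n) * e (Suc p))"
    using has_sum_imp_sums[OF has_sum_infsum[OF abs_summable_summable[OF good_pi_fun_summable[OF good]]]]
    by (rule sums_unique[symmetric])
  finally show ?thesis by (simp add: pi_fun_def)
qed

lemma K_value: "K \<tau> w = w * exp (- eis_log_series \<tau> w)"
  by (rule K_eq[OF \<tau> _ eisenstein_radius]) (use w in auto)

definition \<rho> where "\<rho> = - w\<^sup>2 * chi"
definition r where "r = csqrt \<rho>"
definition d :: "nat \<Rightarrow> complex" where "d k = of_real (sqrt (real k)) * (of_real x * w / r) ^ k"

lemma r_facts: "r \<noteq> 0" "r * r = \<rho>" "(- chi / of_real x) * (of_real x * w / r) = r / w" "of_real x \<noteq> (0 :: complex)"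
proof -
  show xnz: "of_real x \<noteq> (0 :: complex)" using x by simp
  show rr: "r * r = \<rho>"
    using power2_csqrt[of \<rho>] by (simp add: r_def power2_eq_square)
  then show rnz: "r \<noteq> 0" using w chi by (auto simp: \<rho>_def)
  have "(- chi * w) * w = r * r" unfolding rr by (simp add: \<rho>_def power2_eq_square)
  then have "((- chi * w) * w) / (r * w) = (r * r) / (r * w)" by simp
  then have "- chi * w / r = r / w" using rnz w by simp
  then show "(- chi / of_real x) * (of_real x * w / r) = r / w" using xnz by simp
qed

lemma d_nonzero: "d (Suc k) \<noteq> 0"
  using r_facts w by (simp add: d_def)

lemma sqrt_Suc: "of_real (sqrt (real (Suc k))) * of_real (sqrt (real (Suc k))) = (of_nat (Suc k) :: complex)"
  unfolding of_real_mult[symmetric] by (simp del: of_nat_Suc)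

text \<open>All four entries of a block in one computation: the sign is a parameter and Y stands for
  E_(K+L) or P_(K+L). The weights and the diagonal factors combine to (r/w)^(K+L), which together
  with w^(K+L) restores r^(K+L).\<close>

lemma R_entry:
  "- (r ^ (Suc k + Suc l)) / of_real (sqrt (real (Suc k * Suc l))) *
      (\<sigma> * fact (Suc k + Suc l - 1) / (fact (Suc k - 1) * fact (Suc l - 1)) * Y)
    = of_real x ^ Suc k * (- chi / of_real x) ^ Suc l * of_nat (upper_binomial k l) * (- \<sigma> * (Y * w ^ (Suc k + Suc l))) * d (Suc l) / d (Suc k)"
proof -
  define sk where "sk = complex_of_real (sqrt (real (Suc k)))"
  define sl where "sl = complex_of_real (sqrt (real (Suc l)))"
  have sknz: "sk \<noteq> 0" "sl \<noteq> 0" by (auto simp: sk_def sl_def)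
  have sl2: "sl * sl = of_nat (Suc l)" unfolding sl_def by (rule sqrt_Suc)
  have ub: "of_nat (upper_binomial k l) = (fact (Suc (k + l)) / (fact (Suc l) * fact k) :: complex)"
    using binomial_fact[of "Suc l" "k + Suc l", where 'a = complex] by (simp add: upper_binomial_def del: fact_Suc binomial_Suc_Suc)
  have 1: "(- chi / of_real x) ^ Suc l * (of_real x * w / r) ^ Suc l = (r / w) ^ Suc l"
    unfolding power_mult_distrib[symmetric] r_facts(3) ..
  have "of_real x / (of_real x * w / r) = r / w" using r_facts w by simp
  then have 2: "of_real x ^ Suc k / (of_real x * w / r) ^ Suc k = (r / w) ^ Suc k"
    unfolding power_divide[symmetric] by simp
  have "of_real x ^ Suc k * (- chi / of_real x) ^ Suc l * of_nat (upper_binomial k l) * (- \<sigma> * (Y * w ^ (Suc k + Suc l))) * d (Suc l) / d (Suc k)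
     = ((- chi / of_real x) ^ Suc l * (of_real x * w / r) ^ Suc l) * (of_real x ^ Suc k / (of_real x * w / r) ^ Suc k)
        * of_nat (upper_binomial k l) * (- \<sigma> * (Y * w ^ (Suc k + Suc l))) * (sl / sk)"
    unfolding d_def sk_def[symmetric] sl_def[symmetric] by (simp only: times_divide_eq_left times_divide_eq_right divide_divide_eq_left mult_ac)
  also have "\<dots> = (r / w) ^ (Suc k + Suc l) * w ^ (Suc k + Suc l) * (of_nat (upper_binomial k l) * (- \<sigma> * Y) * (sl / sk))"
    unfolding 1 2 power_add by (simp only: mult_ac)
  also have "(r / w) ^ (Suc k + Suc l) * w ^ (Suc k + Suc l) = r ^ (Suc k + Suc l)"
    unfolding power_mult_distrib[symmetric] using w by simp
  also have "of_nat (upper_binomial k l) * (- \<sigma> * Y) * (sl / sk) = - (\<sigma> * fact (Suc (k + l)) / (fact k * fact l) * Y / (sk * sl))"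
  proof -
    have "sl / of_nat (Suc l) = 1 / sl" unfolding sl2[symmetric] using sknz by simp
    moreover have "of_nat (upper_binomial k l) * (- \<sigma> * Y) * (sl / sk) = - (\<sigma> * fact (Suc (k + l)) / (fact k * fact l) * Y / sk * (sl / of_nat (Suc l)))"
      unfolding ub fact_Suc[of l] by (simp add: field_simps del: of_nat_Suc fact_Suc)
    ultimately show ?thesis by simp
  qed
  finally show ?thesis
    unfolding of_nat_mult real_sqrt_mult of_real_mult sk_def[symmetric] sl_def[symmetric] by (simp del: fact_Suc power_Suc)
qed

lemma R_norm_R:
  "R \<tau> w \<rho> (Suc k) (Suc l) $ a $ b = norm_R x chi e (k, a) (l, b) * d (Suc l) / d (Suc k)"
proof -
  define c where "c = - (r ^ (Suc k + Suc l)) / of_real (sqrt (real (Suc k * Suc l)))"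
  define Z where "Z = of_real x ^ Suc k * (- chi / of_real x) ^ Suc l * of_nat (upper_binomial k l)"
  have CCe: "c * CC (Suc k) (Suc l) \<tau> = Z * ((-1) ^ Suc k * e (Suc k + Suc l)) * d (Suc l) / d (Suc k)"
    using R_entry[of k l "(-1) ^ (Suc k + 1)" "eisenstein (Suc k + Suc l) \<tau>"]
    unfolding c_def Z_def CC_def e_def by (simp del: fact_Suc)
  have pp: "P (Suc k + Suc l) \<tau> w * w ^ (Suc k + Suc l) = pi_fun e (Suc k + Suc l)"
    using P_pi_fun[of "k + Suc l"] by simp
  have DD1: "c * DD (Suc k) (Suc l) \<tau> w = Z * ((-1) ^ Suc k * pi_fun e (Suc k + Suc l)) * d (Suc l) / d (Suc k)"
    using R_entry[of k l "(-1) ^ (Suc k + 1)" "P (Suc k + Suc l) \<tau> w"]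
    unfolding c_def Z_def DD_def pp by (simp del: fact_Suc)
  have sw: "Suc l + Suc k = Suc k + Suc l" by simp
  have DD2: "c * DD (Suc l) (Suc k) \<tau> w = Z * ((-1) ^ Suc l * pi_fun e (Suc k + Suc l)) * d (Suc l) / d (Suc k)"
    using R_entry[of k l "(-1) ^ (Suc l + 1)" "P (Suc k + Suc l) \<tau> w"]
    unfolding c_def Z_def DD_def pp sw mult.commute[of "fact (Suc l - 1)" "fact (Suc k - 1)"] by (simp del: fact_Suc)
  have "R \<tau> w \<rho> (Suc k) (Suc l) = vector [vector [c * DD (Suc k) (Suc l) \<tau> w, c * CC (Suc k) (Suc l) \<tau>],
        vector [c * CC (Suc k) (Suc l) \<tau>, c * DD (Suc l) (Suc k) \<tau> w]]"
    unfolding R_def Let_def c_def r_def ..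
  then show ?thesis
    using exhaust_2[of a] exhaust_2[of b] unfolding CCe DD1 DD2 norm_R_def prod.case Z_def[symmetric]
    by (auto simp del: power_Suc add_Suc)
qed

abbreviation "B \<equiv> norm_R x chi e"

lemma RC: "row_contraction B \<theta>"
  by (rule norm_R_row_contraction[OF good])

lemma norm_B_le: "norm (B i j) \<le> \<theta>"
proof -
  have "norm (B i j) = (\<Sum>\<^sub>\<infinity>j\<in>{j}. norm (B i j))" by simp
  also have "\<dots> \<le> (\<Sum>\<^sub>\<infinity>j. norm (B i j))"
    by (rule infsum_mono_neutral) (use row_contractionD(3)[OF RC] in auto)
  also have "\<dots> \<le> \<theta>" by (rule row_contractionD(4)[OF RC])
  finally show ?thesis .
qed

text \<open>Diagonal conjugation passes to powers, because the inner factors cancel.\<close>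

lemma block_power_R:
  "block_power (R \<tau> w \<rho>) n (Suc k) (Suc l) $ a $ b = mat_pow B n (k, a) (l, b) * d (Suc l) / d (Suc k)"
proof (induction n arbitrary: l a b)
  case 0
  show ?case using d_nonzero by (auto simp: mat_def)
next
  case (Suc n)
  define S :: "complex^2^2" where "S = (\<chi> a b. mat_pow B (Suc n) (k, a) (l, b) * d (Suc l) / d (Suc k))"
  have "((\<lambda>m. block_power (R \<tau> w \<rho>) n (Suc k) m ** R \<tau> w \<rho> m (Suc l)) has_sum S) {1..}"
  proof (rule has_sum_atLeast_1, rule has_sum_matrix)
    fix a b
    have sm: "(\<lambda>j. norm (mat_pow B n (k, a) j * B j (l, b))) summable_on UNIV"
      by (rule norm_mult_bounded_summable(1)[OF _ norm_B_le]) (use mat_pow_bound[OF RC] in blast)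
    have "((\<lambda>m. (\<Sum>c\<in>UNIV. mat_pow B n (k, a) (m, c) * B (m, c) (l, b)) * (d (Suc l) / d (Suc k))) has_sum
        (mat_pow B (Suc n) (k, a) (l, b) * (d (Suc l) / d (Suc k)))) UNIV"
      using has_sum_cmult_left[OF idx_has_sum[OF sm], of "d (Suc l) / d (Suc k)"] by simp
    moreover have "(\<Sum>c\<in>UNIV. mat_pow B n (k, a) (m, c) * B (m, c) (l, b)) * (d (Suc l) / d (Suc k))
        = (block_power (R \<tau> w \<rho>) n (Suc k) (Suc m) ** R \<tau> w \<rho> (Suc m) (Suc l)) $ a $ b" for m
      unfolding matrix_matrix_mult_def Suc R_norm_R using d_nonzero[of m] by (simp add: sum_2 distrib_right add_divide_distrib mult.assoc)
    ultimately show "((\<lambda>m. (block_power (R \<tau> w \<rho>) n (Suc k) (Suc m) ** R \<tau> w \<rho> (Suc m) (Suc l)) $ a $ b) has_sum S $ a $ b) UNIV"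
      by (simp add: S_def)
  qed
  then have "block_power (R \<tau> w \<rho>) (Suc n) (Suc k) (Suc l) = S"
    unfolding block_power.simps by (rule infsumI)
  then show ?case by (simp add: S_def)
qed

lemma neumann_inverse_R:
  "neumann_inverse (R \<tau> w \<rho>) (Suc k) (Suc l) $ a $ b = mat_neumann B (k, a) (l, b) * d (Suc l) / d (Suc k)"
proof -
  define S :: "complex^2^2" where "S = (\<chi> a b. mat_neumann B (k, a) (l, b) * d (Suc l) / d (Suc k))"
  have "(\<lambda>n. block_power (R \<tau> w \<rho>) n (Suc k) (Suc l)) sums S"
    by (rule sums_matrix) (simp add: block_power_R S_def sums_divide sums_mult2 mat_neumann_sums[OF RC])
  then have "neumann_inverse (R \<tau> w \<rho>) (Suc k) (Suc l) = S"
    unfolding neumann_inverse_def by (rule sums_unique[symmetric])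
  then show ?thesis by (simp add: S_def)
qed

lemma beta_coeff:
  "csqrt \<rho> ^ Suc k / of_real (sqrt (real (Suc k))) * (P (Suc k) \<tau> w - eisenstein (Suc k) \<tau>)
     = (- chi / of_real x) ^ Suc k / of_nat (Suc k) * (pi_fun e (Suc k) - e (Suc k)) * d (Suc k)"
  "csqrt \<rho> ^ Suc k / of_real (sqrt (real (Suc k))) * (P (Suc k) \<tau> w - eisenstein (Suc k) \<tau>)
     = of_real x ^ Suc k * (pi_fun e (Suc k) - e (Suc k)) / d (Suc k)"
proof -
  define sk where "sk = complex_of_real (sqrt (real (Suc k)))"
  have sknz: "sk \<noteq> 0" by (auto simp: sk_def)
  have sk2: "sk * sk = of_nat (Suc k)" unfolding sk_def by (rule sqrt_Suc)
  define Y where "Y = P (Suc k) \<tau> w - eisenstein (Suc k) \<tau>"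
  have Y: "pi_fun e (Suc k) - e (Suc k) = Y * w ^ Suc k"
  proof -
    have "e (Suc k) = eisenstein (Suc k) \<tau> * w ^ Suc k" by (simp add: e_def)
    then show ?thesis unfolding P_pi_fun[symmetric] Y_def by (simp only: left_diff_distrib)
  qed
  have rw: "(r / w) ^ Suc k * w ^ Suc k = r ^ Suc k"
    unfolding power_mult_distrib[symmetric] using w by simp
  have 1: "(- chi / of_real x) ^ Suc k * (of_real x * w / r) ^ Suc k = (r / w) ^ Suc k"
    unfolding power_mult_distrib[symmetric] r_facts(3) ..
  have "of_real x / (of_real x * w / r) = r / w" using r_facts w by simp
  then have 2: "of_real x ^ Suc k / (of_real x * w / r) ^ Suc k = (r / w) ^ Suc k"
    unfolding power_divide[symmetric] by simp
  have "(- chi / of_real x) ^ Suc k / of_nat (Suc k) * (Y * w ^ Suc k) * d (Suc k)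
      = ((- chi / of_real x) ^ Suc k * (of_real x * w / r) ^ Suc k) * w ^ Suc k * Y * (sk / of_nat (Suc k))"
    unfolding d_def sk_def[symmetric] by (simp only: times_divide_eq_left times_divide_eq_right mult_ac)
  also have "\<dots> = r ^ Suc k * Y / sk"
    unfolding 1 rw sk2[symmetric] using sknz by simp
  finally show "csqrt \<rho> ^ Suc k / of_real (sqrt (real (Suc k))) * (P (Suc k) \<tau> w - eisenstein (Suc k) \<tau>)
     = (- chi / of_real x) ^ Suc k / of_nat (Suc k) * (pi_fun e (Suc k) - e (Suc k)) * d (Suc k)"
    unfolding Y r_def[symmetric] Y_def[symmetric] sk_def[symmetric] by simp
  have "of_real x ^ Suc k * (Y * w ^ Suc k) / d (Suc k)
      = (of_real x ^ Suc k / (of_real x * w / r) ^ Suc k) * w ^ Suc k * Y / sk"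
    unfolding d_def sk_def[symmetric] by (simp only: times_divide_eq_left times_divide_eq_right divide_divide_eq_left mult_ac)
  also have "\<dots> = r ^ Suc k * Y / sk" unfolding 2 rw ..
  finally show "csqrt \<rho> ^ Suc k / of_real (sqrt (real (Suc k))) * (P (Suc k) \<tau> w - eisenstein (Suc k) \<tau>)
     = of_real x ^ Suc k * (pi_fun e (Suc k) - e (Suc k)) / d (Suc k)"
    unfolding Y r_def[symmetric] Y_def[symmetric] sk_def[symmetric] by simp
qed

lemma \<beta>_beta_row: "\<beta> \<tau> w \<rho> (Suc k) $ a = beta_row x chi e (k, a) * d (Suc k)"
  using exhaust_2[of a] unfolding \<beta>_def beta_row_def prod.case beta_coeff(1) by (auto simp del: power_Suc of_nat_Suc)

lemma \<beta>_bar_beta_col: "\<beta>_bar \<tau> w \<rho> (Suc k) $ a = beta_col x e (k, a) / d (Suc k)"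
  using exhaust_2[of a] unfolding \<beta>_bar_def \<beta>_def beta_col_def prod.case beta_coeff(2) by (auto simp del: power_Suc of_nat_Suc)

definition X :: "idx \<Rightarrow> complex" where "X j = (\<Sum>\<^sub>\<infinity>i. beta_row x chi e i * mat_neumann B i j)"

lemma row_times_R: "row_times (\<beta> \<tau> w \<rho>) (neumann_inverse (R \<tau> w \<rho>)) (Suc l) $ b = X (l, b) * d (Suc l)"
proof -
  define S :: "complex^2" where "S = (\<chi> b. X (l, b) * d (Suc l))"
  have "((\<lambda>k. \<beta> \<tau> w \<rho> k v* neumann_inverse (R \<tau> w \<rho>) k (Suc l)) has_sum S) {1..}"
  proof (rule has_sum_atLeast_1, rule has_sum_vector)
    fix b
    have nb: "norm (mat_neumann B i (l, b)) \<le> 1 / (1 - \<theta>)" for i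
    proof -
      have "norm (mat_neumann B i (l, b)) = (\<Sum>\<^sub>\<infinity>j\<in>{(l, b)}. norm (mat_neumann B i j))" by simp
      also have "\<dots> \<le> (\<Sum>\<^sub>\<infinity>j. norm (mat_neumann B i j))"
        by (rule infsum_mono_neutral) (use mat_neumann_norm_summable[OF RC indicator_bound] in auto)
      also have "\<dots> \<le> 1 / (1 - \<theta>)" by (rule mat_neumann_norm_bound[OF RC indicator_bound])
      finally show ?thesis .
    qed
    have sm: "(\<lambda>i. norm (beta_row x chi e i * mat_neumann B i (l, b))) summable_on UNIV"
      by (rule norm_mult_bounded_summable(1)[OF beta_row_summable[OF good] nb])
    have "((\<lambda>k. (\<Sum>a\<in>UNIV. beta_row x chi e (k, a) * mat_neumann B (k, a) (l, b)) * d (Suc l)) has_sum (X (l, b) * d (Suc l))) UNIV"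
      unfolding X_def by (rule has_sum_cmult_left[OF idx_has_sum[OF sm]])
    moreover have "(\<Sum>a\<in>UNIV. beta_row x chi e (k, a) * mat_neumann B (k, a) (l, b)) * d (Suc l)
        = (\<beta> \<tau> w \<rho> (Suc k) v* neumann_inverse (R \<tau> w \<rho>) (Suc k) (Suc l)) $ b" for k
      unfolding vector_matrix_mult_def neumann_inverse_R \<beta>_beta_row using d_nonzero[of k]
      by (simp add: sum_2 algebra_simps)
    ultimately show "((\<lambda>k. (\<beta> \<tau> w \<rho> (Suc k) v* neumann_inverse (R \<tau> w \<rho>) (Suc k) (Suc l)) $ b) has_sum S $ b) UNIV"
      by (simp add: S_def)
  qed
  then have "row_times (\<beta> \<tau> w \<rho>) (neumann_inverse (R \<tau> w \<rho>)) (Suc l) = S"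
    unfolding row_times_def by (rule infsumI)
  then show ?thesis by (simp add: S_def)
qed

text \<open>The diagonal factors of the row and of the barred column cancel, and associativity moves
  the inverse to the column.\<close>

lemma row_dot_R: "row_dot (row_times (\<beta> \<tau> w \<rho>) (neumann_inverse (R \<tau> w \<rho>))) (\<beta>_bar \<tau> w \<rho>) = h_fun x chi e"
proof -
  have sm: "(\<lambda>j. norm (X j * beta_col x e j)) summable_on UNIV"
    unfolding X_def
    by (rule norm_mult_bounded_summable(1)[OF row_neumann_pairing(2)[OF RC beta_row_summable[OF good] indicator_bound] beta_col_bound[OF good]])
  have "((\<lambda>k. \<Sum>a\<in>UNIV. row_times (\<beta> \<tau> w \<rho>) (neumann_inverse (R \<tau> w \<rho>)) k $ a * \<beta>_bar \<tau> w \<rho> k $ a) has_sum (\<Sum>\<^sub>\<infinity>j. X j * beta_col x e j)) {1..}"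
    by (rule has_sum_atLeast_1) (use idx_has_sum[OF sm] d_nonzero in \<open>simp add: row_times_R \<beta>_bar_beta_col\<close>)
  then have "row_dot (row_times (\<beta> \<tau> w \<rho>) (neumann_inverse (R \<tau> w \<rho>))) (\<beta>_bar \<tau> w \<rho>) = (\<Sum>\<^sub>\<infinity>j. X j * beta_col x e j)"
    unfolding row_dot_def by (rule infsumI)
  also have "\<dots> = h_fun x chi e"
    unfolding X_def h_fun_def eta_vec_def
    by (rule row_neumann_pairing(1)[OF RC beta_row_summable[OF good] beta_col_bound[OF good]])
  finally show ?thesis .
qed

lemma infsum_indicator_unit: "(\<Sum>\<^sub>\<infinity>j. f j * indicator unit_set j) = (f (0, 1) + f (0, 2) :: complex)"
proof -
  have "((\<lambda>j. f j * indicator unit_set j) has_sum (\<Sum>j\<in>unit_set. f j * indicator unit_set j)) UNIV"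
    by (rule has_sum_finite_neutralI[of unit_set]) (auto simp: unit_set_def)
  then show ?thesis by (simp add: infsumI sum_unit_set unit_set_def)
qed

lemma Omega12_value: "Omega12 \<tau> w \<rho> = w * (1 - of_real x * g_fun x chi e) / (2 * of_real pi * \<i>)"
proof -
  have "X (0, 1) + X (0, 2) = (\<Sum>\<^sub>\<infinity>j. X j * indicator unit_set j)"
    by (rule infsum_indicator_unit[symmetric])
  also have "\<dots> = g_fun x chi e"
    unfolding X_def g_fun_def xi_vec_def
    by (rule row_neumann_pairing(1)[OF RC beta_row_summable[OF good] indicator_bound])
  finally have g: "X (0, 1) + X (0, 2) = g_fun x chi e" .
  have "csqrt \<rho> * (\<Sum>a\<in>UNIV. row_times (\<beta> \<tau> w \<rho>) (neumann_inverse (R \<tau> w \<rho>)) 1 $ a) = r * d (Suc 0) * (X (0, 1) + X (0, 2))"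
    using row_times_R[of 0] by (simp add: sum_2 r_def[symmetric] algebra_simps)
  also have "r * d (Suc 0) = of_real x * w"
    using r_facts by (simp add: d_def)
  finally show ?thesis
    unfolding Omega12_def g by (simp add: algebra_simps)
qed

lemma Omega11_value: "Omega11 \<tau> w \<rho> = (2 * of_real pi * \<i> * \<tau> + w\<^sup>2 * chi * s_fun x chi e) / (2 * of_real pi * \<i>)"
proof -
  have xi: "xi_vec x chi e (0, a) = mat_neumann B (0, a) (0, 1) + mat_neumann B (0, a) (0, 2)" for a
    unfolding xi_vec_def mat_neumann_app[OF RC indicator_bound, symmetric] by (rule infsum_indicator_unit)
  have "(\<Sum>a\<in>UNIV. \<Sum>b\<in>UNIV. neumann_inverse (R \<tau> w \<rho>) 1 1 $ a $ b) = s_fun x chi e"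
    using neumann_inverse_R[of 0 0] d_nonzero[of 0] by (simp add: sum_2 s_fun_def sum_unit_set xi)
  then show ?thesis
    unfolding Omega11_def by (simp add: \<rho>_def)
qed

end

section \<open>The modular group\<close>

unbundle no fps_syntax

definition mob :: "int^2^2 \<Rightarrow> complex \<Rightarrow> complex" where
  "mob g z = (of_int (g $ 1 $ 1) * z + of_int (g $ 1 $ 2)) / (of_int (g $ 2 $ 1) * z + of_int (g $ 2 $ 2))"

definition autom :: "int^2^2 \<Rightarrow> complex \<Rightarrow> complex" where
  "autom g z = of_int (g $ 2 $ 1) * z + of_int (g $ 2 $ 2)"

lemma mob_autom: "mob g z = (of_int (g $ 1 $ 1) * z + of_int (g $ 1 $ 2)) / autom g z"
  by (simp add: mob_def autom_def)

lemma Gamma1_act_eq: "Gamma1_act g (\<tau>, w, chi) = (mob g \<tau>, w / autom g \<tau>, chi)"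
  by (simp add: Gamma1_act_def mob_def autom_def)

lemma Gamma1_det: "g \<in> Gamma1 \<Longrightarrow> g $ 1 $ 1 * g $ 2 $ 2 - g $ 1 $ 2 * g $ 2 $ 1 = 1"
  by (simp add: Gamma1_def det_2)

lemma
  assumes "g \<in> Gamma1" "Im z > 0"
  shows autom_nonzero: "autom g z \<noteq> 0" and Im_mob: "Im (mob g z) = Im z / (norm (autom g z))\<^sup>2"
    and Im_mob_pos: "Im (mob g z) > 0"
proof -
  show *: "autom g z \<noteq> 0" and **: "Im (mob g z) = Im z / (norm (autom g z))\<^sup>2"
    using Im_modular[OF Gamma1_det[OF assms(1)] assms(2)] by (simp_all add: autom_def mob_def)
  show "Im (mob g z) > 0" using * ** assms(2) by simp
qed

lemma Gamma1_mult: "g \<in> Gamma1 \<Longrightarrow> h \<in> Gamma1 \<Longrightarrow> g ** h \<in> Gamma1"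
  by (simp add: Gamma1_def det_mul)

lemma autom_mult:
  assumes "h \<in> Gamma1" "Im z > 0"
  shows "autom (g ** h) z = autom g (mob h z) * autom h z"
  using autom_nonzero[OF assms]
  by (simp add: autom_def[of g] autom_def[of "g ** h"] mob_autom[of h] matrix_matrix_mult_def sum_2 field_simps)
     (simp add: autom_def algebra_simps)

lemma mob_mult:
  assumes "g \<in> Gamma1" "h \<in> Gamma1" "Im z > 0"
  shows "mob (g ** h) z = mob g (mob h z)"
proof -
  have nz: "autom h z \<noteq> 0" "autom g (mob h z) \<noteq> 0"
    using autom_nonzero[OF assms(2,3)] autom_nonzero[OF assms(1) Im_mob_pos[OF assms(2,3)]] by auto
  have "of_int ((g ** h) $ 1 $ 1) * z + of_int ((g ** h) $ 1 $ 2)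
      = (of_int (g $ 1 $ 1) * mob h z + of_int (g $ 1 $ 2)) * autom h z"
    using nz(1) by (simp add: mob_autom[of h] matrix_matrix_mult_def sum_2 field_simps)
       (simp add: autom_def algebra_simps)
  then show ?thesis
    unfolding mob_autom[of "g ** h"] mob_autom[of g] autom_mult[OF assms(2,3)] using nz by simp
qed

lemma Gamma1_act_mult:
  assumes "g \<in> Gamma1" "h \<in> Gamma1" "Im (fst p) > 0"
  shows "Gamma1_act (g ** h) p = Gamma1_act g (Gamma1_act h p)"
  using assms by (cases p) (simp add: Gamma1_act_eq mob_mult autom_mult)

definition Gamma1_inv :: "int^2^2 \<Rightarrow> int^2^2" where
  "Gamma1_inv g = vector [vector [g $ 2 $ 2, - g $ 1 $ 2], vector [- g $ 2 $ 1, g $ 1 $ 1]]"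

lemma Gamma1_inv:
  assumes "g \<in> Gamma1"
  shows "Gamma1_inv g \<in> Gamma1" "Gamma1_inv g ** g = mat 1" "g ** Gamma1_inv g = mat 1"
  using Gamma1_det[OF assms]
  by (auto simp: Gamma1_def det_2 Gamma1_inv_def vec_eq_iff forall_2 matrix_matrix_mult_def sum_2 mat_def algebra_simps)

lemma Gamma1_one: "mat 1 \<in> Gamma1"
  by (simp add: Gamma1_def)

lemma mob_one [simp]: "mob (mat 1) z = z" and autom_one [simp]: "autom (mat 1) z = 1"
  by (simp_all add: mob_def autom_def mat_def)

lemma Gamma1_act_one [simp]: "Gamma1_act (mat 1) p = p"
  by (cases p) (simp add: Gamma1_act_eq)

lemma Gamma1_act_inv:
  assumes "g \<in> Gamma1" "Im (fst p) > 0"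
  shows "Gamma1_act (Gamma1_inv g) (Gamma1_act g p) = p" "Gamma1_act g (Gamma1_act (Gamma1_inv g) p) = p"
  using Gamma1_inv[OF assms(1)] assms Gamma1_act_mult[of "Gamma1_inv g" g p] Gamma1_act_mult[of g "Gamma1_inv g" p]
  by simp_all

lemma Im_fst_Gamma1_act: "g \<in> Gamma1 \<Longrightarrow> Im (fst p) > 0 \<Longrightarrow> Im (fst (Gamma1_act g p)) > 0"
  by (cases p) (simp add: Gamma1_act_eq Im_mob_pos)

lemma mob_diff:
  assumes "g \<in> Gamma1" "Im z > 0" "Im z' > 0"
  shows "mob g z - mob g z' = (z - z') / (autom g z * autom g z')"
proof -
  define a b c d where "a = complex_of_int (g $ 1 $ 1)" and "b = complex_of_int (g $ 1 $ 2)"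
    and "c = complex_of_int (g $ 2 $ 1)" and "d = complex_of_int (g $ 2 $ 2)"
  have nz: "autom g z \<noteq> 0" "autom g z' \<noteq> 0"
    by (rule autom_nonzero[OF assms(1,2)], rule autom_nonzero[OF assms(1,3)])
  have det: "a * d - b * c = 1"
    using arg_cong[OF Gamma1_det[OF assms(1)], of complex_of_int] by (simp add: a_def b_def c_def d_def)
  have "(a * z + b) * (c * z' + d) - (a * z' + b) * (c * z + d) = (a * d - b * c) * (z - z')"
    by (simp add: algebra_simps)
  then have "(a * z + b) * autom g z' - (a * z' + b) * autom g z = z - z'"
    unfolding det autom_def c_def[symmetric] d_def[symmetric] by simp
  then show ?thesis
    unfolding mob_autom diff_frac_eq[OF nz] a_def b_def by (rule arg_cong)
qed

lemma autom_coeff_le: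
  assumes "Im z > 0"
  shows "\<bar>real_of_int (g $ 2 $ 1)\<bar> * Im z \<le> norm (autom g z)"
proof -
  have "\<bar>real_of_int (g $ 2 $ 1)\<bar> * Im z = \<bar>Im (autom g z)\<bar>" using assms by (simp add: autom_def abs_mult)
  also have "\<dots> \<le> norm (autom g z)" by (rule abs_Im_le_cmod)
  finally show ?thesis .
qed

text \<open>Matrices taking some point of a disc about \<tau>0 into this disc have bounded entries,
  so they are finitely many. Each of them that moves \<tau>0 keeps a small disc away from \<tau>0,
  and the least of these radii works.\<close>

lemma Gamma1_discontinuous:
  assumes y: "Im \<tau>0 > 0"
  shows "\<exists>r>0. \<forall>g\<in>Gamma1. \<forall>z. norm (z - \<tau>0) < r \<longrightarrow> norm (mob g z - \<tau>0) < r \<longrightarrow> mob g \<tau>0 = \<tau>0"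
proof -
  define y where "y = Im \<tau>0"
  define T where "T = norm \<tau>0 + y"
  have ypos: "y > 0" "T > 0" using assms by (auto simp: y_def T_def intro: add_nonneg_pos)
  \<comment> \<open>The sum of the bounds found below for g_21, g_22, g_11 and g_12, in this
    order.\<close>
  define M where "M = (4 / y) + (2 + (4 / y) * T) + (4 * T / y) + (2 * T + (4 * T / y) * T)"
  define S where "S = {g \<in> Gamma1. \<exists>z. norm (z - \<tau>0) < y / 2 \<and> norm (mob g z - \<tau>0) < y / 2}"
  have bound: "\<bar>real_of_int (g $ i $ j)\<bar> \<le> M" if g: "g \<in> S" for g :: "int^2^2" and i j :: 2
  proof -
    obtain z where g1: "g \<in> Gamma1" and z: "norm (z - \<tau>0) < y / 2" "norm (mob g z - \<tau>0) < y / 2"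
      using g by (auto simp: S_def)
    have Imz: "Im z > y / 2" "Im z < 3 * y / 2" "Im (mob g z) > y / 2"
      using z abs_Im_le_cmod[of "z - \<tau>0"] abs_Im_le_cmod[of "mob g z - \<tau>0"] by (auto simp: y_def)
    have nz: "norm z \<le> T" "norm (mob g z) \<le> T"
      using z norm_triangle_sub[of z \<tau>0] norm_triangle_sub[of "mob g z" \<tau>0] ypos by (auto simp: T_def)
    have zpos: "Im z > 0" using Imz ypos by simp
    have jn: "autom g z \<noteq> 0" by (rule autom_nonzero[OF g1 zpos])
    have "Im (mob g z) * (norm (autom g z))\<^sup>2 = Im z"
      using Im_mob[OF g1 zpos] jn by simp
    moreover have "y / 2 * (norm (autom g z))\<^sup>2 \<le> Im (mob g z) * (norm (autom g z))\<^sup>2"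
      using Imz by (intro mult_right_mono) auto
    ultimately have "y / 2 * (norm (autom g z))\<^sup>2 \<le> 3 * y / 2" using Imz by linarith
    then have "(norm (autom g z))\<^sup>2 \<le> 2\<^sup>2" using ypos by simp
    then have j2: "norm (autom g z) \<le> 2" by (rule power2_le_imp_le) simp
    have div: "a \<le> b / (y / 2)" if "a * Im z \<le> b" "a \<ge> 0" for a b :: real
    proof -
      have "a * (y / 2) \<le> a * Im z" using Imz that by (intro mult_left_mono) auto
      then show ?thesis using that ypos by (simp add: pos_le_divide_eq)
    qed
    have c: "\<bar>real_of_int (g $ 2 $ 1)\<bar> \<le> 4 / y"
      using div[OF order_trans[OF autom_coeff_le[OF zpos, of g] j2]] by simp
    have "of_int (g $ 2 $ 2) = autom g z - of_int (g $ 2 $ 1) * z" by (simp add: autom_def)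
    then have "norm (of_int (g $ 2 $ 2) :: complex) \<le> norm (autom g z) + norm (of_int (g $ 2 $ 1) * z)"
      by (metis norm_triangle_ineq4)
    also have "\<dots> \<le> 2 + (4 / y) * T"
      unfolding norm_mult using c nz j2 ypos by (intro add_mono mult_mono) auto
    finally have d: "\<bar>real_of_int (g $ 2 $ 2)\<bar> \<le> 2 + (4 / y) * T" by simp
    define v where "v = of_int (g $ 1 $ 1) * z + of_int (g $ 1 $ 2)"
    have "v = mob g z * autom g z" using jn by (simp add: v_def mob_autom)
    then have "norm v \<le> T * 2" unfolding norm_mult using nz j2 ypos by (auto simp: norm_mult intro: mult_mono)
    have "\<bar>real_of_int (g $ 1 $ 1)\<bar> * Im z = \<bar>Im v\<bar>" using zpos by (simp add: v_def abs_mult)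
    also have "\<dots> \<le> T * 2" using abs_Im_le_cmod[of v] \<open>norm v \<le> T * 2\<close> by linarith
    finally have a: "\<bar>real_of_int (g $ 1 $ 1)\<bar> \<le> 4 * T / y" using div[of "\<bar>real_of_int (g $ 1 $ 1)\<bar>" "T * 2"] by simp
    have "of_int (g $ 1 $ 2) = v - of_int (g $ 1 $ 1) * z" by (simp add: v_def)
    then have "norm (of_int (g $ 1 $ 2) :: complex) \<le> norm v + norm (of_int (g $ 1 $ 1) * z)"
      by (metis norm_triangle_ineq4)
    also have "\<dots> \<le> 2 * T + (4 * T / y) * T"
      unfolding norm_mult using a nz \<open>norm v \<le> T * 2\<close> ypos by (intro add_mono mult_mono) auto
    finally have b: "\<bar>real_of_int (g $ 1 $ 2)\<bar> \<le> 2 * T + (4 * T / y) * T" by simp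
    have pos: "0 \<le> 4 / y" "0 \<le> 2 + (4 / y) * T" "0 \<le> 4 * T / y" "0 \<le> 2 * T + (4 * T / y) * T"
      using ypos by auto
    show ?thesis
      using a b c d pos exhaust_2[of i] exhaust_2[of j] unfolding M_def by auto
  qed
  have "finite S"
  proof -
    let ?I = "{- \<lceil>M\<rceil>..\<lceil>M\<rceil>}"
    have "S \<subseteq> (\<lambda>(a, b, c, d). vector [vector [a, b], vector [c, d]]) ` (?I \<times> ?I \<times> ?I \<times> ?I)"
    proof
      fix g assume g: "g \<in> S"
      have "g $ i $ j \<in> ?I" for i j
        using bound[OF g, of i j] by (auto simp: abs_le_iff) linarith+
      moreover have "g = vector [vector [g $ 1 $ 1, g $ 1 $ 2], vector [g $ 2 $ 1, g $ 2 $ 2]]"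
        by (simp add: vec_eq_iff forall_2)
      ultimately show "g \<in> (\<lambda>(a, b, c, d). vector [vector [a, b], vector [c, d]]) ` (?I \<times> ?I \<times> ?I \<times> ?I)"
        by (intro image_eqI[of _ _ "(g $ 1 $ 1, g $ 1 $ 2, g $ 2 $ 1, g $ 2 $ 2)"]) simp_all
    qed
    then show ?thesis by (rule finite_subset) auto
  qed
  define S' where "S' = {g \<in> S. mob g \<tau>0 \<noteq> \<tau>0}"
  have "\<exists>r>0. \<forall>z. norm (z - \<tau>0) < r \<longrightarrow> norm (mob g z - \<tau>0) \<ge> r" if g: "g \<in> S'" for g
  proof -
    define D where "D = norm (mob g \<tau>0 - \<tau>0)"
    have D: "D > 0" using g by (simp add: S'_def D_def)
    have "isCont (mob g) \<tau>0"
      unfolding mob_def[abs_def] using autom_nonzero[of g \<tau>0] g assms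
      by (intro continuous_intros) (auto simp: S'_def S_def autom_def)
    then obtain r where r: "r > 0" "\<And>z. dist z \<tau>0 < r \<Longrightarrow> dist (mob g z) (mob g \<tau>0) < D / 2"
      using D unfolding continuous_at_eps_delta dist_norm by (meson half_gt_zero)
    show ?thesis
    proof (intro exI[of _ "min r (D / 2)"] conjI allI impI)
      fix z assume z: "norm (z - \<tau>0) < min r (D / 2)"
      have "norm (mob g z - mob g \<tau>0) < D / 2" using r(2)[of z] z by (simp add: dist_norm)
      moreover have "D \<le> norm (mob g z - \<tau>0) + norm (mob g z - mob g \<tau>0)"
        unfolding D_def using norm_triangle_ineq4[of "mob g z - \<tau>0" "mob g z - mob g \<tau>0"] by simp
      ultimately show "min r (D / 2) \<le> norm (mob g z - \<tau>0)" by linarith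
    qed (use r D in auto)
  qed
  then obtain rr where rr: "\<And>g. g \<in> S' \<Longrightarrow> rr g > 0" "\<And>g z. g \<in> S' \<Longrightarrow> norm (z - \<tau>0) < rr g \<Longrightarrow> norm (mob g z - \<tau>0) \<ge> rr g"
    by metis
  have fin: "finite S'" using \<open>finite S\<close> by (simp add: S'_def)
  define r where "r = Min (insert (y / 2) (rr ` S'))"
  have r: "r > 0" "r \<le> y / 2" "\<And>g. g \<in> S' \<Longrightarrow> r \<le> rr g"
  proof -
    show "r > 0" using fin rr(1) ypos by (auto simp: r_def)
    show "r \<le> y / 2" unfolding r_def by (rule Min_le) (use fin in auto)
    show "r \<le> rr g" if "g \<in> S'" for g unfolding r_def by (rule Min_le) (use fin that in auto)
  qed
  show ?thesis
  proof (intro exI[of _ r] conjI r ballI allI impI)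
    fix g z assume *: "g \<in> Gamma1" "norm (z - \<tau>0) < r" "norm (mob g z - \<tau>0) < r"
    then have "g \<in> S" using r(2) by (auto simp: S_def intro!: exI[of _ z])
    show "mob g \<tau>0 = \<tau>0"
    proof (rule ccontr)
      assume "mob g \<tau>0 \<noteq> \<tau>0"
      then have "g \<in> S'" using \<open>g \<in> S\<close> by (simp add: S'_def)
      with rr(2)[of g z] r(3)[of g] * show False by linarith
    qed
  qed
qed

text \<open>Defined by the hyperbolic distance \<open>|\<tau> - \<tau>0|\<^sup>2/(Im \<tau> Im \<tau>0)\<close> and the invariant \<open>|w|\<^sup>2/Im \<tau>\<close>, and therefore
  invariant under the stabiliser of \<open>\<tau>0\<close>.\<close>
definition base_nbhd :: "complex \<Rightarrow> complex \<Rightarrow> real \<Rightarrow> c3 set" where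
  "base_nbhd \<tau>0 chi0 r = {(\<tau>, w, chi). Im \<tau> > 0 \<and> (norm (\<tau> - \<tau>0))\<^sup>2 < r * Im \<tau> * Im \<tau>0 \<and>
     (norm w)\<^sup>2 < r * Im \<tau> \<and> norm (chi - chi0) < r}"

text \<open>The union of the translates, with g applied to p: as a union of preimages under
  continuous maps it is visibly open.\<close>

definition orbit_nbhd :: "complex \<Rightarrow> complex \<Rightarrow> real \<Rightarrow> c3 set" where
  "orbit_nbhd \<tau>0 chi0 r = {p. Im (fst p) > 0 \<and> (\<exists>g\<in>Gamma1. Gamma1_act g p \<in> base_nbhd \<tau>0 chi0 r)}"

lemma open_base_nbhd: "open (base_nbhd \<tau>0 chi0 r)"
proof -
  have "base_nbhd \<tau>0 chi0 r = {p. Im (fst p) > 0} \<inter> {p. (norm (fst p - \<tau>0))\<^sup>2 < r * Im (fst p) * Im \<tau>0}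
     \<inter> {p. (norm (fst (snd p)))\<^sup>2 < r * Im (fst p)} \<inter> {p. norm (snd (snd p) - chi0) < r}"
    by (auto simp: base_nbhd_def)
  then show ?thesis by (auto intro!: open_Int open_Collect_less continuous_intros)
qed

lemma open_orbit_nbhd: "open (orbit_nbhd \<tau>0 chi0 r)"
proof -
  have op: "open {p :: c3. Im (fst p) > 0}" by (intro open_Collect_less continuous_intros)
  have "continuous_on {p. Im (fst p) > 0} (Gamma1_act g)" if "g \<in> Gamma1" for g
  proof -
    have eq: "Gamma1_act g = (\<lambda>p. (mob g (fst p), fst (snd p) / autom g (fst p), snd (snd p)))"
      by (auto simp: fun_eq_iff Gamma1_act_eq)
    show ?thesis
      unfolding eq mob_autom[abs_def] autom_def[abs_def]
      by (intro continuous_intros) (use autom_nonzero[OF that] in \<open>auto simp: autom_def\<close>)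
  qed
  then have "open ({p. Im (fst p) > 0} \<inter> Gamma1_act g -` base_nbhd \<tau>0 chi0 r)" if "g \<in> Gamma1" for g
    using continuous_on_open_vimage[OF op] that open_base_nbhd by (metis inf_commute)
  then have "open (\<Union>g\<in>Gamma1. {p. Im (fst p) > 0} \<inter> Gamma1_act g -` base_nbhd \<tau>0 chi0 r)"
    by blast
  moreover have "orbit_nbhd \<tau>0 chi0 r = (\<Union>g\<in>Gamma1. {p. Im (fst p) > 0} \<inter> Gamma1_act g -` base_nbhd \<tau>0 chi0 r)"
    unfolding orbit_nbhd_def by blast
  ultimately show ?thesis by simp
qed

lemma orbit_nbhd_act: "g \<in> Gamma1 \<Longrightarrow> p \<in> orbit_nbhd \<tau>0 chi0 r \<Longrightarrow> Gamma1_act g p \<in> orbit_nbhd \<tau>0 chi0 r"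
proof -
  assume g: "g \<in> Gamma1" and p: "p \<in> orbit_nbhd \<tau>0 chi0 r"
  then obtain h where h: "h \<in> Gamma1" "Gamma1_act h p \<in> base_nbhd \<tau>0 chi0 r" and pos: "Im (fst p) > 0"
    by (auto simp: orbit_nbhd_def)
  have "Gamma1_act (h ** Gamma1_inv g) (Gamma1_act g p) = Gamma1_act h p"
    using Gamma1_act_mult[OF h(1) Gamma1_inv(1)[OF g] Im_fst_Gamma1_act[OF g pos]] Gamma1_act_inv[OF g pos] by simp
  then show ?thesis
    unfolding orbit_nbhd_def
    using h g pos Gamma1_mult[OF h(1) Gamma1_inv(1)[OF g]] Im_fst_Gamma1_act[OF g pos]
    by (intro CollectI conjI bexI[of _ "h ** Gamma1_inv g"]) simp_all
qed

lemma base_subset_orbit: "base_nbhd \<tau>0 chi0 r \<subseteq> orbit_nbhd \<tau>0 chi0 r"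
  using Gamma1_one by (force simp: orbit_nbhd_def base_nbhd_def)

lemma base_nbhd_mono:
  assumes "r \<le> r'" "Im \<tau>0 > 0"
  shows "base_nbhd \<tau>0 chi0 r \<subseteq> base_nbhd \<tau>0 chi0 r'"
proof -
  have "r * Im \<tau> * Im \<tau>0 \<le> r' * Im \<tau> * Im \<tau>0" "r * Im \<tau> \<le> r' * Im \<tau>" if "Im \<tau> > 0" for \<tau>
    using assms that by (auto intro!: mult_right_mono)
  then show ?thesis using assms(1) unfolding base_nbhd_def by (fastforce intro: less_le_trans)
qed

lemma orbit_nbhd_mono: "r \<le> r' \<Longrightarrow> Im \<tau>0 > 0 \<Longrightarrow> orbit_nbhd \<tau>0 chi0 r \<subseteq> orbit_nbhd \<tau>0 chi0 r'"
  using base_nbhd_mono unfolding orbit_nbhd_def by blast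

lemma base_nbhd_center: "r > 0 \<Longrightarrow> Im \<tau>0 > 0 \<Longrightarrow> (\<tau>0, 0, chi0) \<in> base_nbhd \<tau>0 chi0 r"
  by (simp add: base_nbhd_def)

text \<open>Im \<tau>0 is preserved, so |j(\<tau>0)| = 1. Hence |\<tau> - \<tau>0|^2, |w|^2 and Im
  \<tau> are all divided by the same |j(\<tau>)|^2.\<close>

lemma base_nbhd_stabilizer:
  assumes g: "g \<in> Gamma1" "mob g \<tau>0 = \<tau>0" and y: "Im \<tau>0 > 0" and p: "p \<in> base_nbhd \<tau>0 chi0 r"
  shows "Gamma1_act g p \<in> base_nbhd \<tau>0 chi0 r"
proof -
  obtain \<tau> w chi where p_eq: "p = (\<tau>, w, chi)" by (cases p)
  have \<tau>: "Im \<tau> > 0" "(norm (\<tau> - \<tau>0))\<^sup>2 < r * Im \<tau> * Im \<tau>0" "(norm w)\<^sup>2 < r * Im \<tau>" "norm (chi - chi0) < r"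
    using p by (auto simp: base_nbhd_def p_eq)
  define J J0 where "J = (norm (autom g \<tau>))\<^sup>2" and "J0 = (norm (autom g \<tau>0))\<^sup>2"
  have J: "J > 0" "J0 > 0" using autom_nonzero[OF g(1)] \<tau>(1) y by (auto simp: J_def J0_def)
  have "Im \<tau>0 = Im \<tau>0 / J0" using Im_mob[OF g(1) y] g(2) by (simp add: J0_def)
  then have J01: "J0 = 1" using y J by (simp add: field_simps)
  have "mob g \<tau> - \<tau>0 = (\<tau> - \<tau>0) / (autom g \<tau> * autom g \<tau>0)"
    using mob_diff[OF g(1) \<tau>(1) y] g(2) by simp
  then have "(norm (mob g \<tau> - \<tau>0))\<^sup>2 = (norm (\<tau> - \<tau>0))\<^sup>2 / (J * J0)"
    by (simp add: norm_divide norm_mult power_divide power_mult_distrib J_def J0_def)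
  moreover have "Im (mob g \<tau>) = Im \<tau> / J" using Im_mob[OF g(1) \<tau>(1)] by (simp add: J_def)
  moreover have "(norm (w / autom g \<tau>))\<^sup>2 = (norm w)\<^sup>2 / J" by (simp add: norm_divide power_divide J_def)
  ultimately show ?thesis
    using \<tau> J J01 Im_mob_pos[OF g(1) \<tau>(1)] unfolding p_eq Gamma1_act_eq base_nbhd_def
    by (simp add: divide_strict_right_mono)
qed

text \<open>Replaces Im \<tau> by Im \<tau>0. If |\<tau> - \<tau>0| were at least Im \<tau>0, then
  Im \<tau> would be at most twice this distance, which for r <= 1/2 contradicts the defining
  inequality.\<close>

lemma base_nbhd_bounds:
  assumes r: "0 < r" "r \<le> 1 / 2" and y: "Im \<tau>0 > 0" and p: "(\<tau>, w, chi) \<in> base_nbhd \<tau>0 chi0 r"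
  shows "(norm (\<tau> - \<tau>0))\<^sup>2 < 2 * r * (Im \<tau>0)\<^sup>2" "(norm w)\<^sup>2 < 2 * r * Im \<tau>0" "norm (chi - chi0) < r" "Im \<tau> > 0"
proof -
  define D where "D = norm (\<tau> - \<tau>0)"
  define y where "y = Im \<tau>0"
  have y0: "y > 0" using assms by (simp add: y_def)
  have b: "Im \<tau> > 0" "D\<^sup>2 < r * Im \<tau> * y" "(norm w)\<^sup>2 < r * Im \<tau>" "norm (chi - chi0) < r"
    using p by (auto simp: base_nbhd_def D_def y_def)
  have Im: "Im \<tau> \<le> y + D" using abs_Im_le_cmod[of "\<tau> - \<tau>0"] by (simp add: D_def y_def)
  have "D < y"
  proof (rule ccontr)
    assume "\<not> D < y"
    then have "y \<le> D" by simp
    have "D\<^sup>2 < r * Im \<tau> * y" by (rule b)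
    also have "\<dots> \<le> (1 / 2) * (2 * D) * D"
      using r Im \<open>y \<le> D\<close> b(1) y0 by (intro mult_mono) auto
    also have "\<dots> = D\<^sup>2" by (simp add: power2_eq_square)
    finally show False by simp
  qed
  then have Im2: "Im \<tau> \<le> 2 * y" using Im by simp
  have "r * Im \<tau> * y \<le> r * (2 * y) * y" using Im2 r y0 by (intro mult_right_mono mult_left_mono) auto
  then show "(norm (\<tau> - \<tau>0))\<^sup>2 < 2 * r * (Im \<tau>0)\<^sup>2"
    using b(2) unfolding D_def[symmetric] y_def[symmetric] power2_eq_square[of y] by (simp add: mult_ac)
  have "r * Im \<tau> \<le> r * (2 * y)" using Im2 r by (intro mult_left_mono) auto
  then show "(norm w)\<^sup>2 < 2 * r * Im \<tau>0" using b(3) unfolding y_def[symmetric] by (simp add: mult_ac)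
qed (use p in \<open>auto simp: base_nbhd_def\<close>)

text \<open>Open conditions at the centre can thus be met by shrinking r, without losing invariance
  under the stabiliser.\<close>

lemma base_nbhd_small:
  assumes y: "Im \<tau>0 > 0" and V: "open V" "(\<tau>0, 0, chi0) \<in> V"
  shows "\<exists>r>0. base_nbhd \<tau>0 chi0 r \<subseteq> V"
proof -
  obtain d where d: "d > 0" "ball (\<tau>0, 0, chi0) d \<subseteq> V" using V open_contains_ball by blast
  define y where "y = Im \<tau>0"
  have y0: "y > 0" using assms by (simp add: y_def)
  \<comment> \<open>d / 3 is allotted to each coordinate; the two quotients invert the quadratic
    bounds of \<open>base_nbhd_bounds\<close>.\<close>
  define m where "m = min (1 / 2) (min (d / 3) (min ((d / 3)\<^sup>2 / (2 * y\<^sup>2)) ((d / 3)\<^sup>2 / (2 * y))))"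
  have m: "0 < m" "m \<le> 1 / 2" "m \<le> d / 3" "m \<le> (d / 3)\<^sup>2 / (2 * y\<^sup>2)" "m \<le> (d / 3)\<^sup>2 / (2 * y)"
    using d(1) y0 by (auto simp: m_def)
  show ?thesis
  proof (intro exI[of _ m] conjI m subsetI)
    fix p assume p: "p \<in> base_nbhd \<tau>0 chi0 m"
    obtain \<tau> w chi where p_eq: "p = (\<tau>, w, chi)" by (cases p)
    note b = base_nbhd_bounds[OF m(1,2) assms(1) p[unfolded p_eq], folded y_def]
    have "2 * m * y\<^sup>2 \<le> (d / 3)\<^sup>2" "2 * m * y \<le> (d / 3)\<^sup>2"
      using m(4,5) y0 by (auto simp: field_simps)
    then have "(norm (\<tau> - \<tau>0))\<^sup>2 < (d / 3)\<^sup>2" "(norm w)\<^sup>2 < (d / 3)\<^sup>2" using b by linarith+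
    then have n: "norm (\<tau> - \<tau>0) < d / 3" "norm w < d / 3" "norm (chi - chi0) < d / 3"
      using d(1) b(3) m(3) power2_less_imp_less[of "norm (\<tau> - \<tau>0)" "d / 3"] power2_less_imp_less[of "norm w" "d / 3"]
      by auto
    have "norm ((\<tau>, w, chi) - (\<tau>0, 0, chi0)) \<le> norm (\<tau> - \<tau>0) + (norm w + norm (chi - chi0))"
      by (simp, intro order_trans[OF norm_Pair_le] add_left_mono norm_Pair_le)
    then have "dist (\<tau>0, 0, chi0) p < d" using n unfolding p_eq dist_norm norm_minus_commute[of "(\<tau>0, 0, chi0)"] by linarith
    then show "p \<in> V" using d(2) by auto
  qed
qed

text \<open>The positive-definiteness of \<open>Im \<Omega>\<close> for \<open>\<Omega> = ((z, v), (v, t))\<close>.\<close>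
definition siegel2 :: "complex \<Rightarrow> complex \<Rightarrow> complex \<Rightarrow> bool" where
  "siegel2 z v t \<longleftrightarrow> Im z > 0 \<and> (Im v)\<^sup>2 < Im z * Im t"

text \<open>Completing the square after multiplication by Im z > 0.\<close>

lemma siegel2_imp_siegel:
  assumes "siegel2 z v t"
  shows "vector [vector [z, v], vector [v, t]] \<in> siegel_upper_half_space"
proof -
  define M where "M = (vector [vector [z, v], vector [v, t]] :: complex^2^2)"
  have "u \<bullet> ((\<chi> i j. Im (M $ i $ j)) *v u) > 0" if "u \<noteq> 0" for u :: "real^2"
  proof -
    define p q where "p = u $ 1" and "q = u $ 2"
    define A B C where "A = Im z" and "B = Im v" and "C = Im t"
    have ABC: "A > 0" "B\<^sup>2 < A * C" using assms by (auto simp: siegel2_def A_def B_def C_def)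
    have eq: "u \<bullet> ((\<chi> i j. Im (M $ i $ j)) *v u) = p * (A * p + B * q) + q * (B * p + C * q)"
      by (simp add: inner_vec_def sum_2 matrix_vector_mult_def M_def p_def q_def A_def B_def C_def)
    have "A * (p * (A * p + B * q) + q * (B * p + C * q)) = (A * p + B * q)\<^sup>2 + (A * C - B\<^sup>2) * q\<^sup>2"
      by (simp add: power2_eq_square algebra_simps)
    moreover have "(A * p + B * q)\<^sup>2 + (A * C - B\<^sup>2) * q\<^sup>2 > 0"
    proof (cases "q = 0")
      case True
      then have "p \<noteq> 0" using that by (auto simp: vec_eq_iff forall_2 p_def q_def)
      then show ?thesis using True ABC by simp
    next
      case False
      then show ?thesis using ABC by (intro add_nonneg_pos) auto
    qed
    ultimately have "0 < A * (p * (A * p + B * q) + q * (B * p + C * q))" by (simp only:)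
    then show ?thesis unfolding eq using ABC(1) by (rule zero_less_mult_pos)
  qed
  moreover have "transpose M = M" by (simp add: M_def transpose_def vec_eq_iff forall_2)
  ultimately show ?thesis unfolding siegel_upper_half_space_def M_def by simp
qed

text \<open>The determinant of Im \<Omega> is divided by |c z + d|^2 and Im z stays positive, which
  for a two by two matrix is positive definiteness.\<close>

lemma siegel2_modular:
  assumes g: "g \<in> Gamma1" and s: "siegel2 z v t"
  shows "siegel2 (mob g z) (v / autom g z) (t - of_int (g $ 2 $ 1) * v\<^sup>2 / autom g z)"
proof -
  have z: "Im z > 0" and d: "(Im v)\<^sup>2 < Im z * Im t" using s by (auto simp: siegel2_def)
  define c where "c = real_of_int (g $ 2 $ 1)"
  define J where "J = autom g z"
  define \<alpha> \<beta>' n where "\<alpha> = Re J" and "\<beta>' = Im J" and "n = \<alpha>\<^sup>2 + \<beta>'\<^sup>2"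
  have \<beta>': "\<beta>' = c * Im z" by (simp add: \<beta>'_def J_def autom_def c_def)
  have Jnz: "J \<noteq> 0" using autom_nonzero[OF g z] by (simp add: J_def)
  have n: "n > 0" using Jnz unfolding n_def \<alpha>_def \<beta>'_def by (simp add: complex_eq_iff sum_power2_gt_zero_iff)
  define r s where "r = Re v" and "s = Im v"
  have 1: "Im (mob g z) = Im z / n" using Im_mob[OF g z] by (simp add: J_def[symmetric] cmod_power2 n_def \<alpha>_def \<beta>'_def)
  have 2: "Im (v / J) = (s * \<alpha> - r * \<beta>') / n"
    by (simp add: Im_divide n_def \<alpha>_def \<beta>'_def r_def s_def)
  have 3: "Im (of_int (g $ 2 $ 1) * v\<^sup>2 / J) = c * (2 * r * s * \<alpha> - (r\<^sup>2 - s\<^sup>2) * \<beta>') / n"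
    by (simp add: Im_divide n_def \<alpha>_def \<beta>'_def r_def s_def c_def power2_eq_square algebra_simps)
  have "Im z * (Im t * n - c * (2 * r * s * \<alpha> - (r\<^sup>2 - s\<^sup>2) * \<beta>')) - (s * \<alpha> - r * \<beta>')\<^sup>2 = (Im z * Im t - s\<^sup>2) * n"
  proof -
    have "Im z * (Im t * n - c * (2 * r * s * \<alpha> - (r\<^sup>2 - s\<^sup>2) * \<beta>'))
        = Im z * Im t * n - \<beta>' * (2 * r * s * \<alpha> - (r\<^sup>2 - s\<^sup>2) * \<beta>')"
      unfolding \<beta>' by (simp add: algebra_simps)
    then show ?thesis unfolding n_def by (simp add: power2_eq_square algebra_simps)
  qed
  moreover have "(Im z * Im t - s\<^sup>2) * n > 0" using d n by (simp add: s_def)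
  ultimately have pos: "(s * \<alpha> - r * \<beta>')\<^sup>2 < Im z * (Im t * n - c * (2 * r * s * \<alpha> - (r\<^sup>2 - s\<^sup>2) * \<beta>'))"
    by linarith
  have "(Im (v / J))\<^sup>2 = (s * \<alpha> - r * \<beta>')\<^sup>2 / n\<^sup>2" unfolding 2 by (simp add: power_divide)
  also have "\<dots> < Im z * (Im t * n - c * (2 * r * s * \<alpha> - (r\<^sup>2 - s\<^sup>2) * \<beta>')) / n\<^sup>2"
    using pos n by (intro divide_strict_right_mono) auto
  also have "\<dots> = (Im z / n) * (Im t - c * (2 * r * s * \<alpha> - (r\<^sup>2 - s\<^sup>2) * \<beta>') / n)"
    using n by (simp add: power2_eq_square field_simps)
  finally show ?thesis
    unfolding siegel2_def 1 J_def[symmetric] minus_complex.sel 3 using z n by simp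
qed

text \<open>Only the upper left entry of C is non-zero, so C \<Omega> + D is triangular with an
  explicit inverse. The result is symmetric because the determinant of g is 1.\<close>

lemma Gamma1_act_siegel_eq:
  assumes g: "g \<in> Gamma1" and J: "autom g z \<noteq> 0"
  shows "Gamma1_act_siegel g (vector [vector [z, v], vector [v, t]])
    = vector [vector [mob g z, v / autom g z], vector [v / autom g z, t - of_int (g $ 2 $ 1) * v\<^sup>2 / autom g z]]"
proof -
  define a b c d where "a = complex_of_int (g $ 1 $ 1)" and "b = complex_of_int (g $ 1 $ 2)"
    and "c = complex_of_int (g $ 2 $ 1)" and "d = complex_of_int (g $ 2 $ 2)"
  define J where "J = c * z + d"
  have Jnz: "J \<noteq> 0" using assms by (simp add: J_def autom_def c_def d_def)
  have det: "a * d - b * c = 1"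
    using arg_cong[OF Gamma1_det[OF g], of complex_of_int] by (simp add: a_def b_def c_def d_def)
  define Q where "Q = (vector [vector [J, c * v], vector [0, 1]] :: complex^2^2)"
  define Q' where "Q' = (vector [vector [1 / J, - c * v / J], vector [0, 1]] :: complex^2^2)"
  have QQ: "Q ** Q' = mat 1" "Q' ** Q = mat 1"
    using Jnz by (auto simp: Q_def Q'_def vec_eq_iff forall_2 matrix_matrix_mult_def sum_2 mat_def)
  have inv: "matrix_inv Q = Q'"
  proof -
    have "matrix_inv Q ** Q = mat 1"
      unfolding matrix_inv_def by (rule someI2[of _ Q']) (use QQ in auto)
    then have "matrix_inv Q ** (Q ** Q') = Q'" by (simp add: matrix_mul_assoc)
    then show ?thesis by (simp add: QQ)
  qed
  have C: "vector [vector [c, 0], vector [0, 0]] ** (vector [vector [z, v], vector [v, t]] :: complex^2^2) + vector [vector [d, 0], vector [0, 1]] = Q"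
    by (auto simp: Q_def J_def vec_eq_iff forall_2 matrix_matrix_mult_def sum_2)
  have A: "vector [vector [a, 0], vector [0, 1]] ** (vector [vector [z, v], vector [v, t]] :: complex^2^2) + vector [vector [b, 0], vector [0, 0]]
     = (vector [vector [a * z + b, a * v], vector [v, t]] :: complex^2^2)"
    by (auto simp: vec_eq_iff forall_2 matrix_matrix_mult_def sum_2)
  have "a * v - (a * z + b) * (c * v) / J = v / J"
  proof -
    have "a * v * J - (a * z + b) * (c * v) = (a * d - b * c) * v" by (simp add: J_def algebra_simps)
    then show ?thesis unfolding det using Jnz by (simp add: field_simps)
  qed
  then have "(vector [vector [a * z + b, a * v], vector [v, t]] :: complex^2^2) ** Q'
     = vector [vector [(a * z + b) / J, v / J], vector [v / J, t - c * v\<^sup>2 / J]]"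
    by (auto simp: Q'_def vec_eq_iff forall_2 matrix_matrix_mult_def sum_2 power2_eq_square)
  then show ?thesis
    unfolding Gamma1_act_siegel_def Sp4_act_def a_def[symmetric] b_def[symmetric] c_def[symmetric] d_def[symmetric] A C inv
    by (simp add: mob_def autom_def J_def a_def b_def c_def d_def)
qed

section \<open>The period map near the degeneration locus\<close>

definition e_of :: "c3 \<Rightarrow> nat \<Rightarrow> complex" where
  "e_of p = (\<lambda>m. if m = 0 then 0 else eisenstein m (fst p) * fst (snd p) ^ m)"

definition el_fun :: "(nat \<Rightarrow> complex) \<Rightarrow> complex" where
  "el_fun e = (\<Sum>\<^sub>\<infinity>k. e (k + 2) / of_nat (k + 2))"

definition F11 :: "real \<Rightarrow> c3 \<Rightarrow> complex" where
  "F11 x p = fst p + fst (snd p) ^ 2 * snd (snd p) * s_fun x (snd (snd p)) (e_of p) / (2 * of_real pi * \<i>)"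

definition F12 :: "real \<Rightarrow> c3 \<Rightarrow> complex" where
  "F12 x p = fst (snd p) * (1 - of_real x * g_fun x (snd (snd p)) (e_of p)) / (2 * of_real pi * \<i>)"

text \<open>As -\<rho>/K^2 = \<chi> (w/K)^2 and w/K is the exponential of \<open>el_fun\<close>, its
  logarithm needs only a branch \<open>lg\<close> of log \<chi>. The factors w have disappeared, so
  the formula makes sense at w = 0.\<close>

definition F22 :: "real \<Rightarrow> (complex \<Rightarrow> complex) \<Rightarrow> c3 \<Rightarrow> complex" where
  "F22 x lg p = (lg (snd (snd p)) + 2 * el_fun (e_of p) - h_fun x (snd (snd p)) (e_of p)) / (2 * of_real pi * \<i>)"

definition F_mat :: "real \<Rightarrow> (complex \<Rightarrow> complex) \<Rightarrow> c3 \<Rightarrow> complex^2^2" where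
  "F_mat x lg p = vector [vector [F11 x p, F12 x p], vector [F12 x p, F22 x lg p]]"

lemma F_mat_entries [simp]:
  "F_mat x lg p $ 1 $ 1 = F11 x p" "F_mat x lg p $ 1 $ 2 = F12 x p"
  "F_mat x lg p $ 2 $ 1 = F12 x p" "F_mat x lg p $ 2 $ 2 = F22 x lg p"
  by (simp_all add: F_mat_def)

lemma e_of_w0: "e_of (\<tau>, 0, chi) = (\<lambda>_. 0)"
  by (auto simp: e_of_def fun_eq_iff)

lemma el_fun_0 [simp]: "el_fun (\<lambda>_. 0) = 0"
  by (simp add: el_fun_def)

lemma F11_w0 [simp]: "F11 x (\<tau>, 0, chi) = \<tau>" and F12_w0 [simp]: "F12 x (\<tau>, 0, chi) = 0"
  by (simp_all add: F11_def F12_def)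

text \<open>\<open>exp (2\<pi>i \<Omega>\<^sub>2\<^sub>2)\<close>, which does not depend on the branch of the logarithm.\<close>
definition F33 :: "real \<Rightarrow> c3 \<Rightarrow> complex" where
  "F33 x p = snd (snd p) * exp (2 * el_fun (e_of p) - h_fun x (snd (snd p)) (e_of p))"

lemma exp_F22:
  assumes "exp (lg (snd (snd p))) = snd (snd p)"
  shows "exp (2 * of_real pi * \<i> * F22 x lg p) = F33 x p"
proof -
  have "2 * of_real pi * \<i> * F22 x lg p = lg (snd (snd p)) + (2 * el_fun (e_of p) - h_fun x (snd (snd p)) (e_of p))"
    by (simp add: F22_def)
  then show ?thesis by (simp only: exp_add assms F33_def)
qed

context period_params
begin

lemma el_fun_majorant: "(\<lambda>k. \<epsilon> ^ (k + 2)) summable_on UNIV"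
proof -
  have "(\<lambda>k. \<epsilon> ^ 2 * \<epsilon> ^ k) summable_on UNIV"
    using geometric_summable_on[of \<epsilon> "\<epsilon>\<^sup>2"] \<epsilon> by (simp add: mult.commute)
  then show ?thesis by (simp only: power_add mult.commute)
qed

lemma el_fun_term_bound:
  assumes "good chi e"
  shows "norm (e (k + 2) / of_nat (k + 2)) \<le> \<epsilon> ^ (k + 2)"
proof -
  have "norm (e (k + 2)) \<le> \<epsilon> ^ (k + 2)"
    using assms[unfolded good_def, THEN conjunct1, THEN spec[of _ "Suc k"]] by simp
  then have "norm (e (k + 2)) / real (k + 2) \<le> \<epsilon> ^ (k + 2) / 1"
    using \<epsilon> by (intro frac_le) auto
  then show ?thesis by (simp only: norm_divide norm_of_nat div_by_1)
qed

lemma el_fun_summable: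
  assumes "good chi e"
  shows "(\<lambda>k. e (k + 2) / of_nat (k + 2)) summable_on UNIV"
  by (rule abs_summable_summable, rule summable_on_comparison_test[OF el_fun_majorant])
     (use el_fun_term_bound[OF assms] in auto)

lemma el_fun_change:
  assumes good: "good chi e" and e': "\<And>m. m \<noteq> 2 \<Longrightarrow> e' m = e m" "e' 2 = e 2 - \<kappa>"
  shows "2 * el_fun e' = 2 * el_fun e - \<kappa>"
proof -
  have k: "((\<lambda>k. if k = 0 then \<kappa> / 2 else 0) has_sum (\<Sum>k\<in>{0::nat}. if k = 0 then \<kappa> / 2 else 0)) UNIV"
    by (rule has_sum_finite_neutralI[of "{0}"]) auto
  have "e' (k + 2) / of_nat (k + 2) = e (k + 2) / of_nat (k + 2) - (if k = 0 then \<kappa> / 2 else 0)" for k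
    using e'(1)[of "k + 2"] e'(2) e'(2)[unfolded numeral_2_eq_2] by (cases "k = 0") (auto simp: diff_divide_distrib)
  then have "el_fun e' = el_fun e - \<kappa> / 2"
    unfolding el_fun_def
    using infsum_diff_complex[OF el_fun_summable[OF good] has_sum_imp_summable[OF k]] infsumI[OF k] by simp
  moreover have "2 * (el_fun e - \<kappa> / 2) = 2 * el_fun e - \<kappa>" by (simp add: right_diff_distrib)
  ultimately show ?thesis by simp
qed

end

locale period_domain = period_params +
  fixes N :: "c3 set"
  assumes N: "open N"
    and N_Im: "\<And>p. p \<in> N \<Longrightarrow> Im (fst p) > 0"
    and N_good: "\<And>p. p \<in> N \<Longrightarrow> good (snd (snd p)) (e_of p)"
    and N_chi: "\<And>p. p \<in> N \<Longrightarrow> norm (snd (snd p)) < x\<^sup>2" "\<And>p. p \<in> N \<Longrightarrow> snd (snd p) \<noteq> 0"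
    and N_lattice: "\<And>p l. p \<in> N \<Longrightarrow> l \<in> Lam (fst p) \<Longrightarrow> l \<noteq> 0 \<Longrightarrow> 2 * norm (fst (snd p)) \<le> norm l"
begin

lemma sep_hol_e_of: "sep_hol N (\<lambda>p. e_of p m)"
proof -
  consider "m = 0" | "m = 1" | k where "m = k + 2"
    by (metis One_nat_def Suc_eq_plus1 add_2_eq_Suc' not0_implies_Suc)
  then show ?thesis
  proof cases
    case (3 k)
    have "sep_hol N (\<lambda>p. eisenstein (k + 2) (fst p))"
      by (rule sep_hol_compose[OF sep_hol_fst eisenstein_holomorphic])
         (use N_Im in \<open>auto simp: upper_half_plane_def open_halfspace_Im_gt\<close>)
    then show ?thesis unfolding 3 e_of_def by (auto simp del: add_2_eq_Suc' intro!: sep_hol_mult sep_hol_power)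
  qed (auto simp: e_of_def)
qed

lemma sep_hol_F11: "sep_hol N (F11 x)" and sep_hol_F12: "sep_hol N (F12 x)"
  and sep_hol_F33: "sep_hol N (F33 x)"
  and sep_hol_F22: "lg holomorphic_on S \<Longrightarrow> open S \<Longrightarrow> (\<And>p. p \<in> N \<Longrightarrow> snd (snd p) \<in> S) \<Longrightarrow> sep_hol N (F22 x lg)"
proof -
  note hol = sep_hol_s_fun[OF N sep_hol_e_of sep_hol_snd_snd N_good] sep_hol_g_fun[OF N sep_hol_e_of sep_hol_snd_snd N_good]
    sep_hol_h_fun[OF N sep_hol_e_of sep_hol_snd_snd N_good]
  show "sep_hol N (F11 x)"
    unfolding F11_def[abs_def] by (intro sep_hol_add sep_hol_divide_const sep_hol_mult sep_hol_power sep_hol_fst sep_hol_fst_snd sep_hol_snd_snd hol)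
  show "sep_hol N (F12 x)"
    unfolding F12_def[abs_def] by (intro sep_hol_diff sep_hol_const sep_hol_divide_const sep_hol_mult sep_hol_fst_snd hol)
  have el: "sep_hol N (\<lambda>p. el_fun (e_of p))"
    unfolding el_fun_def
    by (rule sep_hol_infsum[OF N _ _ el_fun_majorant]) (intro sep_hol_divide_const sep_hol_e_of, rule el_fun_term_bound[OF N_good])
  show "sep_hol N (F33 x)"
    unfolding F33_def[abs_def]
    by (intro sep_hol_mult sep_hol_snd_snd sep_hol_compose[where g = exp and S = UNIV] sep_hol_diff sep_hol_const el hol holomorphic_intros) auto
  assume "lg holomorphic_on S" "open S" "\<And>p. p \<in> N \<Longrightarrow> snd (snd p) \<in> S"
  then have "sep_hol N (\<lambda>p. lg (snd (snd p)))"
    by (intro sep_hol_compose[OF sep_hol_snd_snd]) auto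
  then show "sep_hol N (F22 x lg)"
    unfolding F22_def[abs_def] by (intro sep_hol_divide_const sep_hol_diff sep_hol_add sep_hol_mult sep_hol_const el hol)
qed

text \<open>The shift of e_2 by \<kappa> = c w^2 / (2 pi i j) makes D = 1 + \<chi> \<kappa> s the
  quotient of the factors of automorphy at \<Omega>_11 and at \<tau>. So the Sherman-Morrison
  denominators are those of the symplectic action.\<close>

lemma equivariance:
  assumes p: "p \<in> N" and g: "g \<in> Gamma1" and p': "Gamma1_act g p \<in> N"
  shows "autom g (F11 x p) \<noteq> 0" "F11 x (Gamma1_act g p) = mob g (F11 x p)"
    "F12 x (Gamma1_act g p) = F12 x p / autom g (F11 x p)"
    "F22 x lg (Gamma1_act g p) = F22 x lg p - of_int (g $ 2 $ 1) * (F12 x p)\<^sup>2 / autom g (F11 x p)"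
proof -
  obtain \<tau> w chi where p_eq: "p = (\<tau>, w, chi)" by (cases p)
  have \<tau>: "Im \<tau> > 0" using N_Im[OF p] by (simp add: p_eq)
  define j where "j = autom g \<tau>"
  have j: "j \<noteq> 0" unfolding j_def by (rule autom_nonzero[OF g \<tau>])
  define a b c d where "a = complex_of_int (g $ 1 $ 1)" and "b = complex_of_int (g $ 1 $ 2)"
    and "c = complex_of_int (g $ 2 $ 1)" and "d = complex_of_int (g $ 2 $ 2)"
  have det: "a * d - b * c = 1"
    using arg_cong[OF Gamma1_det[OF g], of complex_of_int] by (simp add: a_def b_def c_def d_def)
  define I where "I = 2 * of_real pi * \<i>"
  have I: "I \<noteq> 0" by (simp add: I_def)
  define \<kappa> where "\<kappa> = c / (I * j) * w\<^sup>2"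
  have act: "Gamma1_act g p = (mob g \<tau>, w / j, chi)" by (simp add: p_eq Gamma1_act_eq j_def)
  define e e' where "e = e_of p" and "e' = e_of (Gamma1_act g p)"
  have e'_alt: "e_of (mob g \<tau>, w / j, chi) = e'" by (simp only: e'_def act)
  have good: "good chi e" "good chi e'"
    using N_good[OF p] N_good[OF p', unfolded act] by (simp_all only: e_def e'_def p_eq act[unfolded p_eq] fst_conv snd_conv)
  have chi: "norm chi < x\<^sup>2" "chi \<noteq> 0" using N_chi[OF p] by (simp_all add: p_eq)
  have E: "eisenstein (k + 2) (mob g \<tau>) / j ^ (k + 2) = eisenstein (k + 2) \<tau> - (if k = 0 then c / (I * j) else 0)" for k
    using eisenstein_modular[OF \<tau> Gamma1_det[OF g], of k]
    unfolding mob_def j_def autom_def c_def I_def by (auto simp: algebra_simps)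
  have e'k: "e' (k + 2) = e (k + 2) - (if k = 0 then \<kappa> else 0)" for k
  proof -
    have "e' (k + 2) = (eisenstein (k + 2) (mob g \<tau>) / j ^ (k + 2)) * w ^ (k + 2)"
      by (simp add: e'_def e_of_def act power_divide)
    also have "\<dots> = e (k + 2) - (if k = 0 then \<kappa> else 0)"
      unfolding E by (simp add: e_def e_of_def p_eq left_diff_distrib \<kappa>_def power2_eq_square)
    finally show ?thesis .
  qed
  have e': "e' m = e m" if "m \<noteq> 2" for m
  proof -
    consider "m = 0" | "m = 1" | k where "m = k + 2"
      by (metis One_nat_def Suc_eq_plus1 add_2_eq_Suc' not0_implies_Suc)
    then show ?thesis
    proof cases
      case (3 k)
      then show ?thesis using e'k[of k] that by (cases k) auto
    qed (auto simp: e_def e'_def e_of_def)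
  qed
  have e'2: "e' 2 = e 2 - \<kappa>" using e'k[of 0] by (simp add: numeral_2_eq_2)
  have e_odd: "odd m \<Longrightarrow> e m = 0" for m by (simp add: e_def e_of_def eisenstein_def)
  define s gg where "s = s_fun x chi e" and "gg = 1 - of_real x * g_fun x chi e"
  define D where "D = 1 + chi * \<kappa> * s"
  note mc = modular_change_nonzero[OF good e_odd chi e' e'2] modular_change_s[OF good e_odd chi e' e'2]
    modular_change_g[OF good e_odd chi e' e'2] modular_change_h[OF good e_odd chi e' e'2]
  have D: "D \<noteq> 0" and s': "s_fun x chi e' = s / D" and g': "1 - of_real x * g_fun x chi e' = gg / D"
    and h': "h_fun x chi e' = h_fun x chi e - \<kappa> + \<kappa> * gg\<^sup>2 / D"
    using mc unfolding D_def s_def gg_def by auto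
  define y where "y = w\<^sup>2 * chi * s / I"
  have F11: "F11 x p = \<tau> + y" by (simp add: F11_def p_eq y_def s_def e_def I_def)
  have F12: "F12 x p = w * gg / I" by (simp add: F12_def p_eq gg_def e_def I_def)
  have jc: "j = c * \<tau> + d" by (simp add: j_def autom_def c_def d_def)
  have cy: "c * y = j * (D - 1)"
    using j I by (simp add: y_def D_def \<kappa>_def field_simps)
  have J: "autom g (F11 x p) = j * D"
  proof -
    have "autom g (F11 x p) = j + c * y" by (simp add: F11 autom_def jc c_def d_def algebra_simps)
    then show ?thesis unfolding cy by (simp add: algebra_simps)
  qed
  show "autom g (F11 x p) \<noteq> 0" unfolding J using j D by simp
  have "F11 x (Gamma1_act g p) = mob g \<tau> + y / (j\<^sup>2 * D)"
    by (simp add: F11_def act e'_alt s' y_def I_def power_divide)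
  also have "\<dots> = ((a * \<tau> + b) * (j * D) + y) / (j * (j * D))"
    using j D by (simp add: mob_autom j_def[symmetric] a_def[symmetric] b_def[symmetric] field_simps power2_eq_square)
  also have "(a * \<tau> + b) * (j * D) + y = (a * (\<tau> + y) + b) * j"
  proof -
    have "(a * \<tau> + b) * (j * D) = (a * \<tau> + b) * j + (a * \<tau> + b) * (c * y)" unfolding cy by (simp add: algebra_simps)
    then have "(a * \<tau> + b) * (j * D) + y - (a * (\<tau> + y) + b) * j = y * (1 - (a * d - b * c))"
      by (simp add: jc algebra_simps)
    then show ?thesis by (simp add: det)
  qed
  also have "(a * (\<tau> + y) + b) * j / (j * (j * D)) = mob g (F11 x p)"
    unfolding mob_autom J using j by (simp add: F11 a_def b_def)
  finally show "F11 x (Gamma1_act g p) = mob g (F11 x p)" .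
  show "F12 x (Gamma1_act g p) = F12 x p / autom g (F11 x p)"
    unfolding J F12 by (simp add: F12_def act e'_alt g' I_def[symmetric])
  \<comment> \<open>The \<kappa> from the prime form cancels the linear \<kappa> in h, and
    \<open>lg\<close> does not change because \<chi> is invariant.\<close>
  have "F22 x lg (Gamma1_act g p) = (lg chi + 2 * el_fun e - \<kappa> - (h_fun x chi e - \<kappa> + \<kappa> * gg\<^sup>2 / D)) / I"
    by (simp add: F22_def act e'_alt el_fun_change[OF good(1) e' e'2] h' I_def)
  also have "\<dots> = F22 x lg p - \<kappa> * gg\<^sup>2 / D / I"
    by (simp add: F22_def p_eq e_def I_def diff_divide_distrib add_divide_distrib)
  also have "\<kappa> * gg\<^sup>2 / D / I = c * (F12 x p)\<^sup>2 / autom g (F11 x p)"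
    unfolding F12 J \<kappa>_def using j D I by (simp add: power_divide power_mult_distrib power2_eq_square mult_ac)
  finally show "F22 x lg (Gamma1_act g p) = F22 x lg p - of_int (g $ 2 $ 1) * (F12 x p)\<^sup>2 / autom g (F11 x p)"
    by (simp add: c_def)
qed

lemma F_mat_equivariant:
  assumes "p \<in> N" "g \<in> Gamma1" "Gamma1_act g p \<in> N"
  shows "F_mat x lg (Gamma1_act g p) = Gamma1_act_siegel g (F_mat x lg p)"
  unfolding F_mat_def Gamma1_act_siegel_eq[OF assms(2) equivariance(1)[OF assms]] equivariance[OF assms] ..

lemma Omega2_values:
  assumes p: "(\<tau>, w, chi) \<in> N" and w: "w \<noteq> 0"
  shows "Omega11 \<tau> w (- w\<^sup>2 * chi) = F11 x (\<tau>, w, chi)"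
    and "Omega12 \<tau> w (- w\<^sup>2 * chi) = F12 x (\<tau>, w, chi)"
    and "row_dot (row_times (\<beta> \<tau> w (- w\<^sup>2 * chi)) (neumann_inverse (R \<tau> w (- w\<^sup>2 * chi)))) (\<beta>_bar \<tau> w (- w\<^sup>2 * chi))
       = h_fun x chi (e_of (\<tau>, w, chi))"
    and "- (- w\<^sup>2 * chi) / (K \<tau> w)\<^sup>2 = chi * exp (2 * el_fun (e_of (\<tau>, w, chi)))"
proof -
  define e where "e = e_of (\<tau>, w, chi)"
  interpret pt: period_point x \<epsilon> \<tau> w chi e
  proof
    show "Im \<tau> > 0" "norm chi < x\<^sup>2" "chi \<noteq> 0" "good chi e" "w \<noteq> 0"
      using N_Im[OF p] N_chi[OF p] N_good[OF p] w by (simp_all add: e_def)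
    show "e = (\<lambda>m. if m = 0 then 0 else eisenstein m \<tau> * w ^ m)" unfolding e_def e_of_def fst_conv snd_conv ..
    show "2 * norm w \<le> norm l" if "l \<in> Lam \<tau>" "l \<noteq> 0" for l
      using N_lattice[OF p] that by simp
  qed
  have rho: "- w\<^sup>2 * chi = pt.\<rho>" by (simp add: pt.\<rho>_def)
  show "Omega11 \<tau> w (- w\<^sup>2 * chi) = F11 x (\<tau>, w, chi)"
    unfolding rho pt.Omega11_value by (simp add: F11_def e_def[symmetric] add_divide_distrib)
  show "Omega12 \<tau> w (- w\<^sup>2 * chi) = F12 x (\<tau>, w, chi)"
    unfolding rho pt.Omega12_value by (simp add: F12_def e_def[symmetric])
  show "row_dot (row_times (\<beta> \<tau> w (- w\<^sup>2 * chi)) (neumann_inverse (R \<tau> w (- w\<^sup>2 * chi)))) (\<beta>_bar \<tau> w (- w\<^sup>2 * chi))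
       = h_fun x chi (e_of (\<tau>, w, chi))"
    unfolding rho pt.row_dot_R by (simp add: e_def)
  have "el_fun e = eis_log_series \<tau> w"
  proof -
    have "(\<lambda>k. e (k + 2) / of_nat (k + 2)) sums el_fun e"
      unfolding el_fun_def by (rule has_sum_imp_sums[OF has_sum_infsum[OF el_fun_summable[OF pt.good]]])
    then show ?thesis
      unfolding eis_log_series_def by (simp add: sums_iff e_def e_of_def)
  qed
  then have K: "K \<tau> w = w * exp (- el_fun e)" using pt.K_value by simp
  have "(K \<tau> w)\<^sup>2 * exp (2 * el_fun e) = w\<^sup>2"
    unfolding K by (simp add: power_mult_distrib exp_double[symmetric] mult.assoc mult_exp_exp)
  then have "- (- w\<^sup>2 * chi) / (K \<tau> w)\<^sup>2 = ((K \<tau> w)\<^sup>2 * exp (2 * el_fun e)) * chi / (K \<tau> w)\<^sup>2" by simp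
  also have "\<dots> = chi * exp (2 * el_fun e)" using w by (simp add: K)
  finally show "- (- w\<^sup>2 * chi) / (K \<tau> w)\<^sup>2 = chi * exp (2 * el_fun (e_of (\<tau>, w, chi)))"
    by (simp add: e_def)
qed

lemma is_Omega2_F_mat:
  assumes p: "(\<tau>, w, chi) \<in> N" and w: "w \<noteq> 0" and lg: "exp (lg chi) = chi"
  shows "is_Omega2 \<tau> w (- w\<^sup>2 * chi) (F_mat x lg (\<tau>, w, chi))"
  unfolding is_Omega2_def F_mat_entries Omega2_values[OF p w]
  by (intro conjI refl exI[of _ "lg chi + 2 * el_fun (e_of (\<tau>, w, chi))"])
     (simp_all add: exp_add lg F22_def)

text \<open>Here the logarithm L is arbitrary; exponentiation removes the choice.\<close>

lemma is_Omega2_imp: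
  fixes \<Omega> :: "complex^2^2"
  assumes p: "(\<tau>, w, chi) \<in> N" and w: "w \<noteq> 0" and \<Omega>: "is_Omega2 \<tau> w (- w\<^sup>2 * chi) \<Omega>"
  shows "\<Omega> $ 1 $ 1 = F11 x (\<tau>, w, chi)" "\<Omega> $ 1 $ 2 = F12 x (\<tau>, w, chi)" "\<Omega> $ 2 $ 1 = F12 x (\<tau>, w, chi)"
    "exp (2 * of_real pi * \<i> * \<Omega> $ 2 $ 2) = F33 x (\<tau>, w, chi)"
proof -
  note * = \<Omega>[unfolded is_Omega2_def Omega2_values[OF p w]]
  show "\<Omega> $ 1 $ 1 = F11 x (\<tau>, w, chi)" "\<Omega> $ 1 $ 2 = F12 x (\<tau>, w, chi)" "\<Omega> $ 2 $ 1 = F12 x (\<tau>, w, chi)"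
    using * by auto
  obtain L where L: "exp L = chi * exp (2 * el_fun (e_of (\<tau>, w, chi)))"
    "2 * of_real pi * \<i> * \<Omega> $ 2 $ 2 = L - h_fun x chi (e_of (\<tau>, w, chi))"
    using * by blast
  show "exp (2 * of_real pi * \<i> * \<Omega> $ 2 $ 2) = F33 x (\<tau>, w, chi)"
    unfolding L(2) exp_diff L(1) by (simp add: F33_def exp_diff)
qed

lemma F33_w0:
  assumes "(\<tau>, 0, chi) \<in> N"
  shows "F33 x (\<tau>, 0, chi) = f_chi chi"
  using h_fun_zero N_chi[OF assms] by (simp add: F33_def e_of_w0)

text \<open>|\<chi>| < 1/4 gives 2 |\<rho>|^(1/2) < |w|, and since non-zero lattice points have
  modulus at least 2 |w|, no lattice point is nearer to w than 0.\<close>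

lemma N_subset: "N \<subseteq> D_chi \<union> D_chi0"
proof
  fix p assume p: "p \<in> N"
  obtain \<tau> w chi where p_eq: "p = (\<tau>, w, chi)" by (cases p)
  have \<tau>: "Im \<tau> > 0" and chi: "norm chi < x\<^sup>2" "chi \<noteq> 0"
    and L: "\<And>l. l \<in> Lam \<tau> \<Longrightarrow> l \<noteq> 0 \<Longrightarrow> 2 * norm w \<le> norm l"
    using N_Im[OF p] N_chi[OF p] N_lattice[OF p] by (auto simp: p_eq)
  have "x\<^sup>2 < (1 / 2)\<^sup>2" using x by (intro power_strict_mono) auto
  then have chi4: "norm chi < 1 / 4" using chi by (simp add: power2_eq_square)
  show "p \<in> D_chi \<union> D_chi0"
  proof (cases "w = 0")
    case True
    then show ?thesis using \<tau> chi chi4 by (simp add: p_eq D_chi0_def upper_half_plane_def)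
  next
    case False
    have "sqrt (norm chi) < sqrt ((1 / 2)\<^sup>2)" using chi4 by (intro real_sqrt_less_mono) (simp add: power2_eq_square)
    then have "sqrt (norm chi) < 1 / 2" by simp
    then have "2 * (norm w * sqrt (norm chi)) < norm w" using False by simp
    moreover have "sqrt (norm (- w\<^sup>2 * chi)) = norm w * sqrt (norm chi)"
      by (simp add: norm_mult norm_power real_sqrt_mult)
    ultimately have sq: "2 * sqrt (norm (- w\<^sup>2 * chi)) < norm w" "2 * sqrt (norm (- w\<^sup>2 * chi)) > 0"
      using False chi by simp_all
    have "norm w \<le> norm (w - l)" if "l \<in> Lam \<tau>" for l
    proof (cases "l = 0")
      case False
      then show ?thesis using L[OF that] norm_triangle_ineq2[of l w] by (simp add: norm_minus_commute)
    qed simp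
    then have "norm (w - l) > 2 * sqrt (norm (- w\<^sup>2 * chi))" if "l \<in> Lam \<tau>" for l
      using sq that by (meson less_le_trans)
    then have "(\<tau>, w, - w\<^sup>2 * chi) \<in> D_rho"
      unfolding D_rho_def using \<tau> sq(2) by (auto simp: upper_half_plane_def)
    then show ?thesis using chi chi4 by (simp add: p_eq D_chi_def)
  qed
qed

end

section \<open>Local injectivity\<close>

definition cdot :: "c3 \<Rightarrow> c3 \<Rightarrow> complex" where
  "cdot D v = fst D * fst v + fst (snd D) * fst (snd v) + snd (snd D) * snd (snd v)"

lemma norm_c3_components: "norm (fst v) \<le> norm v" "norm (fst (snd v)) \<le> norm v" "norm (snd (snd v)) \<le> norm v"
  for v :: c3
proof -
  obtain a b c where v: "v = (a, b, c)" by (cases v)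
  show "norm (fst v) \<le> norm v" "norm (fst (snd v)) \<le> norm v" "norm (snd (snd v)) \<le> norm v"
    using norm_fst_le[of a "(b, c)"] norm_snd_le[of "(b, c)" a] norm_fst_le[of b c] norm_snd_le[of c b]
    by (simp_all add: v)
qed

lemma norm_cdot_le: "norm (cdot D v) \<le> 3 * norm D * norm v"
proof -
  have "norm (cdot D v) \<le> norm (fst D) * norm (fst v) + norm (fst (snd D)) * norm (fst (snd v)) + norm (snd (snd D)) * norm (snd (snd v))"
    unfolding cdot_def norm_mult[symmetric] by (meson norm_triangle_ineq add_right_mono order_trans)
  also have "\<dots> \<le> norm D * norm v + norm D * norm v + norm D * norm v"
    by (intro add_mono mult_mono norm_c3_components norm_ge_zero)
  finally show ?thesis by simp
qed

lemma cdot_diff: "cdot D v - cdot D' v = cdot (D - D') v"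
  by (simp add: cdot_def algebra_simps)

lemma sep_hol_gradient:
  assumes "open N" "sep_hol N f"
  shows "\<exists>D. continuous_on N D \<and> (\<forall>p\<in>N. (f has_derivative cdot (D p)) (at p))"
proof -
  obtain D1 D2 D3 where D: "continuous_on N D1" "continuous_on N D2" "continuous_on N D3"
    "\<And>p. p \<in> N \<Longrightarrow> (f has_derivative (\<lambda>(a, b, c). D1 p * a + D2 p * b + D3 p * c)) (at p)"
    using sep_hol_has_derivative[OF assms] by blast
  have "cdot (D1 p, D2 p, D3 p) = (\<lambda>(a, b, c). D1 p * a + D2 p * b + D3 p * c)" for p
    by (auto simp: cdot_def fun_eq_iff)
  then show ?thesis
    using D by (intro exI[of _ "\<lambda>p. (D1 p, D2 p, D3 p)"]) (auto intro!: continuous_intros)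
qed

lemma gradient_components:
  assumes f: "(f has_derivative cdot D) (at (a, b, c))"
  shows "((\<lambda>z. f (z, b, c)) has_field_derivative d) (at a) \<Longrightarrow> fst D = d"
    "((\<lambda>z. f (a, z, c)) has_field_derivative d) (at b) \<Longrightarrow> fst (snd D) = d"
    "((\<lambda>z. f (a, b, z)) has_field_derivative d) (at c) \<Longrightarrow> snd (snd D) = d"
proof -
  have i: "((\<lambda>z. (z, b, c)) has_derivative (\<lambda>z. (z, 0, 0))) (at a)"
    "((\<lambda>z. (a, z, c)) has_derivative (\<lambda>z. (0, z, 0))) (at b)"
    "((\<lambda>z. (a, b, z)) has_derivative (\<lambda>z. (0, 0, z))) (at c)"
    by (intro has_derivative_Pair has_derivative_const has_derivative_ident)+
  have "((\<lambda>z. f (z, b, c)) has_derivative (\<lambda>z. cdot D (z, 0, 0))) (at a)"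
    "((\<lambda>z. f (a, z, c)) has_derivative (\<lambda>z. cdot D (0, z, 0))) (at b)"
    "((\<lambda>z. f (a, b, z)) has_derivative (\<lambda>z. cdot D (0, 0, z))) (at c)"
    using i[THEN has_derivative_compose, of f "cdot D"] f by blast+
  then have *: "((\<lambda>z. f (z, b, c)) has_field_derivative fst D) (at a)"
    "((\<lambda>z. f (a, z, c)) has_field_derivative fst (snd D)) (at b)"
    "((\<lambda>z. f (a, b, z)) has_field_derivative snd (snd D)) (at c)"
    by (simp_all add: cdot_def has_field_derivative_def)
  show "((\<lambda>z. f (z, b, c)) has_field_derivative d) (at a) \<Longrightarrow> fst D = d"
    "((\<lambda>z. f (a, z, c)) has_field_derivative d) (at b) \<Longrightarrow> fst (snd D) = d"
    "((\<lambda>z. f (a, b, z)) has_field_derivative d) (at c) \<Longrightarrow> snd (snd D) = d"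
    using * DERIV_unique by blast+
qed

text \<open>The Jacobian has rows (d1, p, 0), (0, d2, 0), (0, q, d3) with p and q unknown. Solving
  for the middle coordinate first gives the explicit inverse F''.\<close>

lemma sep_hol_locally_injective:
  assumes N: "open N" "(a, b, c) \<in> N" and f: "sep_hol N f1" "sep_hol N f2" "sep_hol N f3"
    and f1: "((\<lambda>z. f1 (z, b, c)) has_field_derivative d1) (at a)" "d1 \<noteq> 0"
      "((\<lambda>z. f1 (a, b, z)) has_field_derivative 0) (at c)"
    and f2: "((\<lambda>z. f2 (z, b, c)) has_field_derivative 0) (at a)"
      "((\<lambda>z. f2 (a, z, c)) has_field_derivative d2) (at b)" "d2 \<noteq> 0"
      "((\<lambda>z. f2 (a, b, z)) has_field_derivative 0) (at c)"
    and f3: "((\<lambda>z. f3 (z, b, c)) has_field_derivative 0) (at a)"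
      "((\<lambda>z. f3 (a, b, z)) has_field_derivative d3) (at c)" "d3 \<noteq> 0"
  shows "\<exists>r>0. inj_on (\<lambda>p. (f1 p, f2 p, f3 p)) (ball (a, b, c) r)"
proof -
  obtain D1 D2 D3 where cont: "continuous_on N D1" "continuous_on N D2" "continuous_on N D3"
    and D: "\<And>p. p \<in> N \<Longrightarrow> (f1 has_derivative cdot (D1 p)) (at p)"
      "\<And>p. p \<in> N \<Longrightarrow> (f2 has_derivative cdot (D2 p)) (at p)"
      "\<And>p. p \<in> N \<Longrightarrow> (f3 has_derivative cdot (D3 p)) (at p)"
    using f[THEN sep_hol_gradient[OF N(1)]] by metis
  define x where "x = (a, b, c)"
  define p q where "p = fst (snd (D1 x))" and "q = fst (snd (D3 x))"
  note G = gradient_components[OF D(1)[OF N(2)]] gradient_components[OF D(2)[OF N(2)]] gradient_components[OF D(3)[OF N(2)]]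
  have D1: "D1 x = (d1, p, 0)"
    using G(1)[OF f1(1)] G(3)[OF f1(3)] by (simp add: x_def p_def prod_eq_iff)
  have D2: "D2 x = (0, d2, 0)"
    using G(4)[OF f2(1)] G(5)[OF f2(2)] G(6)[OF f2(4)] by (simp add: x_def prod_eq_iff)
  have D3: "D3 x = (0, q, d3)"
    using G(7)[OF f3(1)] G(9)[OF f3(2)] by (simp add: x_def q_def prod_eq_iff)
  define F' where "F' u v = (cdot (D1 u) v, cdot (D2 u) v, cdot (D3 u) v)" for u v
  define F'' :: "c3 \<Rightarrow> c3" where
    "F'' v = ((fst v - p * (fst (snd v) / d2)) / d1, fst (snd v) / d2, (snd (snd v) - q * (fst (snd v) / d2)) / d3)" for v
  define S where "S u = norm (D1 u - D1 x) + norm (D2 u - D2 x) + norm (D3 u - D3 x)" for u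
  have bl: "bounded_linear F''"
    unfolding F''_def
    by (intro bounded_linear_Pair bounded_linear_divide[THEN bounded_linear_compose] bounded_linear_sub
        bounded_linear_mult_right[THEN bounded_linear_compose] bounded_linear_fst bounded_linear_snd
        bounded_linear_fst[THEN bounded_linear_compose] bounded_linear_snd[THEN bounded_linear_compose])
  have inv: "F'' \<circ> F' x = id"
    using f1(2) f2(3) f3(3) by (auto simp: F''_def F'_def cdot_def D1 D2 D3 fun_eq_iff)
  have der: "((\<lambda>p. (f1 p, f2 p, f3 p)) has_derivative F' u) (at u)" if "u \<in> N" for u
    unfolding F'_def[abs_def] using that by (intro has_derivative_Pair D)
  have on: "onorm (\<lambda>v. F' u v - F' x v) \<le> 3 * S u" for u
  proof (rule onorm_bound)
    show "0 \<le> 3 * S u" by (simp add: S_def)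
    fix v
    have "norm (F' u v - F' x v) \<le> norm (cdot (D1 u - D1 x) v) + (norm (cdot (D2 u - D2 x) v) + norm (cdot (D3 u - D3 x) v))"
      unfolding F'_def diff_Pair cdot_diff
      by (rule order_trans[OF norm_Pair_le]) (intro add_mono order_refl norm_Pair_le)
    also have "\<dots> \<le> 3 * norm (D1 u - D1 x) * norm v + (3 * norm (D2 u - D2 x) * norm v + 3 * norm (D3 u - D3 x) * norm v)"
      by (intro add_mono norm_cdot_le)
    finally show "norm (F' u v - F' x v) \<le> 3 * S u * norm v" by (simp add: S_def algebra_simps)
  qed
  have "continuous_on N S"
    unfolding S_def by (intro continuous_intros cont)
  then have "isCont S x"
    using N by (simp add: continuous_on_eq_continuous_at x_def)
  then have tend: "(S \<longlongrightarrow> 0) (at x)" by (simp add: isCont_def S_def)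
  have small: "\<exists>d>0. \<forall>u. dist x u < d \<longrightarrow> onorm (\<lambda>v. F' u v - F' x v) < e" if e: "e > 0" for e
  proof -
    obtain d where d: "d > 0" "\<And>u. u \<noteq> x \<Longrightarrow> dist u x < d \<Longrightarrow> norm (S u - 0) < e / 3"
      using tend[unfolded tendsto_iff eventually_at, rule_format, of "e / 3"] e by (auto simp: dist_norm)
    have "onorm (\<lambda>v. F' u v - F' x v) < e" if "dist x u < d" for u
    proof -
      have "norm (S u) < e / 3"
        using d(2)[of u] that e by (cases "u = x") (auto simp: dist_commute S_def)
      then show ?thesis using on[of u] by simp
    qed
    then show ?thesis using d(1) by blast
  qed
  have "x \<in> N" using N by (simp add: x_def)
  from has_derivative_locally_injective[OF this N(1) bl inv der small]
  obtain r where "r > 0" "inj_on (\<lambda>p. (f1 p, f2 p, f3 p)) (ball x r)" by blast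
  then show ?thesis unfolding x_def by blast
qed

context period_params
begin

text \<open>The bounds are proved on the base set, where Im \<tau> > Im \<tau>0 / 2 and w is small,
  and carried along the orbit by quasi-modularity. Only e_2 needs an extra estimate.\<close>

lemma period_domain_orbit:
  assumes y: "Im \<tau>0 > 0" and chi0: "chi0 \<noteq> 0" "norm chi0 < x\<^sup>2"
  shows "\<exists>r>0. r \<le> 1 / 8 \<and> r \<le> norm chi0 \<and> period_domain x \<epsilon> (orbit_nbhd \<tau>0 chi0 r)"
proof -
  define y where "y = Im \<tau>0"
  have y0: "y > 0" using y by (simp add: y_def)
  \<comment> \<open>The value of |q| at Im \<tau> = y / 2, the least height on the base set; \<rho>
    < pi y keeps q0 e^\<rho> < 1.\<close>
  define q0 where "q0 = exp (- pi * y)"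
  define \<rho> where "\<rho> = min 1 (pi * y / 2)"
  have \<rho>: "0 < \<rho>" "\<rho> < 2 * pi" "\<rho> < pi * y"
  proof -
    have "\<rho> \<le> 1" "\<rho> \<le> pi * y / 2" "0 < pi * y" using y0 by (auto simp: \<rho>_def)
    then show "0 < \<rho>" "\<rho> < 2 * pi" "\<rho> < pi * y" using pi_gt3 by (auto simp: \<rho>_def)
  qed
  have q0: "0 \<le> q0" "q0 * exp \<rho> < 1"
    using \<rho>(3) by (simp_all add: q0_def exp_add[symmetric])
  obtain A where A: "\<And>\<tau> k. norm (nome \<tau>) \<le> q0 \<Longrightarrow> norm (eisenstein (k + 2) \<tau>) * \<rho> ^ (k + 1) \<le> A"
    using eisenstein_bound[OF \<rho>(1,2) q0] by blast
  \<comment> \<open>At least 1, so that M <= M^(k+2) and the constant can be distributed over the k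
    + 2 factors w.\<close>
  define M where "M = max 1 (A * \<rho>)"
  have M: "M \<ge> 1" "A * \<rho> \<le> M" by (auto simp: M_def)
  \<comment> \<open>The first entry bounds |E_m w^m| by (\<epsilon>/2)^m, the second keeps 2 |w|
    below the length of every non-zero lattice vector.\<close>
  define \<delta> where "\<delta> = min (\<rho> * \<epsilon> / (2 * M)) (pi * min 1 (y / 2))"
  have \<delta>: "\<delta> > 0" using \<rho> \<epsilon> M y0 by (simp add: \<delta>_def)
  \<comment> \<open>In order: |\<tau> - \<tau>0| < y/2; \<chi> stays away from 0; |\<chi>| < x^2;
    |w| < \<delta>; and 3/4 \<epsilon>^2 is what (\<epsilon>/2)^2 leaves of \<epsilon>^2 for the
    shift of e_2.\<close>
  define r where "r = Min {1 / 8, norm chi0, x\<^sup>2 - norm chi0, \<delta>\<^sup>2 / (2 * y), 3 / 4 * \<epsilon>\<^sup>2}"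
  have r: "0 < r" "r \<le> 1 / 8" "r \<le> norm chi0" "r \<le> x\<^sup>2 - norm chi0" "r \<le> \<delta>\<^sup>2 / (2 * y)" "r \<le> 3 / 4 * \<epsilon>\<^sup>2"
  proof -
    have "r \<le> s" if "s \<in> {1 / 8, norm chi0, x\<^sup>2 - norm chi0, \<delta>\<^sup>2 / (2 * y), 3 / 4 * \<epsilon>\<^sup>2}" for s
      unfolding r_def by (rule Min_le) (use that in auto)
    then show "r \<le> 1 / 8" "r \<le> norm chi0" "r \<le> x\<^sup>2 - norm chi0" "r \<le> \<delta>\<^sup>2 / (2 * y)" "r \<le> 3 / 4 * \<epsilon>\<^sup>2"
      by blast+
    show "0 < r" using chi0 \<delta> y0 \<epsilon> by (simp add: r_def)
  qed
  have base: "norm ch < x\<^sup>2 \<and> ch \<noteq> 0 \<and> Im \<tau> > y / 2 \<and> norm w < \<delta> \<and> (norm w)\<^sup>2 < r * Im \<tau>"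
    if "(\<tau>, w, ch) \<in> base_nbhd \<tau>0 chi0 r" for \<tau> w ch
  proof -
    have b: "(norm (\<tau> - \<tau>0))\<^sup>2 < 2 * r * y\<^sup>2" "(norm w)\<^sup>2 < 2 * r * y" "norm (ch - chi0) < r"
      using base_nbhd_bounds[OF r(1) _ y that] r(2) by (simp_all add: y_def)
    have "2 * r * y\<^sup>2 \<le> 2 * (1 / 8) * y\<^sup>2" using r by (intro mult_right_mono) auto
    then have "(norm (\<tau> - \<tau>0))\<^sup>2 < (y / 2)\<^sup>2" using b(1) by (simp add: power2_eq_square)
    then have "norm (\<tau> - \<tau>0) < y / 2" by (rule power2_less_imp_less) (use y0 in simp)
    then have 1: "Im \<tau> > y / 2"
      using abs_Im_le_cmod[of "\<tau> - \<tau>0"] by (simp add: y_def)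
    have "2 * r * y \<le> \<delta>\<^sup>2" using r(5) y0 by (simp add: field_simps)
    then have "(norm w)\<^sup>2 < \<delta>\<^sup>2" using b(2) by linarith
    then have 2: "norm w < \<delta>" by (rule power2_less_imp_less) (use \<delta> in simp)
    have "norm ch \<le> norm chi0 + norm (ch - chi0)"
      using norm_triangle_ineq[of chi0 "ch - chi0"] by simp
    moreover have "ch \<noteq> 0" using b(3) r(3) by auto
    moreover have "(norm w)\<^sup>2 < r * Im \<tau>" using that by (simp add: base_nbhd_def)
    ultimately show ?thesis using 1 2 b(3) r(4) by simp
  qed
  have eis: "norm (eisenstein (k + 2) \<tau> * w ^ (k + 2)) \<le> (\<epsilon> / 2) ^ (k + 2)"
    if \<tau>: "Im \<tau> > y / 2" and w: "norm w < \<delta>" for \<tau> w k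
  proof -
    have "norm (nome \<tau>) \<le> q0" using \<tau> by (simp add: norm_nome q0_def)
    from A[OF this, of k] have "norm (eisenstein (k + 2) \<tau>) * \<rho> ^ (k + 1) * \<rho> \<le> A * \<rho>"
      using \<rho> by (intro mult_right_mono) auto
    then have "norm (eisenstein (k + 2) \<tau>) * \<rho> ^ (k + 2) \<le> M ^ 1" using M by (simp add: mult_ac)
    also have "\<dots> \<le> M ^ (k + 2)" by (rule power_increasing) (use M in auto)
    finally have 1: "norm (eisenstein (k + 2) \<tau>) \<le> M ^ (k + 2) / \<rho> ^ (k + 2)"
      using \<rho>(1) by (simp add: pos_le_divide_eq)
    have "norm w \<le> \<rho> * \<epsilon> / (2 * M)" using w by (simp add: \<delta>_def)
    then have 2: "norm w ^ (k + 2) \<le> (\<rho> * \<epsilon> / (2 * M)) ^ (k + 2)" by (intro power_mono) auto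
    have "norm (eisenstein (k + 2) \<tau> * w ^ (k + 2)) \<le> M ^ (k + 2) / \<rho> ^ (k + 2) * (\<rho> * \<epsilon> / (2 * M)) ^ (k + 2)"
      unfolding norm_mult norm_power using 1 2 M \<rho>(1) by (intro mult_mono) auto
    also have "\<dots> = (M / \<rho> * (\<rho> * \<epsilon> / (2 * M))) ^ (k + 2)" by (simp only: power_mult_distrib power_divide)
    also have "M / \<rho> * (\<rho> * \<epsilon> / (2 * M)) = \<epsilon> / 2" using M \<rho>(1) by simp
    finally show ?thesis .
  qed
  have good: "good (snd (snd p)) (e_of p)" and lat: "\<And>l. l \<in> Lam (fst p) \<Longrightarrow> l \<noteq> 0 \<Longrightarrow> 2 * norm (fst (snd p)) \<le> norm l"
    and chi: "norm (snd (snd p)) < x\<^sup>2" "snd (snd p) \<noteq> 0"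
    if p: "p \<in> orbit_nbhd \<tau>0 chi0 r" for p
  proof -
    obtain g where g: "g \<in> Gamma1" "Gamma1_act g p \<in> base_nbhd \<tau>0 chi0 r" and pos: "Im (fst p) > 0"
      using p by (auto simp: orbit_nbhd_def)
    obtain \<tau> w ch where u: "Gamma1_act g p = (\<tau>, w, ch)" by (cases "Gamma1_act g p")
    note b = base[OF g(2)[unfolded u]]
    have \<tau>: "Im \<tau> > 0" using b y0 by linarith
    define h where "h = Gamma1_inv g"
    have h: "h \<in> Gamma1" unfolding h_def by (rule Gamma1_inv[OF g(1)])
    define j where "j = autom h \<tau>"
    have j: "j \<noteq> 0" unfolding j_def by (rule autom_nonzero[OF h \<tau>])
    have p_eq: "p = (mob h \<tau>, w / j, ch)"
      using Gamma1_act_inv(1)[OF g(1) pos] by (simp add: u h_def[symmetric] Gamma1_act_eq j_def)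
    show "norm (snd (snd p)) < x\<^sup>2" "snd (snd p) \<noteq> 0" using b by (simp_all add: p_eq)
    define c where "c = (of_int (h $ 2 $ 1) :: complex)"
    have E: "eisenstein (k + 2) (mob h \<tau>) / j ^ (k + 2) = eisenstein (k + 2) \<tau> - (if k = 0 then c / (2 * of_real pi * \<i> * j) else 0)" for k
      using eisenstein_modular[OF \<tau> Gamma1_det[OF h], of k]
      unfolding mob_def j_def autom_def c_def by (auto simp: algebra_simps)
    have e: "norm (e_of p (k + 2)) \<le> \<epsilon> ^ (k + 2)" for k
    proof -
      have "e_of p (k + 2) = (eisenstein (k + 2) (mob h \<tau>) / j ^ (k + 2)) * w ^ (k + 2)"
        by (simp add: p_eq e_of_def power_divide)
      also have "\<dots> = eisenstein (k + 2) \<tau> * w ^ (k + 2) - (if k = 0 then c / (2 * of_real pi * \<i> * j) * w\<^sup>2 else 0)"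
        unfolding E by (simp add: left_diff_distrib power2_eq_square)
      finally have e_eq: "e_of p (k + 2) = eisenstein (k + 2) \<tau> * w ^ (k + 2) - (if k = 0 then c / (2 * of_real pi * \<i> * j) * w\<^sup>2 else 0)" .
      note le = eis[of \<tau> w k, OF b[THEN conjunct2, THEN conjunct2, THEN conjunct1] b[THEN conjunct2, THEN conjunct2, THEN conjunct2, THEN conjunct1]]
      show ?thesis
      proof (cases "k = 0")
        case False
        have "(\<epsilon> / 2) ^ (k + 2) \<le> \<epsilon> ^ (k + 2)" using \<epsilon> by (intro power_mono) auto
        then show ?thesis using le False unfolding e_eq by simp
      next
        case True
        have jn: "norm j > 0" using j by simp
        \<comment> \<open>This bounds the shift of e_2 by the quantity |w|^2 / Im \<tau>, however
          far the translate lies.\<close>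
        have "norm c * Im \<tau> \<le> norm j"
          using autom_coeff_le[OF \<tau>, of h] by (simp add: c_def j_def)
        then have "norm c / norm j \<le> 1 / Im \<tau>" using \<tau> jn by (simp add: field_simps)
        moreover have "norm c / (2 * pi * norm j) \<le> norm c / norm j"
        proof -
          have "1 * norm j \<le> 2 * pi * norm j" using pi_gt3 by (intro mult_right_mono) auto
          then show ?thesis using jn by (intro divide_left_mono) auto
        qed
        ultimately have "norm c / (2 * pi * norm j) * (norm w)\<^sup>2 \<le> 1 / Im \<tau> * (norm w)\<^sup>2"
          by (intro mult_right_mono) auto
        also have "\<dots> \<le> r" using b \<tau> by (simp add: field_simps)
        finally have "norm (c / (2 * of_real pi * \<i> * j) * w\<^sup>2) \<le> r"
          by (simp add: norm_mult norm_divide norm_power)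
        then have "norm (e_of p (k + 2)) \<le> (\<epsilon> / 2) ^ (k + 2) + r"
          unfolding e_eq using le True by (simp add: norm_triangle_le_diff)
        also have "\<dots> \<le> \<epsilon> ^ (k + 2)" using r(6) True by (simp add: power2_eq_square)
        finally show ?thesis .
      qed
    qed
    have "norm (e_of p (Suc m)) \<le> \<epsilon> ^ Suc m" for m
    proof (cases m)
      case 0
      then show ?thesis using \<epsilon> by (simp add: e_of_def eisenstein_def)
    next
      case (Suc k)
      then show ?thesis using e[of k] by simp
    qed
    then show "good (snd (snd p)) (e_of p)" using b by (simp add: good_def p_eq)
    show "2 * norm (fst (snd p)) \<le> norm l" if l: "l \<in> Lam (fst p)" "l \<noteq> 0" for l
    proof -
      have "(j * l) / j \<in> Lam (mob h \<tau>)" using l j by (simp add: p_eq)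
      then have "j * l \<in> Lam \<tau>"
        using Lam_modular[OF \<tau> Gamma1_det[OF h], of "j * l"] j by (simp add: mob_def j_def autom_def)
      from Lam_norm_ge[OF \<tau> this] have "norm j * norm l \<ge> 2 * pi * min 1 (Im \<tau>)"
        using l j by (simp add: norm_mult)
      moreover have "pi * min 1 (y / 2) \<le> pi * min 1 (Im \<tau>)" using b by (intro mult_left_mono) auto
      moreover have "norm w < pi * min 1 (y / 2)" using b by (simp add: \<delta>_def)
      ultimately have "2 * norm w \<le> norm j * norm l" by linarith
      then show ?thesis using j by (simp add: p_eq norm_divide field_simps)
    qed
  qed
  have "period_domain x \<epsilon> (orbit_nbhd \<tau>0 chi0 r)"
    by unfold_locales (use open_orbit_nbhd good lat chi in \<open>auto simp: orbit_nbhd_def\<close>)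
  then show ?thesis using r by blast
qed

end

section \<open>Injectivity on orbits\<close>

lemma w0_not_in_D_chi: "(\<tau>, 0, chi) \<notin> D_chi"
proof
  assume "(\<tau>, 0, chi) \<in> D_chi"
  then have "\<forall>l\<in>Lam \<tau>. False" by (simp add: D_chi_def D_rho_def)
  then show False using Lam_0 by blast
qed

context period_params
begin

text \<open>f(\<chi>) = \<zeta> / (1 - \<zeta>) with |\<zeta>| < 1/2. The functional equation will
  show that f has no critical point, and |f| < 1 that Im \<Omega>_22 > 0 at w = 0.\<close>

lemma f_chi_facts:
  assumes chi: "norm chi < x\<^sup>2" "chi \<noteq> 0"
  shows "chi * (1 + f_chi chi)\<^sup>2 = f_chi chi" "1 + f_chi chi \<noteq> 0" "norm (f_chi chi) < 1"
proof -
  define \<zeta> where "\<zeta> = (1 - csqrt (1 - 4 * chi)) / 2"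
  have z: "\<zeta> * (1 - \<zeta>) = chi" "1 - \<zeta> \<noteq> 0" "norm \<zeta> < 1 / 2"
    using csqrt_root_facts[OF chi(1)] by (simp_all add: \<zeta>_def)
  have \<zeta>: "\<zeta> \<noteq> 0" using z(1) chi(2) by auto
  have "f_chi chi = \<zeta> / chi - 1" by (simp add: f_chi_def \<zeta>_def)
  then have 1: "1 + f_chi chi = 1 / (1 - \<zeta>)" using \<zeta> by (simp add: z(1)[symmetric])
  then have "f_chi chi = 1 / (1 - \<zeta>) - 1" by (simp add: algebra_simps)
  also have "\<dots> = \<zeta> / (1 - \<zeta>)" using z(2) by (simp add: field_simps)
  finally have 2: "f_chi chi = \<zeta> / (1 - \<zeta>)" .
  show "1 + f_chi chi \<noteq> 0" unfolding 1 using z(2) by simp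
  show "chi * (1 + f_chi chi)\<^sup>2 = f_chi chi"
    unfolding 1 unfolding 2 unfolding z(1)[symmetric] using z(2) by (simp add: power2_eq_square)
  have "norm (1 - \<zeta>) \<ge> 1 - norm \<zeta>" using norm_triangle_ineq2[of 1 \<zeta>] by simp
  then have "norm \<zeta> < norm (1 - \<zeta>)" using z(3) by linarith
  then show "norm (f_chi chi) < 1" unfolding 2 norm_divide using z(2) by (simp add: divide_less_eq_1)
qed

end

context period_domain
begin

lemma locally_injective:
  assumes c: "(\<tau>0, 0, chi0) \<in> N"
  shows "\<exists>r>0. inj_on (\<lambda>p. (F11 x p, F12 x p, F33 x p)) (ball (\<tau>0, 0, chi0) r)"
proof -
  have chi0: "norm chi0 < x\<^sup>2" "chi0 \<noteq> 0" using N_chi[OF c] by simp_all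
  define k where "k p = (1 - of_real x * g_fun x (snd (snd p)) (e_of p)) / (2 * of_real pi * \<i>)" for p
  have "sep_hol N k"
    unfolding k_def
    by (intro sep_hol_divide_const sep_hol_diff sep_hol_mult sep_hol_const
        sep_hol_g_fun[OF N sep_hol_e_of sep_hol_snd_snd N_good])
  from sep_holD(2)[OF this c] obtain k' where "((\<lambda>z. k (\<tau>0, z, chi0)) has_field_derivative k') (at 0)"
    unfolding field_differentiable_def by blast
  \<comment> \<open>\<open>F12\<close> is w times \<open>k\<close>, so at w = 0 its derivative is
    the value of \<open>k\<close>, whatever k' is.\<close>
  from DERIV_mult[OF DERIV_ident this]
  have k1: "((\<lambda>z. F12 x (\<tau>0, z, chi0)) has_field_derivative k (\<tau>0, 0, chi0)) (at 0)"
    by (simp add: F12_def k_def)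
  have k2: "k (\<tau>0, 0, chi0) \<noteq> 0"
  proof -
    have "csqrt (1 - 4 * chi0) \<noteq> 0" using csqrt_root_facts(5)[OF chi0(1)] by fastforce
    then show ?thesis using g_fun_zero[OF chi0] by (simp add: k_def e_of_w0)
  qed
  define \<phi> where "\<phi> z = F33 x (\<tau>0, 0, z)" for z
  from sep_holD(3)[OF sep_hol_F33 c] obtain d where d: "(\<phi> has_field_derivative d) (at chi0)"
    unfolding field_differentiable_def \<phi>_def[abs_def] by blast
  have "open ((\<lambda>z. (\<tau>0, 0, z)) -` N)" by (intro continuous_open_vimage N continuous_intros)
  then have "\<forall>\<^sub>F z in nhds chi0. z \<in> (\<lambda>z. (\<tau>0, 0, z)) -` N"
    using c by (intro eventually_nhds_in_open) auto
  then have ev: "\<forall>\<^sub>F z in nhds chi0. z * (1 + \<phi> z)\<^sup>2 = \<phi> z"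
  proof (rule eventually_mono)
    fix z assume "z \<in> (\<lambda>z. (\<tau>0, 0, z)) -` N"
    then have "(\<tau>0, 0, z) \<in> N" by simp
    then show "z * (1 + \<phi> z)\<^sup>2 = \<phi> z"
      using f_chi_facts(1)[of z] N_chi[of "(\<tau>0, 0, z)"] by (simp add: \<phi>_def F33_w0)
  qed
  \<comment> \<open>\<open>z = \<phi>/(1 + \<phi>)\<^sup>2\<close>, so \<open>\<phi>\<close> cannot be stationary.\<close>
  have d0: "d \<noteq> 0"
  proof
    assume "d = 0"
    then have 0: "(\<phi> has_field_derivative 0) (at chi0)" using d by simp
    have "((\<lambda>z. z * (1 + \<phi> z)\<^sup>2) has_field_derivative (1 + \<phi> chi0)\<^sup>2) (at chi0)"
      by (auto intro!: derivative_eq_intros 0)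
    then have "(\<phi> has_field_derivative (1 + \<phi> chi0)\<^sup>2) (at chi0)"
      using DERIV_cong_ev[OF refl ev refl] by simp
    then have "(1 + \<phi> chi0)\<^sup>2 = 0" using 0 DERIV_unique by blast
    then show False using f_chi_facts(2)[OF chi0] by (simp add: \<phi>_def F33_w0[OF c])
  qed
  show ?thesis
    by (rule sep_hol_locally_injective[OF N c sep_hol_F11 sep_hol_F12 sep_hol_F33 _ one_neq_zero _ _ k1 k2 _ _ d[unfolded \<phi>_def[abs_def]] d0])
       (simp_all add: F33_def e_of_w0)
qed

text \<open>At w = 0 the off-diagonal entry vanishes, and Im \<Omega>_22 > 0 amounts to |f(\<chi>)|
  < 1.\<close>

lemma siegel2_center:
  assumes c: "(\<tau>0, 0, chi0) \<in> N" and lg: "exp (lg chi0) = chi0"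
  shows "siegel2 (F11 x (\<tau>0, 0, chi0)) (F12 x (\<tau>0, 0, chi0)) (F22 x lg (\<tau>0, 0, chi0))"
proof -
  define t where "t = F22 x lg (\<tau>0, 0, chi0)"
  have "exp (2 * of_real pi * \<i> * t) = f_chi chi0"
    unfolding t_def using exp_F22[of lg "(\<tau>0, 0, chi0)" x] lg F33_w0[OF c] by simp
  moreover have "norm (f_chi chi0) < 1" using f_chi_facts(3) N_chi[OF c] by simp
  ultimately have "norm (exp (2 * of_real pi * \<i> * t)) < 1" by simp
  then have "Im t > 0" by (simp add: zero_less_mult_iff)
  then show ?thesis using N_Im[OF c] by (simp add: siegel2_def t_def)
qed

lemma open_siegel2:
  assumes "lg holomorphic_on S" "open S" "\<And>p. p \<in> N \<Longrightarrow> snd (snd p) \<in> S"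
  shows "open {p \<in> N. siegel2 (F11 x p) (F12 x p) (F22 x lg p)}"
proof -
  note cont = sep_hol_F11[THEN sep_holI_continuous] sep_hol_F12[THEN sep_holI_continuous]
    sep_hol_F22[OF assms, THEN sep_holI_continuous]
  have "open (N \<inter> (\<lambda>p. (F11 x p, F12 x p, F22 x lg p)) -`
      {q. Im (fst q) > 0 \<and> (Im (fst (snd q)))\<^sup>2 < Im (fst q) * Im (snd (snd q))})"
    by (intro continuous_open_preimage N continuous_on_Pair cont open_Collect_conj open_Collect_less continuous_intros)
  moreover have "N \<inter> (\<lambda>p. (F11 x p, F12 x p, F22 x lg p)) -`
      {q. Im (fst q) > 0 \<and> (Im (fst (snd q)))\<^sup>2 < Im (fst q) * Im (snd (snd q))}
    = {p \<in> N. siegel2 (F11 x p) (F12 x p) (F22 x lg p)}"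
    by (auto simp: siegel2_def)
  ultimately show ?thesis by simp
qed

lemma is_F_chi_F_mat:
  assumes inv: "\<And>g p. g \<in> Gamma1 \<Longrightarrow> p \<in> N \<Longrightarrow> Gamma1_act g p \<in> N"
    and lg: "lg holomorphic_on S" "open S" "\<And>p. p \<in> N \<Longrightarrow> snd (snd p) \<in> S" "\<And>z. z \<in> S \<Longrightarrow> exp (lg z) = z"
    and siegel: "\<And>p. p \<in> N \<Longrightarrow> siegel2 (F11 x p) (F12 x p) (F22 x lg p)"
  shows "is_F_chi N (F_mat x lg)"
proof -
  have "is_Omega2 \<tau> w (- w\<^sup>2 * chi) (F_mat x lg (\<tau>, w, chi))" if "(\<tau>, w, chi) \<in> N \<inter> D_chi" for \<tau> w chi
  proof (rule is_Omega2_F_mat)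
    show "(\<tau>, w, chi) \<in> N" using that by simp
    then show "exp (lg chi) = chi" using lg(3,4) by force
    show "w \<noteq> 0" using that w0_not_in_D_chi by auto
  qed
  moreover have "\<exists>L. exp L = f_chi chi \<and>
      F_mat x lg (\<tau>, 0, chi) = vector [vector [\<tau>, 0], vector [0, L / (2 * of_real pi * \<i>)]]"
    if "(\<tau>, 0, chi) \<in> N \<inter> D_chi0" for \<tau> chi
  proof (intro exI conjI)
    have p: "(\<tau>, 0, chi) \<in> N" using that by simp
    have "exp (lg chi) = chi" using lg(3,4) p by force
    then show "exp (2 * of_real pi * \<i> * F22 x lg (\<tau>, 0, chi)) = f_chi chi"
      using exp_F22[of lg "(\<tau>, 0, chi)" x] F33_w0[OF p] by simp
    show "F_mat x lg (\<tau>, 0, chi) =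
        vector [vector [\<tau>, 0], vector [0, 2 * of_real pi * \<i> * F22 x lg (\<tau>, 0, chi) / (2 * of_real pi * \<i>)]]"
      by (simp add: F_mat_def)
  qed
  moreover have "\<forall>i j. holomorphic3_on (\<lambda>p. F_mat x lg p $ i $ j) N"
    unfolding forall_2 F_mat_entries
    by (intro conjI sep_hol_imp_holomorphic3[OF N] sep_hol_F11 sep_hol_F12 sep_hol_F22[OF lg(1-3)])
  ultimately show ?thesis
    unfolding is_F_chi_def using siegel2_imp_siegel siegel F_mat_equivariant inv
    by (auto simp: F_mat_def)
qed

text \<open>The link to an arbitrary admissible F: off w = 0 through \<open>is_Omega2_imp\<close>,
  and at w = 0 through the prescribed degenerate value.\<close>

lemma F_chi_values:
  fixes F :: "c3 \<Rightarrow> complex^2^2"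
  assumes F: "is_F_chi N F" and p: "p \<in> N"
  shows "(F11 x p, F12 x p, F33 x p) = (F p $ 1 $ 1, F p $ 1 $ 2, exp (2 * of_real pi * \<i> * F p $ 2 $ 2))"
proof -
  obtain \<tau> w chi where p_eq: "p = (\<tau>, w, chi)" by (cases p)
  show ?thesis
  proof (cases "w = 0")
    case False
    then have "p \<in> D_chi" using N_subset p by (auto simp: p_eq D_chi0_def)
    then have "is_Omega2 \<tau> w (- w\<^sup>2 * chi) (F p)"
      using F p unfolding is_F_chi_def p_eq by blast
    from is_Omega2_imp[OF p[unfolded p_eq] False this] show ?thesis by (simp add: p_eq)
  next
    case True
    then have "p \<in> D_chi0" using N_subset p w0_not_in_D_chi by (auto simp: p_eq)
    then obtain L where "exp L = f_chi chi" "F p = vector [vector [\<tau>, 0], vector [0, L / (2 * of_real pi * \<i>)]]"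
      using F p unfolding is_F_chi_def p_eq True by blast
    then show ?thesis using F33_w0 p by (simp add: p_eq True)
  qed
qed

lemma orbit_inj_on:
  assumes N_eq: "N = orbit_nbhd \<tau>0 chi0 r" and y: "Im \<tau>0 > 0"
    and disc: "\<And>g z. g \<in> Gamma1 \<Longrightarrow> norm (z - \<tau>0) < r' \<Longrightarrow> norm (mob g z - \<tau>0) < r' \<Longrightarrow> mob g \<tau>0 = \<tau>0"
    and small: "\<And>p. p \<in> base_nbhd \<tau>0 chi0 r \<Longrightarrow> norm (F11 x p - \<tau>0) < r'"
    and inj: "inj_on (\<lambda>p. (F11 x p, F12 x p, F33 x p)) (base_nbhd \<tau>0 chi0 r)"
    and F: "is_F_chi N F"
  shows "inj_on F N"
proof (rule inj_onI)
  fix p1 p2 assume p: "p1 \<in> N" "p2 \<in> N" "F p1 = F p2"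
  obtain g1 g2 where g: "g1 \<in> Gamma1" "Gamma1_act g1 p1 \<in> base_nbhd \<tau>0 chi0 r"
      "g2 \<in> Gamma1" "Gamma1_act g2 p2 \<in> base_nbhd \<tau>0 chi0 r"
    using p by (auto simp: N_eq orbit_nbhd_def)
  have pos: "Im (fst p1) > 0" "Im (fst p2) > 0" using p N_Im by auto
  \<comment> \<open>Both points are moved by g2, which keeps their images equal; h takes the base
    representative u1 of p1 to v.\<close>
  define u1 u2 v where "u1 = Gamma1_act g1 p1" and "u2 = Gamma1_act g2 p2" and "v = Gamma1_act g2 p1"
  define h where "h = g2 ** Gamma1_inv g1"
  have h: "h \<in> Gamma1" unfolding h_def by (intro Gamma1_mult Gamma1_inv g)
  have v: "Gamma1_act h u1 = v"
    unfolding h_def u1_def v_def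
    using Gamma1_act_mult[OF g(3) Gamma1_inv(1)[OF g(1)] Im_fst_Gamma1_act[OF g(1) pos(1)]] Gamma1_act_inv(1)[OF g(1) pos(1)]
    by simp
  have N': "u1 \<in> N" "u2 \<in> N" "v \<in> N"
    using p g unfolding u1_def u2_def v_def N_eq by (auto intro: orbit_nbhd_act)
  have "F v = F u2" using F p g unfolding is_F_chi_def u2_def v_def by metis
  then have eq: "(F11 x v, F12 x v, F33 x v) = (F11 x u2, F12 x u2, F33 x u2)"
    using F_chi_values[OF F N'(3)] F_chi_values[OF F N'(2)] by simp
  have "F11 x u2 = mob h (F11 x u1)"
    using equivariance(2)[OF N'(1) h, unfolded v, OF N'(3)] eq by simp
  then have "mob h \<tau>0 = \<tau>0"
    using disc[OF h small small[THEN subst[of _ _ "\<lambda>z. norm (z - \<tau>0) < r'", rotated]]] g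
    unfolding u1_def u2_def by metis
  then have "v \<in> base_nbhd \<tau>0 chi0 r"
    using base_nbhd_stabilizer[OF h _ y g(2)[folded u1_def]] v by simp
  then have "v = u2" using inj eq g(4) unfolding inj_on_def u2_def by blast
  then show "p1 = p2"
    using Gamma1_act_inv(1)[OF g(3)] pos unfolding v_def u2_def by metis
qed

end

text \<open>On this disc z/c has positive real part, where the principal logarithm is holomorphic;
  adding a logarithm of c gives one of z.\<close>

lemma ball_log:
  assumes "c \<noteq> (0 :: complex)"
  shows "\<exists>lg. lg holomorphic_on ball c (norm c) \<and> (\<forall>z\<in>ball c (norm c). exp (lg z) = z)"
proof (intro exI conjI ballI)
  have *: "z / c \<notin> \<real>\<^sub>\<le>\<^sub>0" if "z \<in> ball c (norm c)" for z
  proof -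
    have "norm (1 - z / c) = norm (c - z) / norm c"
      using assms by (simp add: norm_divide[symmetric] diff_divide_distrib)
    also have "\<dots> < 1" using that assms by (simp add: dist_norm)
    finally have "Re (1 - z / c) < 1" using complex_Re_le_cmod order_le_less_trans by blast
    then show ?thesis by (auto simp: complex_nonpos_Reals_iff)
  qed
  show "(\<lambda>z. Ln (z / c) + Ln c) holomorphic_on ball c (norm c)"
    using * assms by (auto intro!: holomorphic_intros)
  fix z assume z: "z \<in> ball c (norm c)"
  then have "z \<noteq> 0" by auto
  then show "exp (Ln (z / c) + Ln c) = z" using assms by (simp add: exp_add)
qed

lemma period_params_exist:
  assumes "norm (chi :: complex) < 1 / 4"
  shows "\<exists>x \<epsilon>. period_params x \<epsilon> \<and> norm chi < x\<^sup>2"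
proof -
  define s where "s = sqrt (norm chi)"
  have "s < sqrt ((1 / 2)\<^sup>2)" unfolding s_def using assms by (intro real_sqrt_less_mono) (simp add: power2_eq_square)
  then have s: "0 \<le> s" "s < 1 / 2" "s\<^sup>2 = norm chi" by (simp_all add: s_def)
  \<comment> \<open>The midpoint of |\<chi>|^(1/2) and 1/2.\<close>
  define x where "x = (s + 1 / 2) / 2"
  have x: "s < x" "0 < x" "x < 1 / 2" using s by (auto simp: x_def)
  define \<delta> where "\<delta> = (1 - x / (1 - x)) / 4"
  have \<delta>: "\<delta> > 0" using x by (simp add: \<delta>_def)
  \<comment> \<open>\<epsilon> = \<delta> / (1 + \<delta>) solves \<epsilon> / (1 - \<epsilon>) =
    \<delta>, which is equality in the last condition.\<close>
  have "1 - \<delta> / (1 + \<delta>) = 1 / (1 + \<delta>)" using \<delta> by (simp add: field_simps)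
  then have "\<delta> / (1 + \<delta>) / (1 - \<delta> / (1 + \<delta>)) = \<delta>" using \<delta> by simp
  then have "period_params x (\<delta> / (1 + \<delta>))"
    using x \<delta> by unfold_locales (auto simp: \<delta>_def[symmetric])
  moreover have "s\<^sup>2 < x\<^sup>2" using x s by (intro power_strict_mono) auto
  ultimately show ?thesis using s by auto
qed

theorem proposition6p12:
  fixes x :: "complex \<times> complex \<times> complex"
  assumes "x \<in> D_chi0"
  shows "\<exists>N. open N \<and> x \<in> N \<and> N \<subseteq> D_chi \<union> D_chi0 \<and>
             (\<forall>g\<in>Gamma1. \<forall>p\<in>N. Gamma1_act g p \<in> N) \<and>
             (\<exists>F. is_F_chi N F) \<and>
             (\<forall>F. is_F_chi N F \<longrightarrow> inj_on F N)"
proof -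
  obtain \<tau>0 chi0 where x_eq: "x = (\<tau>0, 0, chi0)" and y: "Im \<tau>0 > 0" and chi0: "chi0 \<noteq> 0" "norm chi0 < 1 / 4"
    using assms by (auto simp: D_chi0_def upper_half_plane_def)
  obtain \<xi> \<epsilon> where par: "period_params \<xi> \<epsilon>" and \<xi>: "norm chi0 < \<xi>\<^sup>2"
    using period_params_exist[OF chi0(2)] by blast
  obtain r0 where r0: "0 < r0" "r0 \<le> norm chi0" "period_domain \<xi> \<epsilon> (orbit_nbhd \<tau>0 chi0 r0)"
    using period_params.period_domain_orbit[OF par y chi0(1) \<xi>] by blast
  define N0 where "N0 = orbit_nbhd \<tau>0 chi0 r0"
  interpret D0: period_domain \<xi> \<epsilon> N0 using r0(3) by (simp add: N0_def)
  have c: "x \<in> N0"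
    using base_nbhd_center[OF r0(1) y] base_subset_orbit unfolding N0_def x_eq by blast
  \<comment> \<open>The disc about chi0 that reaches up to 0, on which log \<chi> has a branch. As
    \<chi> is invariant, r0 <= |chi0| keeps the whole orbit inside.\<close>
  define S where "S = ball chi0 (norm chi0)"
  obtain lg where lg: "lg holomorphic_on S" "\<And>z. z \<in> S \<Longrightarrow> exp (lg z) = z"
    using ball_log[OF chi0(1)] unfolding S_def by blast
  have S: "open S" "chi0 \<in> S" using chi0 by (auto simp: S_def)
  have N0_S: "snd (snd p) \<in> S" if "p \<in> N0" for p
  proof -
    obtain g where "Gamma1_act g p \<in> base_nbhd \<tau>0 chi0 r0"
      using \<open>p \<in> N0\<close> by (auto simp: N0_def orbit_nbhd_def)
    then have "norm (snd (snd p) - chi0) < r0"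
      by (cases p) (simp add: Gamma1_act_eq base_nbhd_def)
    then show ?thesis using r0(2) by (simp add: S_def dist_norm norm_minus_commute)
  qed
  obtain r' where r': "r' > 0"
    and disc: "\<And>g z. g \<in> Gamma1 \<Longrightarrow> norm (z - \<tau>0) < r' \<Longrightarrow> norm (mob g z - \<tau>0) < r' \<Longrightarrow> mob g \<tau>0 = \<tau>0"
    using Gamma1_discontinuous[OF y] by blast
  obtain d where d: "d > 0" and inj: "inj_on (\<lambda>p. (F11 \<xi> p, F12 \<xi> p, F33 \<xi> p)) (ball x d)"
    using D0.locally_injective[OF c[unfolded x_eq]] unfolding x_eq by blast
  \<comment> \<open>Collects the conditions that hold only near x: injectivity, positivity of Im
    \<Omega>, and \<Omega>_11 in the disc of proper discontinuity.\<close>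
  define V where "V = ball x d \<inter> {p \<in> N0. siegel2 (F11 \<xi> p) (F12 \<xi> p) (F22 \<xi> lg p)} \<inter> (N0 \<inter> F11 \<xi> -` ball \<tau>0 r')"
  have "open V" unfolding V_def
    by (intro open_Int open_ball D0.open_siegel2[OF lg(1) S(1) N0_S]
        continuous_open_preimage[OF sep_holI_continuous[OF D0.sep_hol_F11] D0.N open_ball])
  moreover have "x \<in> V"
    using c d r' D0.siegel2_center[of \<tau>0 chi0 lg, OF c[unfolded x_eq] lg(2)[OF S(2)]] by (simp add: V_def x_eq)
  ultimately obtain r1 where r1: "r1 > 0" "base_nbhd \<tau>0 chi0 r1 \<subseteq> V"
    using base_nbhd_small[OF y] unfolding x_eq by blast
  define r where "r = min r0 r1"
  have r: "0 < r" "r \<le> r0" "r \<le> r1" using r0 r1 by (auto simp: r_def)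
  have V: "base_nbhd \<tau>0 chi0 r \<subseteq> V" using base_nbhd_mono[OF r(3) y] r1(2) by blast
  define N where "N = orbit_nbhd \<tau>0 chi0 r"
  have N_N0: "N \<subseteq> N0" unfolding N_def N0_def by (rule orbit_nbhd_mono[OF r(2) y])
  interpret D: period_domain \<xi> \<epsilon> N
    using N_N0 D0.N_Im D0.N_good D0.N_chi D0.N_lattice open_orbit_nbhd
    by unfold_locales (auto simp: N_def)
  have inv: "Gamma1_act g p \<in> N" if "g \<in> Gamma1" "p \<in> N" for g p
    using that unfolding N_def by (rule orbit_nbhd_act)
  \<comment> \<open>Positivity was secured on the base set only; equivariance carries it along the
    orbit.\<close>
  have "siegel2 (F11 \<xi> p) (F12 \<xi> p) (F22 \<xi> lg p)" if p: "p \<in> N" for p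
  proof -
    obtain g where g: "g \<in> Gamma1" "Gamma1_act g p \<in> base_nbhd \<tau>0 chi0 r" and pos: "Im (fst p) > 0"
      using p by (auto simp: N_def orbit_nbhd_def)
    define u h where "u = Gamma1_act g p" and "h = Gamma1_inv g"
    have h: "h \<in> Gamma1" unfolding h_def by (rule Gamma1_inv[OF g(1)])
    have hu: "Gamma1_act h u = p" unfolding h_def u_def by (rule Gamma1_act_inv[OF g(1) pos])
    have "siegel2 (F11 \<xi> u) (F12 \<xi> u) (F22 \<xi> lg u)" using g(2) V by (auto simp: u_def V_def)
    from siegel2_modular[OF h this] show ?thesis
      using D.equivariance(2-)[OF inv[OF g(1) p, folded u_def] h] p unfolding hu by simp
  qed
  then have "is_F_chi N (F_mat \<xi> lg)"
    using N_N0 N0_S by (intro D.is_F_chi_F_mat[OF inv lg(1) S(1) _ lg(2)]) auto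
  moreover have "inj_on F N" if "is_F_chi N F" for F
    by (rule D.orbit_inj_on[OF N_def y disc _ _ that])
       (use V inj in \<open>auto simp: V_def dist_norm norm_minus_commute intro: inj_on_subset\<close>)
  moreover have "x \<in> N"
    using base_nbhd_center[OF r(1) y] base_subset_orbit unfolding N_def x_eq by blast
  ultimately show ?thesis using D.N D.N_subset inv by blast
qed

end
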